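(* Assume $d\geq 2$ and let $\mathbf{a}=(\mathbf{a}_1,\mathbf{a}_2)\in[1,d]^2$. Then for any $(\frac1p,\frac1q)\in\mathrm{int}(\mathcal{R}^{\mathbf{a}})$ and $r\in(0,\infty)$ given by $\frac1r=\frac1p+\frac1q$, there is a constant $C$ such that for all $f\in L^p(\mathbb{R}^d)$ and $g\in L^q(\mathbb{R}^d)$, $$\Big\|\sup_{l\in\mathbb{Z}}|\mathcal{A}^{\mathbf{a}}_{2^{-l}}(f,g)|\Big\|_{r}\leq C\|f\|_p\|g\|_q .$$
   Context: For $\mathbf{a}=(\mathbf{a}_1,\mathbf{a}_2)\in[1,\infty)^2$ let $$\mathcal{S}^{\mathbf{a}}=\{(y,z)\in\mathbb{R}^d\times\mathbb{R}^d:\ |y|^{\mathbf{a}_1}+|z|^{\mathbf{a}_2}=1\},$$ let $\mu^{\mathbf{a}}$ be the surface measure on $\mathcal{S}^{\mathbf{a}}$ (the $(2d-1)$-dimensional surface measure in $\mathbb{R}^{2d}$), and for $t>0$ let $$\mathcal{A}^{\mathbf{a}}_t(f,g)(x)=\int_{\mathcal{S}^{\mathbf{a}}}f(x-ty)\,g(x-tz)\,d\mu^{\mathbf{a}}(y,z),\qquad x\in\mathbb{R}^d .$$ The Hölder boundedness region $\mathcal{R}^{\mathbf{a}}$ is the set of pairs $(\frac1p,\frac1q)$ with $p,q\in[1,\infty]$ such that, with $r\in(0,\infty]$ given by $\frac1r=\frac1p+\frac1q$, the single-scale operator $\mathcal{A}^{\mathbf{a}}_1$ is bounded from $L^p(\mathbb{R}^d)\times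 L^q(\mathbb{R}^d)$ to $L^r(\mathbb{R}^d)$. $\mathrm{int}(\mathcal{R}^{\mathbf{a}})$ is its interior in $\mathbb{R}^2$. For $0<r<\infty$, $\|f\|_r=(\int_{\mathbb{R}^d}|f|^r)^{1/r}$ (also when $r<1$). *)

theory Defs
  imports "HOL-Probability.Essential_Supremum"
begin

section \<open>Hausdorff measure\<close>

text \<open>
  The surface measure on a hypersurface of \<open>\<real>\<^sup>n\<close> is the \<open>(n - 1)\<close>-dimensional Hausdorff measure,
  normalised so that it agrees with Lebesgue measure in dimension \<open>n - 1\<close>.
  The definition below is meant for \<open>s > 0\<close> only: \<open>0 powr 0 = 0\<close>, so for \<open>s = 0\<close> it is not
  counting measure.
\<close>

definition hausdorff_weight :: "real \<Rightarrow> 'a::metric_space set \<Rightarrow> ennreal" where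
  "hausdorff_weight s U = ennreal (unit_ball_vol s * (diameter U / 2) powr s)"

definition hausdorff_covers :: "real \<Rightarrow> 'a::metric_space set \<Rightarrow> (nat \<Rightarrow> 'a set) set" where
  "hausdorff_covers \<delta> A = {U. A \<subseteq> (\<Union>i. U i) \<and> (\<forall>i. bounded (U i) \<and> diameter (U i) \<le> \<delta>)}"

definition hausdorff_pre :: "real \<Rightarrow> real \<Rightarrow> 'a::metric_space set \<Rightarrow> ennreal" where
  "hausdorff_pre s \<delta> A = (INF U\<in>hausdorff_covers \<delta> A. \<Sum>i. hausdorff_weight s (U i))"

definition hausdorff_outer :: "real \<Rightarrow> 'a::metric_space set \<Rightarrow> ennreal" where
  "hausdorff_outer s A = (SUP \<delta>\<in>{0<..}. hausdorff_pre s \<delta> A)"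

definition hausdorff_measure :: "real \<Rightarrow> 'a::metric_space measure" where
  "hausdorff_measure s =
     measure_of UNIV (lambda_system UNIV UNIV (hausdorff_outer s)) (hausdorff_outer s)"

lemma hausdorff_weight_empty [simp]: "hausdorff_weight s {} = 0"
  by (simp add: hausdorff_weight_def)

lemma hausdorff_pre_empty: "0 \<le> \<delta> \<Longrightarrow> hausdorff_pre s \<delta> {} = 0"
proof -
  assume "0 \<le> \<delta>"
  then have "(\<lambda>_. {}) \<in> hausdorff_covers \<delta> ({} :: 'a set)"
    by (auto simp: hausdorff_covers_def)
  then have "hausdorff_pre s \<delta> ({} :: 'a set) \<le> (\<Sum>i::nat. hausdorff_weight s ({} :: 'a set))"
    unfolding hausdorff_pre_def by (rule INF_lower)
  then show ?thesis by simp
qed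

lemma hausdorff_pre_mono:
  assumes "A \<subseteq> B" "\<delta>' \<le> \<delta>"
  shows "hausdorff_pre s \<delta> A \<le> hausdorff_pre s \<delta>' B"
  unfolding hausdorff_pre_def
proof (rule INF_superset_mono)
  show "hausdorff_covers \<delta>' B \<subseteq> hausdorff_covers \<delta> A"
    using assms unfolding hausdorff_covers_def by (auto intro: order_trans)
qed simp

lemma hausdorff_pre_countable_subadditive:
  fixes A :: "nat \<Rightarrow> 'a::metric_space set"
  shows "hausdorff_pre s \<delta> (\<Union>i. A i) \<le> (\<Sum>i. hausdorff_pre s \<delta> (A i))"
proof (rule ennreal_le_epsilon)
  fix e :: real assume fin: "(\<Sum>i. hausdorff_pre s \<delta> (A i)) < top" and e: "0 < e"
  have fini: "hausdorff_pre s \<delta> (A i) \<noteq> top" for i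
    using fin by (metis ennreal_suminf_lessD less_irrefl)
  have "\<exists>U\<in>hausdorff_covers \<delta> (A i). (\<Sum>j. hausdorff_weight s (U j))
          \<le> hausdorff_pre s \<delta> (A i) + ennreal (e * (1/2) ^ Suc i)" for i
  proof -
    have "hausdorff_pre s \<delta> (A i) < hausdorff_pre s \<delta> (A i) + ennreal (e * (1/2) ^ Suc i)"
      using fini[of i] e
      by (cases "hausdorff_pre s \<delta> (A i)")
         (auto simp: ennreal_plus[symmetric] ennreal_less_iff simp del: ennreal_plus)
    then show ?thesis
      unfolding hausdorff_pre_def INF_less_iff by (meson less_imp_le)
  qed
  then obtain U where U: "\<And>i. U i \<in> hausdorff_covers \<delta> (A i)"
    and Ule: "\<And>i. (\<Sum>j. hausdorff_weight s (U i j))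
          \<le> hausdorff_pre s \<delta> (A i) + ennreal (e * (1/2) ^ Suc i)"
    by metis
  define V where "V = (\<lambda>n. case prod_decode n of (i, j) \<Rightarrow> U i j)"
  have "V \<in> hausdorff_covers \<delta> (\<Union>i. A i)"
  proof -
    have "x \<in> (\<Union>n. V n)" if "x \<in> A i" for x i
    proof -
      from that U[of i] obtain j where "x \<in> U i j" by (auto simp: hausdorff_covers_def)
      then have "x \<in> V (prod_encode (i, j))" by (simp add: V_def)
      then show ?thesis by blast
    qed
    then show ?thesis
      using U by (auto simp: hausdorff_covers_def V_def split: prod.split)
  qed
  then have "hausdorff_pre s \<delta> (\<Union>i. A i) \<le> (\<Sum>n. hausdorff_weight s (V n))"
    unfolding hausdorff_pre_def by (rule INF_lower)
  also have "\<dots> = (\<Sum>n. (\<lambda>(i, j). hausdorff_weight s (U i j)) (prod_decode n))"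
    by (intro arg_cong[where f=suminf]) (auto simp: V_def split: prod.split)
  also have "\<dots> = (\<Sum>i. \<Sum>j. hausdorff_weight s (U i j))"
    by (rule suminf_ennreal_2dimen) simp
  also have "\<dots> \<le> (\<Sum>i. hausdorff_pre s \<delta> (A i) + ennreal (e * (1/2) ^ Suc i))"
    by (intro suminf_le Ule) auto
  also have "\<dots> = (\<Sum>i. hausdorff_pre s \<delta> (A i)) + (\<Sum>i. ennreal (e * (1/2) ^ Suc i))"
    by (rule suminf_add[symmetric]) auto
  also have "(\<Sum>i. ennreal (e * (1/2) ^ Suc i)) = ennreal e"
    using e power_half_series sums_mult[OF power_half_series, of e]
    by (intro sums_unique[symmetric]) (auto intro!: sums_ennreal[THEN iffD2])
  finally show "hausdorff_pre s \<delta> (\<Union>i. A i) \<le> (\<Sum>i. hausdorff_pre s \<delta> (A i)) + ennreal e" .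
qed

lemma hausdorff_outer_mono: "A \<subseteq> B \<Longrightarrow> hausdorff_outer s A \<le> hausdorff_outer s B"
  unfolding hausdorff_outer_def by (intro SUP_mono' hausdorff_pre_mono) auto

lemma hausdorff_outer_countable_subadditive:
  "hausdorff_outer s (\<Union>i. A i) \<le> (\<Sum>i::nat. hausdorff_outer s (A i))"
  unfolding hausdorff_outer_def[of s "\<Union>i. A i"]
proof (rule SUP_least)
  fix \<delta> :: real assume \<delta>: "\<delta> \<in> {0<..}"
  have "hausdorff_pre s \<delta> (\<Union>i. A i) \<le> (\<Sum>i. hausdorff_pre s \<delta> (A i))"
    by (rule hausdorff_pre_countable_subadditive)
  also have "\<dots> \<le> (\<Sum>i. hausdorff_outer s (A i))"
    unfolding hausdorff_outer_def using \<delta> by (intro suminf_le SUP_upper) auto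
  finally show "hausdorff_pre s \<delta> (\<Union>i. A i) \<le> (\<Sum>i. hausdorff_outer s (A i))" .
qed

lemma hausdorff_outer_empty [simp]: "hausdorff_outer s {} = 0"
  by (auto simp: hausdorff_outer_def hausdorff_pre_empty)

lemma outer_measure_space_hausdorff: "outer_measure_space UNIV (hausdorff_outer s)"
  unfolding outer_measure_space_def positive_def increasing_def countably_subadditive_def
  by (auto intro: hausdorff_outer_mono hausdorff_outer_countable_subadditive)

lemma measure_space_hausdorff:
  "measure_space UNIV (lambda_system UNIV UNIV (hausdorff_outer s))
     (hausdorff_outer s :: 'a::metric_space set \<Rightarrow> ennreal)"
proof -
  interpret sigma_algebra UNIV "UNIV :: 'a set set"
    using sigma_algebra_Pow[of UNIV] by simp
  show ?thesis
    by (rule caratheodory_lemma[OF outer_measure_space_hausdorff])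
qed

lemma space_hausdorff_measure [simp]: "space (hausdorff_measure s) = UNIV"
  by (simp add: hausdorff_measure_def space_measure_of_conv)

lemma sets_hausdorff_measure:
  "sets (hausdorff_measure s) = lambda_system UNIV UNIV (hausdorff_outer s)"
  unfolding hausdorff_measure_def
  using measure_space_hausdorff[of s]
  by (metis measure_space_def sigma_algebra.sets_measure_of_eq)

lemma emeasure_hausdorff_measure:
  assumes "A \<in> sets (hausdorff_measure s)"
  shows "emeasure (hausdorff_measure s) A = hausdorff_outer s A"
  using measure_space_hausdorff[of s] assms
  unfolding sets_hausdorff_measure unfolding hausdorff_measure_def
  by (intro emeasure_measure_of_sigma) (auto simp: measure_space_def)

lemma hausdorff_outer_Un: "hausdorff_outer s (A \<union> B) \<le> hausdorff_outer s A + hausdorff_outer s B"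
proof -
  have "hausdorff_outer s (\<Union>i. (binaryset A B) i) \<le> (\<Sum>i. hausdorff_outer s (binaryset A B i))"
    by (rule hausdorff_outer_countable_subadditive)
  then show ?thesis
    by (simp add: UN_binaryset_eq suminf_binaryset_eq)
qed

lemma hausdorff_outer_separated:
  assumes "e > 0" and sep: "\<And>x y. x \<in> A \<Longrightarrow> y \<in> B \<Longrightarrow> e \<le> dist x y"
  shows "hausdorff_outer s A + hausdorff_outer s B \<le> hausdorff_outer s (A \<union> B)"
proof -
  have *: "hausdorff_pre s \<delta> A + hausdorff_pre s \<delta>' B \<le> hausdorff_outer s (A \<union> B)"
    if "\<delta> > 0" "\<delta>' > 0" for \<delta> \<delta>'
  proof -
    define \<eta> where "\<eta> = min (min \<delta> \<delta>') (e/2)"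
    have \<eta>: "\<eta> > 0" "\<eta> \<le> \<delta>" "\<eta> \<le> \<delta>'" "\<eta> < e" using that assms(1) by (auto simp: \<eta>_def)
    have "hausdorff_pre s \<delta> A + hausdorff_pre s \<delta>' B \<le> (\<Sum>i. hausdorff_weight s (U i))"
      if U: "U \<in> hausdorff_covers \<eta> (A \<union> B)" for U
    proof -
      define V where "V = (\<lambda>i. if U i \<inter> A \<noteq> {} then U i else {})"
      define W where "W = (\<lambda>i. if U i \<inter> B \<noteq> {} then U i else {})"
      have V: "V \<in> hausdorff_covers \<delta> A" and W: "W \<in> hausdorff_covers \<delta>' B"
      proof -
        have cov: "A \<union> B \<subseteq> (\<Union>i. U i)" and bd: "\<And>i. bounded (U i)"
          and dm: "\<And>i. diameter (U i) \<le> \<delta>" "\<And>i. diameter (U i) \<le> \<delta>'"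
          using U \<eta> unfolding hausdorff_covers_def by (auto intro: order_trans)
        have "A \<subseteq> (\<Union>i. V i)" "B \<subseteq> (\<Union>i. W i)"
          using cov unfolding V_def W_def by (fastforce split: if_splits)+
        then show "V \<in> hausdorff_covers \<delta> A" "W \<in> hausdorff_covers \<delta>' B"
          using bd dm order_trans[OF less_imp_le[OF \<eta>(1)]] \<eta>(2,3) unfolding hausdorff_covers_def V_def W_def by auto
      qed
      have "V i = {} \<or> W i = {}" for i
      proof (rule ccontr)
        assume "\<not> ?thesis"
        then obtain x y where xy: "x \<in> U i" "x \<in> A" "y \<in> U i" "y \<in> B"
          by (auto simp: V_def W_def split: if_splits)
        have "bounded (U i)" "diameter (U i) \<le> \<eta>" using U by (auto simp: hausdorff_covers_def)
        then have "dist x y \<le> \<eta>" using diameter_bounded_bound[of "U i" x y] xy by auto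
        with sep[OF xy(2,4)] \<eta> show False by simp
      qed
      then have le: "hausdorff_weight s (V i) + hausdorff_weight s (W i) \<le> hausdorff_weight s (U i)"
        for i by (metis V_def W_def add.left_neutral add.right_neutral hausdorff_weight_empty
            order_refl zero_le)
      have "hausdorff_pre s \<delta> A + hausdorff_pre s \<delta>' B
          \<le> (\<Sum>i. hausdorff_weight s (V i)) + (\<Sum>i. hausdorff_weight s (W i))"
        unfolding hausdorff_pre_def by (intro add_mono INF_lower V W)
      also have "\<dots> = (\<Sum>i. hausdorff_weight s (V i) + hausdorff_weight s (W i))"
        by (rule suminf_add) auto
      also have "\<dots> \<le> (\<Sum>i. hausdorff_weight s (U i))"
        by (intro suminf_le le) auto
      finally show ?thesis .
    qed
    then have "hausdorff_pre s \<delta> A + hausdorff_pre s \<delta>' B \<le> hausdorff_pre s \<eta> (A \<union> B)"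
      unfolding hausdorff_pre_def[of s \<eta>] by (intro INF_greatest) auto
    also have "\<dots> \<le> hausdorff_outer s (A \<union> B)"
      unfolding hausdorff_outer_def using \<eta> by (intro SUP_upper) auto
    finally show ?thesis .
  qed
  have ne: "{0<..} \<noteq> ({} :: real set)" by (auto intro: exI[of _ 1])
  have "hausdorff_outer s A + hausdorff_pre s \<delta>' B \<le> hausdorff_outer s (A \<union> B)" if "\<delta>' > 0" for \<delta>'
    unfolding hausdorff_outer_def[of s A] ennreal_SUP_add_left[OF ne, symmetric]
    by (intro SUP_least *) (use that in auto)
  then show ?thesis
    unfolding hausdorff_outer_def[of s B] ennreal_SUP_add_right[OF ne]
    by (intro SUP_least) auto
qed

lemma closed_in_sets_hausdorff_measure:
  assumes "closed C"
  shows "C \<in> sets (hausdorff_measure s)"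
proof (cases "C = {}")
  case True
  then show ?thesis by simp
next
  case ne: False
  let ?H = "hausdorff_outer s"
  have ge: "?H (C \<inter> X) + ?H (X - C) \<le> ?H X" for X
  proof (cases "?H X = top")
    case False
    define E where "E n = {x \<in> X. inverse (real (Suc n)) \<le> infdist x C}" for n
    define R where "R n = E (Suc n) - E n" for n
    have sub: "E n \<subseteq> X" "R n \<subseteq> X" for n by (auto simp: E_def R_def)
    have "?H (C \<inter> X) + ?H (E n) \<le> ?H X" for n
    proof -
      have "?H (C \<inter> X) + ?H (E n) \<le> ?H (C \<inter> X \<union> E n)"
      proof (rule hausdorff_outer_separated)
        show "0 < inverse (real (Suc n))" by simp
        fix x y assume "x \<in> C \<inter> X" "y \<in> E n"
        then show "inverse (real (Suc n)) \<le> dist x y"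
          using infdist_le[of x C y] by (simp add: E_def dist_commute)
      qed
      also have "\<dots> \<le> ?H X" by (rule hausdorff_outer_mono) (auto simp: E_def)
      finally show ?thesis .
    qed note CE = this
    have Rsep: "inverse (real (Suc (Suc m))) - inverse (real (Suc n)) \<le> dist x y"
      if "x \<in> R m" "y \<in> R n" for m n x y
    proof -
      have "inverse (real (Suc (Suc m))) \<le> infdist x C" "infdist y C < inverse (real (Suc n))"
        using that by (auto simp: R_def E_def)
      moreover have "infdist x C \<le> infdist y C + dist x y" by (rule infdist_triangle)
      ultimately show ?thesis by linarith
    qed
    have par: "(\<Sum>k<N. ?H (R (2*k+j))) \<le> ?H (\<Union>k<N. R (2*k+j))" for N j
    proof (induction N)
      case (Suc N)
      show ?case
      proof (cases "N = 0")
        case False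
        have "(\<Sum>k<Suc N. ?H (R (2*k+j))) \<le> ?H (\<Union>k<N. R (2*k+j)) + ?H (R (2*N+j))"
          using Suc by (simp add: add_right_mono)
        also have "\<dots> \<le> ?H ((\<Union>k<N. R (2*k+j)) \<union> R (2*N+j))"
        proof (rule hausdorff_outer_separated)
          show "0 < inverse (real (2*N+j)) - inverse (real (Suc (2*N+j)))"
            using False by (auto intro!: less_imp_inverse_less)
        next
          fix x y assume x: "x \<in> (\<Union>k<N. R (2*k+j))" and y: "y \<in> R (2*N+j)"
          from x obtain k where k: "k < N" "x \<in> R (2*k+j)" by auto
          have "inverse (real (2*N+j)) \<le> inverse (real (Suc (Suc (2*k+j))))"
            using k(1) by (intro le_imp_inverse_le) auto
          with Rsep[OF k(2) y]
          show "inverse (real (2*N+j)) - inverse (real (Suc (2*N+j))) \<le> dist x y"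
            by linarith
        qed
        also have "(\<Union>k<N. R (2*k+j)) \<union> R (2*N+j) = (\<Union>k<Suc N. R (2*k+j))"
          by (auto simp: lessThan_Suc)
        finally show ?thesis .
      qed (simp add: lessThan_Suc)
    qed simp
    have par': "(\<Sum>k. ?H (R (2*k+j))) \<le> ?H X" for j
    proof (rule suminf_le_const)
      fix N
      have "?H (\<Union>k<N. R (2*k+j)) \<le> ?H X"
        by (rule hausdorff_outer_mono) (use sub in blast)
      with par[of j N] show "(\<Sum>k<N. ?H (R (2*k+j))) \<le> ?H X" by (rule order_trans)
    qed simp
    have Rle: "(\<Sum>k. ?H (R k)) \<le> ?H X + ?H X"
    proof (rule suminf_le_const)
      fix N
      have dbl: "(\<Sum>k<2*M. ?H (R k)) = (\<Sum>k<M. ?H (R (2*k+0))) + (\<Sum>k<M. ?H (R (2*k+1)))" for M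
        by (induction M) (simp_all add: algebra_simps)
      have "(\<Sum>k<N. ?H (R k)) \<le> (\<Sum>k<2*N. ?H (R k))"
        by (rule sum_mono2) auto
      also have "\<dots> \<le> (\<Sum>k. ?H (R (2*k+0))) + (\<Sum>k. ?H (R (2*k+1)))"
        unfolding dbl by (intro add_mono sum_le_suminf) auto
      also have "\<dots> \<le> ?H X + ?H X" by (intro add_mono par')
      finally show "(\<Sum>k<N. ?H (R k)) \<le> ?H X + ?H X" .
    qed simp
    have Rfin: "(\<Sum>k. ?H (R k)) < top"
    proof -
      have "?H X + ?H X < top" using False by (simp add: less_top)
      with Rle show ?thesis by (rule le_less_trans)
    qed
    have cover: "X - C \<subseteq> E n \<union> (\<Union>k. R (k + n))" for n
    proof
      fix x assume x: "x \<in> X - C"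
      then have "infdist x C > 0"
        using \<open>closed C\<close> ne by (simp add: infdist_pos_not_in_closed)
      then obtain m where m: "inverse (real (Suc m)) < infdist x C"
        using reals_Archimedean by auto
      have xm: "x \<in> E m" using x m by (auto simp: E_def)
      define l where "l = (LEAST m. x \<in> E m)"
      have l: "x \<in> E l" and least: "\<And>i. i < l \<Longrightarrow> x \<notin> E i"
        unfolding l_def using xm by (auto intro: LeastI dest: not_less_Least)
      show "x \<in> E n \<union> (\<Union>k. R (k + n))"
      proof (cases "l \<le> n")
        case True
        then have "inverse (real (Suc n)) \<le> inverse (real (Suc l))"
          by (intro le_imp_inverse_le) auto
        then have "x \<in> E n" using l unfolding E_def by (blast intro: order_trans)
        then show ?thesis by simp
      next
        case False
        then have "x \<in> R ((l - 1 - n) + n)"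
          using l least[of "l - 1"] by (auto simp: R_def)
        then show ?thesis by blast
      qed
    qed
    have bound: "?H (C \<inter> X) + ?H (X - C) \<le> ?H X + (\<Sum>k. ?H (R (k + n)))" for n
    proof -
      have "?H (X - C) \<le> ?H (E n) + ?H (\<Union>k. R (k + n))"
        using hausdorff_outer_mono[OF cover] hausdorff_outer_Un by (rule order_trans)
      also have "\<dots> \<le> ?H (E n) + (\<Sum>k. ?H (R (k + n)))"
        by (intro add_left_mono hausdorff_outer_countable_subadditive)
      finally have "?H (C \<inter> X) + ?H (X - C) \<le> (?H (C \<inter> X) + ?H (E n)) + (\<Sum>k. ?H (R (k + n)))"
        by (simp add: add.assoc add_left_mono)
      also have "\<dots> \<le> ?H X + (\<Sum>k. ?H (R (k + n)))"
        by (intro add_right_mono CE)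
      finally show ?thesis .
    qed
    have "(\<lambda>n. \<Sum>k. ?H (R (k + n))) \<longlonglongrightarrow> 0"
    proof -
      have Hfin: "?H (R k) \<noteq> top" for k
        using Rfin by (metis ennreal_suminf_lessD less_irrefl)
      define h where "h k = enn2real (?H (R k))" for k
      have h: "?H (R k) = ennreal (h k)" "0 \<le> h k" for k
        using Hfin[of k] by (auto simp: h_def less_top)
      have sm: "summable h"
        using Rfin h(2) unfolding h(1) by (intro summable_suminf_not_top) auto
      have "(\<Sum>k. ?H (R (k + n))) = ennreal (\<Sum>k. h (k + n))" for n
        unfolding h(1) using h(2) sm by (intro suminf_ennreal2 summable_ignore_initial_segment)
      moreover have "(\<lambda>n. \<Sum>k. h (k + n)) \<longlonglongrightarrow> 0"
        using suminf_exist_split2[OF sm] by simp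
      ultimately show ?thesis
        using tendsto_ennrealI by fastforce
    qed
    then have "(\<lambda>n. ?H X + (\<Sum>k. ?H (R (k + n)))) \<longlonglongrightarrow> ?H X + 0"
      by (intro tendsto_add tendsto_const)
    then show ?thesis
      using bound by (intro LIMSEQ_le_const[where x="?H X"]) auto
  qed simp
  have "?H (C \<inter> X) + ?H (X - C) = ?H X" for X
    using ge[of X] hausdorff_outer_Un[of s "C \<inter> X" "X - C"]
    by (metis Int_Diff_Un Int_commute antisym)
  then show ?thesis
    by (auto simp: sets_hausdorff_measure lambda_system_def Diff_eq Int_commute)
qed

lemma sets_borel_subset_hausdorff_measure: "sets borel \<subseteq> sets (hausdorff_measure s)"
proof -
  have "sigma_sets UNIV (Collect closed) \<subseteq> sets (hausdorff_measure s)"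
    using closed_in_sets_hausdorff_measure
    by (intro sets.sigma_sets_subset'[where M="hausdorff_measure s", simplified]) auto
  then show ?thesis
    by (simp add: borel_eq_closed)
qed


section \<open>Lebesgue spaces\<close>

text \<open>
  An exponent \<open>p\<close> is a positive extended real. The quasi-norm is taken of functions with
  values in \<open>[0, \<infinity>]\<close>, since the supremum of the averages may be infinite at some points.
\<close>

definition epowr :: "ennreal \<Rightarrow> real \<Rightarrow> ennreal" where
  "epowr x s = (if x = \<infinity> then \<infinity> else ennreal (enn2real x powr s))"

definition Lp_norm :: "ennreal \<Rightarrow> ('a::euclidean_space \<Rightarrow> ennreal) \<Rightarrow> ennreal" where
  "Lp_norm p h =
     (if p = \<infinity> then esssup lebesgue h
      else epowr (\<integral>\<^sup>+x. epowr (h x) (enn2real p) \<partial>lebesgue) (1 / enn2real p))"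

abbreviation Lp_norm_fun :: "ennreal \<Rightarrow> ('a::euclidean_space \<Rightarrow> complex) \<Rightarrow> ennreal" where
  "Lp_norm_fun p f \<equiv> Lp_norm p (\<lambda>x. ennreal (norm (f x)))"

definition Lp_space :: "ennreal \<Rightarrow> ('a::euclidean_space \<Rightarrow> complex) set" where
  "Lp_space p = {f \<in> borel_measurable lebesgue. Lp_norm_fun p f < \<infinity>}"


section \<open>Bilinear averages\<close>

text \<open>
  The norm of a pair is the Euclidean one, so \<open>(real^'d) \<times> (real^'d)\<close> is isometric
  to \<open>\<real>\<^sup>2\<^sup>d\<close> with \<open>d = CARD('d)\<close>.
\<close>

definition surf :: "real \<times> real \<Rightarrow> ((real^'d) \<times> (real^'d)) set" where
  "surf a = {(y, z). norm y powr fst a + norm z powr snd a = 1}"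

definition surf_measure :: "real \<times> real \<Rightarrow> ((real^'d) \<times> (real^'d)) measure" where
  "surf_measure a = restrict_space (hausdorff_measure (2 * real CARD('d) - 1)) (surf a)"

definition avg_integrand ::
  "real \<Rightarrow> (real^'d \<Rightarrow> complex) \<Rightarrow> (real^'d \<Rightarrow> complex) \<Rightarrow> real^'d \<Rightarrow> (real^'d) \<times> (real^'d) \<Rightarrow> complex"
  where "avg_integrand t f g x = (\<lambda>(y, z). f (x - t *\<^sub>R y) * g (x - t *\<^sub>R z))"

definition avg ::
  "real \<times> real \<Rightarrow> real \<Rightarrow> (real^'d \<Rightarrow> complex) \<Rightarrow> (real^'d \<Rightarrow> complex) \<Rightarrow> real^'d \<Rightarrow> complex"
  where "avg a t f g x = (\<integral>w. avg_integrand t f g x w \<partial>surf_measure a)"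

text \<open>
  The Bochner integral is \<open>0\<close> for non-integrable functions, so absolute convergence of the
  average at almost every point has to be demanded separately.
\<close>

definition avg_converges ::
  "real \<times> real \<Rightarrow> real \<Rightarrow> (real^'d \<Rightarrow> complex) \<Rightarrow> (real^'d \<Rightarrow> complex) \<Rightarrow> bool"
  where "avg_converges a t f g \<longleftrightarrow>
    (AE x in lebesgue. integrable (surf_measure a) (avg_integrand t f g x))"

definition avg_bounded :: "'d::finite itself \<Rightarrow> real \<times> real \<Rightarrow> ennreal \<Rightarrow> ennreal \<Rightarrow> ennreal \<Rightarrow> bool" where
  "avg_bounded _ a p q r \<longleftrightarrow>
    (\<exists>C::real. \<forall>f g :: real^'d \<Rightarrow> complex. f \<in> Lp_space p \<longrightarrow> g \<in> Lp_space q \<longrightarrow>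
       avg_converges a 1 f g \<and> avg a 1 f g \<in> Lp_space r \<and>
       Lp_norm_fun r (avg a 1 f g) \<le> ennreal C * Lp_norm_fun p f * Lp_norm_fun q g)"

text \<open>In \<^typ>\<open>ennreal\<close>, \<open>1 / \<infinity> = 0\<close> and \<open>1 / 0 = \<infinity>\<close>.\<close>

definition holder_region :: "'d::finite itself \<Rightarrow> real \<times> real \<Rightarrow> (real \<times> real) set" where
  "holder_region T a = {(enn2real (1 / p), enn2real (1 / q)) | p q.
     1 \<le> p \<and> 1 \<le> q \<and> (\<exists>r>0. 1 / r = 1 / p + 1 / q \<and> avg_bounded T a p q r)}"

lemma surf_in_sets_hausdorff_measure:
  "(surf a :: ((real^'d) \<times> (real^'d)) set) \<in> sets (hausdorff_measure s)"
proof -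
  have "(\<lambda>w. norm (fst w) powr fst a + norm (snd w) powr snd a)
      \<in> borel_measurable (borel :: ((real^'d) \<times> (real^'d)) measure)"
    by (intro borel_measurable_add powr_real_measurable borel_measurable_const
        borel_measurable_continuous_onI continuous_intros)
  then have "(\<lambda>w. norm (fst w) powr fst a + norm (snd w) powr snd a) -` {1} \<inter> space borel
      \<in> sets (borel :: ((real^'d) \<times> (real^'d)) measure)"
    by (rule measurable_sets) simp
  moreover have "surf a =
      (\<lambda>w :: (real^'d) \<times> (real^'d). norm (fst w) powr fst a + norm (snd w) powr snd a) -` {1}"
    by (auto simp: surf_def)
  ultimately have "surf a \<in> sets (borel :: ((real^'d) \<times> (real^'d)) measure)"
    by simp
  then show ?thesis
    using sets_borel_subset_hausdorff_measure by auto
qed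

end

theory Submission
  imports Defs
begin

text \<open>
  A point of the region close to the given one, with exponents \<open>p0 < p\<close> and \<open>q0 < q\<close>, supplies a
  single-scale bound which scaling makes uniform in \<open>t\<close>. Only positive functions matter, and the
  superlevel set of the maximal function at a height \<open>\<lambda>\<close> is estimated. Replacing \<open>f\<close> and \<open>g\<close> by
  lower semicontinuous majorants, they are dominated everywhere by their Hardy-Littlewood maximal
  functions. Let \<open>\<Omega>\<close>, \<open>\<Omega>'\<close> be the sets where these exceed the powers of \<open>\<lambda>\<close> prescribed by
  homogeneity, and at scale \<open>2\<^sup>-\<^sup>l\<close> cut \<open>f\<close>, \<open>g\<close> into their restrictions to the layers of \<open>\<Omega>\<close>, \<open>\<Omega>'\<close>
  at distance about \<open>2\<^sup>-\<^sup>l\<^sup>-\<^sup>j\<close>, \<open>2\<^sup>-\<^sup>l\<^sup>-\<^sup>k\<close> from the complement. The local means of such a piece at the scale of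
  its layer are controlled by the maximal function at a point of the complement.

  For the pair \<open>(j, k)\<close> the values are truncated at a height exponential in \<open>j\<close> and \<open>k\<close>. The large values
  gain a geometric factor from \<open>p0 < p\<close>, \<open>q0 < q\<close> in the single-scale bound. For the bounded remainders
  one may replace a piece by its local means: the averages gain a power of \<open>h / t\<close> in \<open>L\<^sup>2\<close> on
  differences \<open>f - f (\<cdot> - h)\<close>. This smoothing needs no Fourier transform. The surface measure is invariant
  under reflections in each variable. After averaging over \<open>N\<close> reflections in a plane containing \<open>h\<close>, the
  off-diagonal terms of the squared difference move the translation onto a Lipschitz weight, and the
  diagonal is only the fraction \<open>1 / N\<close> of the whole. It remains that the two projections of the
  measure have bounded densities, which holds because the exponents do not exceed the dimension: the shell where
  \<open>norm y powr \<alpha>\<close> lies within \<open>\<epsilon>\<close> of a given value has volume \<open>O(\<epsilon>)\<close> if \<open>\<alpha> \<le> d\<close>. Since the layers of one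
  function are disjoint for different \<open>l\<close>, all errors sum, and integrating in \<open>\<lambda>\<close> yields the strong type bound.
\<close>

text \<open>A bound at one scale says nothing about a supremum over infinitely many scales. The
  supremum is therefore replaced by a sum over \<open>l\<close>, and the sum has to be paid for by
  pieces that are disjoint for different \<open>l\<close>. This is why the layers used at scale
  \<open>2 powr (- l)\<close> are indexed by \<open>l + j\<close>: for fixed \<open>j\<close> they
  are disjoint in \<open>l\<close>, and what remains is a double series in \<open>j\<close> and
  \<open>k\<close>, for which geometric decay must be produced. Young's inequality with a free
  weight \<open>\<sigma>\<close> makes the weak form of the single-scale bound additive: a
  \<open>p0\<close>-integral of one function plus a \<open>q0\<close>-integral of the other. Both
  terms sum over disjoint pieces, and \<open>\<sigma>\<close> carries a gain found in one function
  over to the other. Three exponents \<open>p0 < p1 < p\<close> occur: the gap below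
  \<open>p1\<close> produces the decay in \<open>j + k\<close>, the gap above it makes the integral
  in the height converge near 0. The additive bound for the maximal function turns into a product of
  norms at the end, because the maximal function does not change when \<open>f\<close> is multiplied
  and \<open>g\<close> divided by the same constant.\<close>

lemma nn_integral_lborel_affine:
  fixes f :: "'a::euclidean_space \<Rightarrow> ennreal"
  assumes f[measurable]: "f \<in> borel_measurable borel" and c: "c \<noteq> 0"
  shows "(\<integral>\<^sup>+x. f x \<partial>lborel) = ennreal (\<bar>c\<bar> ^ DIM('a)) * (\<integral>\<^sup>+x. f (t + c *\<^sub>R x) \<partial>lborel)"
  by (subst lborel_affine[OF c, of t])
     (simp add: nn_integral_density nn_integral_distr nn_integral_cmult)

lemma nn_integral_lborel_reflect:
  fixes f :: "'a::euclidean_space \<Rightarrow> ennreal"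
  assumes f: "f \<in> borel_measurable borel"
  shows "(\<integral>\<^sup>+x. f (t - x) \<partial>lborel) = (\<integral>\<^sup>+x. f x \<partial>lborel)"
  using nn_integral_lborel_affine[OF f, of "-1" t] by simp

section \<open>Real powers of extended non-negative reals\<close>

lemma epowr_ennreal: "0 \<le> x \<Longrightarrow> epowr (ennreal x) s = ennreal (x powr s)"
  by (simp add: epowr_def)

lemma epowr_0 [simp]: "epowr 0 s = 0"
  by (simp add: epowr_def)

lemma epowr_top [simp]: "epowr top s = top"
  by (simp add: epowr_def)

lemma epowr_eq_top_iff [simp]: "epowr x s = top \<longleftrightarrow> x = top"
  by (simp add: epowr_def)

lemma epowr_mono: "x \<le> y \<Longrightarrow> 0 \<le> s \<Longrightarrow> epowr x s \<le> epowr y s"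
  by (auto simp: epowr_def top_unique less_top intro!: ennreal_leI powr_mono2 enn2real_mono)

lemma epowr_epowr: "s \<noteq> 0 \<Longrightarrow> epowr (epowr x s) t = epowr x (s * t)"
  by (cases x) (auto simp: epowr_def powr_powr)

lemma epowr_one [simp]: "epowr x 1 = x"
  by (cases x) (auto simp: epowr_def)

lemma epowr_mult: "0 < s \<Longrightarrow> epowr (x * y) s = epowr x s * epowr y s"
  by (cases x; cases y; cases "x = 0"; cases "y = 0")
     (auto simp: epowr_def ennreal_mult[symmetric] powr_mult ennreal_mult_top ennreal_top_mult
        ennreal_mult_eq_top_iff)

lemma epowr_add: "x \<noteq> 0 \<Longrightarrow> x \<noteq> top \<Longrightarrow> epowr x (s + t) = epowr x s * epowr x t"
  by (cases x) (auto simp: epowr_def ennreal_mult[symmetric] powr_add)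

lemma epowr_mono_exponent: "1 \<le> x \<Longrightarrow> s \<le> t \<Longrightarrow> epowr x s \<le> epowr x t"
  by (cases x) (auto simp: epowr_def intro!: ennreal_leI powr_mono)

lemma borel_measurable_epowr [measurable (raw)]:
  "f \<in> borel_measurable M \<Longrightarrow> (\<lambda>x. epowr (f x) s) \<in> borel_measurable M"
proof -
  assume [measurable]: "f \<in> borel_measurable M"
  have "{x \<in> space M. f x = \<infinity>} \<in> sets M" by measurable
  then show ?thesis unfolding epowr_def by (intro measurable_If) measurable
qed

text \<open>This is the layer-cake formula at one point: for \<open>l > 0\<close> the condition cuts
  out the interval below \<open>v powr (1 / \<alpha>)\<close>, over which
  \<open>l powr (s - 1)\<close> is integrable because \<open>s > 0\<close>, even if it is unbounded
  near 0.\<close>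

lemma nn_integral_powr_level:
  assumes "0 < s" "0 < \<alpha>" "v \<noteq> top"
  shows "(\<integral>\<^sup>+l. indicator {0<..} l * (ennreal (l powr (s - 1)) * indicator {l. ennreal (l powr \<alpha>) < v} l) \<partial>lborel)
     = ennreal (1 / s) * epowr v (s / \<alpha>)"
proof -
  obtain r where real: "v = ennreal r" "0 \<le> r" using assms(3) by (cases v) auto
  define R where "R = r powr (1 / \<alpha>)"
  have R0: "0 \<le> R" by (simp add: R_def)
  have iff: "l powr \<alpha> < r \<longleftrightarrow> l < R" if "0 < l" for l
  proof -
    have "R powr \<alpha> = r" using real assms by (simp add: R_def powr_powr)
    then show ?thesis using powr_less_mono2[of \<alpha> l R] powr_mono2[of \<alpha> R l] that assms R0 by (metis less_imp_le not_le)
  qed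
  have "(\<integral>\<^sup>+l. indicator {0<..} l * (ennreal (l powr (s - 1)) * indicator {l. ennreal (l powr \<alpha>) < v} l) \<partial>lborel)
     = (\<integral>\<^sup>+l. ennreal (l powr (s - 1)) * indicator {0<..<R} l \<partial>lborel)"
    using real iff by (intro nn_integral_cong) (auto simp: ennreal_less_iff split: split_indicator)
  also have "\<dots> = ennreal (R powr s / s)"
  proof -
    have "((\<lambda>x. x powr (s - 1)) has_integral (R powr (s - 1 + 1) / (s - 1 + 1))) {0..R}"
      by (rule has_integral_powr_from_0) (use assms R0 in auto)
    then have "((\<lambda>x. x powr (s - 1)) has_integral (R powr s / s)) {0<..<R}"
      by (simp add: has_integral_Icc_iff_Ioo)
    then show ?thesis
      by (intro nn_integral_has_integral_lebesgue') auto
  qed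
  also have "\<dots> = ennreal (1 / s) * epowr v (s / \<alpha>)"
    using real assms by (simp add: epowr_ennreal R_def powr_powr ennreal_mult[symmetric])
  finally show ?thesis .
qed

section \<open>Densities of the projections of the surface measure\<close>

text \<open>The Vitali covering lemma gives a countable set of centres. Numbering it by a set
  \<open>I\<close> of naturals treats finite and infinite families alike: later sums run over all
  naturals, with empty sets put in outside \<open>I\<close>.\<close>

lemma vitali_sequence:
  fixes S :: "'a::euclidean_space set"
  assumes r: "\<And>x. x \<in> S \<Longrightarrow> 0 < r x \<and> r x \<le> B"
  obtains I :: "nat set" and e :: "nat \<Rightarrow> 'a"
  where "e ` I \<subseteq> S" "disjoint_family_on (\<lambda>i. cball (e i) (r (e i))) I"
    "S \<subseteq> (\<Union>i\<in>I. cball (e i) (5 * r (e i)))"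
proof -
  have "S \<subseteq> (\<Union>x\<in>S. cball x (r x))" using r by (force intro: less_imp_le)
  then obtain C where C: "countable C" "C \<subseteq> S"
    and disj: "pairwise (\<lambda>i j. disjnt (cball i (r i)) (cball j (r j))) C"
    and cov: "S \<subseteq> (\<Union>i\<in>C. cball i (5 * r i))"
    by (rule Vitali_covering_lemma_cballs[where B=B and a="\<lambda>x. x" and r=r]) (use r in auto)
  define I where "I = to_nat_on C ` C"
  define e where "e = inv_into C (to_nat_on C)"
  have inj: "inj_on (to_nat_on C) C" by (rule inj_on_to_nat_on[OF C(1)])
  have e: "e i \<in> C" if "i \<in> I" for i using that unfolding I_def e_def by (rule inv_into_into)
  have einj: "i = j" if "e i = e j" "i \<in> I" "j \<in> I" for i j
    using that unfolding I_def e_def by (metis f_inv_into_f)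
  have esur: "\<exists>i\<in>I. e i = c" if "c \<in> C" for c
    using that inj unfolding I_def e_def by (metis imageI inv_into_f_f)
  show ?thesis
  proof (rule that)
    show "e ` I \<subseteq> S" using e C(2) by auto
    show "disjoint_family_on (\<lambda>i. cball (e i) (r (e i))) I"
      unfolding disjoint_family_on_def
    proof (intro ballI impI)
      fix i j assume ij: "i \<in> I" "j \<in> I" "i \<noteq> j"
      then have "e i \<noteq> e j" using einj by blast
      with disj e ij show "cball (e i) (r (e i)) \<inter> cball (e j) (r (e j)) = {}"
        unfolding pairwise_def disjnt_def by blast
    qed
    show "S \<subseteq> (\<Union>i\<in>I. cball (e i) (5 * r (e i)))"
    proof
      fix x assume "x \<in> S"
      with cov obtain c where c: "c \<in> C" "x \<in> cball c (5 * r c)" by blast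
      from esur[OF c(1)] obtain i where "i \<in> I" "e i = c" by blast
      with c(2) show "x \<in> (\<Union>i\<in>I. cball (e i) (5 * r (e i)))" by blast
    qed
  qed
qed

text \<open>Disjoint balls of radius \<open>\<delta>\<close> around points of \<open>A\<close> fit
  into \<open>W\<close>, and their fivefold enlargements, of diameter \<open>10 * \<delta>\<close>,
  cover \<open>A\<close>. In codimension one the weight of an enlarged ball is a constant times the
  volume of the small ball divided by \<open>\<delta>\<close>. Hence volume per unit of thickness
  bounds the Hausdorff premeasure.\<close>

lemma hausdorff_pre_le_neighbourhood:
  fixes A :: "'a::euclidean_space set"
  assumes s: "s = real DIM('a) - 1" and "0 < s" and d: "0 < \<delta>"
    and W: "W \<in> sets borel" and sub: "\<And>x. x \<in> A \<Longrightarrow> cball x \<delta> \<subseteq> W"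
  shows "hausdorff_pre s (10 * \<delta>) A
     \<le> ennreal (unit_ball_vol s * 5 powr s / (unit_ball_vol (real DIM('a)) * \<delta>)) * emeasure lborel W"
proof -
  let ?\<omega> = "unit_ball_vol (real DIM('a))"
  define k where "k = unit_ball_vol s * 5 powr s / (?\<omega> * \<delta>)"
  have wpos: "?\<omega> > 0" by simp
  have "unit_ball_vol s \<ge> 0" using \<open>0 < s\<close> by simp
  then have k0: "k \<ge> 0" unfolding k_def using wpos d by (intro divide_nonneg_pos mult_nonneg_nonneg mult_pos_pos) auto
  obtain I :: "nat set" and e :: "nat \<Rightarrow> 'a" where e: "e ` I \<subseteq> A"
    and disj: "disjoint_family_on (\<lambda>i. cball (e i) \<delta>) I" and cov: "A \<subseteq> (\<Union>i\<in>I. cball (e i) (5 * \<delta>))"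
    by (rule vitali_sequence[of A "\<lambda>_. \<delta>" \<delta>]) (use d in simp, rule that)
  define U where "U i = (if i \<in> I then cball (e i) (5 * \<delta>) else {})" for i
  define V where "V i = (if i \<in> I then cball (e i) \<delta> else {})" for i
  have dU: "diameter (U i) \<le> 10 * \<delta>" for i
    using d by (auto simp: U_def)
  have bU: "bounded (U i)" for i by (auto simp: U_def)
  have "U \<in> hausdorff_covers (10 * \<delta>) A"
    unfolding hausdorff_covers_def using cov dU bU by (force simp: U_def)
  then have "hausdorff_pre s (10 * \<delta>) A \<le> (\<Sum>i. hausdorff_weight s (U i))"
    unfolding hausdorff_pre_def by (rule INF_lower)
  also have "\<dots> \<le> (\<Sum>i. ennreal k * emeasure lborel (V i))"
  proof (intro suminf_le)
    fix i
    show "hausdorff_weight s (U i) \<le> ennreal k * emeasure lborel (V i)"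
    proof (cases "i \<in> I")
      case True
      have "(diameter (U i) / 2) powr s \<le> (5 * \<delta>) powr s"
        by (rule powr_mono2) (use True dU[of i] \<open>0 < s\<close> bU diameter_ge_0 in auto)
      then have "unit_ball_vol s * (diameter (U i) / 2) powr s \<le> unit_ball_vol s * (5 * \<delta>) powr s"
        using \<open>unit_ball_vol s \<ge> 0\<close> by (rule mult_left_mono)
      also have "\<dots> = k * (?\<omega> * \<delta> ^ DIM('a))"
      proof -
        have "\<delta> powr (s + 1) = \<delta> ^ DIM('a)"
          using d by (simp add: s powr_realpow)
        then have "\<delta> ^ DIM('a) = \<delta> powr s * \<delta>" using d by (simp add: powr_add)
        moreover have "?\<omega> \<noteq> 0" using wpos by linarith
          ultimately show ?thesis using d unfolding k_def by (simp add: powr_mult)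
      qed
      finally show ?thesis
        using True d k0 wpos unfolding hausdorff_weight_def V_def
        by (simp add: emeasure_cball ennreal_mult[symmetric] ennreal_leI)
    qed (simp add: U_def)
  qed auto
  also have "\<dots> = ennreal k * (\<Sum>i. emeasure lborel (V i))" by simp
  also have "(\<Sum>i. emeasure lborel (V i)) = emeasure lborel (\<Union>i. V i)"
  proof (rule suminf_emeasure)
    show "range V \<subseteq> sets lborel" by (auto simp: V_def)
    show "disjoint_family V"
      using disj unfolding disjoint_family_on_def V_def by auto
  qed
  also have "emeasure lborel (\<Union>i. V i) \<le> emeasure lborel W"
  proof (rule emeasure_mono)
    show "(\<Union>i. V i) \<subseteq> W" using sub e unfolding V_def by (auto split: if_splits)
  qed (use W in simp)
  finally show ?thesis unfolding k_def by (simp add: mult_left_mono)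
qed

text \<open>Mean value theorem: for \<open>\<rho> \<ge> 1\<close> the derivative of the power is
  nondecreasing, so its value at \<open>B\<close> bounds it on the whole interval.\<close>

lemma powr_diff_le:
  fixes x y B \<rho> :: real
  assumes "1 \<le> \<rho>" "0 \<le> x" "x \<le> y" "y \<le> B"
  shows "y powr \<rho> - x powr \<rho> \<le> \<rho> * B powr (\<rho> - 1) * (y - x)"
proof (cases "x = y")
  case False
  then have xy: "x < y" using assms by simp
  have cont: "continuous_on {x..y} (\<lambda>t. t powr \<rho>)"
    using assms by (intro continuous_on_powr' continuous_intros) auto
  have "((\<lambda>t. t powr \<rho>) has_real_derivative \<rho> * t powr (\<rho> - 1)) (at t)" if "x < t" for t
    using that assms by (intro has_real_derivative_powr) auto
  then obtain l z where z: "x < z" "z < y" "DERIV (\<lambda>t. t powr \<rho>) z :> l" "y powr \<rho> - x powr \<rho> = (y - x) * l"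
      and D: "DERIV (\<lambda>t. t powr \<rho>) z :> \<rho> * z powr (\<rho> - 1)"
    using MVT[OF xy cont] by (metis real_differentiable_def)
  from z(3) D have l: "l = \<rho> * z powr (\<rho> - 1)" by (rule DERIV_unique)
  have "z powr (\<rho> - 1) \<le> B powr (\<rho> - 1)" using z assms by (intro powr_mono2) auto
  then have "\<rho> * z powr (\<rho> - 1) \<le> \<rho> * B powr (\<rho> - 1)" using assms by (intro mult_left_mono) auto
  then show ?thesis unfolding z(4) l mult.commute[of "y - x"] using xy by (intro mult_right_mono) auto
qed simp

text \<open>A ball of radius \<open>v powr (1 / \<alpha>)\<close> has volume proportional to
  \<open>v powr (d / \<alpha>)\<close>. The condition \<open>\<alpha> \<le> d\<close> makes this
  exponent at least 1, so the volume is Lipschitz in \<open>v\<close> down to \<open>v = 0\<close>;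
  for \<open>\<alpha> > d\<close> the slope would blow up there. The numbers 2 in \<open>c\<close>
  come from \<open>v \<le> 2\<close> and from the width \<open>2 * e\<close> of the range of
  \<open>v\<close>.\<close>

lemma emeasure_powr_shell_le:
  fixes u e \<alpha> :: real
  assumes "1 \<le> \<alpha>" "\<alpha> \<le> real DIM('a)" "u \<le> 1" "0 \<le> e" "e \<le> 1"
  defines "c \<equiv> unit_ball_vol (real DIM('a)) * (real DIM('a) / \<alpha> * 2 powr (real DIM('a) / \<alpha> - 1) * 2)"
  shows "emeasure lborel {y :: 'a::euclidean_space. \<bar>norm y powr \<alpha> - u\<bar> \<le> e} \<le> ennreal (c * e)"
proof -
  let ?d = "DIM('a)"
  define \<rho> where "\<rho> = real ?d / \<alpha>"
  have \<rho>: "1 \<le> \<rho>" unfolding \<rho>_def using assms by simp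
  \<comment> \<open>Clipping at 0 is essential since \<open>u\<close> may be negative; it keeps both
    bounds for \<open>norm y powr \<alpha>\<close> and does not widen the interval.\<close>
  define v1 where "v1 = max 0 (u - e)"
  define v2 where "v2 = max 0 (u + e)"
  have v: "0 \<le> v1" "v1 \<le> v2" "v2 \<le> 2" "v2 - v1 \<le> 2 * e" unfolding v1_def v2_def using assms by auto
  let ?r1 = "v1 powr (1 / \<alpha>)" and ?r2 = "v2 powr (1 / \<alpha>)"
  have r: "?r1 \<le> ?r2" using v assms by (intro powr_mono2) auto
  have pw: "(v powr (1 / \<alpha>)) ^ ?d = v powr \<rho>" if "v \<ge> 0" for v
  proof -
    have "(v powr (1 / \<alpha>)) ^ ?d = v powr (1 / \<alpha> * real ?d)"
      by (cases "v = 0") (use that in \<open>auto simp: powr_powr powr_realpow[symmetric]\<close>)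
    then show ?thesis by (simp add: \<rho>_def)
  qed
  have ge: "v powr (1 / \<alpha>) \<le> n" if "v \<le> n powr \<alpha>" "0 \<le> n" "0 \<le> v" for v n :: real
  proof -
    have "v powr (1 / \<alpha>) \<le> (n powr \<alpha>) powr (1 / \<alpha>)" using that assms by (intro powr_mono2) auto
    then show ?thesis using that assms by (simp add: powr_powr)
  qed
  have le: "n \<le> v powr (1 / \<alpha>)" if "n powr \<alpha> \<le> v" "0 \<le> n" for v n :: real
  proof -
    have "(n powr \<alpha>) powr (1 / \<alpha>) \<le> v powr (1 / \<alpha>)" using that assms by (intro powr_mono2) auto
    then show ?thesis using that assms by (simp add: powr_powr)
  qed
  have "{y :: 'a. \<bar>norm y powr \<alpha> - u\<bar> \<le> e} \<subseteq> cball 0 ?r2 - ball 0 ?r1"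
  proof
    fix y :: 'a assume y: "y \<in> {y. \<bar>norm y powr \<alpha> - u\<bar> \<le> e}"
    then have "norm y powr \<alpha> \<le> v2" "v1 \<le> norm y powr \<alpha>" unfolding v1_def v2_def by auto
    then show "y \<in> cball 0 ?r2 - ball 0 ?r1"
      using le[of "norm y" v2] ge[of v1 "norm y"] v by auto
  qed
  then have "emeasure lborel {y :: 'a. \<bar>norm y powr \<alpha> - u\<bar> \<le> e} \<le> emeasure lborel (cball (0::'a) ?r2 - ball 0 ?r1)"
    by (intro emeasure_mono) auto
  also have "\<dots> = emeasure lborel (cball (0::'a) ?r2) - emeasure lborel (ball (0::'a) ?r1)"
    using r by (intro emeasure_Diff) (auto simp: emeasure_ball)
  also have "\<dots> = ennreal (unit_ball_vol (real ?d) * (v2 powr \<rho> - v1 powr \<rho>))"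
    using v by (simp add: emeasure_cball emeasure_ball pw ennreal_minus right_diff_distrib)
  also have "\<dots> \<le> ennreal (c * e)"
  proof (rule ennreal_leI)
    have "v2 powr \<rho> - v1 powr \<rho> \<le> \<rho> * 2 powr (\<rho> - 1) * (v2 - v1)"
      by (rule powr_diff_le[OF \<rho>]) (use v in auto)
    also have "\<dots> \<le> \<rho> * 2 powr (\<rho> - 1) * (2 * e)"
      using v \<rho> by (intro mult_left_mono) auto
    finally show "unit_ball_vol (real ?d) * (v2 powr \<rho> - v1 powr \<rho>) \<le> c * e"
      unfolding c_def \<rho>_def[symmetric] by (simp add: mult.assoc mult_left_mono)
  qed
  finally show ?thesis .
qed

lemma norm_powr_diff_le:
  fixes y y' :: "'a::real_normed_vector"
  assumes "1 \<le> \<alpha>" "norm (y - y') \<le> \<delta>" "norm y' \<le> 1" "\<delta> \<le> 1"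
  shows "\<bar>norm y powr \<alpha> - norm y' powr \<alpha>\<bar> \<le> \<alpha> * 2 powr (\<alpha> - 1) * \<delta>"
proof -
  have d: "\<bar>norm y - norm y'\<bar> \<le> \<delta>" using norm_triangle_ineq3[of y y'] assms by simp
  have y2: "norm y \<le> 2" using d assms by simp
  have *: "b powr \<alpha> - a powr \<alpha> \<le> \<alpha> * 2 powr (\<alpha> - 1) * \<delta> \<and> a powr \<alpha> \<le> b powr \<alpha>"
    if "0 \<le> a" "a \<le> b" "b \<le> 2" "b - a \<le> \<delta>" for a b :: real
  proof
    have "b powr \<alpha> - a powr \<alpha> \<le> \<alpha> * 2 powr (\<alpha> - 1) * (b - a)"
      by (rule powr_diff_le) (use that assms in auto)
    also have "\<dots> \<le> \<alpha> * 2 powr (\<alpha> - 1) * \<delta>" using that assms by (intro mult_left_mono) auto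
    finally show "b powr \<alpha> - a powr \<alpha> \<le> \<alpha> * 2 powr (\<alpha> - 1) * \<delta>" .
    show "a powr \<alpha> \<le> b powr \<alpha>" using that assms by (intro powr_mono2) auto
  qed
  show ?thesis
  proof (cases "norm y \<le> norm y'")
    case True
    then show ?thesis using *[of "norm y" "norm y'"] d assms by auto
  next
    case False
    then show ?thesis using *[of "norm y'" "norm y"] d assms y2 by auto
  qed
qed

lemma surf_norm_le:
  assumes "w \<in> surf a" "1 \<le> fst a" "1 \<le> snd a"
  shows "norm (fst w) \<le> 1" "norm (snd w) \<le> 1"
proof -
  have sum: "norm (fst w) powr fst a + norm (snd w) powr snd a = 1"
    using assms(1) by (auto simp: surf_def)
  have *: "n \<le> 1" if "n powr \<alpha> \<le> 1" "0 \<le> n" "1 \<le> \<alpha>" for n \<alpha> :: real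
  proof (rule ccontr)
    assume "\<not> n \<le> 1"
    then have "1 powr \<alpha> < n powr \<alpha>" using that by (intro powr_less_mono2) auto
    with that show False by simp
  qed
  have "0 \<le> norm (fst w) powr fst a" "0 \<le> norm (snd w) powr snd a" by simp_all
  with sum have "norm (fst w) powr fst a \<le> 1" "norm (snd w) powr snd a \<le> 1" by linarith+
  with * assms(2,3) show "norm (fst w) \<le> 1" "norm (snd w) \<le> 1" by auto
qed

text \<open>The \<open>\<delta>\<close>-neighbourhood of the part of the surface over
  \<open>K\<close> lies in a set whose slices, over points \<open>z\<close> within
  \<open>\<delta>\<close> of \<open>K\<close>, are shells of half-width \<open>L * \<delta>\<close>;
  here \<open>L\<close> is a Lipschitz constant of the defining function near the surface. Fubini
  and the shell estimate give a volume of order \<open>\<delta>\<close> times the measure of the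
  \<open>\<delta>\<close>-neighbourhood of \<open>K\<close>. After division by
  \<open>\<delta>\<close> the limit can be taken, because the closed neighbourhoods of a compact set
  decrease to the set and have finite measure.\<close>

lemma hausdorff_outer_surf_snd_compact:
  fixes K :: "(real^'d) set"
  assumes a: "1 \<le> fst a" "fst a \<le> real CARD('d)" "1 \<le> snd a" and d: "CARD('d) \<ge> 2" and K: "compact K"
  defines "c \<equiv> unit_ball_vol (real CARD('d)) * (real CARD('d) / fst a * 2 powr (real CARD('d) / fst a - 1) * 2)"
  defines "\<sigma> \<equiv> 2 * real CARD('d) - 1"
  defines "L \<equiv> fst a * 2 powr (fst a - 1) + snd a * 2 powr (snd a - 1)"
  shows "hausdorff_outer \<sigma> {w \<in> surf a. snd w \<in> K}
     \<le> ennreal (unit_ball_vol \<sigma> * 5 powr \<sigma> / unit_ball_vol (2 * real CARD('d)) * (c * L)) * emeasure lborel K"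
proof (cases "K = {}")
  case False
  let ?A = "{w \<in> surf a. snd w \<in> K}"
  have c0: "c \<ge> 0" unfolding c_def using a by auto
  have L0: "L > 0" unfolding L_def using a by (intro add_pos_pos mult_pos_pos) auto
  have sg: "\<sigma> > 0" unfolding \<sigma>_def using d by simp
  define k where "k = unit_ball_vol \<sigma> * 5 powr \<sigma> / unit_ball_vol (2 * real CARD('d))"
  have k0: "k \<ge> 0" unfolding k_def using sg by (intro divide_nonneg_pos mult_nonneg_nonneg) auto
  define Kd where "Kd \<delta> = {z. infdist z K \<le> \<delta>}" for \<delta>
  have clKd: "closed (Kd \<delta>)" for \<delta>
    unfolding Kd_def by (intro closed_Collect_le continuous_intros)
  define W where "W \<delta> = {w :: (real^'d) \<times> (real^'d). snd w \<in> Kd \<delta> \<and> \<bar>norm (fst w) powr fst a - (1 - norm (snd w) powr snd a)\<bar> \<le> L * \<delta>}" for \<delta>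
  have meas[measurable]: "(\<lambda>w :: (real^'d) \<times> (real^'d). \<bar>norm (fst w) powr fst a - (1 - norm (snd w) powr snd a)\<bar>) \<in> borel_measurable borel"
    by (intro borel_measurable_abs borel_measurable_diff powr_real_measurable borel_measurable_const
        borel_measurable_continuous_onI continuous_intros)
  have Wb: "W \<delta> \<in> sets borel" for \<delta>
  proof -
    have "W \<delta> = (snd -` Kd \<delta> \<inter> space borel) \<inter> {w\<in>space borel. \<bar>norm (fst w) powr fst a - (1 - norm (snd w) powr snd a)\<bar> \<le> L * \<delta>}"
      by (auto simp: W_def)
    also have "\<dots> \<in> sets borel"
      using clKd by (intro sets.Int measurable_sets[where A=borel] borel_measurable_continuous_onI continuous_intros) auto
    finally show ?thesis .
  qed
  have sub: "cball w \<delta> \<subseteq> W \<delta>" if w: "w \<in> ?A" and \<delta>: "0 < \<delta>" "\<delta> \<le> 1" for w \<delta>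
  proof
    fix v assume v: "v \<in> cball w \<delta>"
    have nf: "norm (fst v - fst w) \<le> \<delta>" and ns: "norm (snd v - snd w) \<le> \<delta>"
      using v dist_fst_le[of v w] dist_snd_le[of v w] by (auto simp: dist_norm[symmetric] dist_commute)
    have "infdist (snd v) K \<le> dist (snd v) (snd w)" using w by (intro infdist_le) auto
    then have 1: "snd v \<in> Kd \<delta>" using ns by (simp add: Kd_def dist_norm)
    have e: "norm (fst w) powr fst a = 1 - norm (snd w) powr snd a" using w by (auto simp: surf_def)
    have n: "norm (fst w) \<le> 1" "norm (snd w) \<le> 1" using w surf_norm_le[of w a] a by auto
    have "\<bar>norm (fst v) powr fst a - norm (fst w) powr fst a\<bar> \<le> fst a * 2 powr (fst a - 1) * \<delta>"
      by (rule norm_powr_diff_le) (use a nf n \<delta> in auto)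
    moreover have "\<bar>norm (snd v) powr snd a - norm (snd w) powr snd a\<bar> \<le> snd a * 2 powr (snd a - 1) * \<delta>"
      by (rule norm_powr_diff_le) (use a ns n \<delta> in auto)
    ultimately have "\<bar>norm (fst v) powr fst a - (1 - norm (snd v) powr snd a)\<bar> \<le> L * \<delta>"
      using e unfolding L_def by (simp add: distrib_right)
    with 1 show "v \<in> W \<delta>" by (simp add: W_def)
  qed
  have Wm: "emeasure lborel (W \<delta>) \<le> ennreal (c * (L * \<delta>)) * emeasure lborel (Kd \<delta>)"
    if \<delta>: "0 < \<delta>" "L * \<delta> \<le> 1" for \<delta>
  proof -
    have "emeasure lborel (W \<delta>) = emeasure (lborel \<Otimes>\<^sub>M lborel) (W \<delta>)" by (simp add: lborel_prod)
    also have "\<dots> = (\<integral>\<^sup>+z. emeasure lborel ((\<lambda>y. (y, z)) -` W \<delta>) \<partial>lborel)"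
      by (rule lborel_pair.emeasure_pair_measure_alt2) (simp only: lborel_prod sets_lborel Wb)
    also have "\<dots> \<le> (\<integral>\<^sup>+z. ennreal (c * (L * \<delta>)) * indicator (Kd \<delta>) z \<partial>lborel)"
    proof (rule nn_integral_mono)
      fix z :: "real^'d"
      show "emeasure lborel ((\<lambda>y. (y, z)) -` W \<delta>) \<le> ennreal (c * (L * \<delta>)) * indicator (Kd \<delta>) z"
      proof (cases "z \<in> Kd \<delta>")
        case True
        have "(\<lambda>y. (y, z)) -` W \<delta> = {y. \<bar>norm y powr fst a - (1 - norm z powr snd a)\<bar> \<le> L * \<delta>}"
          using True by (auto simp: W_def)
        also have "emeasure lborel \<dots> \<le> ennreal (c * (L * \<delta>))"
          unfolding c_def using emeasure_powr_shell_le[where 'a="real^'d", of "fst a" "1 - norm z powr snd a" "L * \<delta>"]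
             a \<delta> L0 by simp
        finally show ?thesis using True by simp
      qed (auto simp: W_def)
    qed
    also have "\<dots> = ennreal (c * (L * \<delta>)) * emeasure lborel (Kd \<delta>)"
      using clKd by (intro nn_integral_cmult_indicator) auto
    finally show ?thesis .
  qed
  have pre: "hausdorff_pre \<sigma> (10 * \<delta>) ?A \<le> ennreal (k * (c * L)) * emeasure lborel (Kd \<delta>)"
    if \<delta>: "0 < \<delta>" "L * \<delta> \<le> 1" "\<delta> \<le> 1" for \<delta>
  proof -
    have D: "real DIM((real^'d) \<times> (real^'d)) = 2 * real CARD('d)" by simp
    have "hausdorff_pre \<sigma> (10 * \<delta>) ?A \<le> ennreal (unit_ball_vol \<sigma> * 5 powr \<sigma> /
           (unit_ball_vol (real DIM((real^'d) \<times> (real^'d))) * \<delta>)) * emeasure lborel (W \<delta>)"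
      by (rule hausdorff_pre_le_neighbourhood) (use \<delta> sg Wb sub in \<open>auto simp: \<sigma>_def\<close>)
    also have "unit_ball_vol \<sigma> * 5 powr \<sigma> / (unit_ball_vol (real DIM((real^'d) \<times> (real^'d))) * \<delta>) = k / \<delta>"
      unfolding D by (simp add: k_def)
    also have "ennreal (k / \<delta>) * emeasure lborel (W \<delta>)
        \<le> ennreal (k / \<delta>) * (ennreal (c * (L * \<delta>)) * emeasure lborel (Kd \<delta>))"
      by (intro mult_left_mono Wm \<delta>) simp
    also have "\<dots> = ennreal (k * (c * L)) * emeasure lborel (Kd \<delta>)"
    proof -
      have "k / \<delta> * (c * (L * \<delta>)) = k * (c * L)" using \<delta> by simp
      then have "ennreal (k / \<delta>) * ennreal (c * (L * \<delta>)) = ennreal (k * (c * L))"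
        using \<delta> k0 c0 L0 by (subst ennreal_mult[symmetric]) auto
      then show ?thesis by (simp only: mult.assoc[symmetric])
    qed
    finally show ?thesis .
  qed
  \<comment> \<open>A null sequence kept below both \<open>1 / L\<close>, as the shell estimate
    demands, and 1, as the Lipschitz estimate demands.\<close>
  define d where "d n = min (1 / L) 1 / real (Suc n)" for n
  have dn: "0 < d n" "L * d n \<le> 1" "d n \<le> 1" for n
  proof -
    have m: "min (1 / L) 1 > 0" using L0 by simp
    show "0 < d n" unfolding d_def using m by simp
    have "d n \<le> min (1 / L) 1 / 1" unfolding d_def by (rule divide_left_mono) (use m L0 in auto)
    then have dn: "d n \<le> 1 / L" "d n \<le> 1" by auto
    show "d n \<le> 1" by (rule dn)
    have "L * d n \<le> L * (1 / L)" using dn(1) L0 by (intro mult_left_mono) auto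
    then show "L * d n \<le> 1" using L0 by simp
  qed
  have d0: "d \<longlonglongrightarrow> 0" unfolding d_def using LIMSEQ_Suc[OF lim_const_over_n[of "min (1 / L) 1"]] by simp
  have lim: "(\<lambda>n. emeasure lborel (Kd (d n))) \<longlonglongrightarrow> emeasure lborel (\<Inter>n. Kd (d n))"
  proof (rule Lim_emeasure_decseq)
    show "range (\<lambda>n. Kd (d n)) \<subseteq> sets lborel" using clKd by auto
    have "d m \<ge> d n" if "m \<le> n" for m n
      unfolding d_def using that L0 by (intro divide_left_mono) auto
    then show "decseq (\<lambda>n. Kd (d n))" unfolding decseq_def Kd_def by force
    fix n
    obtain B where B: "\<And>x. x \<in> K \<Longrightarrow> norm x \<le> B" using compact_imp_bounded[OF K] by (auto simp: bounded_iff)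
    have "norm z \<le> B + 1" if z: "z \<in> Kd (d n)" for z
    proof -
      obtain k where k: "k \<in> K" "infdist z K = dist z k"
        using infdist_attains_inf[OF compact_imp_closed[OF K] False] by metis
      have "dist z k \<le> 1" using z k dn(3)[of n] by (simp add: Kd_def)
      then show ?thesis using B[OF k(1)] norm_triangle_sub[of z k] by (simp add: dist_norm)
    qed
    then have "bounded (Kd (d n))" by (meson boundedI)
    then show "emeasure lborel (Kd (d n)) \<noteq> \<infinity>" using emeasure_bounded_finite by force
  qed
  have "(\<Inter>n. Kd (d n)) = K"
  proof -
    have "z \<in> K" if "\<And>n. infdist z K \<le> d n" for z
    proof -
      have "infdist z K \<le> 0" using d0 that by (intro LIMSEQ_le_const[OF d0]) auto
      then show ?thesis using in_closed_iff_infdist_zero[OF compact_imp_closed[OF K] False] infdist_nonneg[of z K] by auto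
    qed
    then have "(\<Inter>n. Kd (d n)) \<subseteq> K" unfolding Kd_def by blast
    moreover have "z \<in> Kd (d n)" if "z \<in> K" for z n
      using dn(1)[of n] that by (simp add: Kd_def)
    ultimately show ?thesis by blast
  qed
  with lim have lim: "(\<lambda>n. emeasure lborel (Kd (d n))) \<longlonglongrightarrow> emeasure lborel K" by simp
  show ?thesis unfolding k_def[symmetric] hausdorff_outer_def
  proof (rule SUP_least)
    \<comment> \<open>The premeasure grows when the mesh shrinks, so for a fixed mesh all large
      \<open>n\<close> give an upper bound, and only this bound varies with \<open>n\<close> in the
      limit.\<close>
    fix \<epsilon> :: real assume "\<epsilon> \<in> {0<..}"
    then have \<epsilon>: "\<epsilon> / 10 > 0" by simp
    have "\<forall>\<^sub>F n in sequentially. d n < \<epsilon> / 10" using order_tendstoD(2)[OF d0 \<epsilon>] .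
    then have ev: "\<forall>\<^sub>F n in sequentially. hausdorff_pre \<sigma> \<epsilon> ?A \<le> ennreal (k * (c * L)) * emeasure lborel (Kd (d n))"
    proof eventually_elim
      case (elim n)
      have "hausdorff_pre \<sigma> \<epsilon> ?A \<le> hausdorff_pre \<sigma> (10 * d n) ?A"
        using elim by (intro hausdorff_pre_mono) auto
      also have "\<dots> \<le> ennreal (k * (c * L)) * emeasure lborel (Kd (d n))" by (intro pre dn)
      finally show ?case .
    qed
    have "(\<lambda>n. ennreal (k * (c * L)) * emeasure lborel (Kd (d n))) \<longlonglongrightarrow> ennreal (k * (c * L)) * emeasure lborel K"
      by (intro ennreal_tendsto_cmult lim) simp
    from tendsto_lowerbound[OF this ev]
    show "hausdorff_pre \<sigma> \<epsilon> ?A \<le> ennreal (k * (c * L)) * emeasure lborel K" by simp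
  qed
qed simp

section \<open>The Hardy-Littlewood maximal function\<close>

lemma ennreal_divide_le_iff: "b \<noteq> 0 \<Longrightarrow> b \<noteq> top \<Longrightarrow> a / b \<le> c \<longleftrightarrow> a \<le> c * (b::ennreal)"
proof
  assume b: "b \<noteq> 0" "b \<noteq> top"
  { assume "a / b \<le> c"
    then have "a / b * b \<le> c * b" by (rule mult_right_mono) simp
    then show "a \<le> c * b" using b by (simp add: ennreal_divide_times ennreal_divide_self less_top) }
  { assume "a \<le> c * b"
    then show "a / b \<le> c" using b by (intro divide_le_posI_ennreal) (auto simp: zero_less_iff_neq_zero mult.commute) }
qed

definition hl :: "('a::euclidean_space \<Rightarrow> ennreal) \<Rightarrow> 'a \<Rightarrow> ennreal" where
  "hl f x = (SUP r\<in>{0<..}. (\<integral>\<^sup>+y. f y * indicator (cball x r) y \<partial>lborel) / emeasure lborel (cball x r))"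

lemma cball_in_sets_borel [measurable]: "cball (x::'a::metric_space) r \<in> sets borel"
  by simp

lemma unit_ball_vol_of_nat_neq_0 [simp]: "unit_ball_vol (real n) \<noteq> 0"
  using unit_ball_vol_pos[of "real n"] by linarith

lemma emeasure_cball_nontrivial:
  "0 < r \<Longrightarrow> emeasure lborel (cball (x::'a::euclidean_space) r) \<noteq> 0"
  "emeasure lborel (cball (x::'a::euclidean_space) r) \<noteq> top"
  using emeasure_bounded_finite[of "cball x r"] by (auto simp: emeasure_cball)

lemma hl_le_iff:
  fixes f :: "'a::euclidean_space \<Rightarrow> ennreal"
  shows "hl f x \<le> c \<longleftrightarrow> (\<forall>r>0. (\<integral>\<^sup>+y. f y * indicator (cball x r) y \<partial>lborel) \<le> c * emeasure lborel (cball x r))"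
  unfolding hl_def SUP_le_iff using emeasure_cball_nontrivial[where 'a='a] by (auto simp: ennreal_divide_le_iff)

lemma nn_integral_cball_le_hl:
  "0 < r \<Longrightarrow> (\<integral>\<^sup>+y. f y * indicator (cball x r) y \<partial>lborel) \<le> hl f x * emeasure lborel (cball x r)"
  using hl_le_iff[of f x "hl f x"] by simp

lemma hl_le_const: "(\<And>x. f x \<le> c) \<Longrightarrow> hl f x \<le> c"
  unfolding hl_le_iff
proof (intro allI impI)
  fix r :: real assume "\<And>x. f x \<le> c"
  then have "(\<integral>\<^sup>+y. f y * indicator (cball x r) y \<partial>lborel) \<le> (\<integral>\<^sup>+y. c * indicator (cball x r) y \<partial>lborel)"
    by (intro nn_integral_mono mult_right_mono) auto
  then show "(\<integral>\<^sup>+y. f y * indicator (cball x r) y \<partial>lborel) \<le> c * emeasure lborel (cball x r)"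
    by (simp add: nn_integral_cmult_indicator)
qed

lemma hl_cmult_le:
  assumes [measurable]: "f \<in> borel_measurable borel"
  shows "hl (\<lambda>x. c * f x) x \<le> c * hl f x"
  unfolding hl_le_iff
proof (intro allI impI)
  fix r :: real assume "0 < r"
  have "(\<integral>\<^sup>+y. c * f y * indicator (cball x r) y \<partial>lborel) = c * (\<integral>\<^sup>+y. f y * indicator (cball x r) y \<partial>lborel)"
    by (simp add: mult.assoc nn_integral_cmult)
  also have "\<dots> \<le> c * (hl f x * emeasure lborel (cball x r))"
    by (intro mult_left_mono nn_integral_cball_le_hl \<open>0 < r\<close>) simp
  finally show "(\<integral>\<^sup>+y. c * f y * indicator (cball x r) y \<partial>lborel) \<le> c * hl f x * emeasure lborel (cball x r)"
    by (simp add: mult.assoc)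
qed

lemma hl_cmult:
  assumes f: "f \<in> borel_measurable borel" and c: "0 < c"
  shows "hl (\<lambda>x. ennreal c * f x) x = ennreal c * hl f x"
proof (rule antisym[OF hl_cmult_le[OF f]])
  have "hl (\<lambda>x. ennreal (1 / c) * (ennreal c * f x)) x \<le> ennreal (1 / c) * hl (\<lambda>x. ennreal c * f x) x"
    using f by (intro hl_cmult_le) measurable
  then have "ennreal c * hl (\<lambda>x. ennreal (1 / c) * (ennreal c * f x)) x
      \<le> ennreal c * (ennreal (1 / c) * hl (\<lambda>x. ennreal c * f x) x)"
    by (rule mult_left_mono) simp
  moreover have "ennreal (1 / c) * (ennreal c * z) = z" "ennreal c * (ennreal (1 / c) * z) = z" for z
    using c by (simp_all add: mult.assoc[symmetric] ennreal_mult[symmetric])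
  ultimately show "ennreal c * hl f x \<le> hl (\<lambda>x. ennreal c * f x) x" by simp
qed

text \<open>If the mean over a ball around \<open>x\<close> exceeds \<open>c\<close> strictly, this
  survives a small increase of the radius, and the larger ball around any nearby centre contains the
  original one.\<close>

lemma open_hl_greater:
  fixes f :: "'a::euclidean_space \<Rightarrow> ennreal"
  shows "open {x. c < hl f x}"
  unfolding open_dist
proof (intro ballI)
  fix x assume x: "x \<in> {x. c < hl f x}"
  then obtain r where r: "r > 0" and I: "c * emeasure lborel (cball x r) < (\<integral>\<^sup>+y. f y * indicator (cball x r) y \<partial>lborel)"
    using hl_le_iff[of f x c] by (auto simp: not_le[symmetric])
  have c: "c \<noteq> top" using x by auto
  have "((\<lambda>s. c * ennreal (unit_ball_vol (real DIM('a)) * (r + s) ^ DIM('a))) \<longlongrightarrow>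
        c * ennreal (unit_ball_vol (real DIM('a)) * (r + 0) ^ DIM('a))) (at_right 0)"
    using c by (intro ennreal_tendsto_cmult tendsto_ennrealI tendsto_intros) (auto simp: less_top)
  then have "\<forall>\<^sub>F s in at_right 0. c * ennreal (unit_ball_vol (real DIM('a)) * (r + s) ^ DIM('a))
      < (\<integral>\<^sup>+y. f y * indicator (cball x r) y \<partial>lborel)"
    using I r by (intro order_tendstoD(2)) (auto simp: emeasure_cball)
  then have "\<forall>\<^sub>F s in at_right 0. 0 < s \<and> c * ennreal (unit_ball_vol (real DIM('a)) * (r + s) ^ DIM('a))
      < (\<integral>\<^sup>+y. f y * indicator (cball x r) y \<partial>lborel)"
    using eventually_at_right_less[of 0] by eventually_elim auto
  then obtain s where s: "0 < s" and sI: "c * ennreal (unit_ball_vol (real DIM('a)) * (r + s) ^ DIM('a))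
      < (\<integral>\<^sup>+y. f y * indicator (cball x r) y \<partial>lborel)"
    using eventually_happens'[OF trivial_limit_at_right_real] by blast
  show "\<exists>e>0. \<forall>y. dist y x < e \<longrightarrow> y \<in> {x. c < hl f x}"
  proof (intro exI conjI allI impI)
    fix z assume z: "dist z x < s"
    have sub: "cball x r \<subseteq> cball z (r + s)"
    proof
      fix y assume "y \<in> cball x r"
      then show "y \<in> cball z (r + s)" using z dist_triangle[of z y x] by auto
    qed
    have "c * emeasure lborel (cball z (r + s)) < (\<integral>\<^sup>+y. f y * indicator (cball x r) y \<partial>lborel)"
      using sI r s by (simp add: emeasure_cball)
    also have "\<dots> \<le> (\<integral>\<^sup>+y. f y * indicator (cball z (r + s)) y \<partial>lborel)"
      using sub by (intro nn_integral_mono mult_left_mono) (auto simp: indicator_def)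
    finally show "z \<in> {x. c < hl f x}"
      using hl_le_iff[of f z c] r s by (auto simp: not_le[symmetric] dest!: spec[of _ "r + s"])
  qed (rule s)
qed

lemma borel_measurable_hl [measurable]: "hl f \<in> borel_measurable borel"
proof (rule borel_measurableI_greater)
  fix y show "{x \<in> space borel. y < hl f x} \<in> sets borel"
    using open_hl_greater[of y f] by simp
qed

text \<open>Every point of the superlevel set is the centre of a ball on which the integral of
  \<open>f\<close> is at least \<open>c\<close> times the volume. A disjoint subfamily has fivefold
  enlargements that cover the set, whence the factor \<open>5 ^ d\<close>.\<close>

lemma hl_weak_type:
  fixes f :: "'a::euclidean_space \<Rightarrow> ennreal"
  assumes f[measurable]: "f \<in> borel_measurable borel" and c: "0 < c"
  shows "ennreal c * emeasure lborel {x. ennreal c < hl f x} \<le> 5 ^ DIM('a) * (\<integral>\<^sup>+x. f x \<partial>lborel)"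
proof (cases "(\<integral>\<^sup>+x. f x \<partial>lborel) = top")
  case True
  then show ?thesis by (simp add: ennreal_mult_top)
next
  case fin: False
  let ?E = "{x. ennreal c < hl f x}"
  let ?V = "\<lambda>r. unit_ball_vol (real DIM('a)) * r ^ DIM('a)"
  define r where "r x = (SOME r. 0 < r \<and> ennreal c * emeasure lborel (cball x r) \<le> (\<integral>\<^sup>+y. f y * indicator (cball x r) y \<partial>lborel))" for x
  have r: "0 < r x \<and> ennreal c * emeasure lborel (cball x (r x)) \<le> (\<integral>\<^sup>+y. f y * indicator (cball x (r x)) y \<partial>lborel)"
    if x: "x \<in> ?E" for x
    unfolding r_def by (rule someI_ex) (use x hl_le_iff[of f x "ennreal c"] in \<open>auto simp: not_le[symmetric]\<close>)
  define b where "b = enn2real (\<integral>\<^sup>+x. f x \<partial>lborel)"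
  have b: "(\<integral>\<^sup>+x. f x \<partial>lborel) = ennreal b" "0 \<le> b" unfolding b_def using fin by (auto simp: less_top)
  \<comment> \<open>The radius at which \<open>c\<close> times the volume of the ball equals the
    total integral; no selected ball can be larger, which is the boundedness that the covering lemma
    asks for.\<close>
  define B where "B = root DIM('a) (b / (c * unit_ball_vol (real DIM('a))))"
  have rB: "r x \<le> B" if x: "x \<in> ?E" for x
  proof -
    have "ennreal (c * ?V (r x)) = ennreal c * emeasure lborel (cball x (r x))"
      using r[OF x] c by (simp add: emeasure_cball ennreal_mult)
    also have "\<dots> \<le> (\<integral>\<^sup>+y. f y * indicator (cball x (r x)) y \<partial>lborel)" using r[OF x] by simp
    also have "\<dots> \<le> ennreal b" unfolding b(1)[symmetric] by (intro nn_integral_mono) (auto simp: indicator_def)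
    finally have "c * ?V (r x) \<le> b" using b by (simp add: ennreal_le_iff)
    moreover have "c * unit_ball_vol (real DIM('a)) > 0" using c by simp
    ultimately have "r x ^ DIM('a) \<le> b / (c * unit_ball_vol (real DIM('a)))" by (simp add: field_simps)
    then have "root DIM('a) (r x ^ DIM('a)) \<le> B" unfolding B_def by simp
    then show ?thesis using r[OF x] by (simp add: real_root_power_cancel)
  qed
  obtain I and e :: "nat \<Rightarrow> 'a" where Ie: "e ` I \<subseteq> ?E" "disjoint_family_on (\<lambda>i. cball (e i) (r (e i))) I"
    "?E \<subseteq> (\<Union>i\<in>I. cball (e i) (5 * r (e i)))"
    by (rule vitali_sequence[of ?E r B]) (use r rB in auto)
  have ei: "e i \<in> ?E" if "i \<in> I" for i using Ie(1) that by auto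
  let ?U = "\<lambda>i. if i \<in> I then cball (e i) (5 * r (e i)) else {}"
  let ?W = "\<lambda>i. if i \<in> I then cball (e i) (r (e i)) else {}"
  have "ennreal c * emeasure lborel ?E \<le> ennreal c * emeasure lborel (\<Union>i. ?U i)"
    using Ie(3) by (intro mult_left_mono emeasure_mono) fastforce+
  also have "\<dots> \<le> ennreal c * (\<Sum>i. emeasure lborel (?U i))"
    by (intro mult_left_mono emeasure_subadditive_countably) auto
  also have "\<dots> = (\<Sum>i. ennreal c * emeasure lborel (?U i))" by simp
  also have "\<dots> \<le> (\<Sum>i. 5 ^ DIM('a) * (\<integral>\<^sup>+y. f y * indicator (?W i) y \<partial>lborel))"
  proof (intro suminf_le)
    fix i
    show "ennreal c * emeasure lborel (?U i) \<le> 5 ^ DIM('a) * (\<integral>\<^sup>+y. f y * indicator (?W i) y \<partial>lborel)"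
    proof (cases "i \<in> I")
      case True
      have "ennreal c * emeasure lborel (?U i) = 5 ^ DIM('a) * (ennreal c * emeasure lborel (cball (e i) (r (e i))))"
      proof -
        have "(5::ennreal) ^ DIM('a) = ennreal (5 ^ DIM('a))" by (simp add: ennreal_power[symmetric])
        then show ?thesis using True r[OF ei[OF True]] c
          by (simp add: emeasure_cball power_mult_distrib ennreal_mult[symmetric] algebra_simps)
      qed
      also have "\<dots> \<le> 5 ^ DIM('a) * (\<integral>\<^sup>+y. f y * indicator (?W i) y \<partial>lborel)"
        using True r[OF ei[OF True]] by (intro mult_left_mono) auto
      finally show ?thesis .
    qed simp
  qed auto
  also have "\<dots> = 5 ^ DIM('a) * (\<Sum>i. \<integral>\<^sup>+y. f y * indicator (?W i) y \<partial>lborel)" by simp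
  also have "(\<Sum>i. \<integral>\<^sup>+y. f y * indicator (?W i) y \<partial>lborel) = (\<integral>\<^sup>+y. (\<Sum>i. f y * indicator (?W i) y) \<partial>lborel)"
    by (intro nn_integral_suminf[symmetric]) auto
  also have "\<dots> = (\<integral>\<^sup>+y. f y * indicator (\<Union>i. ?W i) y \<partial>lborel)"
  proof -
    have "disjoint_family ?W" using Ie(2) by (auto simp: disjoint_family_on_def)
    then show ?thesis by (simp add: suminf_indicator)
  qed
  also have "\<dots> \<le> (\<integral>\<^sup>+y. f y \<partial>lborel)" by (intro nn_integral_mono) (auto simp: indicator_def)
  finally show ?thesis by (simp add: mult_left_mono)
qed

text \<open>If \<open>c < f x\<close>, then \<open>f\<close> exceeds \<open>c\<close> on a whole
  ball around \<open>x\<close>, so a mean exceeds \<open>c\<close>. Lower semicontinuity thus gives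
  domination at every point, where the differentiation theorem would give it only almost
  everywhere.\<close>

lemma le_hl_of_open_superlevel:
  fixes f :: "'a::euclidean_space \<Rightarrow> ennreal"
  assumes "\<And>c. open {x. c < f x}"
  shows "f x \<le> hl f x"
proof (rule dense_le)
  fix c assume c: "c < f x"
  then obtain r where r: "r > 0" "cball x r \<subseteq> {x. c < f x}"
    using assms[of c] by (auto simp: open_contains_cball)
  have "c * emeasure lborel (cball x r) = (\<integral>\<^sup>+y. c * indicator (cball x r) y \<partial>lborel)"
    by (simp add: nn_integral_cmult_indicator)
  also have "\<dots> \<le> (\<integral>\<^sup>+y. f y * indicator (cball x r) y \<partial>lborel)"
  proof (intro nn_integral_mono)
    fix y show "c * indicator (cball x r) y \<le> f y * indicator (cball x r) y"
      using r(2) by (cases "y \<in> cball x r") (auto intro: less_imp_le)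
  qed
  also have "\<dots> \<le> hl f x * emeasure lborel (cball x r)" by (rule nn_integral_cball_le_hl[OF r(1)])
  finally show "c \<le> hl f x" using emeasure_cball_nontrivial(1)[OF r(1), of x] emeasure_cball_nontrivial(2)[of x r]
    by (metis ennreal_divide_le_iff ennreal_mult_divide_eq)
qed

lemma borel_measurable_of_open_superlevel:
  fixes f :: "'a::topological_space \<Rightarrow> ennreal"
  assumes "\<And>c. open {x. c < f x}"
  shows "f \<in> borel_measurable borel"
  by (rule borel_measurableI_greater) (use assms in auto)

text \<open>Marcinkiewicz interpolation between the weak bound at exponent 1 and the trivial bound
  for bounded functions. Integrating \<open>l powr (p - 2)\<close> over \<open>l < 2 * f x\<close>
  gives the factor \<open>1 / (p - 1)\<close> and, with the 2 of the refined weak bound,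
  \<open>2 powr p\<close>. The bound by \<open>B\<close> keeps the maximal function finite, as the
  layer-cake formula demands.\<close>

lemma hl_strong_type:
  fixes f :: "'a::euclidean_space \<Rightarrow> ennreal"
  assumes f[measurable]: "f \<in> borel_measurable borel" and p: "1 < p" and fin: "\<And>x. f x \<le> ennreal B"
  shows "(\<integral>\<^sup>+x. epowr (hl f x) p \<partial>lborel)
    \<le> ennreal (p / (p - 1) * 2 powr p * 5 ^ DIM('a)) * (\<integral>\<^sup>+x. epowr (f x) p \<partial>lborel)"
proof -
  let ?n = "DIM('a)"
  have hfin: "hl f x \<noteq> top" for x
    using hl_le_const[of f "ennreal B" x] fin by (auto simp: top_unique)
  have ffin: "f x \<noteq> top" for x using fin[of x] by (auto simp: top_unique)
  \<comment> \<open>Values of \<open>f\<close> up to \<open>l / 2\<close> contribute at most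
    \<open>l / 2\<close> to any mean, so the rest of \<open>f\<close> must have a maximal function
    above \<open>l / 2\<close>.\<close>
  have weak: "ennreal l * emeasure lborel {x. ennreal l < hl f x}
      \<le> 2 * 5 ^ ?n * (\<integral>\<^sup>+x. f x * indicator {x. ennreal l < 2 * f x} x \<partial>lborel)" if l: "0 < l" for l
  proof -
    let ?g = "\<lambda>x. f x * indicator {x. ennreal l < 2 * f x} x"
    have "hl f x \<le> hl ?g x + ennreal (l / 2)" for x
      unfolding hl_le_iff[of f]
    proof (intro allI impI)
      fix r :: real assume r: "0 < r"
      have "f y \<le> ?g y + ennreal (l / 2)" for y
      proof (cases "ennreal l < 2 * f y")
        case False
        then have "2 * f y \<le> 2 * ennreal (l / 2)"
          using l by (simp add: not_less ennreal_mult[symmetric] flip: ennreal_numeral)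
        then show ?thesis using False by (simp add: ennreal_mult_le_mult_iff)
      qed simp
      then have "(\<integral>\<^sup>+y. f y * indicator (cball x r) y \<partial>lborel)
         \<le> (\<integral>\<^sup>+y. ?g y * indicator (cball x r) y + ennreal (l / 2) * indicator (cball x r) y \<partial>lborel)"
        by (intro nn_integral_mono) (auto simp: indicator_def)
      also have "\<dots> = (\<integral>\<^sup>+y. ?g y * indicator (cball x r) y \<partial>lborel) + ennreal (l / 2) * emeasure lborel (cball x r)"
        by (subst nn_integral_add) (auto simp: nn_integral_cmult_indicator)
      also have "\<dots> \<le> hl ?g x * emeasure lborel (cball x r) + ennreal (l / 2) * emeasure lborel (cball x r)"
        by (intro add_right_mono nn_integral_cball_le_hl r)
      finally show "(\<integral>\<^sup>+y. f y * indicator (cball x r) y \<partial>lborel)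
          \<le> (hl ?g x + ennreal (l / 2)) * emeasure lborel (cball x r)"
        by (simp add: distrib_right)
    qed
    moreover have "ennreal l = ennreal (l / 2) + ennreal (l / 2)" using l by (simp add: ennreal_plus[symmetric] del: ennreal_plus)
    ultimately have "{x. ennreal l < hl f x} \<subseteq> {x. ennreal (l / 2) < hl ?g x}"
    proof (intro subsetI CollectI)
      fix x assume hlb: "\<And>x. hl f x \<le> hl ?g x + ennreal (l / 2)" and eq: "ennreal l = ennreal (l / 2) + ennreal (l / 2)"
        and x: "x \<in> {x. ennreal l < hl f x}"
      show "ennreal (l / 2) < hl ?g x"
      proof (rule ccontr)
        assume "\<not> ennreal (l / 2) < hl ?g x"
        then have "hl ?g x + ennreal (l / 2) \<le> ennreal l" unfolding eq by (intro add_right_mono) simp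
        with hlb[of x] x show False by simp
      qed
    qed
    then have "ennreal l * emeasure lborel {x. ennreal l < hl f x} \<le> ennreal l * emeasure lborel {x. ennreal (l / 2) < hl ?g x}"
      using open_hl_greater[of "ennreal (l / 2)" ?g] by (intro mult_left_mono emeasure_mono) auto
    also have "\<dots> = 2 * (ennreal (l / 2) * emeasure lborel {x. ennreal (l / 2) < hl ?g x})"
    proof -
      have "ennreal l = 2 * ennreal (l / 2)" using l by (simp add: ennreal_mult[symmetric] flip: ennreal_numeral)
      then show ?thesis by (simp only: mult.assoc)
    qed
    also have "\<dots> \<le> 2 * (5 ^ ?n * (\<integral>\<^sup>+x. ?g x \<partial>lborel))"
      using l by (intro mult_left_mono hl_weak_type) auto
    finally show ?thesis by (simp add: mult.assoc)
  qed
  have "(\<integral>\<^sup>+x. epowr (hl f x) p \<partial>lborel) = (\<integral>\<^sup>+x. ennreal p * (\<integral>\<^sup>+l. indicator {0<..} l * (ennreal (l powr (p - 1)) * indicator {l. ennreal (l powr 1) < hl f x} l) \<partial>lborel) \<partial>lborel)"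
    using p hfin by (subst nn_integral_powr_level) (auto simp: mult.assoc[symmetric] ennreal_mult[symmetric])
  also have "\<dots> = ennreal p * (\<integral>\<^sup>+l. (\<integral>\<^sup>+x. indicator {0<..} l * (ennreal (l powr (p - 1)) * indicator {l. ennreal (l powr 1) < hl f x} l) \<partial>lborel) \<partial>lborel)"
    by (subst nn_integral_cmult, measurable, subst lborel_pair.Fubini') auto
  also have "\<dots> \<le> ennreal p * (\<integral>\<^sup>+l. (\<integral>\<^sup>+x. 2 * 5 ^ ?n * f x * (indicator {0<..} l * (ennreal (l powr (p - 1 - 1)) * indicator {l. ennreal (l powr 1) < 2 * f x} l)) \<partial>lborel) \<partial>lborel)"
  proof (rule mult_left_mono[OF nn_integral_mono])
    fix l :: real
    show "(\<integral>\<^sup>+x. indicator {0<..} l * (ennreal (l powr (p - 1)) * indicator {l. ennreal (l powr 1) < hl f x} l) \<partial>lborel)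
       \<le> (\<integral>\<^sup>+x. 2 * 5 ^ ?n * f x * (indicator {0<..} l * (ennreal (l powr (p - 1 - 1)) * indicator {l. ennreal (l powr 1) < 2 * f x} l)) \<partial>lborel)"
    proof (cases "0 < l")
      case l: True
      have "(\<integral>\<^sup>+x. indicator {0<..} l * (ennreal (l powr (p - 1)) * indicator {l. ennreal (l powr 1) < hl f x} l) \<partial>lborel)
          = (\<integral>\<^sup>+x. ennreal (l powr (p - 1)) * indicator {x. ennreal l < hl f x} x \<partial>lborel)"
        using l by (intro nn_integral_cong) (auto simp: indicator_def)
      also have "\<dots> = ennreal (l powr (p - 1)) * emeasure lborel {x. ennreal l < hl f x}"
        using open_hl_greater[of "ennreal l" f] by (intro nn_integral_cmult_indicator) auto
      also have "\<dots> = ennreal (l powr (p - 1 - 1)) * ennreal l * emeasure lborel {x. ennreal l < hl f x}"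
      proof -
        have "ennreal (l powr (p - 1)) = ennreal (l powr (p - 1 - 1)) * ennreal l"
          using l powr_add[of l "p - 1 - 1" 1] by (simp add: ennreal_mult[symmetric])
        then show ?thesis by simp
      qed
      also have "\<dots> \<le> ennreal (l powr (p - 1 - 1)) * (2 * 5 ^ ?n * (\<integral>\<^sup>+x. f x * indicator {x. ennreal l < 2 * f x} x \<partial>lborel))"
        unfolding mult.assoc[of _ "ennreal l"] by (intro mult_left_mono weak l) simp
      also have "\<dots> = (\<integral>\<^sup>+x. ennreal (l powr (p - 1 - 1)) * (2 * 5 ^ ?n * (f x * indicator {x. ennreal l < 2 * f x} x)) \<partial>lborel)"
        by (simp add: nn_integral_cmult)
      also have "\<dots> = (\<integral>\<^sup>+x. 2 * 5 ^ ?n * f x * (indicator {0<..} l * (ennreal (l powr (p - 1 - 1)) * indicator {l. ennreal (l powr 1) < 2 * f x} l)) \<partial>lborel)"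
        using l by (intro nn_integral_cong) (auto simp: indicator_def mult_ac)
      finally show ?thesis .
    qed simp
  qed simp
  also have "\<dots> = ennreal p * (\<integral>\<^sup>+x. 2 * 5 ^ ?n * f x * (\<integral>\<^sup>+l. indicator {0<..} l * (ennreal (l powr (p - 1 - 1)) * indicator {l. ennreal (l powr 1) < 2 * f x} l) \<partial>lborel) \<partial>lborel)"
    by (subst lborel_pair.Fubini') (auto simp: nn_integral_cmult)
  also have "\<dots> = ennreal p * (\<integral>\<^sup>+x. 2 * 5 ^ ?n * f x * (ennreal (1 / (p - 1)) * epowr (2 * f x) ((p - 1) / 1)) \<partial>lborel)"
    using p ffin by (subst nn_integral_powr_level) (auto simp: ennreal_mult_eq_top_iff)
  also have "\<dots> = ennreal p * (\<integral>\<^sup>+x. ennreal (5 ^ ?n * (1 / (p - 1)) * 2 powr p) * epowr (f x) p \<partial>lborel)"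
  proof (rule arg_cong[where f="\<lambda>z. ennreal p * z", OF nn_integral_cong])
    fix x
    obtain u where u: "f x = ennreal u" "0 \<le> u" using ffin[of x] by (cases "f x") auto
    have "2 * 5 ^ ?n * f x * (ennreal (1 / (p - 1)) * epowr (2 * f x) ((p - 1) / 1))
       = ennreal (2 * 5 ^ ?n * u * (1 / (p - 1) * (2 * u) powr (p - 1)))"
      using u p by (simp add: epowr_ennreal ennreal_mult[symmetric] ennreal_power flip: ennreal_numeral)
    also have "2 * 5 ^ ?n * u * (1 / (p - 1) * (2 * u) powr (p - 1)) = 5 ^ ?n * (1 / (p - 1)) * 2 powr p * u powr p"
    proof (cases "u = 0")
      case False
      have "(2 * u) powr p = (2 * u) * (2 * u) powr (p - 1)"
        using u False powr_add[of "2 * u" 1 "p - 1"] by simp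
      then have "2 powr p * u powr p = 2 * u * (2 * u) powr (p - 1)" using u by (simp add: powr_mult)
      then show ?thesis by (simp add: mult.assoc)
    qed (use p in simp)
    finally show "2 * 5 ^ ?n * f x * (ennreal (1 / (p - 1)) * epowr (2 * f x) ((p - 1) / 1))
        = ennreal (5 ^ ?n * (1 / (p - 1)) * 2 powr p) * epowr (f x) p"
      using u p by (simp add: epowr_ennreal ennreal_mult[symmetric])
  qed
  also have "\<dots> = ennreal (p / (p - 1) * 2 powr p * 5 ^ ?n) * (\<integral>\<^sup>+x. epowr (f x) p \<partial>lborel)"
  proof -
    have "ennreal p * ennreal (5 ^ ?n * (1 / (p - 1)) * 2 powr p) = ennreal (p / (p - 1) * 2 powr p * 5 ^ ?n)"
      using p by (subst ennreal_mult[symmetric]) (auto simp: mult_ac)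
    then show ?thesis by (simp add: nn_integral_cmult mult.assoc[symmetric])
  qed
  finally show ?thesis .
qed

section \<open>Averages over reflections\<close>

text \<open>For a unit vector \<open>v\<close> this is the reflection in the hyperplane orthogonal
  to \<open>v\<close>; for other lengths it is not an isometry in general.\<close>

definition reflection :: "'a::real_inner \<Rightarrow> 'a \<Rightarrow> 'a" where
  "reflection v x = x - (2 * (x \<bullet> v)) *\<^sub>R v"

lemma norm_reflection: "norm v = 1 \<Longrightarrow> norm (reflection v x) = norm x"
proof -
  assume "norm v = 1"
  then have "v \<bullet> v = 1" by (simp add: norm_eq_sqrt_inner)
  then have "reflection v x \<bullet> reflection v x = x \<bullet> x"
    by (simp add: reflection_def inner_diff_left inner_diff_right inner_commute[of v x] algebra_simps)
  then show ?thesis by (simp add: norm_eq_sqrt_inner)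
qed

lemma reflection_reflection: "norm v = 1 \<Longrightarrow> reflection v (reflection v x) = x"
proof -
  assume "norm v = 1"
  then have "v \<bullet> v = 1" by (simp add: norm_eq_sqrt_inner)
  then show ?thesis by (simp add: reflection_def inner_diff_left algebra_simps)
qed

lemma reflection_add: "reflection v (x + y) = reflection v x + reflection v y"
  and refl_diff: "reflection v (x - y) = reflection v x - reflection v y"
  and refl_scale: "reflection v (c *\<^sub>R x) = c *\<^sub>R reflection v x"
  by (simp_all add: reflection_def inner_add_left inner_diff_left algebra_simps)

lemma continuous_on_reflection: "continuous_on A (reflection v)"
  unfolding reflection_def by (intro continuous_intros)

lemma borel_measurable_reflection [measurable]: "reflection (v::'a::euclidean_space) \<in> borel_measurable borel"
  by (intro borel_measurable_continuous_onI continuous_on_reflection)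

text \<open>The directions \<open>e + (i / N) e'\<close>, normalised; differences of two such reflections act on
  the plane of \<open>e, e'\<close> as a multiple \<open>2 \<bar>sin\<bar>\<close> of a reflection.\<close>

lemma exists_separated_reflections:
  fixes e :: "'a::euclidean_space"
  assumes e: "norm e = 1" and d: "2 \<le> DIM('a)" and N: "0 < N"
  obtains v :: "nat \<Rightarrow> 'a"
  where "\<And>i. norm (v i) = 1"
    "\<And>i j. i < N \<Longrightarrow> j < N \<Longrightarrow> i \<noteq> j \<Longrightarrow> \<exists>\<zeta>. norm \<zeta> \<le> real N \<and> reflection (v i) \<zeta> - reflection (v j) \<zeta> = e"
proof -
  obtain y where y: "y \<noteq> 0" "orthogonal e y" using orthogonal_to_vector_exists[OF d, of e] by blast
  define e' where "e' = y /\<^sub>R norm y"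
  have "norm e' = 1" using y by (simp add: e'_def)
  then have ee: "e \<bullet> e = 1" "e' \<bullet> e' = 1" "e \<bullet> e' = 0" "e' \<bullet> e = 0"
  proof -
    show "e \<bullet> e = 1" "e' \<bullet> e' = 1" using e \<open>norm e' = 1\<close> by (simp_all add: norm_eq_1)
    show "e \<bullet> e' = 0" "e' \<bullet> e = 0" using y by (auto simp: e'_def orthogonal_def inner_commute)
  qed
  define s where "s i = real i / real N" for i
  define al where "al i = 1 / sqrt (1 + (s i)\<^sup>2)" for i
  define be where "be i = s i / sqrt (1 + (s i)\<^sup>2)" for i
  have Dp: "1 + (s i)\<^sup>2 > 0" for i by (simp add: add_pos_nonneg)
  have ab: "(al i)\<^sup>2 + (be i)\<^sup>2 = 1" for i
    using Dp[of i] by (simp add: al_def be_def power_divide add_divide_distrib[symmetric])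
  define v where "v i = al i *\<^sub>R e + be i *\<^sub>R e'" for i
  have v1: "norm (v i) = 1" for i
    using ab[of i] by (simp add: v_def norm_eq_sqrt_inner inner_add_left inner_add_right ee power2_eq_square)
  have "\<exists>\<zeta>. norm \<zeta> \<le> real N \<and> reflection (v i) \<zeta> - reflection (v j) \<zeta> = e"
    if ij: "i < N" "j < N" "i \<noteq> j" for i j
  proof -
    \<comment> \<open>In the basis \<open>e\<close>, \<open>e'\<close> the difference of the two
      reflections is a symmetric matrix of trace zero that sends \<open>e\<close> to
      \<open>P e + Q e'\<close>. Its square is \<open>k\<close> times the identity on the plane, so
      the image of \<open>e\<close>, divided by \<open>k\<close>, is the preimage of
      \<open>e\<close>, and its norm is \<open>1 / sqrt k\<close>.\<close>
    define P where "P = 2 * ((al j)\<^sup>2 - (al i)\<^sup>2)"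
    define Q where "Q = 2 * (al j * be j - al i * be i)"
    define k where "k = P\<^sup>2 + Q\<^sup>2"
    have "k = 4 * (al i * be j - al j * be i)\<^sup>2"
      using ab[of i] ab[of j] unfolding k_def P_def Q_def by algebra
    also have "al i * be j - al j * be i = (s j - s i) / (sqrt (1 + (s i)\<^sup>2) * sqrt (1 + (s j)\<^sup>2))"
      unfolding al_def be_def using Dp[of i] Dp[of j] by (simp add: diff_divide_distrib mult.commute)
    finally have k: "k = 4 * (s j - s i)\<^sup>2 / ((1 + (s i)\<^sup>2) * (1 + (s j)\<^sup>2))"
      using Dp[of i] Dp[of j] by (simp add: power_divide power_mult_distrib)
    \<comment> \<open>Slopes with index below \<open>N\<close> lie between 0 and 1 and are at least
      \<open>1 / N\<close> apart. The factor 4 in the numerator of \<open>k\<close> cancels the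
      bound \<open>2 * 2\<close> for its denominator, which leaves \<open>k\<close> at least the
      square of \<open>1 / N\<close>.\<close>
    have s2: "(s i)\<^sup>2 \<le> 1" if "i < N" for i
      using that by (intro power_le_one) (auto simp: s_def)
    have "(s j - s i)\<^sup>2 \<ge> (1 / real N)\<^sup>2"
    proof -
      have "1 \<le> \<bar>real j - real i\<bar>" using ij(3) by linarith
      then have "1 / real N \<le> \<bar>s j - s i\<bar>"
        using N by (simp add: s_def diff_divide_distrib[symmetric] divide_right_mono)
      then show ?thesis by (metis abs_ge_zero abs_le_square_iff abs_of_nonneg divide_nonneg_nonneg of_nat_0_le_iff zero_le_one)
    qed
    moreover have "(1 + (s i)\<^sup>2) * (1 + (s j)\<^sup>2) \<le> 2 * 2"
      using s2[OF ij(1)] s2[OF ij(2)] by (intro mult_mono) auto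
    ultimately have "4 * (1 / real N)\<^sup>2 / 4 \<le> k"
      unfolding k using Dp[of i] Dp[of j] by (intro frac_le) auto
    then have kN: "(1 / real N)\<^sup>2 \<le> k" by simp
    moreover have "(1 / real N)\<^sup>2 > 0" using N by simp
    ultimately have k0: "k > 0" by linarith
    define \<zeta> where "\<zeta> = (P / k) *\<^sub>R e + (Q / k) *\<^sub>R e'"
    have L: "reflection (v i) x - reflection (v j) x = (2 * (x \<bullet> v j)) *\<^sub>R v j - (2 * (x \<bullet> v i)) *\<^sub>R v i" for x
      by (simp add: reflection_def)
    define a where "a m = 2 * (P * al m + Q * be m) / k" for m
    have iv: "2 * (\<zeta> \<bullet> v m) = a m" for m
      unfolding \<zeta>_def v_def a_def
      by (simp add: inner_add_left inner_add_right ee add_divide_distrib distrib_left mult_ac)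
    have Lv: "reflection (v i) \<zeta> - reflection (v j) \<zeta> = a j *\<^sub>R v j - a i *\<^sub>R v i"
      by (simp only: L iv)
    have "reflection (v i) \<zeta> - reflection (v j) \<zeta> = (a j * al j - a i * al i) *\<^sub>R e + (a j * be j - a i * be i) *\<^sub>R e'"
      unfolding Lv unfolding v_def by (simp add: scaleR_add_right scaleR_diff_left)
    also have "a j * al j - a i * al i = (2 * (P * al j + Q * be j) * al j - 2 * (P * al i + Q * be i) * al i) / k"
      unfolding a_def by (simp only: diff_divide_distrib times_divide_eq_left)
    also have "2 * (P * al j + Q * be j) * al j - 2 * (P * al i + Q * be i) * al i = k"
      unfolding k_def by (simp add: P_def Q_def power2_eq_square algebra_simps)
    also have "a j * be j - a i * be i = (2 * (P * al j + Q * be j) * be j - 2 * (P * al i + Q * be i) * be i) / k"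
      unfolding a_def by (simp only: diff_divide_distrib times_divide_eq_left)
    also have "2 * (P * al j + Q * be j) * be j - 2 * (P * al i + Q * be i) * be i = 0"
      using ab[of i] ab[of j] unfolding P_def Q_def by algebra
    finally have Lz: "reflection (v i) \<zeta> - reflection (v j) \<zeta> = e" using k0 by simp
    have "(norm \<zeta>)\<^sup>2 = (P\<^sup>2 + Q\<^sup>2) / k\<^sup>2"
      unfolding \<zeta>_def power2_norm_eq_inner
      by (simp add: inner_add_left inner_add_right ee power2_eq_square add_divide_distrib)
    also have "\<dots> = 1 / k" unfolding k_def[symmetric] using k0 by (simp add: power2_eq_square)
    also have "\<dots> \<le> 1 / (1 / real N)\<^sup>2" using kN k0 N by (intro divide_left_mono mult_pos_pos) auto
    also have "\<dots> = (real N)\<^sup>2" by (simp add: power_divide)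
    finally have "norm \<zeta> \<le> real N" by (rule power2_le_imp_le) simp
    with Lz show ?thesis by blast
  qed
  with v1 that show ?thesis by blast
qed

text \<open>A class closed under sums, products and translations, all of whose members are
  integrable, so that squares may be expanded and integrals split freely. It contains the
  truncations to which the general case is reduced.\<close>

definition bdd_supp :: "('a::euclidean_space \<Rightarrow> real) \<Rightarrow> bool" where
  "bdd_supp f \<longleftrightarrow> f \<in> borel_measurable borel \<and> (\<exists>B. \<forall>x. \<bar>f x\<bar> \<le> B) \<and> (\<exists>R. \<forall>x. R < norm x \<longrightarrow> f x = 0)"

lemma bdd_supp_measurable [measurable_dest]: "bdd_supp f \<Longrightarrow> f \<in> borel_measurable borel"
  by (simp add: bdd_supp_def)

lemma bdd_suppE:
  assumes "bdd_supp f"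
  obtains B R where "0 \<le> B" "\<And>x. \<bar>f x\<bar> \<le> B" "\<And>x. R < norm x \<Longrightarrow> f x = 0"
  using assms unfolding bdd_supp_def by (metis abs_ge_zero order_trans)

lemma bdd_suppI:
  "f \<in> borel_measurable borel \<Longrightarrow> (\<And>x. \<bar>f x\<bar> \<le> B) \<Longrightarrow> (\<And>x. R < norm x \<Longrightarrow> f x = 0) \<Longrightarrow> bdd_supp f"
  unfolding bdd_supp_def by blast

lemma bdd_supp_mult_bounded:
  assumes "bdd_supp f" and [measurable]: "g \<in> borel_measurable borel" and "\<And>x. \<bar>g x\<bar> \<le> B"
  shows "bdd_supp (\<lambda>x. f x * g x)"
proof -
  obtain C R where C: "0 \<le> C" "\<And>x. \<bar>f x\<bar> \<le> C" "\<And>x. R < norm x \<Longrightarrow> f x = 0" using bdd_suppE[OF assms(1)] by blast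
  note [measurable] = bdd_supp_measurable[OF assms(1)]
  show ?thesis
  proof (rule bdd_suppI[where B="C * B" and R=R])
    show "\<bar>f x * g x\<bar> \<le> C * B" for x
      unfolding abs_mult using C assms(3)[of x] by (intro mult_mono) auto
  qed (use C in auto)
qed

lemma bdd_supp_mult: "bdd_supp f \<Longrightarrow> bdd_supp g \<Longrightarrow> bdd_supp (\<lambda>x. f x * g x)"
  by (rule bdd_suppE[of g]) (auto intro: bdd_supp_mult_bounded bdd_supp_measurable)

lemma bdd_supp_add:
  assumes "bdd_supp f" "bdd_supp g" shows "bdd_supp (\<lambda>x. f x + g x)"
proof -
  obtain C R where C: "0 \<le> C" "\<And>x. \<bar>f x\<bar> \<le> C" "\<And>x. R < norm x \<Longrightarrow> f x = 0" using bdd_suppE[OF assms(1)] by blast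
  obtain C' R' where C': "0 \<le> C'" "\<And>x. \<bar>g x\<bar> \<le> C'" "\<And>x. R' < norm x \<Longrightarrow> g x = 0" using bdd_suppE[OF assms(2)] by blast
  note [measurable] = bdd_supp_measurable[OF assms(1)] bdd_supp_measurable[OF assms(2)]
  show ?thesis
  proof (rule bdd_suppI[where B="C + C'" and R="max R R'"])
    show "\<bar>f x + g x\<bar> \<le> C + C'" for x using C(2)[of x] C'(2)[of x] by linarith
  qed (use C C' in auto)
qed

lemma bdd_supp_cmult: "bdd_supp f \<Longrightarrow> bdd_supp (\<lambda>x. c * f x)"
  using bdd_supp_mult_bounded[of f "\<lambda>_. c" "\<bar>c\<bar>"] by (simp add: mult.commute)

lemma bdd_supp_diff: "bdd_supp f \<Longrightarrow> bdd_supp g \<Longrightarrow> bdd_supp (\<lambda>x. f x - g x)"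
  using bdd_supp_add[of f "\<lambda>x. - 1 * g x"] bdd_supp_cmult[of g "- 1"] by simp

lemma bdd_supp_translate: fixes f :: "'a::euclidean_space \<Rightarrow> real" assumes "bdd_supp f" shows "bdd_supp (\<lambda>x. f (x + p))"
proof -
  obtain C R where C: "0 \<le> C" "\<And>x. \<bar>f x\<bar> \<le> C" "\<And>x. R < norm x \<Longrightarrow> f x = 0" using bdd_suppE[OF assms(1)] by blast
  note [measurable] = bdd_supp_measurable[OF assms(1)]
  show ?thesis
  proof (rule bdd_suppI[where B=C and R="R + norm p"])
    fix x :: 'a assume "R + norm p < norm x"
    then have "R < norm (x + p)" using norm_triangle_ineq4[of "x + p" p] by simp
    then show "f (x + p) = 0" by (rule C)
  qed (use C in auto)
qed

lemma bdd_supp_translate_diff: "bdd_supp f \<Longrightarrow> bdd_supp (\<lambda>x. f (x - p))"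
  using bdd_supp_translate[of f "- p"] by simp

lemma bdd_supp_integrable: assumes "bdd_supp f" shows "integrable lborel f"
proof -
  obtain C R where C: "0 \<le> C" "\<And>x. \<bar>f x\<bar> \<le> C" "\<And>x. R < norm x \<Longrightarrow> f x = 0" using bdd_suppE[OF assms(1)] by blast
  note [measurable] = bdd_supp_measurable[OF assms(1)]
  show ?thesis
  proof (rule Bochner_Integration.integrable_bound[where f="\<lambda>x. C * indicator (cball 0 R) x"])
    have "emeasure lborel (cball (0::'a) R) < \<infinity>" using emeasure_bounded_finite[of "cball (0::'a) R"] by simp
    then show "integrable lborel (\<lambda>x. C * indicator (cball (0::'a) R) x)" by (intro integrable_mult_right integrable_real_indicator) auto
    show "AE x in lborel. norm (f x) \<le> norm (C * indicator (cball (0::'a) R) x :: real)"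
      using C by (intro AE_I2) (auto simp: indicator_def not_le)
  qed simp
qed

lemma integral_lborel_translate:
  fixes f :: "'a::euclidean_space \<Rightarrow> real"
  assumes [measurable]: "f \<in> borel_measurable borel"
  shows "(\<integral>x. f (x + t) \<partial>lborel) = (\<integral>x. f x \<partial>lborel)"
proof -
  have "(\<integral>x. f x \<partial>distr lborel borel ((+) t)) = (\<integral>x. f (t + x) \<partial>lborel)"
    by (intro integral_distr) auto
  then show ?thesis by (simp add: lborel_distr_plus add.commute)
qed

section \<open>Autocorrelations and a Lipschitz weight\<close>

definition autocorr :: "('a::euclidean_space \<Rightarrow> real) \<Rightarrow> 'a \<Rightarrow> real" where
  "autocorr f v = (\<integral>x. f x * f (x + v) \<partial>lborel)"

lemma borel_measurable_autocorr [measurable]: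
  assumes [measurable]: "f \<in> borel_measurable borel"
  shows "autocorr f \<in> borel_measurable borel"
  unfolding autocorr_def by measurable

text \<open>The product is at most half the sum of the squares, and both squares have the same
  integral by translation invariance.\<close>

lemma abs_autocorr_le:
  fixes f :: "'a::euclidean_space \<Rightarrow> real"
  assumes f: "bdd_supp f"
  shows "\<bar>autocorr f v\<bar> \<le> (\<integral>x. (f x)\<^sup>2 \<partial>lborel)"
proof -
  note [measurable] = bdd_supp_measurable[OF f]
  have i1: "integrable lborel (\<lambda>x. (f x)\<^sup>2)"
    unfolding power2_eq_square by (intro bdd_supp_integrable bdd_supp_mult f)
  have i2: "integrable lborel (\<lambda>x. (f (x + v))\<^sup>2)"
    unfolding power2_eq_square by (intro bdd_supp_integrable bdd_supp_mult bdd_supp_translate f)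
  have i3: "integrable lborel (\<lambda>x. f x * f (x + v))"
    by (intro bdd_supp_integrable bdd_supp_mult bdd_supp_translate f)
  have "\<bar>autocorr f v\<bar> \<le> (\<integral>x. \<bar>f x * f (x + v)\<bar> \<partial>lborel)"
    unfolding autocorr_def by (rule integral_abs_bound)
  also have "\<dots> \<le> (\<integral>x. ((f x)\<^sup>2 + (f (x + v))\<^sup>2) / 2 \<partial>lborel)"
  proof (rule integral_mono)
    fix x
    have "0 \<le> (\<bar>f x\<bar> - \<bar>f (x + v)\<bar>)\<^sup>2" by simp
    then show "\<bar>f x * f (x + v)\<bar> \<le> ((f x)\<^sup>2 + (f (x + v))\<^sup>2) / 2"
      by (simp add: power2_diff abs_mult)
  qed (use i1 i2 i3 in auto)
  also have "\<dots> = ((\<integral>x. (f x)\<^sup>2 \<partial>lborel) + (\<integral>x. (f (x + v))\<^sup>2 \<partial>lborel)) / 2"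
    using i1 i2 by simp
  also have "(\<integral>x. (f (x + v))\<^sup>2 \<partial>lborel) = (\<integral>x. (f x)\<^sup>2 \<partial>lborel)"
    by (rule integral_lborel_translate) measurable
  finally show ?thesis by simp
qed

text \<open>Expanding the product of two differences leaves a second difference of the
  autocorrelation in the direction \<open>h\<close>. In this form the translation by
  \<open>h\<close> can be absorbed by a change of variables.\<close>

lemma autocorr_diff_translate:
  fixes f :: "'a::euclidean_space \<Rightarrow> real"
  assumes f: "bdd_supp f"
  shows "autocorr (\<lambda>x. f x - f (x - h)) v = 2 * autocorr f v - autocorr f (v - h) - autocorr f (v + h)"
proof -
  note [measurable] = bdd_supp_measurable[OF f]
  have I: "integrable lborel (\<lambda>x. f (x + p) * f (x + q))" for p q
    by (intro bdd_supp_integrable bdd_supp_mult bdd_supp_translate f)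
  have T: "(\<integral>x. f (x + p) * f (x + q) \<partial>lborel) = autocorr f (q - p)" for p q
    using integral_lborel_translate[of "\<lambda>x. f x * f (x + (q - p))" p]
    by (simp add: autocorr_def add.assoc)
  have "autocorr (\<lambda>x. f x - f (x - h)) v = (\<integral>x. f (x + 0) * f (x + v) - f (x + 0) * f (x + (v - h))
      - f (x + - h) * f (x + v) + f (x + - h) * f (x + (v - h)) \<partial>lborel)"
    unfolding autocorr_def by (intro Bochner_Integration.integral_cong) (auto simp: algebra_simps)
  also have "\<dots> = autocorr f v - autocorr f (v - h) - autocorr f (v + h) + autocorr f v"
    using I T by (simp only: Bochner_Integration.integral_diff Bochner_Integration.integral_add
        Bochner_Integration.integrable_diff) simp
  finally show ?thesis by simp
qed

text \<open>At least 1 on the unit ball, supported in the ball of radius 2, and Lipschitz: it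
  dominates the indicator of the unit ball, while a translation changes it by no more than the
  length of the translation.\<close>

definition tent :: "'a::euclidean_space \<Rightarrow> real" where
  "tent y = max 0 (2 - norm y)"

lemma tent_nonneg: "0 \<le> tent y"
  by (simp add: tent_def)

lemma bdd_supp_tent: "bdd_supp (tent :: 'a::euclidean_space \<Rightarrow> real)"
  unfolding tent_def by (rule bdd_suppI[where B=2 and R=2]) auto

lemma abs_tent_translate_le: "\<bar>tent y - tent (y + z)\<bar> \<le> norm z"
proof -
  have "norm y \<le> norm (y + z) + norm z" "norm (y + z) \<le> norm y + norm z"
    using norm_triangle_ineq4[of "y + z" z] norm_triangle_ineq[of y z] by auto
  then show ?thesis unfolding tent_def by linarith
qed

text \<open>The difference is at most \<open>norm z\<close> and vanishes off two balls of radius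
  2.\<close>

lemma integral_tent_translate_le:
  fixes z :: "'a::euclidean_space"
  shows "(\<integral>y. \<bar>tent y - tent (y + z)\<bar> \<partial>lborel) \<le> 2 * measure lborel (cball (0::'a) 2) * norm z"
proof -
  have int: "integrable lborel (indicator (cball c 2) :: 'a \<Rightarrow> real)" for c
    using emeasure_bounded_finite[of "cball c (2::real)"] by (intro integrable_real_indicator) auto
  have "(\<integral>y. \<bar>tent y - tent (y + z)\<bar> \<partial>lborel)
     \<le> (\<integral>y. norm z * (indicator (cball 0 2) y + indicator (cball (- z) 2) y) \<partial>lborel)"
  proof (rule integral_mono)
    show "integrable lborel (\<lambda>y. \<bar>tent y - tent (y + z)\<bar>)"
      by (intro integrable_abs bdd_supp_integrable bdd_supp_diff bdd_supp_translate bdd_supp_tent)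
    show "integrable lborel (\<lambda>y. norm z * (indicator (cball 0 2) y + indicator (cball (- z) 2) y))"
      using int by auto
    fix y :: 'a
    show "\<bar>tent y - tent (y + z)\<bar> \<le> norm z * (indicator (cball 0 2) y + indicator (cball (- z) 2) y)"
    proof (cases "y \<in> cball 0 2 \<or> y \<in> cball (- z) 2")
      case True
      then have "norm z * 1 \<le> norm z * (indicator (cball 0 2) y + indicator (cball (- z) 2) y)"
        by (intro mult_left_mono) (auto simp: indicator_def)
      then show ?thesis using abs_tent_translate_le[of y z] by linarith
    next
      case False
      then have "2 < norm y" "2 < norm (y + z)" by (auto simp: dist_norm norm_minus_commute add.commute)
      then show ?thesis by (simp add: tent_def)
    qed
  qed
  also have "\<dots> = norm z * (measure lborel (cball (0::'a) 2) + measure lborel (cball (- z) 2))"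
    using int by (simp add: measure_def)
  also have "measure lborel (cball (- z) 2) = measure lborel (cball (0::'a) 2)"
    by (simp add: content_cball)
  finally show ?thesis by (simp add: mult.commute)
qed

lemma integral_tent_le: "(\<integral>y. tent (y::'a::euclidean_space) \<partial>lborel) \<le> 2 * measure lborel (cball (0::'a) 2)"
proof -
  have "emeasure lborel (cball (0::'a) 2) < \<infinity>"
    using emeasure_bounded_finite[of "cball (0::'a) 2"] by simp
  then have int: "integrable lborel (\<lambda>y. 2 * indicator (cball (0::'a) 2) y :: real)"
    by (intro integrable_mult_right integrable_real_indicator) auto
  have "(\<integral>y. tent (y::'a) \<partial>lborel) \<le> (\<integral>y. 2 * indicator (cball (0::'a) 2) y \<partial>lborel)"
    by (rule integral_mono[OF bdd_supp_integrable[OF bdd_supp_tent] int]) (auto simp: tent_def indicator_def)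
  then show ?thesis by simp
qed

text \<open>Off the diagonal, \<open>h = t *\<^sub>R (reflection (v i) \<zeta> - reflection (v j) \<zeta>)\<close> turns the translation by \<open>h\<close> into
  a translation of the weight by \<open>\<zeta>\<close>; the diagonal contributes \<open>1 / N\<close>.\<close>

lemma averaged_difference_le:
  fixes f :: "'a::euclidean_space \<Rightarrow> real" and v :: "nat \<Rightarrow> 'a"
  assumes f: "bdd_supp f" and e: "norm e = 1" and s: "0 \<le> s" and t: "0 < t" and N: "0 < N"
    and v: "\<And>i j. i < N \<Longrightarrow> j < N \<Longrightarrow> i \<noteq> j \<Longrightarrow> \<exists>\<zeta>. norm \<zeta> \<le> real N \<and> reflection (v i) \<zeta> - reflection (v j) \<zeta> = e"
  defines "u \<equiv> \<lambda>x. f x - f (x - s *\<^sub>R e)"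
  shows "(\<integral>\<^sup>+y. ennreal (tent y) * (\<integral>\<^sup>+x. ennreal ((\<Sum>i<N. u (x - t *\<^sub>R reflection (v i) y))\<^sup>2) \<partial>lborel) \<partial>lborel)
    \<le> ennreal (8 * measure lborel (cball (0::'a) 2) * (real N + real N ^ 3 * s / t) * (\<integral>x. (f x)\<^sup>2 \<partial>lborel))"
proof -
  define A where "A = (\<integral>x. (f x)\<^sup>2 \<partial>lborel)"
  define V where "V = measure lborel (cball (0::'a) 2)"
  have A0: "0 \<le> A" unfolding A_def by simp
  have V0: "0 \<le> V" unfolding V_def by simp
  note [measurable] = bdd_supp_measurable[OF f]
  have u: "bdd_supp u" unfolding u_def by (intro bdd_supp_diff bdd_supp_translate_diff f)
  note [measurable] = bdd_supp_measurable[OF u]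
  let ?c = "autocorr u"
  let ?D = "\<lambda>i j y. t *\<^sub>R (reflection (v i) y - reflection (v j) y)"
  have c: "?c w = 2 * autocorr f w - autocorr f (w - s *\<^sub>R e) - autocorr f (w + s *\<^sub>R e)" for w
    unfolding u_def by (rule autocorr_diff_translate[OF f])
  have aA: "\<bar>autocorr f w\<bar> \<le> A" for w unfolding A_def by (rule abs_autocorr_le[OF f])
  have cb: "\<bar>?c w\<bar> \<le> 4 * A" for w
    unfolding c using aA[of w] aA[of "w - s *\<^sub>R e"] aA[of "w + s *\<^sub>R e"] by linarith
  have tb: "integrable lborel (\<lambda>y. tent y * g y)" if "g \<in> borel_measurable borel" "\<And>y. \<bar>g y\<bar> \<le> B" for g :: "'a \<Rightarrow> real" and B
    by (intro bdd_supp_integrable bdd_supp_mult_bounded[OF bdd_supp_tent that])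
  \<comment> \<open>Opening the square gives, for each pair of reflections, the autocorrelation of
    \<open>u\<close> at the difference of the two translations. The double sum is an integral of a
    square, hence non-negative, although its single terms may have either sign.\<close>
  have inner: "(\<Sum>i<N. \<Sum>j<N. ?c (?D i j y)) \<ge> 0 \<and> (\<integral>\<^sup>+x. ennreal ((\<Sum>i<N. u (x - t *\<^sub>R reflection (v i) y))\<^sup>2) \<partial>lborel) = ennreal (\<Sum>i<N. \<Sum>j<N. ?c (?D i j y))" for y
  proof -
    have I: "integrable lborel (\<lambda>x. u (x - p) * u (x - q))" for p q
      by (intro bdd_supp_integrable bdd_supp_mult bdd_supp_translate_diff u)
    have T: "(\<integral>x. u (x - p) * u (x - q) \<partial>lborel) = ?c (p - q)" for p q
      using integral_lborel_translate[of "\<lambda>x. u x * u (x + (p - q))" "- p"]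
      by (simp add: autocorr_def)
    have eq: "(\<Sum>i<N. u (x - t *\<^sub>R reflection (v i) y))\<^sup>2
        = (\<Sum>i<N. \<Sum>j<N. u (x - t *\<^sub>R reflection (v i) y) * u (x - t *\<^sub>R reflection (v j) y))" for x
      by (simp add: power2_eq_square sum_product)
    have "(\<integral>\<^sup>+x. ennreal ((\<Sum>i<N. u (x - t *\<^sub>R reflection (v i) y))\<^sup>2) \<partial>lborel)
        = ennreal (\<integral>x. (\<Sum>i<N. u (x - t *\<^sub>R reflection (v i) y))\<^sup>2 \<partial>lborel)"
    proof (rule nn_integral_eq_integral)
      show "integrable lborel (\<lambda>x. (\<Sum>i<N. u (x - t *\<^sub>R reflection (v i) y))\<^sup>2)"
        unfolding eq by (intro Bochner_Integration.integrable_sum I)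
    qed simp
    also have "(\<integral>x. (\<Sum>i<N. u (x - t *\<^sub>R reflection (v i) y))\<^sup>2 \<partial>lborel) = (\<Sum>i<N. \<Sum>j<N. ?c (?D i j y))"
      unfolding eq using I by (simp add: Bochner_Integration.integral_sum Bochner_Integration.integrable_sum T scaleR_diff_right)
    moreover have "0 \<le> (\<integral>x. (\<Sum>i<N. u (x - t *\<^sub>R reflection (v i) y))\<^sup>2 \<partial>lborel)" by simp
    ultimately show ?thesis by metis
  qed
  have nonneg: "0 \<le> (\<Sum>i<N. \<Sum>j<N. ?c (?D i j y))" for y using inner by blast
  have inner: "(\<integral>\<^sup>+x. ennreal ((\<Sum>i<N. u (x - t *\<^sub>R reflection (v i) y))\<^sup>2) \<partial>lborel) = ennreal (\<Sum>i<N. \<Sum>j<N. ?c (?D i j y))" for y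
    using inner by blast
  have term_int: "integrable lborel (\<lambda>y. tent y * ?c (?D i j y))" for i j
    by (rule tb[where B="4 * A"]) (use cb in auto)
  have diag: "(\<integral>y. tent y * ?c (?D i i y) \<partial>lborel) \<le> 8 * V * A" for i
  proof -
    have "(\<integral>y. tent y * ?c (?D i i y) \<partial>lborel) = (\<integral>y. tent (y::'a) \<partial>lborel) * ?c 0" by simp
    also have "\<dots> \<le> (2 * V) * (4 * A)"
      using integral_tent_le[where 'a='a] cb[of 0] A0 V0 unfolding V_def[symmetric]
      by (intro mult_mono') (auto intro: order_trans[OF abs_ge_self] Bochner_Integration.integral_nonneg tent_nonneg simp: autocorr_def)
    finally show ?thesis by simp
  qed
  have off: "(\<integral>y. tent y * ?c (?D i j y) \<partial>lborel) \<le> 8 * V * A * (real N * s / t)"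
    if ij: "i < N" "j < N" "i \<noteq> j" for i j
  proof -
    obtain z0 where z0: "norm z0 \<le> real N" "reflection (v i) z0 - reflection (v j) z0 = e" using v[OF ij] by blast
    \<comment> \<open>The map \<open>?D i j\<close> is linear and sends \<open>z\<close> to
      \<open>s *\<^sub>R e\<close>. The second difference of the autocorrelation with step
      \<open>s *\<^sub>R e\<close> is therefore a second difference in \<open>y\<close> with step
      \<open>z\<close>, and a change of variables puts it on the weight, at the cost
      \<open>norm z \<le> N * s / t\<close>.\<close>
    define z where "z = (s / t) *\<^sub>R z0"
    have nz: "norm z \<le> real N * s / t"
      using z0(1) s t by (simp add: z_def mult_left_mono divide_right_mono mult.commute)
    have Dz: "?D i j z = s *\<^sub>R e"
      using z0(2) t by (simp add: z_def refl_scale scaleR_diff_right[symmetric])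
    define b where "b y = autocorr f (?D i j y)" for y
    have [measurable]: "b \<in> borel_measurable borel" unfolding b_def by measurable
    have bA: "\<bar>b y\<bar> \<le> A" for y unfolding b_def by (rule aA)
    have cD: "?c (?D i j y) = 2 * b y - b (y - z) - b (y + z)" for y
      unfolding c b_def Dz[symmetric] by (simp add: reflection_add refl_diff algebra_simps)
    have Ib: "integrable lborel (\<lambda>y. tent (y + p) * b (y + q))" for p q
      using bdd_supp_mult_bounded[OF bdd_supp_translate[OF bdd_supp_tent], of "\<lambda>y. b (y + q)" A p] bA
      by (intro bdd_supp_integrable) auto
    have sh: "(\<integral>y. tent y * b (y + p) \<partial>lborel) = (\<integral>y. tent (y - p) * b y \<partial>lborel)" for p
    proof -
      have [measurable]: "tent \<in> borel_measurable (borel :: 'a measure)" by (rule bdd_supp_measurable[OF bdd_supp_tent])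
      have "(\<integral>y. tent (y + - p) * b (y + - p + p) \<partial>lborel) = (\<integral>y. tent y * b (y + p) \<partial>lborel)"
        by (rule integral_lborel_translate) measurable
      then show ?thesis by simp
    qed
    have Ib': "integrable lborel (\<lambda>y. tent y * b (y + p))" "integrable lborel (\<lambda>y. tent (y + p) * b y)" for p
      using Ib[of 0 p] Ib[of p 0] by simp_all
    have "(\<integral>y. tent y * ?c (?D i j y) \<partial>lborel)
        = (\<integral>y. (tent y * b y - tent y * b (y + - z)) + (tent y * b y - tent y * b (y + z)) \<partial>lborel)"
      unfolding cD by (intro Bochner_Integration.integral_cong) (auto simp: algebra_simps)
    also have "\<dots> = ((\<integral>y. tent y * b y \<partial>lborel) - (\<integral>y. tent y * b (y + - z) \<partial>lborel))
        + ((\<integral>y. tent y * b y \<partial>lborel) - (\<integral>y. tent y * b (y + z) \<partial>lborel))"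
      using Ib'[of "- z"] Ib'[of z] Ib[of 0 0] by (simp del: diff_conv_add_uminus)
    also have "\<dots> = ((\<integral>y. tent y * b y \<partial>lborel) - (\<integral>y. tent (y + z) * b y \<partial>lborel))
        + ((\<integral>y. tent y * b y \<partial>lborel) - (\<integral>y. tent (y + - z) * b y \<partial>lborel))"
      unfolding sh by simp
    also have "\<dots> = (\<integral>y. (tent y - tent (y + z)) * b y \<partial>lborel) + (\<integral>y. (tent y - tent (y + - z)) * b y \<partial>lborel)"
      using Ib'[of z] Ib'[of "- z"] Ib[of 0 0] by (simp add: left_diff_distrib del: diff_conv_add_uminus)
    also have "\<dots> \<le> (\<integral>y. \<bar>tent y - tent (y + z)\<bar> * A \<partial>lborel) + (\<integral>y. \<bar>tent y - tent (y + - z)\<bar> * A \<partial>lborel)"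
    proof -
      have "(\<integral>y. (tent y - tent (y + p)) * b y \<partial>lborel) \<le> (\<integral>y. \<bar>tent y - tent (y + p)\<bar> * A \<partial>lborel)" for p
      proof (rule integral_mono)
        show "integrable lborel (\<lambda>y. (tent y - tent (y + p)) * b y)"
          using Ib'[of p] Ib[of 0 0] by (simp add: left_diff_distrib)
        show "integrable lborel (\<lambda>y. \<bar>tent y - tent (y + p)\<bar> * A)"
          by (intro integrable_mult_left integrable_abs bdd_supp_integrable bdd_supp_diff bdd_supp_translate bdd_supp_tent)
        show "(tent y - tent (y + p)) * b y \<le> \<bar>tent y - tent (y + p)\<bar> * A" for y
          using mult_left_mono[OF bA[of y], of "\<bar>tent y - tent (y + p)\<bar>"] abs_ge_self[of "(tent y - tent (y + p)) * b y"]
          by (simp add: abs_mult)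
      qed
      then show ?thesis by (intro add_mono)
    qed
    also have "\<dots> \<le> 2 * V * norm z * A + 2 * V * norm (- z) * A"
      using integral_tent_translate_le[of z] integral_tent_translate_le[of "- z"] A0
      unfolding V_def by (simp only: integral_mult_left_zero) (intro add_mono mult_right_mono)
    also have "\<dots> = 4 * V * A * norm z" by simp
    also have "\<dots> \<le> 4 * V * A * (real N * s / t)" using nz A0 V0 by (intro mult_left_mono) auto
    also have "\<dots> \<le> 8 * V * A * (real N * s / t)" using A0 V0 s t by (intro mult_right_mono) auto
    finally show ?thesis .
  qed
  have "(\<integral>\<^sup>+y. ennreal (tent y) * (\<integral>\<^sup>+x. ennreal ((\<Sum>i<N. u (x - t *\<^sub>R reflection (v i) y))\<^sup>2) \<partial>lborel) \<partial>lborel)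
      = (\<integral>\<^sup>+y. ennreal (\<Sum>i<N. \<Sum>j<N. tent y * ?c (?D i j y)) \<partial>lborel)"
    unfolding inner using nonneg by (intro nn_integral_cong) (simp add: ennreal_mult[symmetric] tent_nonneg sum_distrib_left)
  also have "\<dots> = ennreal (\<integral>y. (\<Sum>i<N. \<Sum>j<N. tent y * ?c (?D i j y)) \<partial>lborel)"
  proof (rule nn_integral_eq_integral)
    show "AE y in lborel. 0 \<le> (\<Sum>i<N. \<Sum>j<N. tent y * ?c (?D i j y))"
      using nonneg by (intro AE_I2) (simp add: sum_distrib_left[symmetric] tent_nonneg)
  qed (intro Bochner_Integration.integrable_sum term_int)
  also have "(\<integral>y. (\<Sum>i<N. \<Sum>j<N. tent y * ?c (?D i j y)) \<partial>lborel)
      = (\<Sum>i<N. \<Sum>j<N. (\<integral>y. tent y * ?c (?D i j y) \<partial>lborel))"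
    by (subst Bochner_Integration.integral_sum, intro Bochner_Integration.integrable_sum term_int,
        subst Bochner_Integration.integral_sum, rule term_int, rule refl)
  \<comment> \<open>The bound for the off-diagonal terms is non-negative and is granted to the
    diagonal ones too: \<open>N\<close> diagonal terms of size \<open>8 * V * A\<close> and
    \<open>N * N\<close> terms with the factor \<open>N * s / t\<close>.\<close>
  also have "\<dots> \<le> (\<Sum>i<N. \<Sum>j<N. (if i = j then 8 * V * A else 0) + 8 * V * A * (real N * s / t))"
  proof (intro sum_mono)
    fix i j assume "i \<in> {..<N}" "j \<in> {..<N}"
    moreover have "0 \<le> 8 * V * A * (real N * s / t)" using A0 V0 s t by simp
    ultimately show "(\<integral>y. tent y * ?c (?D i j y) \<partial>lborel) \<le> (if i = j then 8 * V * A else 0) + 8 * V * A * (real N * s / t)"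
      using diag[of i] off[of i j] by (cases "i = j") auto
  qed
  also have "\<dots> = 8 * V * (real N + real N ^ 3 * s / t) * A"
    by (simp add: sum.distrib algebra_simps power3_eq_cube)
  finally show ?thesis unfolding A_def V_def by (simp add: ennreal_leI)
qed

lemma bdd_supp_bounded: "bdd_supp f \<Longrightarrow> \<exists>B\<ge>0. \<forall>x. \<bar>f x\<bar> \<le> B"
  by (erule bdd_suppE) blast

section \<open>Smoothing of differences\<close>

text \<open>With values in \<open>ennreal\<close> the average is always defined, and sums, suprema
  and Fubini pass through it freely.\<close>

definition posavg :: "('a::euclidean_space \<times> 'a) measure \<Rightarrow> real \<Rightarrow> ('a \<Rightarrow> ennreal) \<Rightarrow> ('a \<Rightarrow> ennreal) \<Rightarrow> 'a \<Rightarrow> ennreal" where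
  "posavg M t f g x = (\<integral>\<^sup>+w. f (x - t *\<^sub>R fst w) * g (x - t *\<^sub>R snd w) \<partial>M)"

text \<open>Together with the weak bound at a single scale, these properties are all that the
  maximal estimate takes from the surface measure: finite mass, support in the product of unit
  balls, both projections with density at most \<open>K\<close>, and invariance under reflections of
  each variable separately. The measure lives on Borel sets.\<close>

locale averaging_measure =
  fixes M :: "('a::euclidean_space \<times> 'a) measure" and K :: real
  assumes fin: "finite_measure M" and sets_M: "sets M = sets (borel \<Otimes>\<^sub>M borel)"
    and dim: "2 \<le> DIM('a)" and K0: "0 \<le> K"
    and supp: "AE w in M. norm (fst w) \<le> 1 \<and> norm (snd w) \<le> 1"
    and fst_le: "\<And>E. E \<in> sets borel \<Longrightarrow> emeasure M {w. fst w \<in> E} \<le> ennreal K * emeasure lborel E"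
    and snd_le: "\<And>E. E \<in> sets borel \<Longrightarrow> emeasure M {w. snd w \<in> E} \<le> ennreal K * emeasure lborel E"
    and fst_reflection: "\<And>v. norm v = 1 \<Longrightarrow> distr M (borel \<Otimes>\<^sub>M borel) (\<lambda>w. (reflection v (fst w), snd w)) = M"
    and snd_reflection: "\<And>v. norm v = 1 \<Longrightarrow> distr M (borel \<Otimes>\<^sub>M borel) (\<lambda>w. (fst w, reflection v (snd w))) = M"
begin

sublocale finite_measure M by (rule fin)

declare sets_M [measurable_cong]

lemma space_M [simp]: "space M = UNIV"
  using sets_eq_imp_space_eq[OF sets_M] by (simp add: space_pair_measure)

lemma nn_integral_fst_le:
  assumes [measurable]: "g \<in> borel_measurable borel"
  shows "(\<integral>\<^sup>+w. g (fst w) \<partial>M) \<le> ennreal K * (\<integral>\<^sup>+y. g y \<partial>lborel)"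
proof -
  have fm: "fst \<in> measurable M borel" by measurable
  have "(\<integral>\<^sup>+w. g (fst w) \<partial>M) = (\<integral>\<^sup>+y. g y \<partial>distr M borel fst)"
    using fm by (subst nn_integral_distr) auto
  also have "\<dots> \<le> (\<integral>\<^sup>+y. g y \<partial>scale_measure (ennreal K) lborel)"
  proof (rule nn_integral_mono_measure)
    show "distr M borel fst \<le> scale_measure (ennreal K) (lborel :: 'a measure)"
    proof (subst le_measure)
      show "\<forall>A\<in>sets (distr M borel fst). emeasure (distr M borel fst) A \<le> emeasure (scale_measure (ennreal K) lborel) A"
        using fst_le by (auto simp: emeasure_distr[OF fm] vimage_def)
    qed simp
  qed simp
  also have "\<dots> = ennreal K * (\<integral>\<^sup>+y. g y \<partial>lborel)" by (rule nn_integral_scale_measure) simp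
  finally show ?thesis .
qed

lemma borel_measurable_posavg [measurable]:
  assumes [measurable]: "f \<in> borel_measurable borel" "g \<in> borel_measurable borel"
  shows "posavg M t f g \<in> borel_measurable borel"
  unfolding posavg_def by measurable

lemma posavg_mono: "(\<And>x. f x \<le> f' x) \<Longrightarrow> (\<And>x. g x \<le> g' x) \<Longrightarrow> posavg M t f g x \<le> posavg M t f' g' x"
  unfolding posavg_def by (intro nn_integral_mono mult_mono) auto

text \<open>With a constant in the second slot only the first projection of \<open>M\<close>
  matters. It has density at most \<open>K\<close> on the unit ball, so the average is at most
  \<open>K\<close> times the volume of the unit ball times a mean over
  \<open>cball x t\<close>.\<close>

lemma posavg_one_right_le:
  assumes [measurable]: "f \<in> borel_measurable borel" and t: "0 < t"
  shows "posavg M t f (\<lambda>_. 1) x \<le> ennreal (K * unit_ball_vol (real DIM('a))) * hl f x"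
proof -
  let ?n = "DIM('a)"
  have "posavg M t f (\<lambda>_. 1) x = (\<integral>\<^sup>+w. f (x - t *\<^sub>R fst w) * indicator (cball x t) (x - t *\<^sub>R fst w) \<partial>M)"
    unfolding posavg_def
  proof (rule nn_integral_cong_AE)
    show "AE w in M. f (x - t *\<^sub>R fst w) * 1 = f (x - t *\<^sub>R fst w) * indicator (cball x t) (x - t *\<^sub>R fst w)"
      using supp
    proof eventually_elim
      case (elim w)
      then have "t * norm (fst w) \<le> t * 1" using t by (intro mult_left_mono) auto
      then show ?case using t by (simp add: dist_norm indicator_def)
    qed
  qed
  also have "\<dots> \<le> ennreal K * (\<integral>\<^sup>+y. f (x - t *\<^sub>R y) * indicator (cball x t) (x - t *\<^sub>R y) \<partial>lborel)"
    by (rule nn_integral_fst_le[where g="\<lambda>y. f (x - t *\<^sub>R y) * indicator (cball x t) (x - t *\<^sub>R y)"]) measurable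
  also have "(\<integral>\<^sup>+y. f (x - t *\<^sub>R y) * indicator (cball x t) (x - t *\<^sub>R y) \<partial>lborel)
      = ennreal (1 / t ^ ?n) * (\<integral>\<^sup>+y. f y * indicator (cball x t) y \<partial>lborel)"
  proof -
    have "(\<integral>\<^sup>+y. f y * indicator (cball x t) y \<partial>lborel)
       = ennreal (\<bar>- t\<bar> ^ ?n) * (\<integral>\<^sup>+y. f (x + (- t) *\<^sub>R y) * indicator (cball x t) (x + (- t) *\<^sub>R y) \<partial>lborel)"
      by (rule nn_integral_lborel_affine) (use t in auto)
    then show ?thesis using t by (simp add: mult.assoc[symmetric] ennreal_mult[symmetric])
  qed
  also have "ennreal K * (ennreal (1 / t ^ ?n) * (\<integral>\<^sup>+y. f y * indicator (cball x t) y \<partial>lborel))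
      \<le> ennreal K * (ennreal (1 / t ^ ?n) * (hl f x * emeasure lborel (cball x t)))"
    by (intro mult_left_mono nn_integral_cball_le_hl t) simp_all
  also have "\<dots> = ennreal K * (ennreal (1 / t ^ ?n) * emeasure lborel (cball x t)) * hl f x" by (simp only: mult_ac)
  also have "ennreal (1 / t ^ ?n) * emeasure lborel (cball x t) = ennreal (unit_ball_vol (real ?n))"
    using t by (simp add: emeasure_cball ennreal_mult[symmetric])
  also have "ennreal K * ennreal (unit_ball_vol (real ?n)) = ennreal (K * unit_ball_vol (real ?n))"
    using K0 by (subst ennreal_mult) auto
  finally show ?thesis .
qed

definition diffavg :: "real \<Rightarrow> 'a \<Rightarrow> ('a \<Rightarrow> real) \<Rightarrow> ('a \<Rightarrow> real) \<Rightarrow> 'a \<Rightarrow> real" where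
  "diffavg t h f g x = (\<integral>w. (f (x - t *\<^sub>R fst w) - f (x - t *\<^sub>R fst w - h)) * g (x - t *\<^sub>R snd w) \<partial>M)"

lemma integrable_avg:
  assumes f: "bdd_supp f" and [measurable]: "g \<in> borel_measurable borel" and g: "\<And>x. \<bar>g x\<bar> \<le> B"
  shows "integrable M (\<lambda>w. f (x - t *\<^sub>R fst w) * g (x - t *\<^sub>R snd w))"
proof -
  obtain C where C: "0 \<le> C" "\<And>x. \<bar>f x\<bar> \<le> C" using bdd_supp_bounded[OF f] by auto
  note [measurable] = bdd_supp_measurable[OF f]
  show ?thesis
  proof (rule integrable_const_bound[where B="C * B"])
    show "AE w in M. norm (f (x - t *\<^sub>R fst w) * g (x - t *\<^sub>R snd w)) \<le> C * B"
      unfolding real_norm_def abs_mult using C g by (intro AE_I2 mult_mono) auto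
  qed measurable
qed

definition smoothing_const :: real where
  "smoothing_const = 8 * measure lborel (cball (0::'a) 2) * K * measure M UNIV"

lemma smoothing_const_nonneg: "0 \<le> smoothing_const"
  unfolding smoothing_const_def using K0 by simp

text \<open>By invariance the average equals the mean of \<open>N\<close> averages in which the
  first variable is reflected. Cauchy-Schwarz with respect to \<open>M\<close> removes the bounded
  \<open>g\<close>, and the density bound replaces \<open>M\<close> by Lebesgue measure with the
  tent weight. The estimate for the sum of the reflected differences, divided by the square of
  \<open>N\<close>, leaves \<open>1 / N\<close> from the diagonal and \<open>N * norm h / t\<close>
  from the rest.\<close>

lemma nn_integral_diffavg_square_le:
  assumes f: "bdd_supp f" and g[measurable]: "g \<in> borel_measurable borel" and gB: "\<And>x. \<bar>g x\<bar> \<le> B"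
    and t: "0 < t" and N: "0 < N"
  shows "(\<integral>\<^sup>+x. ennreal ((diffavg t h f g x)\<^sup>2) \<partial>lborel)
    \<le> ennreal (smoothing_const * B\<^sup>2 * (1 / real N + real N * norm h / t) * (\<integral>x. (f x)\<^sup>2 \<partial>lborel))"
proof -
  note [measurable] = bdd_supp_measurable[OF f]
  have B0: "0 \<le> B" using gB[of 0] by linarith
  define s where "s = norm h"
  obtain b :: 'a where b: "b \<in> Basis" using nonempty_Basis by blast
  \<comment> \<open>For \<open>h = 0\<close> any unit vector serves, since then
    \<open>s = 0\<close>.\<close>
  define e where "e = (if h = 0 then b else h /\<^sub>R norm h)"
  have e: "norm e = 1" using b by (simp add: e_def)
  have h: "h = s *\<^sub>R e" by (simp add: s_def e_def)
  have s: "0 \<le> s" by (simp add: s_def)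
  obtain v :: "nat \<Rightarrow> 'a" where v1: "\<And>i. norm (v i) = 1" and
    v: "\<And>i j. i < N \<Longrightarrow> j < N \<Longrightarrow> i \<noteq> j \<Longrightarrow> \<exists>\<zeta>. norm \<zeta> \<le> real N \<and> reflection (v i) \<zeta> - reflection (v j) \<zeta> = e"
    using exists_separated_reflections[OF e dim N] by blast
  define u where "u = (\<lambda>x. f x - f (x - s *\<^sub>R e))"
  have u: "bdd_supp u" unfolding u_def by (intro bdd_supp_diff bdd_supp_translate_diff f)
  note [measurable] = bdd_supp_measurable[OF u]
  define S where "S x y = (\<Sum>i<N. u (x - t *\<^sub>R reflection (v i) y))" for x y
  let ?D = "diffavg t h f g"
  have D: "?D x = (\<integral>w. u (x - t *\<^sub>R fst w) * g (x - t *\<^sub>R snd w) \<partial>M)" for x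
    unfolding diffavg_def u_def h by simp
  have Drefl: "?D x = (\<integral>w. u (x - t *\<^sub>R reflection (v i) (fst w)) * g (x - t *\<^sub>R snd w) \<partial>M)" for x i
  proof -
    have "?D x = (\<integral>w. u (x - t *\<^sub>R fst w) * g (x - t *\<^sub>R snd w) \<partial>distr M (borel \<Otimes>\<^sub>M borel) (\<lambda>w. (reflection (v i) (fst w), snd w)))"
      unfolding D fst_reflection[OF v1] ..
    also have "\<dots> = (\<integral>w. u (x - t *\<^sub>R reflection (v i) (fst w)) * g (x - t *\<^sub>R snd w) \<partial>M)"
      using integral_distr[of "\<lambda>w. (reflection (v i) (fst w), snd w)" M "borel \<Otimes>\<^sub>M borel"
          "\<lambda>w. u (x - t *\<^sub>R fst w) * g (x - t *\<^sub>R snd w)"] by simp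
    finally show ?thesis .
  qed
  obtain C where C: "0 \<le> C" "\<And>x. \<bar>u x\<bar> \<le> C" using bdd_supp_bounded[OF u] by auto
  have Iterm: "integrable M (\<lambda>w. u (x - t *\<^sub>R reflection (v i) (fst w)) * g (x - t *\<^sub>R snd w))" for x i
  proof (rule integrable_const_bound[where B="C * B"])
    show "AE w in M. norm (u (x - t *\<^sub>R reflection (v i) (fst w)) * g (x - t *\<^sub>R snd w)) \<le> C * B"
      unfolding real_norm_def abs_mult using C gB by (intro AE_I2 mult_mono) auto
  qed measurable
  have ND: "real N * ?D x = (\<integral>w. S x (fst w) * g (x - t *\<^sub>R snd w) \<partial>M)" for x
  proof -
    have "real N * ?D x = (\<Sum>i<N. ?D x)" by simp
    also have "\<dots> = (\<Sum>i<N. (\<integral>w. u (x - t *\<^sub>R reflection (v i) (fst w)) * g (x - t *\<^sub>R snd w) \<partial>M))"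
      using Drefl by (intro sum.cong) auto
    also have "\<dots> = (\<integral>w. S x (fst w) * g (x - t *\<^sub>R snd w) \<partial>M)"
      unfolding S_def sum_distrib_right using Iterm by (simp add: Bochner_Integration.integral_sum)
    finally show ?thesis .
  qed
  have ptw: "ennreal ((real N * ?D x)\<^sup>2) \<le> ennreal (B\<^sup>2 * measure M UNIV) * (\<integral>\<^sup>+w. ennreal ((S x (fst w))\<^sup>2) \<partial>M)" for x
  proof -
    have [measurable]: "S x \<in> borel_measurable borel" unfolding S_def by measurable
    have "ennreal \<bar>real N * ?D x\<bar> \<le> (\<integral>\<^sup>+w. ennreal \<bar>S x (fst w) * g (x - t *\<^sub>R snd w)\<bar> \<partial>M)"
      unfolding ND using integral_norm_bound_ennreal[of M "\<lambda>w. S x (fst w) * g (x - t *\<^sub>R snd w)"]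
      by (cases "integrable M (\<lambda>w. S x (fst w) * g (x - t *\<^sub>R snd w))") (auto simp: not_integrable_integral_eq)
    also have "\<dots> \<le> (\<integral>\<^sup>+w. ennreal \<bar>S x (fst w)\<bar> * ennreal B \<partial>M)"
      using gB B0 by (intro nn_integral_mono) (auto simp: abs_mult ennreal_mult[symmetric] intro!: ennreal_leI mult_left_mono)
    finally have "(ennreal \<bar>real N * ?D x\<bar>)\<^sup>2 \<le> (\<integral>\<^sup>+w. ennreal \<bar>S x (fst w)\<bar> * ennreal B \<partial>M)\<^sup>2"
      by (rule power_mono) simp
    also have "\<dots> \<le> (\<integral>\<^sup>+w. (ennreal \<bar>S x (fst w)\<bar>)\<^sup>2 \<partial>M) * (\<integral>\<^sup>+w. (ennreal B)\<^sup>2 \<partial>M)"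
      by (rule Cauchy_Schwarz_nn_integral) auto
    also have "(\<integral>\<^sup>+w. (ennreal B)\<^sup>2 \<partial>M) = ennreal (B\<^sup>2 * measure M UNIV)"
      using B0 by (simp add: emeasure_eq_measure ennreal_power ennreal_mult[symmetric])
    also have "(\<integral>\<^sup>+w. (ennreal \<bar>S x (fst w)\<bar>)\<^sup>2 \<partial>M) = (\<integral>\<^sup>+w. ennreal ((S x (fst w))\<^sup>2) \<partial>M)"
      by (simp add: ennreal_power)
    also have "(ennreal \<bar>real N * ?D x\<bar>)\<^sup>2 = ennreal ((real N * ?D x)\<^sup>2)" by (simp only: ennreal_power abs_ge_zero power2_abs)
    finally show ?thesis by (simp add: mult.commute)
  qed
  let ?A = "(\<integral>x. (f x)\<^sup>2 \<partial>lborel)"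
  let ?V = "measure lborel (cball (0::'a) 2)"
  have "ennreal ((real N)\<^sup>2) * (\<integral>\<^sup>+x. ennreal ((?D x)\<^sup>2) \<partial>lborel) = (\<integral>\<^sup>+x. ennreal ((real N * ?D x)\<^sup>2) \<partial>lborel)"
  proof -
    have "?D \<in> borel_measurable borel" unfolding diffavg_def by measurable
    then show ?thesis by (subst nn_integral_cmult[symmetric]) (auto simp: power_mult_distrib ennreal_mult)
  qed
  also have "\<dots> \<le> (\<integral>\<^sup>+x. ennreal (B\<^sup>2 * measure M UNIV) * (\<integral>\<^sup>+w. ennreal ((S x (fst w))\<^sup>2) \<partial>M) \<partial>lborel)"
    by (intro nn_integral_mono ptw)
  also have "\<dots> = ennreal (B\<^sup>2 * measure M UNIV) * (\<integral>\<^sup>+x. (\<integral>\<^sup>+w. ennreal ((S x (fst w))\<^sup>2) \<partial>M) \<partial>lborel)"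
    unfolding S_def by (rule nn_integral_cmult) measurable
  finally have 0: "ennreal ((real N)\<^sup>2) * (\<integral>\<^sup>+x. ennreal ((?D x)\<^sup>2) \<partial>lborel)
     \<le> ennreal (B\<^sup>2 * measure M UNIV) * (\<integral>\<^sup>+x. (\<integral>\<^sup>+w. ennreal ((S x (fst w))\<^sup>2) \<partial>M) \<partial>lborel)" .
  have "(\<integral>\<^sup>+x. (\<integral>\<^sup>+w. ennreal ((S x (fst w))\<^sup>2) \<partial>M) \<partial>lborel) = (\<integral>\<^sup>+w. (\<integral>\<^sup>+x. ennreal ((S x (fst w))\<^sup>2) \<partial>lborel) \<partial>M)"
  proof -
    interpret P: pair_sigma_finite lborel M by unfold_locales
    show ?thesis unfolding S_def by (rule P.Fubini'[symmetric]) measurable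
  qed
  also have "\<dots> \<le> (\<integral>\<^sup>+w. ennreal (tent (fst w)) * (\<integral>\<^sup>+x. ennreal ((S x (fst w))\<^sup>2) \<partial>lborel) \<partial>M)"
  proof (rule nn_integral_mono_AE)
    show "AE w in M. (\<integral>\<^sup>+x. ennreal ((S x (fst w))\<^sup>2) \<partial>lborel) \<le> ennreal (tent (fst w)) * (\<integral>\<^sup>+x. ennreal ((S x (fst w))\<^sup>2) \<partial>lborel)"
      using supp
    proof eventually_elim
      case (elim w)
      \<comment> \<open>The weight is at least 1 on the support of the measure, so inserting it can
        only enlarge the integral.\<close>
      then have "1 \<le> tent (fst w)" by (simp add: tent_def)
      then have "1 * (\<integral>\<^sup>+x. ennreal ((S x (fst w))\<^sup>2) \<partial>lborel) \<le> ennreal (tent (fst w)) * (\<integral>\<^sup>+x. ennreal ((S x (fst w))\<^sup>2) \<partial>lborel)"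
        by (intro mult_right_mono) (auto simp: ennreal_ge_1)
      then show ?case by simp
    qed
  qed
  also have "\<dots> \<le> ennreal K * (\<integral>\<^sup>+y. ennreal (tent y) * (\<integral>\<^sup>+x. ennreal ((S x y)\<^sup>2) \<partial>lborel) \<partial>lborel)"
  proof (rule nn_integral_fst_le[where g="\<lambda>y. ennreal (tent y) * (\<integral>\<^sup>+x. ennreal ((S x y)\<^sup>2) \<partial>lborel)"])
    have [measurable]: "tent \<in> borel_measurable (borel :: 'a measure)" by (rule bdd_supp_measurable[OF bdd_supp_tent])
    show "(\<lambda>y. ennreal (tent y) * (\<integral>\<^sup>+x. ennreal ((S x y)\<^sup>2) \<partial>lborel)) \<in> borel_measurable borel"
      unfolding S_def by measurable
  qed
  finally have 1: "(\<integral>\<^sup>+x. (\<integral>\<^sup>+w. ennreal ((S x (fst w))\<^sup>2) \<partial>M) \<partial>lborel)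
      \<le> ennreal K * (\<integral>\<^sup>+y. ennreal (tent y) * (\<integral>\<^sup>+x. ennreal ((S x y)\<^sup>2) \<partial>lborel) \<partial>lborel)" .
  have 2: "(\<integral>\<^sup>+y. ennreal (tent y) * (\<integral>\<^sup>+x. ennreal ((S x y)\<^sup>2) \<partial>lborel) \<partial>lborel)
      \<le> ennreal (8 * ?V * (real N + real N ^ 3 * s / t) * ?A)"
    unfolding S_def u_def by (rule averaged_difference_le[OF f e s t N v])
  have "ennreal ((real N)\<^sup>2) * (\<integral>\<^sup>+x. ennreal ((?D x)\<^sup>2) \<partial>lborel)
     \<le> ennreal (B\<^sup>2 * measure M UNIV) * (ennreal K * ennreal (8 * ?V * (real N + real N ^ 3 * s / t) * ?A))"
    by (intro order_trans[OF 0] mult_left_mono order_trans[OF 1] 2) simp_all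
  also have "\<dots> = ennreal ((real N)\<^sup>2 * (smoothing_const * B\<^sup>2 * (1 / real N + real N * s / t) * ?A))"
  proof -
    have e: "(real N)\<^sup>2 * (1 / real N + real N * s / t) = real N + real N ^ 3 * s / t"
      using N t by (simp add: distrib_left power2_eq_square power3_eq_cube)
    have eq: "(real N)\<^sup>2 * (smoothing_const * B\<^sup>2 * (1 / real N + real N * s / t) * ?A)
        = (B\<^sup>2 * measure M UNIV) * (K * (8 * ?V * (real N + real N ^ 3 * s / t) * ?A))"
      unfolding e[symmetric] smoothing_const_def by (simp only: mult_ac)
    define z where "z = 8 * ?V * (real N + real N ^ 3 * s / t) * ?A"
    have "0 \<le> z" unfolding z_def using s t by simp
    then show ?thesis unfolding eq z_def[symmetric] using K0
      by (simp only: ennreal_mult[symmetric] mult_nonneg_nonneg zero_le_power2 measure_nonneg)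
  qed
  finally have le: "ennreal ((real N)\<^sup>2) * (\<integral>\<^sup>+x. ennreal ((?D x)\<^sup>2) \<partial>lborel)
      \<le> ennreal ((real N)\<^sup>2) * ennreal (smoothing_const * B\<^sup>2 * (1 / real N + real N * s / t) * ?A)"
    using smoothing_const_nonneg s t by (simp add: ennreal_mult)
  have "ennreal ((real N)\<^sup>2) \<noteq> 0" using N by simp
  with le show ?thesis unfolding s_def by (subst (asm) ennreal_mult_le_mult_iff) auto
qed

end

lemma ennreal_le_plusI: "a \<le> b + c \<Longrightarrow> 0 \<le> b \<Longrightarrow> 0 \<le> c \<Longrightarrow> ennreal a \<le> ennreal b + ennreal c"
  by (metis ennreal_leI ennreal_plus)

context averaging_measure
begin

text \<open>The assumptions are symmetric in the two variables. Interpreting them for the swapped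
  measure carries every estimate that smooths the first function over to the second.\<close>

lemma averaging_measure_swap: "averaging_measure (distr M (borel \<Otimes>\<^sub>M borel) (\<lambda>w. (snd w, fst w))) K"
proof -
  let ?s = "\<lambda>w :: 'a \<times> 'a. (snd w, fst w)"
  let ?N = "distr M (borel \<Otimes>\<^sub>M borel) ?s"
  have sw[measurable]: "?s \<in> measurable M (borel \<Otimes>\<^sub>M borel)" by measurable
  have [simp]: "space ?N = UNIV" by (simp add: space_pair_measure)
  show ?thesis
  proof (rule averaging_measure.intro)
    show "finite_measure ?N" using sw by (rule finite_measure_distr)
    show "AE w in ?N. norm (fst w) \<le> 1 \<and> norm (snd w) \<le> 1"
    proof (subst AE_distr_iff[OF sw])
      show "{x \<in> space (borel \<Otimes>\<^sub>M borel). norm (fst x) \<le> 1 \<and> norm (snd x) \<le> 1} \<in> sets (borel \<Otimes>\<^sub>M borel)" by measurable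
      show "AE x in M. norm (fst (?s x)) \<le> 1 \<and> norm (snd (?s x)) \<le> 1"
        using supp by eventually_elim auto
    qed
    show "emeasure ?N {w. fst w \<in> E} \<le> ennreal K * emeasure lborel E" if [measurable]: "E \<in> sets borel" for E
    proof -
      have "{w. fst w \<in> E} = {w \<in> space (borel \<Otimes>\<^sub>M borel). fst w \<in> E}" by (simp add: space_pair_measure)
      also have "\<dots> \<in> sets (borel \<Otimes>\<^sub>M borel)" by measurable
      finally have "emeasure ?N {w. fst w \<in> E} = emeasure M {w. snd w \<in> E}"
        using sw by (subst emeasure_distr) (auto simp: vimage_def)
      then show ?thesis using snd_le[OF that] by simp
    qed
    show "emeasure ?N {w. snd w \<in> E} \<le> ennreal K * emeasure lborel E" if [measurable]: "E \<in> sets borel" for E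
    proof -
      have "{w. snd w \<in> E} = {w \<in> space (borel \<Otimes>\<^sub>M borel). snd w \<in> E}" by (simp add: space_pair_measure)
      also have "\<dots> \<in> sets (borel \<Otimes>\<^sub>M borel)" by measurable
      finally have "emeasure ?N {w. snd w \<in> E} = emeasure M {w. fst w \<in> E}"
        using sw by (subst emeasure_distr) (auto simp: vimage_def)
      then show ?thesis using fst_le[OF that] by simp
    qed
    fix v :: 'a assume v: "norm v = 1"
    have "distr ?N (borel \<Otimes>\<^sub>M borel) (\<lambda>w. (reflection v (fst w), snd w)) = distr (distr M (borel \<Otimes>\<^sub>M borel) (\<lambda>w. (fst w, reflection v (snd w)))) (borel \<Otimes>\<^sub>M borel) ?s"
      by (subst (1 2) distr_distr) (auto simp: comp_def)
    then show "distr ?N (borel \<Otimes>\<^sub>M borel) (\<lambda>w. (reflection v (fst w), snd w)) = ?N" using snd_reflection[OF v] by simp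
    have "distr ?N (borel \<Otimes>\<^sub>M borel) (\<lambda>w. (fst w, reflection v (snd w))) = distr (distr M (borel \<Otimes>\<^sub>M borel) (\<lambda>w. (reflection v (fst w), snd w))) (borel \<Otimes>\<^sub>M borel) ?s"
      by (subst (1 2) distr_distr) (auto simp: comp_def)
    then show "distr ?N (borel \<Otimes>\<^sub>M borel) (\<lambda>w. (fst w, reflection v (snd w))) = ?N" using fst_reflection[OF v] by simp
  qed (use dim K0 in simp_all)
qed

lemma posavg_swap:
  assumes [measurable]: "f \<in> borel_measurable borel" "g \<in> borel_measurable borel"
  shows "posavg (distr M (borel \<Otimes>\<^sub>M borel) (\<lambda>w. (snd w, fst w))) t g f x = posavg M t f g x"
proof -
  let ?s = "\<lambda>w :: 'a \<times> 'a. (snd w, fst w)"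
  have sw[measurable]: "?s \<in> measurable M (borel \<Otimes>\<^sub>M borel)" by measurable
  show ?thesis unfolding posavg_def by (subst nn_integral_distr) (auto simp: mult.commute)
qed

definition ball_mean :: "real \<Rightarrow> ('a \<Rightarrow> ennreal) \<Rightarrow> 'a \<Rightarrow> ennreal" where
  "ball_mean \<delta> f v = (\<integral>\<^sup>+h. f (v - h) * indicator (cball 0 \<delta>) h \<partial>lborel) / emeasure lborel (cball (0::'a) \<delta>)"

text \<open>The error made when the first function is replaced by its local mean at scale
  \<open>\<delta>\<close>. The absolute value stands inside the mean over \<open>h\<close>, so
  bounds for each single translation suffice.\<close>

definition mean_diffavg :: "real \<Rightarrow> real \<Rightarrow> ('a \<Rightarrow> real) \<Rightarrow> ('a \<Rightarrow> real) \<Rightarrow> 'a \<Rightarrow> ennreal" where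
  "mean_diffavg \<delta> t f g x = (\<integral>\<^sup>+h. ennreal \<bar>diffavg t h f g x\<bar> * indicator (cball 0 \<delta>) h \<partial>lborel) / emeasure lborel (cball (0::'a) \<delta>)"

lemma borel_measurable_ball_mean [measurable]:
  assumes [measurable]: "f \<in> borel_measurable borel"
  shows "ball_mean \<delta> f \<in> borel_measurable borel"
  unfolding ball_mean_def by measurable

lemma borel_measurable_mean_diffavg [measurable]:
  assumes [measurable]: "f \<in> borel_measurable borel" "g \<in> borel_measurable borel"
  shows "mean_diffavg \<delta> t f g \<in> borel_measurable borel"
  unfolding mean_diffavg_def diffavg_def by measurable

lemma posavg_le_posavg_translate:
  assumes f: "bdd_supp f" and g: "bdd_supp g" and f0: "\<And>x. 0 \<le> f x" and g0: "\<And>x. 0 \<le> g x"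
  shows "posavg M t (\<lambda>x. ennreal (f x)) (\<lambda>x. ennreal (g x)) x
    \<le> posavg M t (\<lambda>x. ennreal (f (x - h))) (\<lambda>x. ennreal (g x)) x + ennreal \<bar>diffavg t h f g x\<bar>"
proof -
  obtain B where B: "0 \<le> B" "\<And>x. \<bar>g x\<bar> \<le> B" using bdd_supp_bounded[OF g] by auto
  have eq: "posavg M t (\<lambda>x. ennreal (f' x)) (\<lambda>x. ennreal (g x)) x = ennreal (\<integral>w. f' (x - t *\<^sub>R fst w) * g (x - t *\<^sub>R snd w) \<partial>M)"
    if "bdd_supp f'" "\<And>x. 0 \<le> f' x" for f'
    unfolding posavg_def using that g0
    by (subst nn_integral_eq_integral[symmetric])
       (auto intro!: integrable_avg[OF _ bdd_supp_measurable[OF g] B(2)] simp: ennreal_mult)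
  have fh: "bdd_supp (\<lambda>x. f (x - h))" by (intro bdd_supp_translate_diff f)
  have "(\<integral>w. f (x - t *\<^sub>R fst w) * g (x - t *\<^sub>R snd w) \<partial>M)
      = (\<integral>w. f (x - t *\<^sub>R fst w - h) * g (x - t *\<^sub>R snd w) \<partial>M) + diffavg t h f g x"
    unfolding diffavg_def left_diff_distrib
    using integrable_avg[OF f bdd_supp_measurable[OF g] B(2)] integrable_avg[OF fh bdd_supp_measurable[OF g] B(2)]
    by simp
  also have "\<dots> \<le> (\<integral>w. f (x - t *\<^sub>R fst w - h) * g (x - t *\<^sub>R snd w) \<partial>M) + \<bar>diffavg t h f g x\<bar>" by simp
  finally have "ennreal (\<integral>w. f (x - t *\<^sub>R fst w) * g (x - t *\<^sub>R snd w) \<partial>M)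
     \<le> ennreal (\<integral>w. f (x - t *\<^sub>R fst w - h) * g (x - t *\<^sub>R snd w) \<partial>M) + ennreal \<bar>diffavg t h f g x\<bar>"
    using f0 g0 by (intro ennreal_le_plusI) (auto intro!: Bochner_Integration.integral_nonneg)
  then show ?thesis using eq[OF f] eq[OF fh] f0 by simp
qed

text \<open>The inequality for one translation is averaged over all \<open>h\<close> in the ball; by
  Fubini the translated functions become the local mean inside the average.\<close>

lemma posavg_le_ball_mean:
  assumes f: "bdd_supp f" and g: "bdd_supp g" and f0: "\<And>x. 0 \<le> f x" and g0: "\<And>x. 0 \<le> g x" and \<delta>: "0 < \<delta>"
  shows "posavg M t (\<lambda>x. ennreal (f x)) (\<lambda>x. ennreal (g x)) x
    \<le> posavg M t (ball_mean \<delta> (\<lambda>x. ennreal (f x))) (\<lambda>x. ennreal (g x)) x + mean_diffavg \<delta> t f g x"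
proof -
  note [measurable] = bdd_supp_measurable[OF f] bdd_supp_measurable[OF g]
  let ?V = "emeasure lborel (cball (0::'a) \<delta>)"
  let ?P = "posavg M t (\<lambda>x. ennreal (f x)) (\<lambda>x. ennreal (g x)) x"
  have V: "?V \<noteq> 0" "?V \<noteq> top" using emeasure_cball_nontrivial[where 'a='a] \<delta> by auto
  have "?P * ?V = (\<integral>\<^sup>+h. ?P * indicator (cball (0::'a) \<delta>) h \<partial>lborel)" by (simp add: nn_integral_cmult_indicator)
  also have "\<dots> \<le> (\<integral>\<^sup>+h. posavg M t (\<lambda>x. ennreal (f (x - h))) (\<lambda>x. ennreal (g x)) x * indicator (cball 0 \<delta>) h
      + ennreal \<bar>diffavg t h f g x\<bar> * indicator (cball 0 \<delta>) h \<partial>lborel)"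
    unfolding distrib_right[symmetric]
    by (intro nn_integral_mono mult_right_mono posavg_le_posavg_translate f g f0 g0) simp
  also have "\<dots> = (\<integral>\<^sup>+h. posavg M t (\<lambda>x. ennreal (f (x - h))) (\<lambda>x. ennreal (g x)) x * indicator (cball 0 \<delta>) h \<partial>lborel)
      + (\<integral>\<^sup>+h. ennreal \<bar>diffavg t h f g x\<bar> * indicator (cball 0 \<delta>) h \<partial>lborel)"
    unfolding posavg_def diffavg_def by (rule nn_integral_add) measurable
  also have "(\<integral>\<^sup>+h. posavg M t (\<lambda>x. ennreal (f (x - h))) (\<lambda>x. ennreal (g x)) x * indicator (cball 0 \<delta>) h \<partial>lborel)
      = (\<integral>\<^sup>+h. (\<integral>\<^sup>+w. ennreal (g (x - t *\<^sub>R snd w)) * (ennreal (f (x - t *\<^sub>R fst w - h)) * indicator (cball 0 \<delta>) h) \<partial>M) \<partial>lborel)"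
    unfolding posavg_def
    by (intro nn_integral_cong, subst nn_integral_multc[symmetric]) (auto simp: mult_ac)
  also have "\<dots> = (\<integral>\<^sup>+w. (\<integral>\<^sup>+h. ennreal (g (x - t *\<^sub>R snd w)) * (ennreal (f (x - t *\<^sub>R fst w - h)) * indicator (cball 0 \<delta>) h) \<partial>lborel) \<partial>M)"
  proof -
    interpret P: pair_sigma_finite lborel M by unfold_locales
    show ?thesis by (rule P.Fubini'[symmetric]) measurable
  qed
  also have "\<dots> = (\<integral>\<^sup>+w. ball_mean \<delta> (\<lambda>x. ennreal (f x)) (x - t *\<^sub>R fst w) * ennreal (g (x - t *\<^sub>R snd w)) * ?V \<partial>M)"
  proof (intro nn_integral_cong)
    fix w
    have "(\<integral>\<^sup>+h. ennreal (g (x - t *\<^sub>R snd w)) * (ennreal (f (x - t *\<^sub>R fst w - h)) * indicator (cball 0 \<delta>) h) \<partial>lborel)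
      = ennreal (g (x - t *\<^sub>R snd w)) * (\<integral>\<^sup>+h. ennreal (f (x - t *\<^sub>R fst w - h)) * indicator (cball 0 \<delta>) h \<partial>lborel)"
      by (rule nn_integral_cmult) measurable
    moreover have "(\<integral>\<^sup>+h. ennreal (f (x - t *\<^sub>R fst w - h)) * indicator (cball 0 \<delta>) h \<partial>lborel)
       = ball_mean \<delta> (\<lambda>x. ennreal (f x)) (x - t *\<^sub>R fst w) * ?V"
      unfolding ball_mean_def using V by (simp add: ennreal_divide_times ennreal_divide_self less_top)
    ultimately show "(\<integral>\<^sup>+h. ennreal (g (x - t *\<^sub>R snd w)) * (ennreal (f (x - t *\<^sub>R fst w - h)) * indicator (cball 0 \<delta>) h) \<partial>lborel)
      = ball_mean \<delta> (\<lambda>x. ennreal (f x)) (x - t *\<^sub>R fst w) * ennreal (g (x - t *\<^sub>R snd w)) * ?V"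
      by (simp only: mult_ac)
  qed
  also have "\<dots> = posavg M t (ball_mean \<delta> (\<lambda>x. ennreal (f x))) (\<lambda>x. ennreal (g x)) x * ?V"
    unfolding posavg_def by (rule nn_integral_multc) measurable
  also have "(\<integral>\<^sup>+h. ennreal \<bar>diffavg t h f g x\<bar> * indicator (cball 0 \<delta>) h \<partial>lborel) = mean_diffavg \<delta> t f g x * ?V"
    unfolding mean_diffavg_def using V by (simp add: ennreal_divide_times ennreal_divide_self less_top)
  finally have "?P * ?V \<le> (posavg M t (ball_mean \<delta> (\<lambda>x. ennreal (f x))) (\<lambda>x. ennreal (g x)) x + mean_diffavg \<delta> t f g x) * ?V"
    by (simp only: distrib_right)
  then show ?thesis using V by (simp only: mult.commute[of _ ?V] ennreal_mult_le_mult_iff less_top simp_thms)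
qed

text \<open>Chebyshev's inequality in \<open>L^2\<close>: where the mean of the absolute differences
  exceeds \<open>s\<close>, the mean of their squares reaches at least the square of
  \<open>s\<close>. The square integral is known for each \<open>h\<close> of length at most
  \<open>\<delta>\<close>.\<close>

lemma mean_diffavg_weak:
  assumes f: "bdd_supp f" and g: "bdd_supp g" and gB: "\<And>x. \<bar>g x\<bar> \<le> B"
    and \<delta>: "0 < \<delta>" and t: "0 < t" and N: "0 < N" and s: "0 < s"
  shows "emeasure lborel {x. ennreal s < mean_diffavg \<delta> t f g x}
    \<le> ennreal (1 / s\<^sup>2 * (smoothing_const * B\<^sup>2 * (1 / real N + real N * \<delta> / t) * (\<integral>x. (f x)\<^sup>2 \<partial>lborel)))"
proof -
  note [measurable] = bdd_supp_measurable[OF f] bdd_supp_measurable[OF g]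
  let ?V = "emeasure lborel (cball (0::'a) \<delta>)"
  have V: "?V \<noteq> 0" "?V \<noteq> top" using emeasure_cball_nontrivial[where 'a='a] \<delta> by auto
  define v where "v = enn2real ?V"
  have v: "?V = ennreal v" "0 < v" using V unfolding v_def by (auto simp: less_top enn2real_positive_iff zero_less_iff_neq_zero)
  let ?D = "\<lambda>h x. diffavg t h f g x"
  let ?Q = "\<lambda>x. \<integral>\<^sup>+h. ennreal ((?D h x)\<^sup>2) * indicator (cball 0 \<delta>) h \<partial>lborel"
  define c where "c = smoothing_const * B\<^sup>2 * (1 / real N + real N * \<delta> / t) * (\<integral>x. (f x)\<^sup>2 \<partial>lborel)"
  have c0: "0 \<le> c" unfolding c_def using smoothing_const_nonneg \<delta> t by simp
  have sub: "{x. ennreal s < mean_diffavg \<delta> t f g x} \<subseteq> {x \<in> space lborel. 1 \<le> ennreal (1 / (s\<^sup>2 * v)) * ?Q x}"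
  proof (intro subsetI, rule ccontr)
    fix x assume x: "x \<in> {x. ennreal s < mean_diffavg \<delta> t f g x}" and nx: "x \<notin> {x \<in> space lborel. 1 \<le> ennreal (1 / (s\<^sup>2 * v)) * ?Q x}"
    have "?Q x \<le> ennreal (s\<^sup>2 * v)"
    proof (rule ccontr)
      assume "\<not> ?Q x \<le> ennreal (s\<^sup>2 * v)"
      then have "ennreal (1 / (s\<^sup>2 * v)) * ennreal (s\<^sup>2 * v) \<le> ennreal (1 / (s\<^sup>2 * v)) * ?Q x" by (intro mult_left_mono) auto
      then show False using nx s v(2) by (simp add: ennreal_mult[symmetric])
    qed
    have "(\<integral>\<^sup>+h. ennreal \<bar>?D h x\<bar> * indicator (cball 0 \<delta>) h \<partial>lborel)
       \<le> (\<integral>\<^sup>+h. ennreal (s / 2) * indicator (cball 0 \<delta>) h + ennreal (1 / (2 * s)) * (ennreal ((?D h x)\<^sup>2) * indicator (cball 0 \<delta>) h) \<partial>lborel)"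
    proof (intro nn_integral_mono)
      fix h
      \<comment> \<open>This gives \<open>\<bar>D\<bar> \<le> s / 2 + D^2 / (2 * s)\<close>, which
        plays the role of Cauchy-Schwarz over the ball: a mean square of at most \<open>s^2\<close>
        forces a mean of at most \<open>s\<close>.\<close>
      have "0 \<le> (\<bar>?D h x\<bar> - s)\<^sup>2" by simp
      then have "2 * s * \<bar>?D h x\<bar> \<le> s\<^sup>2 + (?D h x)\<^sup>2" by (simp add: power2_diff mult_ac)
      then have "\<bar>?D h x\<bar> \<le> s / 2 + 1 / (2 * s) * (?D h x)\<^sup>2" using s by (simp add: field_simps power2_eq_square)
      then have "ennreal \<bar>?D h x\<bar> \<le> ennreal (s / 2) + ennreal (1 / (2 * s)) * ennreal ((?D h x)\<^sup>2)"
        using s by (subst ennreal_mult[symmetric], simp, simp) (intro ennreal_le_plusI, auto)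
      then show "ennreal \<bar>?D h x\<bar> * indicator (cball 0 \<delta>) h
        \<le> ennreal (s / 2) * indicator (cball 0 \<delta>) h + ennreal (1 / (2 * s)) * (ennreal ((?D h x)\<^sup>2) * indicator (cball 0 \<delta>) h)"
        by (auto simp: indicator_def)
    qed
    also have "\<dots> = (\<integral>\<^sup>+h. ennreal (s / 2) * indicator (cball (0::'a) \<delta>) h \<partial>lborel) + (\<integral>\<^sup>+h. ennreal (1 / (2 * s)) * (ennreal ((?D h x)\<^sup>2) * indicator (cball 0 \<delta>) h) \<partial>lborel)"
      unfolding diffavg_def by (rule nn_integral_add) measurable
    also have "(\<integral>\<^sup>+h. ennreal (s / 2) * indicator (cball (0::'a) \<delta>) h \<partial>lborel) = ennreal (s / 2) * ?V"
      by (simp add: nn_integral_cmult_indicator)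
    also have "(\<integral>\<^sup>+h. ennreal (1 / (2 * s)) * (ennreal ((?D h x)\<^sup>2) * indicator (cball 0 \<delta>) h) \<partial>lborel) = ennreal (1 / (2 * s)) * ?Q x"
      unfolding diffavg_def by (rule nn_integral_cmult) measurable
    also have "ennreal (s / 2) * ?V + ennreal (1 / (2 * s)) * ?Q x \<le> ennreal (s / 2) * ?V + ennreal (1 / (2 * s)) * ennreal (s\<^sup>2 * v)"
      by (intro add_left_mono mult_left_mono) (use \<open>?Q x \<le> ennreal (s\<^sup>2 * v)\<close> in auto)
    also have "\<dots> = ennreal (s / 2 * v + 1 / (2 * s) * (s\<^sup>2 * v))"
      unfolding v using s v(2) by (simp add: ennreal_mult[symmetric] ennreal_plus[symmetric] del: ennreal_plus)
    also have "s / 2 * v + 1 / (2 * s) * (s\<^sup>2 * v) = s * v" using s by (simp add: power2_eq_square)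
    also have "ennreal (s * v) = ennreal s * ?V" unfolding v using s v(2) by (simp add: ennreal_mult)
    finally have "mean_diffavg \<delta> t f g x \<le> ennreal s" unfolding mean_diffavg_def using V by (simp add: ennreal_divide_le_iff)
    with x show False by simp
  qed
  have Qm: "?Q \<in> borel_measurable lborel" unfolding diffavg_def by measurable
  have "emeasure lborel {x. ennreal s < mean_diffavg \<delta> t f g x} \<le> emeasure lborel {x \<in> space lborel. 1 \<le> ennreal (1 / (s\<^sup>2 * v)) * ?Q x}"
    by (rule emeasure_mono[OF sub]) (use Qm in measurable)
  also have "\<dots> \<le> ennreal (1 / (s\<^sup>2 * v)) * (\<integral>\<^sup>+x. ?Q x \<partial>lborel)"
    using nn_integral_Markov_inequality[of ?Q UNIV lborel "ennreal (1 / (s\<^sup>2 * v))"] Qm by simp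
  also have "(\<integral>\<^sup>+x. ?Q x \<partial>lborel) = (\<integral>\<^sup>+h. (\<integral>\<^sup>+x. ennreal ((?D h x)\<^sup>2) * indicator (cball 0 \<delta>) h \<partial>lborel) \<partial>lborel)"
    unfolding diffavg_def by (rule lborel_pair.Fubini') measurable
  also have "ennreal (1 / (s\<^sup>2 * v)) * \<dots> \<le> ennreal (1 / (s\<^sup>2 * v)) * (\<integral>\<^sup>+h. ennreal c * indicator (cball (0::'a) \<delta>) h \<partial>lborel)"
  proof (rule mult_left_mono[OF nn_integral_mono])
    fix h :: 'a
    have "(\<integral>\<^sup>+x. ennreal ((?D h x)\<^sup>2) \<partial>lborel) \<le> ennreal c" if h: "norm h \<le> \<delta>"
    proof -
      have "(\<integral>\<^sup>+x. ennreal ((?D h x)\<^sup>2) \<partial>lborel) \<le> ennreal (smoothing_const * B\<^sup>2 * (1 / real N + real N * norm h / t) * (\<integral>x. (f x)\<^sup>2 \<partial>lborel))"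
        by (rule nn_integral_diffavg_square_le[OF f bdd_supp_measurable[OF g] gB t N])
      also have "\<dots> \<le> ennreal c" unfolding c_def
        by (intro ennreal_leI mult_right_mono mult_left_mono add_left_mono divide_right_mono) (use h t smoothing_const_nonneg in auto)
      finally show ?thesis .
    qed
    then show "(\<integral>\<^sup>+x. ennreal ((?D h x)\<^sup>2) * indicator (cball 0 \<delta>) h \<partial>lborel) \<le> ennreal c * indicator (cball 0 \<delta>) h"
      by (cases "norm h \<le> \<delta>") auto
  qed simp
  also have "\<dots> = ennreal (1 / (s\<^sup>2 * v)) * (ennreal c * ennreal v)" by (simp add: nn_integral_cmult_indicator v)
  also have "\<dots> = ennreal (1 / (s\<^sup>2 * v) * (c * v))" using c0 v(2) by (simp only: ennreal_mult[symmetric] less_imp_le mult_nonneg_nonneg divide_nonneg_nonneg zero_le_one zero_le_power2)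
  also have "1 / (s\<^sup>2 * v) * (c * v) = 1 / s\<^sup>2 * c" using v(2) by simp
  finally show ?thesis unfolding c_def .
qed

end

section \<open>Layers and level sets\<close>

text \<open>The assumption \<open>weak\<close> is the single-scale bound after Chebyshev and Young,
  uniform in the scale \<open>t\<close>; \<open>\<gamma>\<close> will be \<open>q0 / p0\<close>. The
  decay rate \<open>\<kappa>\<close> is tied to \<open>r0 + 2\<close>: a threshold
  \<open>2 powr (- (\<kappa> * m))\<close> loses \<open>\<kappa> * r0\<close> in the exponent, and
  \<open>2 * \<kappa>\<close> must be left over for summation. The four bounds on
  \<open>\<kappa>\<close> correspond to the two terms of \<open>weak\<close> in each of the two
  cases in which one function is large.\<close>

locale scale_average = averaging_measure M K
  for M :: "('a::euclidean_space \<times> 'a) measure" and K :: real +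
  fixes B p0 q0 r0 \<gamma> p1 q1 \<kappa> :: real
  assumes pos: "0 \<le> B" "0 < p0" "p0 < p1" "0 < q0" "q0 < q1" "0 < r0" "0 < \<gamma>" "0 < \<kappa>" "\<kappa> \<le> 1 / 32"
    and \<kappa>_le: "\<kappa> * (r0 + 2) \<le> (p1 - p0) / 64" "\<kappa> * (r0 + 2) \<le> \<gamma> * (p1 - p0) / 64"
      "\<kappa> * (r0 + 2) \<le> (q1 - q0) / (64 * \<gamma>)" "\<kappa> * (r0 + 2) \<le> (q1 - q0) / 64"
    and weak: "\<And>t c \<sigma> f g. 0 < t \<Longrightarrow> 0 < c \<Longrightarrow> 0 < \<sigma> \<Longrightarrow> bdd_supp f \<Longrightarrow> bdd_supp g \<Longrightarrow>
      (\<And>x. 0 \<le> f x) \<Longrightarrow> (\<And>x. 0 \<le> g x) \<Longrightarrow>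
      emeasure lborel {x. ennreal c < posavg M t (\<lambda>x. ennreal (f x)) (\<lambda>x. ennreal (g x)) x}
        \<le> ennreal (B * c powr (- r0)) * (ennreal \<sigma> * (\<integral>\<^sup>+x. ennreal (f x powr p0) \<partial>lborel)
            + ennreal (\<sigma> powr (- \<gamma>)) * (\<integral>\<^sup>+x. ennreal (g x powr q0) \<partial>lborel))"
begin

text \<open>The bookkeeping of exponents: the loss \<open>\<kappa> * r0\<close> from the threshold
  against the gain \<open>\<kappa> * (r0 + 2)\<close> in both terms.\<close>

lemma weak_geometric:
  fixes m :: nat
  assumes "X \<le> ennreal (2 powr (- (\<kappa> * (r0 + 2) * m))) * X'" "Y \<le> ennreal (2 powr (- (\<kappa> * (r0 + 2) * m))) * Y'"
  shows "ennreal (B * (2 powr (- (\<kappa> * m))) powr (- r0)) * (X + Y) \<le> ennreal (B * 2 powr (- (2 * \<kappa> * m))) * (X' + Y')"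
proof -
  have "(2 powr (- (\<kappa> * m))) powr (- r0) * 2 powr (- (\<kappa> * (r0 + 2) * m)) = 2 powr (- (2 * \<kappa> * m))"
    by (simp add: powr_powr powr_add[symmetric] algebra_simps)
  then have e: "B * (2 powr (- (\<kappa> * m))) powr (- r0) * 2 powr (- (\<kappa> * (r0 + 2) * m)) = B * 2 powr (- (2 * \<kappa> * m))"
    by (simp add: mult.assoc)
  have "ennreal (B * (2 powr (- (\<kappa> * m))) powr (- r0)) * (X + Y)
     \<le> ennreal (B * (2 powr (- (\<kappa> * m))) powr (- r0)) * (ennreal (2 powr (- (\<kappa> * (r0 + 2) * m))) * X' + ennreal (2 powr (- (\<kappa> * (r0 + 2) * m))) * Y')"
    by (intro mult_left_mono add_mono assms) simp
  also have "\<dots> = ennreal (B * (2 powr (- (\<kappa> * m))) powr (- r0)) * ennreal (2 powr (- (\<kappa> * (r0 + 2) * m))) * (X' + Y')"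
    by (simp only: distrib_left mult.assoc)
  also have "ennreal (B * (2 powr (- (\<kappa> * m))) powr (- r0)) * ennreal (2 powr (- (\<kappa> * (r0 + 2) * m))) = ennreal (B * 2 powr (- (2 * \<kappa> * m)))"
    unfolding e[symmetric] using pos by (intro ennreal_mult[symmetric]) auto
  finally show ?thesis .
qed

text \<open>Where \<open>f\<close> is not zero it exceeds \<open>2 powr (m / 32)\<close>, so raising
  the exponent from \<open>s\<close> to \<open>s'\<close> gains
  \<open>2 powr ((s' - s) * m / 32)\<close>. Half of this pays for the weight on the left, the other
  half yields the decay; hence the 64.\<close>

lemma large_values_gain:
  fixes m :: nat and f :: "'a \<Rightarrow> real" and s s' :: real
  assumes [measurable]: "f \<in> borel_measurable borel" and f0: "\<And>x. 0 \<le> f x" and large: "\<And>x. f x \<noteq> 0 \<Longrightarrow> 2 powr (m / 32) < f x"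
    and s: "0 < s" "s < s'" and k: "\<kappa> * (r0 + 2) \<le> (s' - s) / 64"
  shows "ennreal (2 powr ((s' - s) * m / 64)) * (\<integral>\<^sup>+x. ennreal (f x powr s) \<partial>lborel)
    \<le> ennreal (2 powr (- (\<kappa> * (r0 + 2) * m))) * (\<integral>\<^sup>+x. ennreal (f x powr s') \<partial>lborel)"
proof -
  have "2 powr ((s' - s) * m / 64) * f x powr s \<le> 2 powr (- (\<kappa> * (r0 + 2) * m)) * f x powr s'" for x
  proof (cases "f x = 0")
    case False
    have "(2 powr (m / 32)) powr (s' - s) \<le> f x powr (s' - s)"
      using large[OF False] s by (intro powr_mono2) auto
    then have a: "2 powr ((s' - s) * m / 32) \<le> f x powr (s' - s)" by (simp add: powr_powr mult.commute)
    have "\<kappa> * (r0 + 2) * m \<le> (s' - s) / 64 * m" using k by (intro mult_right_mono) auto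
    then have "2 powr (- ((s' - s) / 64 * m)) \<le> 2 powr (- (\<kappa> * (r0 + 2) * m))" by simp
    then have "2 powr (- ((s' - s) / 64 * m)) * 2 powr ((s' - s) * m / 32) \<le> 2 powr (- (\<kappa> * (r0 + 2) * m)) * f x powr (s' - s)"
      using a by (intro mult_mono) auto
    then have "2 powr ((s' - s) * m / 64) * f x powr s \<le> 2 powr (- (\<kappa> * (r0 + 2) * m)) * f x powr (s' - s) * f x powr s"
      by (intro mult_right_mono) (auto simp: powr_add[symmetric] mult.commute[of "real m"])
    also have "\<dots> = 2 powr (- (\<kappa> * (r0 + 2) * m)) * f x powr s'"
      by (simp add: mult.assoc powr_add[symmetric])
    finally show ?thesis .
  qed simp
  then have "(\<integral>\<^sup>+x. ennreal (2 powr ((s' - s) * m / 64)) * ennreal (f x powr s) \<partial>lborel)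
     \<le> (\<integral>\<^sup>+x. ennreal (2 powr (- (\<kappa> * (r0 + 2) * m))) * ennreal (f x powr s') \<partial>lborel)"
    by (intro nn_integral_mono) (auto simp: ennreal_mult[symmetric] intro!: ennreal_leI)
  then show ?thesis by (simp add: nn_integral_cmult)
qed

text \<open>The weight \<open>\<sigma> = 2 powr ((p1 - p0) * m / 64)\<close> grows with
  \<open>m\<close>. The large values of \<open>f\<close> can afford it, and its power
  \<open>- \<gamma>\<close> supplies the decay in the term with \<open>g\<close>, which has no gain
  of its own.\<close>

lemma weak_large_left:
  fixes m :: nat
  assumes f: "bdd_supp f" and g: "bdd_supp g" and f0: "\<And>x. 0 \<le> f x" and g0: "\<And>x. 0 \<le> g x"
    and large: "\<And>x. f x \<noteq> 0 \<Longrightarrow> 2 powr (m / 32) < f x" and t: "0 < t"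
  shows "emeasure lborel {x. ennreal (2 powr (- (\<kappa> * m))) < posavg M t (\<lambda>x. ennreal (f x)) (\<lambda>x. ennreal (g x)) x}
     \<le> ennreal (B * 2 powr (- (2 * \<kappa> * m))) * ((\<integral>\<^sup>+x. ennreal (f x powr p1) \<partial>lborel) + (\<integral>\<^sup>+x. ennreal (g x powr q0) \<partial>lborel))"
proof (rule order_trans[OF weak[of t "2 powr (- (\<kappa> * m))" "2 powr ((p1 - p0) * m / 64)" f g] weak_geometric])
  show "ennreal (2 powr ((p1 - p0) * m / 64)) * (\<integral>\<^sup>+x. ennreal (f x powr p0) \<partial>lborel)
    \<le> ennreal (2 powr (- (\<kappa> * (r0 + 2) * m))) * (\<integral>\<^sup>+x. ennreal (f x powr p1) \<partial>lborel)"
    using bdd_supp_measurable[OF f] f0 large pos \<kappa>_le by (intro large_values_gain) auto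
  have "\<kappa> * (r0 + 2) * m \<le> \<gamma> * (p1 - p0) / 64 * m" using \<kappa>_le by (intro mult_right_mono) auto
  then show "ennreal ((2 powr ((p1 - p0) * m / 64)) powr - \<gamma>) * (\<integral>\<^sup>+x. ennreal (g x powr q0) \<partial>lborel)
    \<le> ennreal (2 powr (- (\<kappa> * (r0 + 2) * m))) * (\<integral>\<^sup>+x. ennreal (g x powr q0) \<partial>lborel)"
    by (intro mult_right_mono ennreal_leI) (auto simp: powr_powr mult_ac)
qed (use f g f0 g0 t in auto)

text \<open>Mirror image of the previous case: now \<open>\<sigma>\<close> decays, which serves the
  term with \<open>f\<close>, and \<open>\<sigma> powr (- \<gamma>)\<close> grows, which the large
  values of \<open>g\<close> absorb.\<close>

lemma weak_large_right:
  fixes m :: nat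
  assumes f: "bdd_supp f" and g: "bdd_supp g" and f0: "\<And>x. 0 \<le> f x" and g0: "\<And>x. 0 \<le> g x"
    and large: "\<And>x. g x \<noteq> 0 \<Longrightarrow> 2 powr (m / 32) < g x" and t: "0 < t"
  shows "emeasure lborel {x. ennreal (2 powr (- (\<kappa> * m))) < posavg M t (\<lambda>x. ennreal (f x)) (\<lambda>x. ennreal (g x)) x}
     \<le> ennreal (B * 2 powr (- (2 * \<kappa> * m))) * ((\<integral>\<^sup>+x. ennreal (f x powr p0) \<partial>lborel) + (\<integral>\<^sup>+x. ennreal (g x powr q1) \<partial>lborel))"
proof (rule order_trans[OF weak[of t "2 powr (- (\<kappa> * m))" "2 powr (- ((q1 - q0) * m / (64 * \<gamma>)))" f g] weak_geometric])
  have "(2 powr (- ((q1 - q0) * m / (64 * \<gamma>)))) powr (- \<gamma>) = 2 powr ((q1 - q0) * m / 64)"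
    using pos by (simp add: powr_powr)
  then show "ennreal ((2 powr (- ((q1 - q0) * m / (64 * \<gamma>)))) powr - \<gamma>) * (\<integral>\<^sup>+x. ennreal (g x powr q0) \<partial>lborel)
    \<le> ennreal (2 powr (- (\<kappa> * (r0 + 2) * m))) * (\<integral>\<^sup>+x. ennreal (g x powr q1) \<partial>lborel)"
    using bdd_supp_measurable[OF g] g0 large pos \<kappa>_le by (simp only:) (intro large_values_gain, auto)
  have "\<kappa> * (r0 + 2) * m \<le> (q1 - q0) / (64 * \<gamma>) * m" using \<kappa>_le by (intro mult_right_mono) auto
  then show "ennreal (2 powr (- ((q1 - q0) * m / (64 * \<gamma>)))) * (\<integral>\<^sup>+x. ennreal (f x powr p0) \<partial>lborel)
    \<le> ennreal (2 powr (- (\<kappa> * (r0 + 2) * m))) * (\<integral>\<^sup>+x. ennreal (f x powr p0) \<partial>lborel)"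
    by (intro mult_right_mono ennreal_leI) auto
qed (use f g f0 g0 t in auto)

end

text \<open>The truncation height costs \<open>2 powr (m / 16)\<close> twice, once for the square of
  \<open>f\<close> and once for the square of the bound of \<open>g\<close>, and the threshold costs
  \<open>2 powr (2 * \<kappa> * m)\<close>, where \<open>m = j + k\<close>. Smoothing at the
  relative scale \<open>2 powr (- j)\<close> gains \<open>2 powr (- j / 2)\<close>. Since
  \<open>k \<le> j\<close>, this is at most \<open>2 powr (- m / 4)\<close>, and
  \<open>\<kappa> \<le> 1 / 32\<close> is exactly what leaves the decay
  \<open>2 powr (- (2 * \<kappa> * m))\<close>.\<close>

lemma (in averaging_measure) weak_small:
  fixes j k :: nat and \<kappa> :: real
  assumes f: "bdd_supp f" and g: "bdd_supp g" and f0: "\<And>x. 0 \<le> f x" and g0: "\<And>x. 0 \<le> g x"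
    and fm: "\<And>x. f x \<le> 2 powr (real (j + k) / 32)" and gm: "\<And>x. g x \<le> 2 powr (real (j + k) / 32)"
    and t: "0 < t" and jk: "k \<le> j" and \<kappa>: "\<kappa> \<le> 1 / 32"
  shows "emeasure lborel {x. ennreal (2 powr (- (\<kappa> * real (j + k)))) < mean_diffavg (t * 2 powr (- real j)) t f g x}
     \<le> ennreal (3 * smoothing_const * 2 powr (- (2 * \<kappa> * real (j + k)))) * emeasure lborel {x. f x \<noteq> 0}"
proof -
  define m where "m = real (j + k)"
  note [measurable] = bdd_supp_measurable[OF f] bdd_supp_measurable[OF g]
  define A where "A = measure lborel {x. f x \<noteq> 0}"
  obtain R where R: "\<And>x. R < norm x \<Longrightarrow> f x = 0" using f by (auto simp: bdd_supp_def)
  have Am: "{x. f x \<noteq> 0} \<in> sets borel" by measurable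
  have "bounded {x. f x \<noteq> 0}" by (rule boundedI[where B=R]) (use R in \<open>auto simp: not_less[symmetric]\<close>)
  then have Afin: "emeasure lborel {x. f x \<noteq> 0} < \<infinity>" using emeasure_bounded_finite by blast
  then have A: "emeasure lborel {x. f x \<noteq> 0} = ennreal A" unfolding A_def by (intro emeasure_eq_ennreal_measure) auto
  have A0: "0 \<le> A" by (simp add: A_def)
  \<comment> \<open>The number of reflections balances \<open>1 / N\<close> against
    \<open>N * 2 powr (- j)\<close>; both become about \<open>2 powr (- j / 2)\<close>. Rounding
    \<open>j / 2\<close> down accounts for the factor 2 in the first bound, hence for the 3 in the
    sum.\<close>
  define N :: nat where "N = 2 ^ (j div 2)"
  have N2: "real N = 2 powr real (j div 2)" by (simp add: N_def powr_realpow)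
  have Nlo: "1 / real N \<le> 2 * 2 powr (- j / 2)"
  proof -
    have "1 / real N = 2 powr (- real (j div 2))" unfolding N2 by (simp add: powr_minus_divide)
    also have "\<dots> \<le> 2 powr (1 - j / 2)" by (intro powr_mono) linarith+
    also have "\<dots> = 2 * 2 powr (- j / 2)" using powr_add[of 2 1 "- j / 2"] by simp
    finally show ?thesis .
  qed
  have Nhi: "real N * 2 powr (- real j) \<le> 2 powr (- j / 2)"
  proof -
    have "real N * 2 powr (- real j) = 2 powr (real (j div 2) - j)" unfolding N2 by (simp add: powr_add[symmetric])
    also have "\<dots> \<le> 2 powr (- j / 2)" by (intro powr_mono) linarith+
    finally show ?thesis .
  qed
  have int: "(\<integral>x. (f x)\<^sup>2 \<partial>lborel) \<le> 2 powr (m / 16) * A"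
  proof -
    have "(\<integral>x. (f x)\<^sup>2 \<partial>lborel) \<le> (\<integral>x. 2 powr (m / 16) * indicator {x. f x \<noteq> 0} x \<partial>lborel)"
    proof (rule integral_mono)
      show "integrable lborel (\<lambda>x. (f x)\<^sup>2)" unfolding power2_eq_square by (intro bdd_supp_integrable bdd_supp_mult f)
      show "integrable lborel (\<lambda>x. 2 powr (m / 16) * indicator {x. f x \<noteq> 0} x)"
        using Afin Am by (intro integrable_mult_right integrable_real_indicator) auto
      fix x
      have "(f x)\<^sup>2 \<le> (2 powr (m / 32))\<^sup>2" using fm[of x] f0[of x] unfolding m_def by (intro power_mono) auto
      also have "\<dots> = 2 powr (m / 16)" by (simp add: power2_eq_square powr_add[symmetric])
      finally show "(f x)\<^sup>2 \<le> 2 powr (m / 16) * indicator {x. f x \<noteq> 0} x" by (auto simp: indicator_def)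
    qed
    also have "\<dots> = 2 powr (m / 16) * A" using Am by (simp add: A_def)
    finally show ?thesis .
  qed
  have gB: "\<bar>g x\<bar> \<le> 2 powr (m / 32)" for x using gm[of x] g0[of x] by (simp add: m_def)
  have "emeasure lborel {x. ennreal (2 powr (- (\<kappa> * m))) < mean_diffavg (t * 2 powr (- real j)) t f g x}
    \<le> ennreal (1 / (2 powr (- (\<kappa> * m)))\<^sup>2 * (smoothing_const * (2 powr (m / 32))\<^sup>2 * (1 / real N + real N * (t * 2 powr (- real j)) / t) * (\<integral>x. (f x)\<^sup>2 \<partial>lborel)))"
    by (rule mean_diffavg_weak[OF f g gB]) (use t in \<open>auto simp: N_def\<close>)
  also have "\<dots> \<le> ennreal (3 * smoothing_const * 2 powr (- (2 * \<kappa> * m)) * A)"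
  proof (rule ennreal_leI)
    have e: "1 / (2 powr (- (\<kappa> * m)))\<^sup>2 = 2 powr (2 * \<kappa> * m)"
    proof -
      have "(2 powr (- (\<kappa> * m)))\<^sup>2 = 2 powr (- (2 * \<kappa> * m))" by (simp add: power2_eq_square powr_add[symmetric] mult.assoc)
      then show ?thesis by (simp add: powr_minus_divide)
    qed
    have e2: "(2 powr (m / 32))\<^sup>2 = 2 powr (m / 16)" by (simp add: power2_eq_square powr_add[symmetric])
    have "1 / real N + real N * (t * 2 powr (- real j)) / t \<le> 3 * 2 powr (- j / 2)"
      using Nlo Nhi t by simp
    then have "smoothing_const * 2 powr (m / 16) * (1 / real N + real N * (t * 2 powr (- real j)) / t) * (\<integral>x. (f x)\<^sup>2 \<partial>lborel)
      \<le> smoothing_const * 2 powr (m / 16) * (3 * 2 powr (- j / 2)) * (2 powr (m / 16) * A)"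
      using int smoothing_const_nonneg t by (intro mult_mono) auto
    then have "1 / (2 powr (- (\<kappa> * m)))\<^sup>2 * (smoothing_const * (2 powr (m / 32))\<^sup>2 * (1 / real N + real N * (t * 2 powr (- real j)) / t) * (\<integral>x. (f x)\<^sup>2 \<partial>lborel))
      \<le> 2 powr (2 * \<kappa> * m) * (smoothing_const * 2 powr (m / 16) * (3 * 2 powr (- j / 2)) * (2 powr (m / 16) * A))"
      unfolding e e2 by (intro mult_left_mono) auto
    also have "\<dots> = 3 * smoothing_const * 2 powr (2 * \<kappa> * m + m / 16 + - j / 2 + m / 16) * A"
      by (simp only: powr_add mult_ac)
    also have "\<dots> \<le> 3 * smoothing_const * 2 powr (- (2 * \<kappa> * m)) * A"
    proof -
      have "m \<le> 2 * j" using jk by (simp add: m_def)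
      moreover have "4 * \<kappa> * m \<le> 4 * (1 / 32) * m" using \<kappa> by (intro mult_right_mono) (auto simp: m_def)
      ultimately have "2 * \<kappa> * m + m / 16 + - j / 2 + m / 16 \<le> - (2 * \<kappa> * m)" by simp
      then show ?thesis using smoothing_const_nonneg A0 by (intro mult_right_mono mult_left_mono powr_mono) auto
    qed
    finally show "1 / (2 powr (- (\<kappa> * m)))\<^sup>2 * (smoothing_const * (2 powr (m / 32))\<^sup>2 * (1 / real N + real N * (t * 2 powr (- real j)) / t) * (\<integral>x. (f x)\<^sup>2 \<partial>lborel))
      \<le> 3 * smoothing_const * 2 powr (- (2 * \<kappa> * m)) * A" .
  qed
  also have "\<dots> = ennreal (3 * smoothing_const * 2 powr (- (2 * \<kappa> * m))) * emeasure lborel {x. f x \<noteq> 0}"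
    unfolding A using smoothing_const_nonneg A0 by (intro ennreal_mult) auto
  finally show ?thesis unfolding m_def .
qed

text \<open>Dyadic shells by the distance to the complement. The factors 4 and 8 leave room: a ball
  of radius \<open>2 powr (- m)\<close> that meets the layer has its centre at distance between 3
  and 9 times that radius from the complement. For \<open>\<Omega> = UNIV\<close> the distance to
  the empty set is 0 by convention and all layers are empty.\<close>

definition layer :: "'a::metric_space set \<Rightarrow> int \<Rightarrow> 'a set" where
  "layer \<Omega> m = {x. 4 * 2 powr (- real_of_int m) \<le> infdist x (- \<Omega>) \<and> infdist x (- \<Omega>) < 8 * 2 powr (- real_of_int m)}"

lemma layer_in_sets [measurable]: "layer (\<Omega> :: 'a::metric_space set) m \<in> sets borel"
proof -
  have [measurable]: "(\<lambda>x. infdist x (- \<Omega>)) \<in> borel_measurable borel"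
    by (intro borel_measurable_continuous_onI continuous_intros)
  have "layer \<Omega> m = {x \<in> space borel. 4 * 2 powr (- real_of_int m) \<le> infdist x (- \<Omega>) \<and> infdist x (- \<Omega>) < 8 * 2 powr (- real_of_int m)}"
    by (simp add: layer_def)
  also have "\<dots> \<in> sets borel" by measurable
  finally show ?thesis .
qed

lemma layer_disjoint: "x \<in> layer \<Omega> m \<Longrightarrow> x \<in> layer \<Omega> m' \<Longrightarrow> m = m'"
proof -
  have *: "m \<le> m'" if "x \<in> layer \<Omega> m" "x \<in> layer \<Omega> m'" for m m'
  proof -
    have "4 * 2 powr (- real_of_int m') < 8 * 2 powr (- real_of_int m)" using that by (auto simp: layer_def)
    also have "8 * 2 powr (- real_of_int m) = 4 * 2 powr (1 - real_of_int m)"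
      using powr_add[of 2 1 "- real_of_int m"] by simp
    finally have "- real_of_int m' < 1 - real_of_int m" by simp
    then show ?thesis by linarith
  qed
  assume "x \<in> layer \<Omega> m" "x \<in> layer \<Omega> m'"
  then show ?thesis using *[of m m'] *[of m' m] by simp
qed

lemma layer_subset: "layer \<Omega> m \<subseteq> \<Omega>"
proof
  fix x assume "x \<in> layer \<Omega> m"
  then have "infdist x (- \<Omega>) > 0" unfolding layer_def using powr_gt_zero[of 2 "- real_of_int m"] by auto
  then show "x \<in> \<Omega>" using infdist_zero[of x "- \<Omega>"] by (cases "x \<in> \<Omega>") auto
qed

lemma ex_layer:
  assumes "open \<Omega>" "- \<Omega> \<noteq> {}" "x \<in> \<Omega>"
  shows "\<exists>m. x \<in> layer \<Omega> m"
proof -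
  define d where "d = infdist x (- \<Omega>)"
  have d: "0 < d" unfolding d_def using assms by (intro infdist_pos_not_in_closed) (auto simp: closed_Compl)
  define m where "m = \<lceil>2 - log 2 d\<rceil>"
  have m: "2 - log 2 d \<le> m" "m < 3 - log 2 d" unfolding m_def by linarith+
  have dd: "2 powr (log 2 d) = d" using d by simp
  have "2 powr (2 - real_of_int m) \<le> 2 powr (log 2 d)" using m by (intro powr_mono) auto
  then have 1: "4 * 2 powr (- real_of_int m) \<le> d" using powr_add[of 2 2 "- real_of_int m"] dd by simp
  have "2 powr (log 2 d) < 2 powr (3 - real_of_int m)" using m by (intro powr_less_mono) auto
  then have 2: "d < 8 * 2 powr (- real_of_int m)" using powr_add[of 2 3 "- real_of_int m"] dd by simp
  from 1 2 show ?thesis unfolding layer_def d_def by blast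
qed

text \<open>From a point outside \<open>\<Omega>\<close>, displacements of length at most
  \<open>2 powr (- l)\<close> reach only points within that distance of the complement, that is
  layers no coarser than \<open>l\<close>. Hence \<open>j\<close> is a natural number and the double
  series is one-sided.\<close>

lemma ex_layer_near:
  assumes "open \<Omega>" "x \<notin> \<Omega>" "y \<in> \<Omega>" "dist x y \<le> 2 powr (- real_of_int l)"
  shows "\<exists>j::nat. y \<in> layer \<Omega> (l + int j)"
proof -
  obtain m where m: "y \<in> layer \<Omega> m" using ex_layer[of \<Omega> y] assms by blast
  have "infdist y (- \<Omega>) \<le> dist y x" using assms by (intro infdist_le) auto
  then have "4 * 2 powr (- real_of_int m) \<le> 2 powr (- real_of_int l)" using m assms(4) by (simp add: layer_def dist_commute)
  moreover have "2 powr (- real_of_int m) \<le> 4 * 2 powr (- real_of_int m)" by simp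
  ultimately have "2 powr (- real_of_int m) \<le> 2 powr (- real_of_int l)" by linarith
  then have "l \<le> m" by simp
  then have "m = l + int (nat (m - l))" by simp
  with m show ?thesis by metis
qed

lemma suminf_ge_term: "f n \<le> (\<Sum>i. f i :: ennreal)"
  using sum_le_suminf[of f "{n}"] by simp

lemma suminf_layer_le: "(\<Sum>j. c * indicator (layer \<Omega> (l + int j)) y) \<le> (c :: ennreal)"
proof -
  have "disjoint_family (\<lambda>j. layer \<Omega> (l + int j))"
    unfolding disjoint_family_on_def using layer_disjoint by fastforce
  then have "(\<Sum>j. c * indicator (layer \<Omega> (l + int j)) y) = c * indicator (\<Union>j. layer \<Omega> (l + int j)) y"
    by (simp add: suminf_indicator)
  also have "\<dots> \<le> c * 1" by (intro mult_left_mono) (auto simp: indicator_def)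
  finally show ?thesis by simp
qed

context averaging_measure
begin

lemma ball_mean_eq:
  assumes [measurable]: "f \<in> borel_measurable borel"
  shows "ball_mean \<delta> f v = (\<integral>\<^sup>+y. f y * indicator (cball v \<delta>) y \<partial>lborel) / emeasure lborel (cball (0::'a) \<delta>)"
proof -
  have "(\<integral>\<^sup>+h. f (v - h) * indicator (cball 0 \<delta>) (v - (v - h)) \<partial>lborel) = (\<integral>\<^sup>+y. f y * indicator (cball 0 \<delta>) (v - y) \<partial>lborel)"
    by (rule nn_integral_lborel_reflect[where f="\<lambda>y. f y * indicator (cball 0 \<delta>) (v - y)"]) measurable
  also have "\<dots> = (\<integral>\<^sup>+y. f y * indicator (cball v \<delta>) y \<partial>lborel)"
    by (intro nn_integral_cong) (auto simp: indicator_def dist_norm norm_minus_commute)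
  finally show ?thesis by (simp add: ball_mean_def)
qed

lemma ball_mean_mono: "(\<And>x. f x \<le> g x) \<Longrightarrow> ball_mean \<delta> f v \<le> ball_mean \<delta> g v"
  unfolding ball_mean_def by (intro divide_right_mono_ennreal nn_integral_mono mult_right_mono) auto

text \<open>Only layers whose radius is comparable with the distance \<open>d\<close> from
  \<open>v\<close> to the complement contribute, so every mean can be normalised by the volume of
  one ball of radius \<open>d / 9\<close>. The layers are disjoint; the sum is at most the integral
  of \<open>f\<close> over \<open>cball v d\<close>, which lies in a ball of radius
  \<open>2 * d\<close> around the nearest point outside \<open>\<Omega>\<close>. There the maximal
  function is at most 1, and the ratio of the radii \<open>2 * d\<close> and \<open>d / 9\<close> is
  18.\<close>

lemma sum_ball_mean_layer_le:
  assumes [measurable]: "f \<in> borel_measurable borel"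
    and \<Omega>: "open \<Omega>" "- \<Omega> \<noteq> {}" and hl1: "\<And>x. x \<notin> \<Omega> \<Longrightarrow> hl f x \<le> 1"
  shows "(\<Sum>j. ball_mean (2 powr (- real_of_int (l + int j))) (\<lambda>x. f x * indicator (layer \<Omega> (l + int j)) x) v)
    \<le> ennreal (18 ^ DIM('a))"
proof -
  let ?n = "DIM('a)"
  let ?\<delta> = "\<lambda>j::nat. 2 powr (- real_of_int (l + int j)) :: real"
  let ?A = "\<lambda>j::nat. layer \<Omega> (l + int j)"
  let ?V = "\<lambda>r. emeasure lborel (cball (0::'a) r)"
  define d where "d = infdist v (- \<Omega>)"
  have d0: "0 \<le> d" by (simp add: d_def infdist_nonneg)
  have bm: "ball_mean (?\<delta> j) (\<lambda>x. f x * indicator (?A j) x) v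
      = (\<integral>\<^sup>+y. f y * indicator (?A j) y * indicator (cball v (?\<delta> j)) y \<partial>lborel) / ?V (?\<delta> j)" for j
    by (rule ball_mean_eq) measurable
  have near: "3 * ?\<delta> j \<le> d \<and> d \<le> 9 * ?\<delta> j" if "y \<in> ?A j" "y \<in> cball v (?\<delta> j)" for y j
  proof -
    have "infdist y (- \<Omega>) \<le> d + dist y v" "d \<le> infdist y (- \<Omega>) + dist v y"
      unfolding d_def by (rule infdist_triangle)+
    then show ?thesis using that by (auto simp: layer_def dist_commute)
  qed
  have zero: "ball_mean (?\<delta> j) (\<lambda>x. f x * indicator (?A j) x) v = 0"
    if "\<not> (\<exists>y. y \<in> ?A j \<and> y \<in> cball v (?\<delta> j))" for j
  proof -
    have "(\<integral>\<^sup>+y. f y * indicator (?A j) y * indicator (cball v (?\<delta> j)) y \<partial>lborel) = (\<integral>\<^sup>+y. 0 \<partial>(lborel :: 'a measure))"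
      using that by (intro nn_integral_cong) (auto simp: indicator_def)
    then show ?thesis unfolding bm by simp
  qed
  show ?thesis
  proof (cases "d = 0")
    \<comment> \<open>A point at distance 0 from the complement is too far from every layer for its
      ball to meet it, so all means vanish.\<close>
    case True
    have "ball_mean (?\<delta> j) (\<lambda>x. f x * indicator (?A j) x) v = 0" for j
    proof (rule zero, rule notI)
      assume "\<exists>y. y \<in> ?A j \<and> y \<in> cball v (?\<delta> j)"
      then have "3 * ?\<delta> j \<le> d" using near by blast
      then show False using True powr_gt_zero[of 2 "- real_of_int (l + int j)"] by linarith
    qed
    then show ?thesis by simp
  next
    case False
    with d0 have d: "0 < d" by simp
    let ?Y = "\<lambda>j. \<integral>\<^sup>+y. f y * indicator (?A j) y * indicator (cball v d) y \<partial>lborel"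
    have V: "?V (d / 9) \<noteq> 0" "?V (d / 9) \<noteq> top" using emeasure_cball_nontrivial[where 'a='a] d by auto
    have tm: "ball_mean (?\<delta> j) (\<lambda>x. f x * indicator (?A j) x) v \<le> ?Y j * inverse (?V (d / 9))" for j
    proof (cases "\<exists>y. y \<in> ?A j \<and> y \<in> cball v (?\<delta> j)")
      case True
      then have \<delta>: "3 * ?\<delta> j \<le> d" "d \<le> 9 * ?\<delta> j" using near by blast+
      have dp: "0 < ?\<delta> j" by simp
      have "(\<integral>\<^sup>+y. f y * indicator (?A j) y * indicator (cball v (?\<delta> j)) y \<partial>lborel) \<le> ?Y j"
      proof -
        have "?\<delta> j \<le> d" using \<delta>(1) dp by linarith
        then have "cball v (?\<delta> j) \<subseteq> cball v d" by (rule subset_cball)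
        then show ?thesis by (intro nn_integral_mono mult_left_mono) (auto simp: indicator_def)
      qed
      also have "\<dots> = ?Y j / ?V (d / 9) * ?V (d / 9)"
        using V by (simp add: ennreal_divide_times ennreal_divide_self less_top)
      also have "\<dots> \<le> ?Y j / ?V (d / 9) * ?V (?\<delta> j)"
        using \<delta>(2) by (intro mult_left_mono emeasure_mono) auto
      finally show ?thesis unfolding bm divide_ennreal_def[symmetric]
        using emeasure_cball_nontrivial[where 'a='a] dp by (subst ennreal_divide_le_iff) auto
    next
      case False
      then show ?thesis by (subst zero) simp_all
    qed
    have "(\<Sum>j. ball_mean (?\<delta> j) (\<lambda>x. f x * indicator (?A j) x) v) \<le> (\<Sum>j. ?Y j * inverse (?V (d / 9)))"
      by (intro suminf_le tm) auto
    also have "\<dots> = (\<Sum>j. ?Y j) * inverse (?V (d / 9))" by (rule ennreal_suminf_multc)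
    finally have le: "(\<Sum>j. ball_mean (?\<delta> j) (\<lambda>x. f x * indicator (?A j) x) v) \<le> (\<Sum>j. ?Y j) * inverse (?V (d / 9))" .
    have "(\<Sum>j. ?Y j) = (\<integral>\<^sup>+y. (\<Sum>j. f y * indicator (?A j) y * indicator (cball v d) y) \<partial>lborel)"
      by (rule nn_integral_suminf[symmetric]) measurable
    also have "\<dots> \<le> (\<integral>\<^sup>+y. f y * indicator (cball v d) y \<partial>lborel)"
    proof (rule nn_integral_mono)
      fix y
      have "disjoint_family ?A" unfolding disjoint_family_on_def using layer_disjoint by fastforce
      then have "(\<Sum>j. f y * indicator (?A j) y * indicator (cball v d) y) = f y * indicator (\<Union>j. ?A j) y * indicator (cball v d) y"
        by (simp add: suminf_indicator)
      also have "\<dots> \<le> f y * indicator (cball v d) y" by (auto simp: indicator_def)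
      finally show "(\<Sum>j. f y * indicator (?A j) y * indicator (cball v d) y) \<le> f y * indicator (cball v d) y" .
    qed
    also have "\<dots> \<le> ennreal (18 ^ ?n) * ?V (d / 9)"
    proof -
      \<comment> \<open>A nearest point of the closed complement: the only place where the
        hypothesis on the maximal function enters.\<close>
      obtain w where w: "w \<in> - \<Omega>" "d = dist v w"
        using infdist_attains_inf[of "- \<Omega>" v] \<Omega> unfolding d_def by (auto simp: closed_Compl)
      have "(\<integral>\<^sup>+y. f y * indicator (cball v d) y \<partial>lborel) \<le> (\<integral>\<^sup>+y. f y * indicator (cball w (2 * d)) y \<partial>lborel)"
      proof (intro nn_integral_mono mult_left_mono)
        fix y
        have "dist w y \<le> 2 * d" if "dist v y \<le> d" using that dist_triangle[of w y v] w(2) by (simp add: dist_commute)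
        then show "indicator (cball v d) y \<le> (indicator (cball w (2 * d)) y :: ennreal)" by (auto simp: indicator_def)
      qed simp
      also have "\<dots> \<le> hl f w * emeasure lborel (cball w (2 * d))" using d by (intro nn_integral_cball_le_hl) simp
      also have "\<dots> \<le> 1 * emeasure lborel (cball w (2 * d))" using hl1 w by (intro mult_right_mono) auto
      also have "\<dots> = ennreal (18 ^ ?n) * ?V (d / 9)"
      proof -
        have a: "emeasure lborel (cball w (2 * d)) = ennreal (unit_ball_vol (real ?n) * (2 * d) ^ ?n)"
          using d by (intro emeasure_cball) simp
        have b: "?V (d / 9) = ennreal (unit_ball_vol (real ?n) * (d / 9) ^ ?n)"
          using d by (intro emeasure_cball) simp
        have "(2 * d) ^ ?n = (18 * (d / 9)) ^ ?n" by simp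
        also have "\<dots> = 18 ^ ?n * (d / 9) ^ ?n" by (rule power_mult_distrib)
        finally have e: "unit_ball_vol (real ?n) * (2 * d) ^ ?n = 18 ^ ?n * (unit_ball_vol (real ?n) * (d / 9) ^ ?n)"
          by (simp only: mult_ac)
        show ?thesis unfolding a b e mult_1_left using d by (intro ennreal_mult) auto
      qed
      finally show ?thesis .
    qed
    finally have le2: "(\<Sum>j. ?Y j) \<le> ennreal (18 ^ ?n) * ?V (d / 9)" .
    note le
    also have "(\<Sum>j. ?Y j) * inverse (?V (d / 9)) \<le> ennreal (18 ^ ?n) * ?V (d / 9) * inverse (?V (d / 9))"
      by (rule mult_right_mono[OF le2]) simp
    also have "\<dots> = ennreal (18 ^ ?n)"
      unfolding divide_ennreal_def[symmetric] using V by (rule ennreal_mult_divide_eq)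
    finally show ?thesis .
  qed
qed

lemma posavg_one_left_le:
  assumes g[measurable]: "g \<in> borel_measurable borel" and t: "0 < t"
  shows "posavg M t (\<lambda>_. 1) g x \<le> ennreal (K * unit_ball_vol (real DIM('a))) * hl g x"
proof -
  interpret sw: averaging_measure "distr M (borel \<Otimes>\<^sub>M borel) (\<lambda>w. (snd w, fst w))" K by (rule averaging_measure_swap)
  have "posavg M t (\<lambda>_. 1) g x = posavg (distr M (borel \<Otimes>\<^sub>M borel) (\<lambda>w. (snd w, fst w))) t g (\<lambda>_. 1) x"
    by (rule posavg_swap[symmetric]) measurable
  then show ?thesis using sw.posavg_one_right_le[OF g t] by simp
qed

lemma posavg_cmult_left:
  assumes [measurable]: "f \<in> borel_measurable borel" "g \<in> borel_measurable borel"
  shows "posavg M t (\<lambda>x. c * f x) g x = c * posavg M t f g x"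
  unfolding posavg_def by (subst nn_integral_cmult[symmetric]) (auto simp: mult.assoc)

lemma posavg_cmult_right:
  assumes [measurable]: "f \<in> borel_measurable borel" "g \<in> borel_measurable borel"
  shows "posavg M t f (\<lambda>x. c * g x) x = c * posavg M t f g x"
  unfolding posavg_def by (subst nn_integral_cmult[symmetric]) (auto simp: mult_ac)

lemma posavg_suminf:
  assumes [measurable]: "\<And>j. a j \<in> borel_measurable borel" "\<And>k. b k \<in> borel_measurable borel"
  shows "(\<Sum>j. \<Sum>k. posavg M t (a j) (b k) x) = posavg M t (\<lambda>x. \<Sum>j. a j x) (\<lambda>x. \<Sum>k. b k x) x"
proof -
  have "(\<Sum>j. \<Sum>k. posavg M t (a j) (b k) x) = (\<Sum>j. \<integral>\<^sup>+w. (\<Sum>k. a j (x - t *\<^sub>R fst w) * b k (x - t *\<^sub>R snd w)) \<partial>M)"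
    unfolding posavg_def by (subst nn_integral_suminf) auto
  also have "\<dots> = (\<integral>\<^sup>+w. (\<Sum>j. \<Sum>k. a j (x - t *\<^sub>R fst w) * b k (x - t *\<^sub>R snd w)) \<partial>M)"
    by (subst nn_integral_suminf) auto
  finally show ?thesis unfolding posavg_def by simp
qed

text \<open>The 2 counts the two roles of the functions. The summand 1 belongs to the points where
  one function is outside its set, the power of 18 to the local means of the layers.\<close>

definition local_const :: real where
  "local_const = 2 * (1 + 18 ^ DIM('a)) * (K * unit_ball_vol (real DIM('a)))"

text \<open>For a point of the support of the measure, either one argument lies outside its set,
  where that function is at most 1, or both arguments lie in layers with natural indices. In the
  first case the average is controlled by the maximal function of the other function at
  \<open>x\<close>, which is at most 1. In the second case one piece of each pair is exchanged for
  its local means; these sum to at most \<open>18 ^ d\<close>, so again only one function is left,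
  and the errors \<open>E\<close> are collected.\<close>

lemma posavg_layer_bound:
  fixes f g :: "'a \<Rightarrow> real" and E :: "nat \<Rightarrow> nat \<Rightarrow> ennreal" and l :: int and \<Omega> \<Omega>' :: "'a set"
  defines "t \<equiv> 2 powr (- real_of_int l)"
    and "F \<equiv> \<lambda>j x. ennreal (f x) * indicator (layer \<Omega> (l + int j)) x"
    and "G \<equiv> \<lambda>k x. ennreal (g x) * indicator (layer \<Omega>' (l + int k)) x"
  assumes [measurable]: "f \<in> borel_measurable borel" "g \<in> borel_measurable borel"
    and \<Omega>: "open \<Omega>" "x \<notin> \<Omega>" and \<Omega>': "open \<Omega>'" "x \<notin> \<Omega>'"
    and f1: "\<And>y. y \<notin> \<Omega> \<Longrightarrow> f y \<le> 1" "\<And>y. y \<notin> \<Omega> \<Longrightarrow> hl (\<lambda>x. ennreal (f x)) y \<le> 1"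
    and g1: "\<And>y. y \<notin> \<Omega>' \<Longrightarrow> g y \<le> 1" "\<And>y. y \<notin> \<Omega>' \<Longrightarrow> hl (\<lambda>x. ennreal (g x)) y \<le> 1"
    and E: "\<And>j k. posavg M t (F j) (G k) x \<le> posavg M t (ball_mean (t * 2 powr (- real j)) (F j)) (G k) x
        + posavg M t (F j) (ball_mean (t * 2 powr (- real k)) (G k)) x + E j k"
  shows "posavg M t (\<lambda>x. ennreal (f x)) (\<lambda>x. ennreal (g x)) x \<le> ennreal local_const + (\<Sum>j. \<Sum>k. E j k)"
proof -
  let ?F = "\<lambda>x. ennreal (f x)" and ?G = "\<lambda>x. ennreal (g x)"
  let ?c = "ennreal (18 ^ DIM('a))" and ?k = "ennreal (K * unit_ball_vol (real DIM('a)))"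
  have t: "0 < t" by (simp add: t_def)
  have [measurable]: "F j \<in> borel_measurable borel" "G j \<in> borel_measurable borel" for j
    unfolding F_def G_def by measurable
  have ne: "- \<Omega> \<noteq> {}" "- \<Omega>' \<noteq> {}" using \<Omega> \<Omega>' by auto
  have tj: "t * 2 powr (- real j) = 2 powr (- real_of_int (l + int j))" for j
    by (simp add: t_def powr_add[symmetric])
  have sF: "(\<Sum>j. F j y) \<le> ?F y" and sG: "(\<Sum>j. G j y) \<le> ?G y" for y
    unfolding F_def G_def by (rule suminf_layer_le)+
  \<comment> \<open>The single term with the right indices is bounded by the full double series, so
    the indices need not be chosen measurably.\<close>
  have ptw: "AE w in M. ?F (x - t *\<^sub>R fst w) * ?G (x - t *\<^sub>R snd w) \<le> 1 * ?G (x - t *\<^sub>R snd w) + ?F (x - t *\<^sub>R fst w) * 1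
      + (\<Sum>j. \<Sum>k. F j (x - t *\<^sub>R fst w) * G k (x - t *\<^sub>R snd w))"
    using supp
  proof eventually_elim
    case (elim w)
    let ?y = "x - t *\<^sub>R fst w" and ?z = "x - t *\<^sub>R snd w"
    have dy: "dist x ?y \<le> 2 powr (- real_of_int l)" "dist x ?z \<le> 2 powr (- real_of_int l)"
      using elim t by (auto simp: dist_norm t_def)
    show ?case
    proof (cases "?y \<in> \<Omega> \<and> ?z \<in> \<Omega>'")
      case True
      then obtain j k where jk: "?y \<in> layer \<Omega> (l + int j)" "?z \<in> layer \<Omega>' (l + int k)"
        using ex_layer_near[OF \<Omega> _ dy(1)] ex_layer_near[OF \<Omega>' _ dy(2)] by blast
      have "?F ?y * ?G ?z = F j ?y * G k ?z" using jk by (simp add: F_def G_def)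
      also have "\<dots> \<le> (\<Sum>k. F j ?y * G k ?z)" by (rule suminf_ge_term)
      also have "\<dots> \<le> (\<Sum>j. \<Sum>k. F j ?y * G k ?z)" by (rule suminf_ge_term[where f="\<lambda>j. \<Sum>k. F j ?y * G k ?z"])
      finally show ?thesis by (simp add: add_increasing)
    next
      case False
      then consider "?F ?y \<le> 1" | "?G ?z \<le> 1" using f1(1)[of ?y] g1(1)[of ?z] by (auto simp: ennreal_le_1)
      then show ?thesis
      proof cases
        case 1
        then have "?F ?y * ?G ?z \<le> 1 * ?G ?z" by (rule mult_right_mono) simp
        then show ?thesis by (simp add: add_increasing2)
      next
        case 2
        then have "?F ?y * ?G ?z \<le> ?F ?y * 1" by (rule mult_left_mono) simp
        then show ?thesis by (simp add: add_increasing2 add_increasing)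
      qed
    qed
  qed
  have "posavg M t ?F ?G x \<le> (\<integral>\<^sup>+w. 1 * ?G (x - t *\<^sub>R snd w) + ?F (x - t *\<^sub>R fst w) * 1
      + (\<Sum>j. \<Sum>k. F j (x - t *\<^sub>R fst w) * G k (x - t *\<^sub>R snd w)) \<partial>M)"
    unfolding posavg_def by (rule nn_integral_mono_AE[OF ptw])
  also have "\<dots> = posavg M t (\<lambda>_. 1) ?G x + posavg M t ?F (\<lambda>_. 1) x + posavg M t (\<lambda>x. \<Sum>j. F j x) (\<lambda>x. \<Sum>k. G k x) x"
    unfolding posavg_def by (simp add: nn_integral_add)
  also have "posavg M t (\<lambda>x. \<Sum>j. F j x) (\<lambda>x. \<Sum>k. G k x) x = (\<Sum>j. \<Sum>k. posavg M t (F j) (G k) x)"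
    by (rule posavg_suminf[symmetric]) measurable
  also have "\<dots> \<le> (\<Sum>j. \<Sum>k. posavg M t (ball_mean (t * 2 powr (- real j)) (F j)) (G k) x
        + posavg M t (F j) (ball_mean (t * 2 powr (- real k)) (G k)) x + E j k)"
    by (intro suminf_le E) auto
  also have "\<dots> = (\<Sum>j. \<Sum>k. posavg M t (ball_mean (t * 2 powr (- real j)) (F j)) (G k) x)
      + (\<Sum>j. \<Sum>k. posavg M t (F j) (ball_mean (t * 2 powr (- real k)) (G k)) x) + (\<Sum>j. \<Sum>k. E j k)"
    by (simp add: suminf_add[symmetric])
  also have "(\<Sum>j. \<Sum>k. posavg M t (ball_mean (t * 2 powr (- real j)) (F j)) (G k) x)
      = posavg M t (\<lambda>x. \<Sum>j. ball_mean (t * 2 powr (- real j)) (F j) x) (\<lambda>x. \<Sum>k. G k x) x"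
    by (rule posavg_suminf) measurable
  also have "(\<Sum>j. \<Sum>k. posavg M t (F j) (ball_mean (t * 2 powr (- real k)) (G k)) x)
      = posavg M t (\<lambda>x. \<Sum>j. F j x) (\<lambda>x. \<Sum>k. ball_mean (t * 2 powr (- real k)) (G k) x) x"
    by (rule posavg_suminf) measurable
  finally have main: "posavg M t ?F ?G x \<le> posavg M t (\<lambda>_. 1) ?G x + posavg M t ?F (\<lambda>_. 1) x
     + (posavg M t (\<lambda>x. \<Sum>j. ball_mean (t * 2 powr (- real j)) (F j) x) (\<lambda>x. \<Sum>k. G k x) x
      + posavg M t (\<lambda>x. \<Sum>j. F j x) (\<lambda>x. \<Sum>k. ball_mean (t * 2 powr (- real k)) (G k) x) x + (\<Sum>j. \<Sum>k. E j k))"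
    by (auto intro: add_left_mono)
  have 1: "posavg M t (\<lambda>_. 1) ?G x \<le> ?k"
    using posavg_one_left_le[of ?G t x] mult_left_mono[OF g1(2)[OF \<Omega>'(2)], of ?k] t by (auto intro: order_trans)
  have 2: "posavg M t ?F (\<lambda>_. 1) x \<le> ?k"
    using posavg_one_right_le[of ?F t x] mult_left_mono[OF f1(2)[OF \<Omega>(2)], of ?k] t by (auto intro: order_trans)
  \<comment> \<open>The local means of all layers together act as the constant
    \<open>18 ^ d\<close>, while the layers of the other function sum to at most that function; what
    remains is an average of one function at \<open>x\<close>.\<close>
  have "posavg M t (\<lambda>x. \<Sum>j. ball_mean (t * 2 powr (- real j)) (F j) x) (\<lambda>x. \<Sum>k. G k x) x \<le> posavg M t (\<lambda>_. ?c * 1) ?G x"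
  proof (rule posavg_mono)
    show "(\<Sum>j. ball_mean (t * 2 powr (- real j)) (F j) y) \<le> ?c * 1" for y
      unfolding tj F_def using sum_ball_mean_layer_le[of ?F \<Omega> l y] \<Omega> ne f1(2) by simp
  qed (rule sG)
  also have "\<dots> = ?c * posavg M t (\<lambda>_. 1) ?G x" by (rule posavg_cmult_left) measurable
  also have "\<dots> \<le> ?c * ?k" by (rule mult_left_mono[OF 1]) simp
  finally have 3: "posavg M t (\<lambda>x. \<Sum>j. ball_mean (t * 2 powr (- real j)) (F j) x) (\<lambda>x. \<Sum>k. G k x) x \<le> ?c * ?k" .
  have "posavg M t (\<lambda>x. \<Sum>j. F j x) (\<lambda>x. \<Sum>k. ball_mean (t * 2 powr (- real k)) (G k) x) x \<le> posavg M t ?F (\<lambda>_. ?c * 1) x"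
  proof (rule posavg_mono)
    show "(\<Sum>k. ball_mean (t * 2 powr (- real k)) (G k) y) \<le> ?c * 1" for y
      unfolding tj G_def using sum_ball_mean_layer_le[of ?G \<Omega>' l y] \<Omega>' ne g1(2) by simp
  qed (rule sF)
  also have "\<dots> = ?c * posavg M t ?F (\<lambda>_. 1) x" by (rule posavg_cmult_right) measurable
  also have "\<dots> \<le> ?c * ?k" by (rule mult_left_mono[OF 2]) simp
  finally have 4: "posavg M t (\<lambda>x. \<Sum>j. F j x) (\<lambda>x. \<Sum>k. ball_mean (t * 2 powr (- real k)) (G k) x) x \<le> ?c * ?k" .
  have "posavg M t ?F ?G x \<le> ?k + ?k + (?c * ?k + ?c * ?k + (\<Sum>j. \<Sum>k. E j k))"
    by (rule order_trans[OF main]) (intro add_mono 1 2 3 4 order_refl)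
  also have "\<dots> = (?k + ?k + ?c * ?k + ?c * ?k) + (\<Sum>j. \<Sum>k. E j k)" by (simp add: add.assoc)
  also have "?k + ?k + ?c * ?k + ?c * ?k = ennreal local_const"
  proof -
    define k c where "k = K * unit_ball_vol (real DIM('a))" and "c = (18::real) ^ DIM('a)"
    have "0 \<le> k" "0 \<le> c" using K0 by (auto simp: k_def c_def)
    then show ?thesis unfolding local_const_def k_def[symmetric] c_def[symmetric]
      by (simp add: ennreal_mult[symmetric] ennreal_plus[symmetric] algebra_simps del: ennreal_plus)
  qed
  finally show ?thesis .
qed

end

section \<open>Exceptional sets for a pair of layers\<close>

lemma suminf_geometric_double:
  fixes c s :: real
  assumes "0 \<le> c" "0 < s"
  shows "(\<Sum>j. \<Sum>k. ennreal (c * 2 powr (- (s * real (j + k))))) = ennreal (c * (1 / (1 - 2 powr (- s)))\<^sup>2)"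
proof -
  define a where "a = 2 powr (- s)"
  have a: "0 < a" "a < 1" unfolding a_def using assms by (auto simp: powr_less_one)
  have pw: "2 powr (- (s * real n)) = a ^ n" for n
  proof -
    have "2 powr (- (s * real n)) = a powr real n" unfolding a_def by (simp add: powr_powr)
    then show ?thesis using a(1) by (simp add: powr_realpow)
  qed
  have geo: "(\<Sum>k. ennreal (d * a ^ k)) = ennreal (d * (1 / (1 - a)))" if "0 \<le> d" for d
  proof (rule suminf_ennreal_eq)
    show "(\<lambda>k. d * a ^ k) sums (d * (1 / (1 - a)))"
      using a by (intro sums_mult geometric_sums) auto
  qed (use a that in auto)
  have inner: "(\<Sum>k. ennreal (c * a ^ (j + k))) = ennreal ((c * (1 / (1 - a))) * a ^ j)" for j
  proof -
    have e: "c * a ^ (j + k) = c * a ^ j * a ^ k" for k by (simp only: power_add mult.assoc)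
    have "(\<Sum>k. ennreal (c * a ^ (j + k))) = ennreal (c * a ^ j * (1 / (1 - a)))"
      unfolding e by (rule geo) (use assms a in simp)
    then show ?thesis by (simp only: mult_ac)
  qed
  have "(\<Sum>j. \<Sum>k. ennreal (c * a ^ (j + k))) = ennreal (c * (1 / (1 - a)) * (1 / (1 - a)))"
    unfolding inner by (rule geo) (use assms a in simp)
  then show ?thesis unfolding pw a_def[symmetric] by (simp add: power2_eq_square)
qed

lemma bdd_supp_indicator:
  "bdd_supp f \<Longrightarrow> A \<in> sets borel \<Longrightarrow> bdd_supp (\<lambda>x. f x * indicator A x)"
  by (rule bdd_supp_mult_bounded[where B=1]) (auto simp: indicator_def)

context scale_average
begin

text \<open>Two weak bounds, each with the common majorant counted twice, give \<open>4 * B\<close>.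
  The other terms stem from the smoothing estimate in its two orientations; they are added so that
  one constant serves both orders of \<open>j\<close> and \<open>k\<close>.\<close>

definition pair_const :: real where
  "pair_const = 4 * B + 3 * smoothing_const
     + 3 * averaging_measure.smoothing_const (distr M (borel \<Otimes>\<^sub>M borel) (\<lambda>w. (snd w, fst w))) K"

lemma pair_const_nonneg: "0 \<le> pair_const"
proof -
  interpret sw: averaging_measure "distr M (borel \<Otimes>\<^sub>M borel) (\<lambda>w. (snd w, fst w))" K by (rule averaging_measure_swap)
  show ?thesis unfolding pair_const_def using pos smoothing_const_nonneg sw.smoothing_const_nonneg by simp
qed

text \<open>Values above \<open>h = 2 powr ((j + k) / 32)\<close> are split off. A product of values
  of the two pieces is covered by large times anything, anything times large, or small times small.
  The first two averages are below the threshold off the exceptional sets of the weak bound. The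
  third is compared with local means, and the function with the larger index is the one smoothed,
  because its scale is the finer one. The majorants \<open>u\<close> and \<open>v\<close>, at least
  1 on the layers, make all the integrals and the measures of supports comparable.\<close>

lemma layer_pair_error:
  fixes f g :: "'a \<Rightarrow> real" and u v :: "'a \<Rightarrow> ennreal" and j k :: nat
  assumes f: "bdd_supp f" and g: "bdd_supp g" and f0: "\<And>x. 0 \<le> f x" and g0: "\<And>x. 0 \<le> g x"
    and A[measurable]: "A \<in> sets borel" and A'[measurable]: "A' \<in> sets borel"
    and u: "\<And>x. x \<in> A \<Longrightarrow> ennreal (f x) \<le> u x" "\<And>x. x \<in> A \<Longrightarrow> 1 \<le> u x"
    and v: "\<And>x. x \<in> A' \<Longrightarrow> ennreal (g x) \<le> v x" "\<And>x. x \<in> A' \<Longrightarrow> 1 \<le> v x"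
    and uv[measurable]: "u \<in> borel_measurable borel" "v \<in> borel_measurable borel" and t: "0 < t"
  defines "F \<equiv> \<lambda>x. ennreal (f x) * indicator A x" and "G \<equiv> \<lambda>x. ennreal (g x) * indicator A' x"
  shows "\<exists>S\<in>sets borel. emeasure lborel S \<le> ennreal (pair_const * 2 powr (- (2 * \<kappa> * real (j + k))))
          * ((\<integral>\<^sup>+x. epowr (u x) p1 * indicator A x \<partial>lborel) + (\<integral>\<^sup>+x. epowr (v x) q1 * indicator A' x \<partial>lborel)) \<and>
      (\<forall>x. x \<notin> S \<longrightarrow> posavg M t F G x \<le> posavg M t (ball_mean (t * 2 powr (- real j)) F) G x
          + posavg M t F (ball_mean (t * 2 powr (- real k)) G) x + ennreal (3 * 2 powr (- (\<kappa> * real (j + k)))))"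
proof -
  interpret sw: averaging_measure "distr M (borel \<Otimes>\<^sub>M borel) (\<lambda>w. (snd w, fst w))" K by (rule averaging_measure_swap)
  note [measurable] = bdd_supp_measurable[OF f] bdd_supp_measurable[OF g]
  define m where "m = j + k"
  define h where "h = 2 powr (real m / 32)"
  define c where "c = 2 powr (- (\<kappa> * real m))"
  define q where "q = 2 powr (- (2 * \<kappa> * real m))"
  define W where "W = (\<integral>\<^sup>+x. epowr (u x) p1 * indicator A x \<partial>lborel) + (\<integral>\<^sup>+x. epowr (v x) q1 * indicator A' x \<partial>lborel)"
  define fA where "fA x = f x * indicator A x" for x
  define gA where "gA x = g x * indicator A' x" for x
  define fL where "fL x = f x * indicator (A \<inter> {x. h < f x}) x" for x
  define gL where "gL x = g x * indicator (A' \<inter> {x. h < g x}) x" for x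
  define fS where "fS x = f x * indicator (A \<inter> {x. f x \<le> h}) x" for x
  define gS where "gS x = g x * indicator (A' \<inter> {x. g x \<le> h}) x" for x
  have bs: "bdd_supp fA" "bdd_supp gA" "bdd_supp fL" "bdd_supp gL" "bdd_supp fS" "bdd_supp gS"
    unfolding fA_def gA_def fL_def gL_def fS_def gS_def
    by (intro bdd_supp_indicator f g; measurable)+
  note [measurable] = bs[THEN bdd_supp_measurable]
  have nn: "0 \<le> fA x" "0 \<le> gA x" "0 \<le> fL x" "0 \<le> gL x" "0 \<le> fS x" "0 \<le> gS x" for x
    unfolding fA_def gA_def fL_def gL_def fS_def gS_def using f0 g0 by auto
  have FA: "F = (\<lambda>x. ennreal (fA x))" "G = (\<lambda>x. ennreal (gA x))"
    unfolding F_def G_def fA_def gA_def by (auto simp: fun_eq_iff indicator_def)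
  have h0: "0 < h" unfolding h_def by simp
  \<comment> \<open>Because \<open>u\<close> dominates \<open>f\<close> and is at least 1 on
    \<open>A\<close>, raising the exponent to \<open>p1\<close> only increases the integrand; the
    same majorant therefore serves \<open>p0\<close> and \<open>p1\<close>.\<close>
  have Vf: "(\<integral>\<^sup>+x. ennreal (\<phi> x powr s) \<partial>lborel) \<le> W"
    if "\<And>x. 0 \<le> \<phi> x" "\<And>x. \<phi> x \<noteq> 0 \<Longrightarrow> x \<in> A \<and> \<phi> x \<le> f x" "0 < s" "s \<le> p1" for \<phi> s
  proof -
    have "(\<integral>\<^sup>+x. ennreal (\<phi> x powr s) \<partial>lborel) \<le> (\<integral>\<^sup>+x. epowr (u x) p1 * indicator A x \<partial>lborel)"
    proof (rule nn_integral_mono)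
      fix x show "ennreal (\<phi> x powr s) \<le> epowr (u x) p1 * indicator A x"
      proof (cases "\<phi> x = 0")
        case False
        then have x: "x \<in> A" "\<phi> x \<le> f x" using that by auto
        have "ennreal (\<phi> x powr s) = epowr (ennreal (\<phi> x)) s" using that by (simp add: epowr_ennreal)
        also have "\<dots> \<le> epowr (u x) s" using x u(1)[OF x(1)] that by (intro epowr_mono) (auto intro: order_trans ennreal_leI)
        also have "\<dots> \<le> epowr (u x) p1" using u(2)[OF x(1)] that by (intro epowr_mono_exponent) auto
        finally show ?thesis using x by simp
      qed simp
    qed
    then show ?thesis unfolding W_def by (simp add: add_increasing2)
  qed
  have Vg: "(\<integral>\<^sup>+x. ennreal (\<phi> x powr s) \<partial>lborel) \<le> W"
    if "\<And>x. 0 \<le> \<phi> x" "\<And>x. \<phi> x \<noteq> 0 \<Longrightarrow> x \<in> A' \<and> \<phi> x \<le> g x" "0 < s" "s \<le> q1" for \<phi> s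
  proof -
    have "(\<integral>\<^sup>+x. ennreal (\<phi> x powr s) \<partial>lborel) \<le> (\<integral>\<^sup>+x. epowr (v x) q1 * indicator A' x \<partial>lborel)"
    proof (rule nn_integral_mono)
      fix x show "ennreal (\<phi> x powr s) \<le> epowr (v x) q1 * indicator A' x"
      proof (cases "\<phi> x = 0")
        case False
        then have x: "x \<in> A'" "\<phi> x \<le> g x" using that by auto
        have "ennreal (\<phi> x powr s) = epowr (ennreal (\<phi> x)) s" using that by (simp add: epowr_ennreal)
        also have "\<dots> \<le> epowr (v x) s" using x v(1)[OF x(1)] that by (intro epowr_mono) (auto intro: order_trans ennreal_leI)
        also have "\<dots> \<le> epowr (v x) q1" using v(2)[OF x(1)] that by (intro epowr_mono_exponent) auto
        finally show ?thesis using x by simp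
      qed simp
    qed
    then show ?thesis unfolding W_def by (simp add: add_increasing)
  qed
  have two: "X + Y \<le> W + W" if "X \<le> W" "Y \<le> W" for X Y using that by (rule add_mono)
  let ?P = "\<lambda>\<phi> \<psi>. posavg M t (\<lambda>x. ennreal (\<phi> x)) (\<lambda>x. ennreal (\<psi> x))"
  define S1 where "S1 = {x. ennreal c < ?P fL gA x}"
  define S2 where "S2 = {x. ennreal c < ?P fA gL x}"
  \<comment> \<open>The larger index dominates \<open>j + k\<close> up to the factor 2, which is
    what the smoothing bound asks of the function that is smoothed.\<close>
  define S3 where "S3 = (if k \<le> j then {x. ennreal c < mean_diffavg (t * 2 powr (- real j)) t fS gS x}
     else {x. ennreal c < sw.mean_diffavg (t * 2 powr (- real k)) t gS fS x})"
  define c3 where "c3 = 3 * smoothing_const + 3 * sw.smoothing_const"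
  have c3: "3 * smoothing_const \<le> c3" "3 * sw.smoothing_const \<le> c3" "0 \<le> c3"
    unfolding c3_def using smoothing_const_nonneg sw.smoothing_const_nonneg by auto
  have S_sets: "S1 \<in> sets borel" "S2 \<in> sets borel" "S3 \<in> sets borel"
  proof -
    have gt: "{x. ennreal c < \<phi> x} \<in> sets borel" if "\<phi> \<in> borel_measurable borel" for \<phi> :: "'a \<Rightarrow> ennreal"
    proof -
      have "{x \<in> space borel. ennreal c < \<phi> x} \<in> sets borel" using that by measurable
      then show ?thesis by simp
    qed
    show "S1 \<in> sets borel" unfolding S1_def by (rule gt) measurable
    show "S2 \<in> sets borel" unfolding S2_def by (rule gt) measurable
    have "mean_diffavg (t * 2 powr (- real j)) t fS gS \<in> borel_measurable borel" by measurable
    moreover have "sw.mean_diffavg (t * 2 powr (- real k)) t gS fS \<in> borel_measurable borel" by measurable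
    ultimately show "S3 \<in> sets borel" unfolding S3_def using gt by simp
  qed
  have q0': "0 \<le> q" by (simp add: q_def)
  have ind: "x \<in> A" if "fL x \<noteq> 0 \<or> fS x \<noteq> 0 \<or> fA x \<noteq> 0" for x
    using that by (auto simp: fL_def fS_def fA_def indicator_def split: if_splits)
  have ind': "x \<in> A'" if "gL x \<noteq> 0 \<or> gS x \<noteq> 0 \<or> gA x \<noteq> 0" for x
    using that by (auto simp: gL_def gS_def gA_def indicator_def split: if_splits)
  have le: "fL x \<le> f x" "fS x \<le> f x" "fA x \<le> f x" "gL x \<le> g x" "gS x \<le> g x" "gA x \<le> g x" for x
    using f0[of x] g0[of x] by (auto simp: fL_def fS_def fA_def gL_def gS_def gA_def indicator_def)
  have fLl: "2 powr (real m / 32) < fL x" if "fL x \<noteq> 0" for x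
    using that by (auto simp: fL_def h_def[symmetric] indicator_def split: if_splits)
  have gLl: "2 powr (real m / 32) < gL x" if "gL x \<noteq> 0" for x
    using that by (auto simp: gL_def h_def[symmetric] indicator_def split: if_splits)
  have e1: "emeasure lborel S1 \<le> ennreal (B * q) * (W + W)"
  proof -
    have "emeasure lborel S1 \<le> ennreal (B * q) * ((\<integral>\<^sup>+x. ennreal (fL x powr p1) \<partial>lborel) + (\<integral>\<^sup>+x. ennreal (gA x powr q0) \<partial>lborel))"
      unfolding S1_def c_def q_def
      by (rule weak_large_left) (use bs nn t fLl in auto)
    also have "\<dots> \<le> ennreal (B * q) * (W + W)"
      by (intro mult_left_mono two Vf Vg) (use nn ind ind' le pos in auto)
    finally show ?thesis .
  qed
  have e2: "emeasure lborel S2 \<le> ennreal (B * q) * (W + W)"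
  proof -
    have "emeasure lborel S2 \<le> ennreal (B * q) * ((\<integral>\<^sup>+x. ennreal (fA x powr p0) \<partial>lborel) + (\<integral>\<^sup>+x. ennreal (gL x powr q1) \<partial>lborel))"
      unfolding S2_def c_def q_def
      by (rule weak_large_right) (use bs nn t gLl in auto)
    also have "\<dots> \<le> ennreal (B * q) * (W + W)"
      by (intro mult_left_mono two Vf Vg) (use nn ind ind' le pos in auto)
    finally show ?thesis .
  qed
  have small: "fS x \<le> h" "gS x \<le> h" for x
    unfolding fS_def gS_def using h0 by (auto simp: indicator_def)
  have supp_le: "emeasure lborel {x. fS x \<noteq> 0} \<le> W" "emeasure lborel {x. gS x \<noteq> 0} \<le> W"
  proof -
    have "emeasure lborel {x. fS x \<noteq> 0} = (\<integral>\<^sup>+x. indicator {x. fS x \<noteq> 0} x \<partial>lborel)" by simp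
    also have "\<dots> \<le> (\<integral>\<^sup>+x. epowr (u x) p1 * indicator A x \<partial>lborel)"
    proof (rule nn_integral_mono)
      fix x show "indicator {x. fS x \<noteq> 0} x \<le> epowr (u x) p1 * indicator A x"
        using epowr_mono[OF u(2)[of x], of p1] ind[of x] pos epowr_ennreal[of 1 p1] by (auto simp: indicator_def)
    qed
    also have "\<dots> \<le> W" unfolding W_def by (simp add: add_increasing2)
    finally show "emeasure lborel {x. fS x \<noteq> 0} \<le> W" .
    have "emeasure lborel {x. gS x \<noteq> 0} = (\<integral>\<^sup>+x. indicator {x. gS x \<noteq> 0} x \<partial>lborel)" by simp
    also have "\<dots> \<le> (\<integral>\<^sup>+x. epowr (v x) q1 * indicator A' x \<partial>lborel)"
    proof (rule nn_integral_mono)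
      fix x show "indicator {x. gS x \<noteq> 0} x \<le> epowr (v x) q1 * indicator A' x"
        using epowr_mono[OF v(2)[of x], of q1] ind'[of x] pos epowr_ennreal[of 1 q1] by (auto simp: indicator_def)
    qed
    also have "\<dots> \<le> W" unfolding W_def by (simp add: add_increasing)
    finally show "emeasure lborel {x. gS x \<noteq> 0} \<le> W" .
  qed
  have e3: "emeasure lborel S3 \<le> ennreal (c3 * q) * W"
  proof (cases "k \<le> j")
    case True
    have "emeasure lborel S3 \<le> ennreal (3 * smoothing_const * q) * emeasure lborel {x. fS x \<noteq> 0}"
      using True weak_small[OF bs(5,6) nn(5,6), of j k t \<kappa>] small t pos
      by (simp add: S3_def c_def q_def m_def h_def)
    also have "\<dots> \<le> ennreal (c3 * q) * W"
      by (intro mult_mono ennreal_leI mult_right_mono c3 supp_le q0') auto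
    finally show ?thesis .
  next
    case False
    have "emeasure lborel S3 \<le> ennreal (3 * sw.smoothing_const * q) * emeasure lborel {x. gS x \<noteq> 0}"
      using False sw.weak_small[OF bs(6,5) nn(6,5), of k j t \<kappa>] small t pos
      by (simp add: S3_def c_def q_def m_def h_def add.commute[of "real k"])
    also have "\<dots> \<le> ennreal (c3 * q) * W"
      by (intro mult_mono ennreal_leI mult_right_mono c3 supp_le q0') auto
    finally show ?thesis .
  qed
  have meas: "emeasure lborel (S1 \<union> S2 \<union> S3) \<le> ennreal (pair_const * q) * W"
  proof -
    have "emeasure lborel (S1 \<union> S2 \<union> S3) \<le> emeasure lborel (S1 \<union> S2) + emeasure lborel S3"
      by (rule emeasure_subadditive) (use S_sets in auto)
    also have "\<dots> \<le> emeasure lborel S1 + emeasure lborel S2 + emeasure lborel S3"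
      by (intro add_right_mono emeasure_subadditive) (use S_sets in auto)
    also have "\<dots> \<le> ennreal (B * q) * (W + W) + ennreal (B * q) * (W + W) + ennreal (c3 * q) * W"
      by (intro add_mono e1 e2 e3)
    also have "\<dots> = (ennreal (B * q) + ennreal (B * q) + ennreal (B * q) + ennreal (B * q) + ennreal (c3 * q)) * W"
      by (simp add: distrib_left distrib_right add.assoc)
    also have "ennreal (B * q) + ennreal (B * q) + ennreal (B * q) + ennreal (B * q) + ennreal (c3 * q) = ennreal (pair_const * q)"
    proof -
      have "pair_const * q = B * q + B * q + B * q + B * q + c3 * q"
        unfolding pair_const_def c3_def by (simp add: algebra_simps)
      moreover have "0 \<le> B * q" "0 \<le> c3 * q" using pos q0' c3 by auto
      ultimately show ?thesis by (simp only: ennreal_plus add_nonneg_nonneg)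
    qed
    finally show ?thesis .
  qed
  have ptw: "posavg M t F G x \<le> posavg M t (ball_mean (t * 2 powr (- real j)) F) G x
          + posavg M t F (ball_mean (t * 2 powr (- real k)) G) x + ennreal (3 * c)" if x: "x \<notin> S1 \<union> S2 \<union> S3" for x
  proof -
    have c0: "0 \<le> c" by (simp add: c_def)
    \<comment> \<open>If \<open>f\<close> is large at \<open>y\<close>, the first product is the
      whole; if \<open>g\<close> is large at \<open>z\<close>, the second one is; otherwise both
      values are small and the third one is.\<close>
    have prod: "ennreal (fA y) * ennreal (gA z) \<le> ennreal (fL y) * ennreal (gA z) + ennreal (fA y) * ennreal (gL z) + ennreal (fS y) * ennreal (gS z)" for y z
    proof -
      have "fL y = fA y \<or> gL z = gA z \<or> (fS y = fA y \<and> gS z = gA z)"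
        by (auto simp: fL_def gL_def fS_def gS_def fA_def gA_def indicator_def)
      then show ?thesis by (auto simp: add_increasing add_increasing2)
    qed
    have "posavg M t F G x \<le> ?P fL gA x + ?P fA gL x + ?P fS gS x"
    proof -
      have "posavg M t F G x \<le> (\<integral>\<^sup>+w. ennreal (fL (x - t *\<^sub>R fst w)) * ennreal (gA (x - t *\<^sub>R snd w))
          + ennreal (fA (x - t *\<^sub>R fst w)) * ennreal (gL (x - t *\<^sub>R snd w)) + ennreal (fS (x - t *\<^sub>R fst w)) * ennreal (gS (x - t *\<^sub>R snd w)) \<partial>M)"
        unfolding FA posavg_def by (intro nn_integral_mono prod)
      also have "\<dots> = ?P fL gA x + ?P fA gL x + ?P fS gS x"
        unfolding posavg_def by (simp add: nn_integral_add)
      finally show ?thesis .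
    qed
    also have "\<dots> \<le> ennreal c + ennreal c + ?P fS gS x"
      using x by (intro add_mono) (auto simp: S1_def S2_def)
    finally have 1: "posavg M t F G x \<le> ennreal c + ennreal c + ?P fS gS x" .
    have fSF: "ennreal (fS y) \<le> F y" "ennreal (gS y) \<le> G y" for y
      unfolding FA by (auto simp: fS_def gS_def fA_def gA_def indicator_def intro!: ennreal_leI f0 g0)
    have 2: "?P fS gS x \<le> posavg M t (ball_mean (t * 2 powr (- real j)) F) G x
          + posavg M t F (ball_mean (t * 2 powr (- real k)) G) x + ennreal c"
    proof (cases "k \<le> j")
      case True
      have "?P fS gS x \<le> posavg M t (ball_mean (t * 2 powr (- real j)) (\<lambda>x. ennreal (fS x))) (\<lambda>x. ennreal (gS x)) x
           + mean_diffavg (t * 2 powr (- real j)) t fS gS x"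
        by (rule posavg_le_ball_mean) (use bs nn t in auto)
      also have "\<dots> \<le> posavg M t (ball_mean (t * 2 powr (- real j)) F) G x + ennreal c"
        using x True by (intro add_mono posavg_mono ball_mean_mono fSF) (auto simp: S3_def)
      finally show ?thesis by (rule order_trans) (simp add: add.assoc add_left_mono add_increasing)
    next
      case False
      have "?P fS gS x = posavg (distr M (borel \<Otimes>\<^sub>M borel) (\<lambda>w. (snd w, fst w))) t (\<lambda>x. ennreal (gS x)) (\<lambda>x. ennreal (fS x)) x"
        by (rule posavg_swap[symmetric]) measurable
      also have "\<dots> \<le> posavg (distr M (borel \<Otimes>\<^sub>M borel) (\<lambda>w. (snd w, fst w))) t (ball_mean (t * 2 powr (- real k)) (\<lambda>x. ennreal (gS x))) (\<lambda>x. ennreal (fS x)) x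
           + sw.mean_diffavg (t * 2 powr (- real k)) t gS fS x"
        by (rule sw.posavg_le_ball_mean) (use bs nn t in auto)
      also have "posavg (distr M (borel \<Otimes>\<^sub>M borel) (\<lambda>w. (snd w, fst w))) t (ball_mean (t * 2 powr (- real k)) (\<lambda>x. ennreal (gS x))) (\<lambda>x. ennreal (fS x)) x
          = posavg M t (\<lambda>x. ennreal (fS x)) (ball_mean (t * 2 powr (- real k)) (\<lambda>x. ennreal (gS x))) x"
        by (rule posavg_swap) measurable
      also have "posavg M t (\<lambda>x. ennreal (fS x)) (ball_mean (t * 2 powr (- real k)) (\<lambda>x. ennreal (gS x))) x
           + sw.mean_diffavg (t * 2 powr (- real k)) t gS fS x \<le> posavg M t F (ball_mean (t * 2 powr (- real k)) G) x + ennreal c"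
        using x False by (intro add_mono posavg_mono ball_mean_mono fSF) (auto simp: S3_def)
      finally show ?thesis by (rule order_trans) (simp add: add.assoc add_increasing)
    qed
    have 3: "ennreal (3 * c) = ennreal c + ennreal c + ennreal c" using c0 by (simp add: ennreal_plus[symmetric] del: ennreal_plus)
    have "posavg M t F G x \<le> ennreal c + ennreal c + (posavg M t (ball_mean (t * 2 powr (- real j)) F) G x
          + posavg M t F (ball_mean (t * 2 powr (- real k)) G) x + ennreal c)"
      by (rule order_trans[OF 1]) (intro add_left_mono 2)
    then show ?thesis unfolding 3 by (simp only: ac_simps)
  qed
  have Ssets: "S1 \<union> S2 \<union> S3 \<in> sets borel" using S_sets by auto
  show ?thesis
    using Ssets meas ptw unfolding c_def q_def m_def W_def by blast
qed

end

section \<open>The layer-cake formula and the measure of a level set of the maximal function\<close>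

lemma layer_cake:
  fixes w h :: "'a::euclidean_space \<Rightarrow> ennreal"
  assumes [measurable]: "w \<in> borel_measurable borel" "h \<in> borel_measurable borel"
    and h: "\<And>x. h x \<noteq> top" and s: "0 < s" and \<alpha>: "0 < \<alpha>"
  shows "(\<integral>\<^sup>+l. indicator {0<..} l * (ennreal (l powr (s - 1)) * (\<integral>\<^sup>+x. w x * indicator {x. ennreal (l powr \<alpha>) < h x} x \<partial>lborel)) \<partial>lborel)
    = ennreal (1 / s) * (\<integral>\<^sup>+x. w x * epowr (h x) (s / \<alpha>) \<partial>lborel)"
proof -
  have "(\<integral>\<^sup>+l. indicator {0<..} l * (ennreal (l powr (s - 1)) * (\<integral>\<^sup>+x. w x * indicator {x. ennreal (l powr \<alpha>) < h x} x \<partial>lborel)) \<partial>lborel)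
     = (\<integral>\<^sup>+l. (\<integral>\<^sup>+x. w x * (indicator {0<..} l * (ennreal (l powr (s - 1)) * indicator {l. ennreal (l powr \<alpha>) < h x} l)) \<partial>lborel) \<partial>lborel)"
  proof (rule nn_integral_cong)
    fix l :: real
    have "(\<integral>\<^sup>+x. w x * (indicator {0<..} l * (ennreal (l powr (s - 1)) * indicator {l. ennreal (l powr \<alpha>) < h x} l)) \<partial>lborel)
       = (\<integral>\<^sup>+x. (indicator {0<..} l * ennreal (l powr (s - 1))) * (w x * indicator {x. ennreal (l powr \<alpha>) < h x} x) \<partial>lborel)"
      by (intro nn_integral_cong) (auto simp: indicator_def mult_ac)
    also have "\<dots> = (indicator {0<..} l * ennreal (l powr (s - 1))) * (\<integral>\<^sup>+x. w x * indicator {x. ennreal (l powr \<alpha>) < h x} x \<partial>lborel)"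
      by (rule nn_integral_cmult) measurable
    finally show "indicator {0<..} l * (ennreal (l powr (s - 1)) * (\<integral>\<^sup>+x. w x * indicator {x. ennreal (l powr \<alpha>) < h x} x \<partial>lborel))
      = (\<integral>\<^sup>+x. w x * (indicator {0<..} l * (ennreal (l powr (s - 1)) * indicator {l. ennreal (l powr \<alpha>) < h x} l)) \<partial>lborel)"
      by (simp only: mult.assoc)
  qed
  also have "\<dots> = (\<integral>\<^sup>+x. (\<integral>\<^sup>+l. w x * (indicator {0<..} l * (ennreal (l powr (s - 1)) * indicator {l. ennreal (l powr \<alpha>) < h x} l)) \<partial>lborel) \<partial>lborel)"
    by (rule lborel_pair.Fubini'[where f="\<lambda>x l. w x * (indicator {0<..} l * (ennreal (l powr (s - 1)) * indicator {l. ennreal (l powr \<alpha>) < h x} l))"]) measurable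
  also have "\<dots> = (\<integral>\<^sup>+x. ennreal (1 / s) * (w x * epowr (h x) (s / \<alpha>)) \<partial>lborel)"
  proof (rule nn_integral_cong)
    fix x
    have "(\<integral>\<^sup>+l. w x * (indicator {0<..} l * (ennreal (l powr (s - 1)) * indicator {l. ennreal (l powr \<alpha>) < h x} l)) \<partial>lborel)
       = w x * (\<integral>\<^sup>+l. indicator {0<..} l * (ennreal (l powr (s - 1)) * indicator {l. ennreal (l powr \<alpha>) < h x} l) \<partial>lborel)"
      by (rule nn_integral_cmult) measurable
    then show "(\<integral>\<^sup>+l. w x * (indicator {0<..} l * (ennreal (l powr (s - 1)) * indicator {l. ennreal (l powr \<alpha>) < h x} l)) \<partial>lborel)
       = ennreal (1 / s) * (w x * epowr (h x) (s / \<alpha>))"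
      unfolding nn_integral_powr_level[OF s \<alpha> h] by (simp only: mult_ac)
  qed
  also have "\<dots> = ennreal (1 / s) * (\<integral>\<^sup>+x. w x * epowr (h x) (s / \<alpha>) \<partial>lborel)"
    by (rule nn_integral_cmult) measurable
  finally show ?thesis .
qed

context scale_average
begin

text \<open>The local part plus the sum over \<open>j\<close> and \<open>k\<close> of the errors
  \<open>3 * 2 powr (- (\<kappa> * (j + k)))\<close>.\<close>

definition level_const :: real where
  "level_const = local_const + 3 * (1 / (1 - 2 powr (- \<kappa>)))\<^sup>2"

text \<open>The 1 pays for the two superlevel sets themselves, the other summand for the exceptional
  sets of all pairs of layers.\<close>

definition measure_const :: real where
  "measure_const = 1 + pair_const * (1 / (1 - 2 powr (- (2 * \<kappa>))))\<^sup>2"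

text \<open>Off \<open>\<Omega>\<close>, \<open>\<Omega>'\<close> and the exceptional sets, the
  bound by layers holds at every scale, and the errors form a convergent double geometric series.
  For a fixed pair \<open>j\<close>, \<open>k\<close> the exceptional sets of the different scales
  are paid for by the disjoint layers \<open>l + j\<close> and \<open>l + k\<close>, so their total
  measure does not depend on \<open>L\<close>. Lower semicontinuity of \<open>f\<close> and
  \<open>g\<close> lets their maximal functions serve as majorants at every point, and off the two
  sets bounds the functions by 1.\<close>

lemma level_set_estimate:
  fixes f g :: "'a \<Rightarrow> real" and L :: nat
  assumes f: "bdd_supp f" and g: "bdd_supp g" and f0: "\<And>x. 0 \<le> f x" and g0: "\<And>x. 0 \<le> g x"
    and fo: "\<And>c. open {x. c < ennreal (f x)}" and go: "\<And>c. open {x. c < ennreal (g x)}"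
  defines "F \<equiv> \<lambda>x. ennreal (f x)" and "G \<equiv> \<lambda>x. ennreal (g x)"
  shows "emeasure lborel {x. \<exists>l\<in>{- int L..int L}. ennreal level_const < posavg M (2 powr (- real_of_int l)) F G x}
    \<le> ennreal measure_const * ((\<integral>\<^sup>+x. epowr (hl F x) p1 * indicator {x. 1 < hl F x} x \<partial>lborel)
        + (\<integral>\<^sup>+x. epowr (hl G x) q1 * indicator {x. 1 < hl G x} x \<partial>lborel))"
proof -
  note [measurable] = bdd_supp_measurable[OF f] bdd_supp_measurable[OF g]
  define \<Omega> where "\<Omega> = {x. 1 < hl F x}"
  define \<Omega>' where "\<Omega>' = {x. 1 < hl G x}"
  have op: "open \<Omega>" "open \<Omega>'" unfolding \<Omega>_def \<Omega>'_def by (rule open_hl_greater)+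
  have [measurable]: "\<Omega> \<in> sets borel" "\<Omega>' \<in> sets borel" using op by auto
  define T where "T l = (2::real) powr (- real_of_int l)" for l
  define FF where "FF l j x = F x * indicator (layer \<Omega> (l + int j)) x" for l x and j :: nat
  define GG where "GG l j x = G x * indicator (layer \<Omega>' (l + int j)) x" for l x and j :: nat
  define V where "V E = (\<integral>\<^sup>+x. epowr (hl F x) p1 * indicator E x \<partial>lborel)" for E
  define V' where "V' E = (\<integral>\<^sup>+x. epowr (hl G x) q1 * indicator E x \<partial>lborel)" for E
  have Tp: "0 < T l" for l by (simp add: T_def)
  define Q where "Q l j k S \<longleftrightarrow> S \<in> sets borel \<and> emeasure lborel S \<le> ennreal (pair_const * 2 powr (- (2 * \<kappa> * real (j + k))))
          * (V (layer \<Omega> (l + int j)) + V' (layer \<Omega>' (l + int k))) \<and>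
      (\<forall>x. x \<notin> S \<longrightarrow> posavg M (T l) (FF l j) (GG l k) x \<le> posavg M (T l) (ball_mean (T l * 2 powr (- real j)) (FF l j)) (GG l k) x
          + posavg M (T l) (FF l j) (ball_mean (T l * 2 powr (- real k)) (GG l k)) x + ennreal (3 * 2 powr (- (\<kappa> * real (j + k)))))"
    for l :: int and j k :: nat and S :: "'a set"
  have "\<exists>S. Q l j k S" for l j k
  proof -
    have a: "1 \<le> hl F x" if "x \<in> layer \<Omega> (l + int j)" for x
      using that layer_subset[of \<Omega> "l + int j"] by (auto simp: \<Omega>_def)
    have b: "1 \<le> hl G x" if "x \<in> layer \<Omega>' (l + int k)" for x
      using that layer_subset[of \<Omega>' "l + int k"] by (auto simp: \<Omega>'_def)
    have c: "ennreal (f x) \<le> hl F x" "ennreal (g x) \<le> hl G x" for x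
      unfolding F_def G_def using le_hl_of_open_superlevel[OF fo] le_hl_of_open_superlevel[OF go] by auto
    have cA: "x \<in> layer \<Omega> (l + int j) \<Longrightarrow> ennreal (f x) \<le> hl F x" for x by (rule c(1))
    have cB: "x \<in> layer \<Omega>' (l + int k) \<Longrightarrow> ennreal (g x) \<le> hl G x" for x by (rule c(2))
    from layer_pair_error[where j=j and k=k and t="T l" and A="layer \<Omega> (l + int j)" and A'="layer \<Omega>' (l + int k)" and u="hl F" and v="hl G",
        OF f g f0 g0 layer_in_sets layer_in_sets cA a cB b borel_measurable_hl borel_measurable_hl Tp]
    show ?thesis
      unfolding Q_def V_def V'_def FF_def GG_def F_def G_def Bex_def .
  qed
  then obtain S where S: "\<And>l j k. Q l j k (S l j k)" by metis
  then have S_sets[measurable]: "S l j k \<in> sets borel" for l j k unfolding Q_def by blast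
  define U where "U = (\<lambda>j k. \<Union>l\<in>{- int L..int L}. S l j k)"
  have U_sets[measurable]: "U j k \<in> sets borel" for j k unfolding U_def by (intro sets.finite_UN) auto
  \<comment> \<open>At most one \<open>l\<close> contributes at each point, because \<open>j\<close>
    is fixed; the sum over scales therefore costs no more than a single integral over the whole
    set.\<close>
  have layers: "(\<Sum>l\<in>{- int L..int L}. (\<integral>\<^sup>+x. \<phi> x * indicator (layer \<Theta> (l + int j)) x \<partial>lborel)) \<le> (\<integral>\<^sup>+x. \<phi> x * indicator \<Theta> x \<partial>lborel)"
    if [measurable]: "\<phi> \<in> borel_measurable borel" for \<phi> :: "'a \<Rightarrow> ennreal" and \<Theta> j
  proof -
    have "(\<Sum>l\<in>{- int L..int L}. (\<integral>\<^sup>+x. \<phi> x * indicator (layer \<Theta> (l + int j)) x \<partial>lborel))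
       = (\<integral>\<^sup>+x. (\<Sum>l\<in>{- int L..int L}. \<phi> x * indicator (layer \<Theta> (l + int j)) x) \<partial>lborel)"
      by (rule nn_integral_sum[symmetric]) measurable
    also have "\<dots> \<le> (\<integral>\<^sup>+x. \<phi> x * indicator \<Theta> x \<partial>lborel)"
    proof (rule nn_integral_mono)
      fix x
      show "(\<Sum>l\<in>{- int L..int L}. \<phi> x * indicator (layer \<Theta> (l + int j)) x) \<le> \<phi> x * indicator \<Theta> x"
      proof (cases "\<exists>l\<in>{- int L..int L}. x \<in> layer \<Theta> (l + int j)")
        case True
        then obtain l where l: "l \<in> {- int L..int L}" "x \<in> layer \<Theta> (l + int j)" by blast
        have "(\<Sum>l\<in>{- int L..int L}. \<phi> x * indicator (layer \<Theta> (l + int j)) x) = (\<Sum>l'\<in>{l}. \<phi> x * indicator (layer \<Theta> (l' + int j)) x)"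
        proof (rule sum.mono_neutral_right)
          show "\<forall>i\<in>{- int L..int L} - {l}. \<phi> x * indicator (layer \<Theta> (i + int j)) x = 0"
          proof
            fix i assume "i \<in> {- int L..int L} - {l}"
            then have "x \<notin> layer \<Theta> (i + int j)" using layer_disjoint[OF _ l(2), of "i + int j"] by auto
            then show "\<phi> x * indicator (layer \<Theta> (i + int j)) x = 0" by simp
          qed
        qed (use l in auto)
        moreover have "x \<in> \<Theta>" using l(2) layer_subset by blast
        ultimately show ?thesis using l by simp
      qed (simp add: sum.neutral)
    qed
    finally show ?thesis .
  qed
  have Um: "emeasure lborel (U j k) \<le> ennreal (pair_const * 2 powr (- (2 * \<kappa> * real (j + k)))) * (V \<Omega> + V' \<Omega>')" for j k
  proof -
    have "emeasure lborel (U j k) \<le> (\<Sum>l\<in>{- int L..int L}. emeasure lborel (S l j k))"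
      unfolding U_def by (rule emeasure_subadditive_finite) auto
    also have "\<dots> \<le> (\<Sum>l\<in>{- int L..int L}. ennreal (pair_const * 2 powr (- (2 * \<kappa> * real (j + k)))) * (V (layer \<Omega> (l + int j)) + V' (layer \<Omega>' (l + int k))))"
      using S unfolding Q_def by (intro sum_mono) blast
    also have "\<dots> = ennreal (pair_const * 2 powr (- (2 * \<kappa> * real (j + k)))) * ((\<Sum>l\<in>{- int L..int L}. V (layer \<Omega> (l + int j))) + (\<Sum>l\<in>{- int L..int L}. V' (layer \<Omega>' (l + int k))))"
      by (simp only: sum_distrib_left[symmetric] sum.distrib)
    also have "\<dots> \<le> ennreal (pair_const * 2 powr (- (2 * \<kappa> * real (j + k)))) * (V \<Omega> + V' \<Omega>')"
      unfolding V_def V'_def by (intro mult_left_mono add_mono layers) measurable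
    finally show ?thesis .
  qed
  \<comment> \<open>Chebyshev's inequality: the maximal functions exceed 1 on these sets.\<close>
  have Omega: "emeasure lborel \<Omega> \<le> V \<Omega>" "emeasure lborel \<Omega>' \<le> V' \<Omega>'"
  proof -
    have one: "1 \<le> epowr y s" if "1 \<le> y" "0 \<le> s" for y s
      using epowr_mono[OF that(1), of s] that epowr_ennreal[of 1 s] by simp
    have "emeasure lborel \<Omega> = (\<integral>\<^sup>+x. indicator \<Omega> x \<partial>lborel)" by simp
    also have "\<dots> \<le> V \<Omega>" unfolding V_def using pos by (intro nn_integral_mono) (auto simp: indicator_def \<Omega>_def intro!: one)
    finally show "emeasure lborel \<Omega> \<le> V \<Omega>" .
    have "emeasure lborel \<Omega>' = (\<integral>\<^sup>+x. indicator \<Omega>' x \<partial>lborel)" by simp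
    also have "\<dots> \<le> V' \<Omega>'" unfolding V'_def using pos by (intro nn_integral_mono) (auto simp: indicator_def \<Omega>'_def intro!: one)
    finally show "emeasure lborel \<Omega>' \<le> V' \<Omega>'" .
  qed
  have off: "f y \<le> 1 \<and> hl F y \<le> 1" if "y \<notin> \<Omega>" for y
  proof -
    have "hl F y \<le> 1" using that by (simp add: \<Omega>_def)
    moreover have "ennreal (f y) \<le> hl F y" unfolding F_def by (rule le_hl_of_open_superlevel[OF fo])
    ultimately have "ennreal (f y) \<le> 1" by (rule order_trans[rotated])
    then show ?thesis using \<open>hl F y \<le> 1\<close> by (simp add: ennreal_le_1)
  qed
  have off': "g y \<le> 1 \<and> hl G y \<le> 1" if "y \<notin> \<Omega>'" for y
  proof -
    have "hl G y \<le> 1" using that by (simp add: \<Omega>'_def)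
    moreover have "ennreal (g y) \<le> hl G y" unfolding G_def by (rule le_hl_of_open_superlevel[OF go])
    ultimately have "ennreal (g y) \<le> 1" by (rule order_trans[rotated])
    then show ?thesis using \<open>hl G y \<le> 1\<close> by (simp add: ennreal_le_1)
  qed
  have loc0: "0 \<le> local_const" unfolding local_const_def using K0 by simp
  have sub: "{x. \<exists>l\<in>{- int L..int L}. ennreal level_const < posavg M (2 powr (- real_of_int l)) F G x}
     \<subseteq> (\<Omega> \<union> \<Omega>') \<union> (\<Union>j. \<Union>k. U j k)"
  proof (intro subsetI, rule ccontr)
    fix x assume "x \<in> {x. \<exists>l\<in>{- int L..int L}. ennreal level_const < posavg M (2 powr (- real_of_int l)) F G x}"
      and nx: "x \<notin> (\<Omega> \<union> \<Omega>') \<union> (\<Union>j. \<Union>k. U j k)"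
    then obtain l where l: "l \<in> {- int L..int L}" "ennreal level_const < posavg M (T l) F G x" by (auto simp: T_def)
    have "posavg M (T l) F G x \<le> ennreal local_const + (\<Sum>j. \<Sum>k. ennreal (3 * 2 powr (- (\<kappa> * real (j + k)))))"
      unfolding F_def G_def T_def
    proof (rule posavg_layer_bound[where \<Omega>=\<Omega> and \<Omega>'=\<Omega>'])
      fix j k
      have "x \<notin> S l j k" using nx l(1) by (auto simp: U_def)
      then show "posavg M (2 powr (- real_of_int l)) (\<lambda>x. ennreal (f x) * indicator (layer \<Omega> (l + int j)) x) (\<lambda>x. ennreal (g x) * indicator (layer \<Omega>' (l + int k)) x) x
        \<le> posavg M (2 powr (- real_of_int l)) (ball_mean (2 powr (- real_of_int l) * 2 powr (- real j)) (\<lambda>x. ennreal (f x) * indicator (layer \<Omega> (l + int j)) x)) (\<lambda>x. ennreal (g x) * indicator (layer \<Omega>' (l + int k)) x) x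
         + posavg M (2 powr (- real_of_int l)) (\<lambda>x. ennreal (f x) * indicator (layer \<Omega> (l + int j)) x) (ball_mean (2 powr (- real_of_int l) * 2 powr (- real k)) (\<lambda>x. ennreal (g x) * indicator (layer \<Omega>' (l + int k)) x)) x
         + ennreal (3 * 2 powr (- (\<kappa> * real (j + k))))"
        using S[of l j k] unfolding Q_def FF_def GG_def F_def G_def T_def by blast
    qed (use op nx off off' in \<open>auto simp: F_def G_def\<close>)
    also have "(\<Sum>j. \<Sum>k. ennreal (3 * 2 powr (- (\<kappa> * real (j + k))))) = ennreal (3 * (1 / (1 - 2 powr (- \<kappa>)))\<^sup>2)"
      by (rule suminf_geometric_double) (use pos in auto)
    also have "ennreal local_const + \<dots> = ennreal level_const"
      unfolding level_const_def using loc0 by (intro ennreal_plus[symmetric]) auto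
    finally show False using l(2) by simp
  qed
  have "emeasure lborel {x. \<exists>l\<in>{- int L..int L}. ennreal level_const < posavg M (2 powr (- real_of_int l)) F G x}
     \<le> emeasure lborel ((\<Omega> \<union> \<Omega>') \<union> (\<Union>j. \<Union>k. U j k))"
    by (rule emeasure_mono[OF sub]) auto
  also have "\<dots> \<le> emeasure lborel (\<Omega> \<union> \<Omega>') + emeasure lborel (\<Union>j. \<Union>k. U j k)"
    by (rule emeasure_subadditive) auto
  also have "\<dots> \<le> (V \<Omega> + V' \<Omega>') + ennreal (pair_const * (1 / (1 - 2 powr (- (2 * \<kappa>))))\<^sup>2) * (V \<Omega> + V' \<Omega>')"
  proof (rule add_mono)
    show "emeasure lborel (\<Omega> \<union> \<Omega>') \<le> V \<Omega> + V' \<Omega>'"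
      by (rule order_trans[OF emeasure_subadditive add_mono[OF Omega]]) auto
    have "emeasure lborel (\<Union>j. \<Union>k. U j k) \<le> (\<Sum>j. emeasure lborel (\<Union>k. U j k))"
      by (rule emeasure_subadditive_countably) auto
    also have "\<dots> \<le> (\<Sum>j. \<Sum>k. emeasure lborel (U j k))"
      by (intro suminf_le emeasure_subadditive_countably) auto
    also have "\<dots> \<le> (\<Sum>j. \<Sum>k. ennreal (pair_const * 2 powr (- (2 * \<kappa> * real (j + k)))) * (V \<Omega> + V' \<Omega>'))"
      by (intro suminf_le Um) auto
    also have "\<dots> = (\<Sum>j. \<Sum>k. ennreal (pair_const * 2 powr (- (2 * \<kappa> * real (j + k))))) * (V \<Omega> + V' \<Omega>')"
      by (simp only: ennreal_suminf_multc)
    also have "(\<Sum>j. \<Sum>k. ennreal (pair_const * 2 powr (- (2 * \<kappa> * real (j + k))))) = ennreal (pair_const * (1 / (1 - 2 powr (- (2 * \<kappa>))))\<^sup>2)"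
      by (rule suminf_geometric_double) (use pos pair_const_nonneg in auto)
    finally show "emeasure lborel (\<Union>j. \<Union>k. U j k) \<le> ennreal (pair_const * (1 / (1 - 2 powr (- (2 * \<kappa>))))\<^sup>2) * (V \<Omega> + V' \<Omega>')" .
  qed
  also have "\<dots> = (1 + ennreal (pair_const * (1 / (1 - 2 powr (- (2 * \<kappa>))))\<^sup>2)) * (V \<Omega> + V' \<Omega>')"
    by (simp only: distrib_right mult_1_left)
  also have "1 + ennreal (pair_const * (1 / (1 - 2 powr (- (2 * \<kappa>))))\<^sup>2) = ennreal measure_const"
    unfolding measure_const_def using pair_const_nonneg by (subst ennreal_plus) auto
  finally show ?thesis unfolding V_def V'_def \<Omega>_def \<Omega>'_def .
qed

end

section \<open>Strong type bounds\<close>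

lemma open_superlevel_ennreal:
  assumes "\<And>c::real. open {x. c < f x}"
  shows "open {x. c < ennreal (f x)}"
proof (cases c)
  case (real r)
  then have "{x. c < ennreal (f x)} = {x. r < f x}" by (auto simp: ennreal_less_iff)
  then show ?thesis using assms by simp
qed simp

lemma one_less_cmult_iff:
  assumes "0 < a" shows "1 < ennreal (1 / a) * y \<longleftrightarrow> ennreal a < y"
proof (cases y)
  case (real r)
  then have "1 < ennreal (1 / a) * y \<longleftrightarrow> ennreal 1 < ennreal (1 / a * r)"
    using assms by (simp add: ennreal_mult[symmetric])
  also have "\<dots> \<longleftrightarrow> 1 < 1 / a * r" by (rule ennreal_less_iff) simp
  also have "\<dots> \<longleftrightarrow> a < r" using assms by (simp add: field_simps)
  finally show ?thesis using real assms by (simp add: ennreal_less_iff)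
qed (use assms in \<open>simp add: ennreal_mult_top\<close>)

context averaging_measure
begin

lemma posavg_bounded:
  assumes "\<And>x. f x \<le> ennreal B" "\<And>x. g x \<le> ennreal B'" "0 \<le> B" "0 \<le> B'"
  shows "posavg M t f g x \<le> ennreal (B * B' * measure M UNIV)"
proof -
  have "posavg M t f g x \<le> (\<integral>\<^sup>+w. ennreal (B * B') \<partial>M)"
    unfolding posavg_def using assms by (intro nn_integral_mono) (auto simp: ennreal_mult intro!: mult_mono)
  also have "\<dots> = ennreal (B * B' * measure M UNIV)"
    using assms by (simp add: emeasure_eq_measure ennreal_mult)
  finally show ?thesis .
qed

end

context scale_average
begin

lemma level_const_pos: "0 < level_const"
proof -
  have "2 powr (- \<kappa>) \<noteq> 1" using pos by simp
  then have "0 < (1 / (1 - 2 powr (- \<kappa>)))\<^sup>2" by simp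
  then show ?thesis unfolding level_const_def local_const_def using K0 by (intro add_nonneg_pos) auto
qed

lemma measure_const_nonneg: "0 \<le> measure_const"
  unfolding measure_const_def using pair_const_nonneg by simp

text \<open>Only scales with \<open>\<bar>l\<bar> \<le> L\<close>, in bounds that do not depend on
  \<open>L\<close>; the restriction is lifted by monotone convergence together with the truncation
  of the functions.\<close>

definition maximal :: "nat \<Rightarrow> ('a \<Rightarrow> ennreal) \<Rightarrow> ('a \<Rightarrow> ennreal) \<Rightarrow> 'a \<Rightarrow> ennreal" where
  "maximal L F G x = (SUP l\<in>{- int L..int L}. posavg M (2 powr (- real_of_int l)) F G x)"

text \<open>The estimate at height 1 applied to \<open>f / a\<close> and \<open>g / b\<close>: the
  average is homogeneous of degree one in each function, and so is the maximal function. Taking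
  \<open>a\<close> and \<open>b\<close> apart leaves the freedom to match the homogeneities of the
  two norms.\<close>

lemma level_set_scaled:
  fixes f g :: "'a \<Rightarrow> real"
  assumes f: "bdd_supp f" and g: "bdd_supp g" and f0: "\<And>x. 0 \<le> f x" and g0: "\<And>x. 0 \<le> g x"
    and fo: "\<And>c. open {x. c < f x}" and go: "\<And>c. open {x. c < g x}"
    and ab: "0 < a" "0 < b"
  defines "F \<equiv> \<lambda>x. ennreal (f x)" and "G \<equiv> \<lambda>x. ennreal (g x)"
  shows "emeasure lborel {x. ennreal (a * b) < ennreal (1 / level_const) * maximal L F G x}
    \<le> ennreal measure_const * (ennreal (a powr (- p1)) * (\<integral>\<^sup>+x. epowr (hl F x) p1 * indicator {x. ennreal a < hl F x} x \<partial>lborel)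
        + ennreal (b powr (- q1)) * (\<integral>\<^sup>+x. epowr (hl G x) q1 * indicator {x. ennreal b < hl G x} x \<partial>lborel))"
proof -
  note [measurable] = bdd_supp_measurable[OF f] bdd_supp_measurable[OF g]
  have Fm[measurable]: "F \<in> borel_measurable borel" "G \<in> borel_measurable borel" unfolding F_def G_def by measurable
  let ?F = "\<lambda>x. ennreal (1 / a * f x)" and ?G = "\<lambda>x. ennreal (1 / b * g x)"
  have FF: "?F = (\<lambda>x. ennreal (1 / a) * F x)" "?G = (\<lambda>x. ennreal (1 / b) * G x)"
    unfolding F_def G_def using ab f0 g0 by (auto simp: fun_eq_iff ennreal_mult[symmetric])
  have hlF: "hl ?F x = ennreal (1 / a) * hl F x" "hl ?G x = ennreal (1 / b) * hl G x" for x
    unfolding FF using ab by (intro hl_cmult; simp)+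
  have PA: "posavg M t ?F ?G x = ennreal (1 / (a * b)) * posavg M t F G x" for t x
  proof -
    have "posavg M t ?F ?G x = ennreal (1 / a) * posavg M t F ?G x"
      unfolding FF(1) by (rule posavg_cmult_left) measurable
    also have "posavg M t F ?G x = ennreal (1 / b) * posavg M t F G x"
      unfolding FF(2) by (rule posavg_cmult_right) measurable
    also have "ennreal (1 / a) * (ennreal (1 / b) * posavg M t F G x) = ennreal (1 / a * (1 / b)) * posavg M t F G x"
      using ab by (subst ennreal_mult) (auto simp: mult.assoc)
    finally show ?thesis by simp
  qed
  have eqset: "{x. ennreal (a * b) < ennreal (1 / level_const) * maximal L F G x}
     = {x. \<exists>l\<in>{- int L..int L}. ennreal level_const < posavg M (2 powr (- real_of_int l)) ?F ?G x}"
  proof -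
    have iff: "ennreal (a * b) < ennreal (1 / level_const) * y \<longleftrightarrow> ennreal level_const < ennreal (1 / (a * b)) * y" for y
    proof (cases y)
      case (real r)
      have "ennreal (a * b) < ennreal (1 / level_const) * y \<longleftrightarrow> a * b < 1 / level_const * r"
        using real ab level_const_pos by (simp add: ennreal_mult[symmetric] ennreal_less_iff)
      also have "\<dots> \<longleftrightarrow> level_const < 1 / (a * b) * r" using ab level_const_pos by (simp add: field_simps)
      also have "\<dots> \<longleftrightarrow> ennreal level_const < ennreal (1 / (a * b)) * y"
        using real ab level_const_pos by (simp add: ennreal_mult[symmetric] ennreal_less_iff)
      finally show ?thesis .
    qed (use ab level_const_pos in \<open>simp add: ennreal_mult_top\<close>)
    have "ennreal (1 / level_const) * maximal L F G x = (SUP l\<in>{- int L..int L}. ennreal (1 / level_const) * posavg M (2 powr (- real_of_int l)) F G x)" for x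
      unfolding maximal_def by (rule SUP_mult_left_ennreal)
    then show ?thesis unfolding PA by (simp add: less_SUP_iff iff)
  qed
  have est: "emeasure lborel {x. \<exists>l\<in>{- int L..int L}. ennreal level_const < posavg M (2 powr (- real_of_int l)) ?F ?G x} \<le> ennreal measure_const * ((\<integral>\<^sup>+x. epowr (hl ?F x) p1 * indicator {x. 1 < hl ?F x} x \<partial>lborel)
        + (\<integral>\<^sup>+x. epowr (hl ?G x) q1 * indicator {x. 1 < hl ?G x} x \<partial>lborel))"
  proof (rule level_set_estimate)
    show "bdd_supp (\<lambda>x. 1 / a * f x)" "bdd_supp (\<lambda>x. 1 / b * g x)" by (intro bdd_supp_cmult f g)+
    have ea: "c < 1 / a * f x \<longleftrightarrow> c * a < f x" for c x using ab by (simp add: pos_less_divide_eq)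
    show "open {x. c < ennreal (1 / a * f x)}" for c
      by (rule open_superlevel_ennreal) (simp only: ea fo)
    have eb: "c < 1 / b * g x \<longleftrightarrow> c * b < g x" for c x using ab by (simp add: pos_less_divide_eq)
    show "open {x. c < ennreal (1 / b * g x)}" for c
      by (rule open_superlevel_ennreal) (simp only: eb go)
  qed (use f0 g0 ab in auto)
  have i1: "(\<integral>\<^sup>+x. epowr (hl ?F x) p1 * indicator {x. 1 < hl ?F x} x \<partial>lborel)
     = ennreal (a powr (- p1)) * (\<integral>\<^sup>+x. epowr (hl F x) p1 * indicator {x. ennreal a < hl F x} x \<partial>lborel)"
  proof -
    have "(1 / a) powr p1 = a powr (- p1)" using ab by (simp add: powr_divide powr_minus inverse_eq_divide)
    then have "epowr (ennreal (1 / a)) p1 = ennreal (a powr (- p1))" using ab by (subst epowr_ennreal) auto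
    then have "(\<integral>\<^sup>+x. epowr (hl ?F x) p1 * indicator {x. 1 < hl ?F x} x \<partial>lborel)
      = (\<integral>\<^sup>+x. ennreal (a powr (- p1)) * (epowr (hl F x) p1 * indicator {x. ennreal a < hl F x} x) \<partial>lborel)"
      unfolding hlF one_less_cmult_iff[OF ab(1)] using pos by (simp add: epowr_mult mult.assoc)
    also have "\<dots> = ennreal (a powr (- p1)) * (\<integral>\<^sup>+x. epowr (hl F x) p1 * indicator {x. ennreal a < hl F x} x \<partial>lborel)"
      by (rule nn_integral_cmult) measurable
    finally show ?thesis .
  qed
  have i2: "(\<integral>\<^sup>+x. epowr (hl ?G x) q1 * indicator {x. 1 < hl ?G x} x \<partial>lborel)
     = ennreal (b powr (- q1)) * (\<integral>\<^sup>+x. epowr (hl G x) q1 * indicator {x. ennreal b < hl G x} x \<partial>lborel)"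
  proof -
    have "(1 / b) powr q1 = b powr (- q1)" using ab by (simp add: powr_divide powr_minus inverse_eq_divide)
    then have "epowr (ennreal (1 / b)) q1 = ennreal (b powr (- q1))" using ab by (subst epowr_ennreal) auto
    then have "(\<integral>\<^sup>+x. epowr (hl ?G x) q1 * indicator {x. 1 < hl ?G x} x \<partial>lborel)
      = (\<integral>\<^sup>+x. ennreal (b powr (- q1)) * (epowr (hl G x) q1 * indicator {x. ennreal b < hl G x} x) \<partial>lborel)"
      unfolding hlF one_less_cmult_iff[OF ab(2)] using pos by (simp add: epowr_mult mult.assoc)
    also have "\<dots> = ennreal (b powr (- q1)) * (\<integral>\<^sup>+x. epowr (hl G x) q1 * indicator {x. ennreal b < hl G x} x \<partial>lborel)"
      by (rule nn_integral_cmult) measurable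
    finally show ?thesis .
  qed
  show ?thesis unfolding eqset by (rule order_trans[OF est]) (simp only: i1 i2 order_refl)
qed

text \<open>With the threshold \<open>l powr (r / p)\<close> the powers of \<open>l\<close> combine
  to the exponent \<open>S - 1\<close>, where \<open>S = r / p * (p - s)\<close> is positive because
  \<open>s < p\<close>; this is convergence near 0. The layer-cake formula then raises the exponent
  of the maximal function from \<open>s\<close> to \<open>p\<close>, where the strong bound
  applies.\<close>

lemma level_integral_hl:
  fixes f :: "'a \<Rightarrow> real" and s p r :: real
  assumes f: "bdd_supp f" and f0: "\<And>x. 0 \<le> f x" and p: "1 < p" "s < p" "0 < s" and r: "0 < r"
  defines "F \<equiv> \<lambda>x. ennreal (f x)"
  shows "(\<integral>\<^sup>+l. indicator {0<..} l * (ennreal (l powr (r - 1)) * (ennreal ((l powr (r / p)) powr (- s))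
       * (\<integral>\<^sup>+x. epowr (hl F x) s * indicator {x. ennreal (l powr (r / p)) < hl F x} x \<partial>lborel))) \<partial>lborel)
    \<le> ennreal (p / (r * (p - s)) * (p / (p - 1) * 2 powr p * 5 ^ DIM('a))) * (\<integral>\<^sup>+x. epowr (F x) p \<partial>lborel)"
proof -
  note [measurable] = bdd_supp_measurable[OF f]
  have Fm[measurable]: "F \<in> borel_measurable borel" unfolding F_def by measurable
  obtain B where B: "0 \<le> B" "\<And>x. \<bar>f x\<bar> \<le> B" using bdd_supp_bounded[OF f] by auto
  have FB: "F x \<le> ennreal B" for x unfolding F_def using B(2)[of x] by (intro ennreal_leI) simp
  have hfin: "hl F x \<noteq> top" for x using hl_le_const[of F "ennreal B" x] FB by (auto simp: top_unique)
  define S where "S = r / p * (p - s)"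
  have S: "0 < S" "S / (r / p) = p - s" "S - 1 = (r - 1) + r / p * (- s)" unfolding S_def using p r by (auto simp: field_simps)
  have "(\<integral>\<^sup>+l. indicator {0<..} l * (ennreal (l powr (r - 1)) * (ennreal ((l powr (r / p)) powr (- s))
       * (\<integral>\<^sup>+x. epowr (hl F x) s * indicator {x. ennreal (l powr (r / p)) < hl F x} x \<partial>lborel))) \<partial>lborel)
    = (\<integral>\<^sup>+l. indicator {0<..} l * (ennreal (l powr (S - 1)) * (\<integral>\<^sup>+x. epowr (hl F x) s * indicator {x. ennreal (l powr (r / p)) < hl F x} x \<partial>lborel)) \<partial>lborel)"
  proof (rule nn_integral_cong)
    fix l :: real
    have "ennreal (l powr (r - 1)) * (ennreal ((l powr (r / p)) powr (- s)) * y) = ennreal (l powr (S - 1)) * y" for y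
    proof -
      have "l powr (r - 1) * (l powr (r / p)) powr (- s) = l powr (S - 1)"
        unfolding S(3) powr_add powr_powr ..
      then show ?thesis by (subst mult.assoc[symmetric], subst ennreal_mult[symmetric]) auto
    qed
    then show "indicator {0<..} l * (ennreal (l powr (r - 1)) * (ennreal ((l powr (r / p)) powr (- s))
       * (\<integral>\<^sup>+x. epowr (hl F x) s * indicator {x. ennreal (l powr (r / p)) < hl F x} x \<partial>lborel)))
      = indicator {0<..} l * (ennreal (l powr (S - 1)) * (\<integral>\<^sup>+x. epowr (hl F x) s * indicator {x. ennreal (l powr (r / p)) < hl F x} x \<partial>lborel))"
      by simp
  qed
  also have "\<dots> = ennreal (1 / S) * (\<integral>\<^sup>+x. epowr (hl F x) s * epowr (hl F x) (S / (r / p)) \<partial>lborel)"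
    by (rule layer_cake) (use hfin S p r in auto)
  also have "(\<integral>\<^sup>+x. epowr (hl F x) s * epowr (hl F x) (S / (r / p)) \<partial>lborel) = (\<integral>\<^sup>+x. epowr (hl F x) p \<partial>lborel)"
  proof (rule nn_integral_cong)
    fix x
    show "epowr (hl F x) s * epowr (hl F x) (S / (r / p)) = epowr (hl F x) p"
      unfolding S(2) using epowr_add[of "hl F x" s "p - s"] hfin[of x] by (cases "hl F x = 0") auto
  qed
  also have "ennreal (1 / S) * (\<integral>\<^sup>+x. epowr (hl F x) p \<partial>lborel)
     \<le> ennreal (1 / S) * (ennreal (p / (p - 1) * 2 powr p * 5 ^ DIM('a)) * (\<integral>\<^sup>+x. epowr (F x) p \<partial>lborel))"
    by (intro mult_left_mono hl_strong_type[OF Fm p(1) FB]) simp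
  also have "\<dots> = ennreal (p / (r * (p - s)) * (p / (p - 1) * 2 powr p * 5 ^ DIM('a))) * (\<integral>\<^sup>+x. epowr (F x) p \<partial>lborel)"
  proof -
    have "p / (r * (p - s)) = 1 / S" unfolding S_def by simp
    then show ?thesis using S(1) p by (simp only: mult.assoc[symmetric]) (subst ennreal_mult[symmetric], auto)
  qed
  finally show ?thesis .
qed

text \<open>At height \<open>l\<close> the thresholds are \<open>l powr (r / p)\<close> and
  \<open>l powr (r / q)\<close>. Their product is \<open>l\<close>, since
  \<open>r / p + r / q = 1\<close>, so integrating the level-set estimate against
  \<open>l powr (r - 1)\<close> gives the \<open>r\<close>-th power on the left, for
  \<open>r\<close> below 1 as well. Dividing by \<open>level_const\<close> makes the heights on both
  sides agree.\<close>

lemma maximal_strong_type: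
  fixes p q r :: real
  assumes p: "1 < p" "p1 < p" and q: "1 < q" "q1 < q" and r: "0 < r" "1 / r = 1 / p + 1 / q"
  obtains C where "0 \<le> C" "\<And>f g L. bdd_supp f \<Longrightarrow> bdd_supp g \<Longrightarrow> (\<And>x. 0 \<le> f x) \<Longrightarrow> (\<And>x. 0 \<le> g x) \<Longrightarrow>
     (\<And>c. open {x. c < f x}) \<Longrightarrow> (\<And>c. open {x. c < g x}) \<Longrightarrow>
     (\<integral>\<^sup>+x. epowr (maximal L (\<lambda>x. ennreal (f x)) (\<lambda>x. ennreal (g x)) x) r \<partial>lborel)
       \<le> ennreal C * ((\<integral>\<^sup>+x. epowr (ennreal (f x)) p \<partial>lborel) + (\<integral>\<^sup>+x. epowr (ennreal (g x)) q \<partial>lborel))"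
proof -
  define c1 where "c1 = p / (r * (p - p1)) * (p / (p - 1) * 2 powr p * 5 ^ DIM('a))"
  define c2 where "c2 = q / (r * (q - q1)) * (q / (q - 1) * 2 powr q * 5 ^ DIM('a))"
  have c: "0 \<le> c1" "0 \<le> c2" unfolding c1_def c2_def using p q r by auto
  define C where "C = level_const powr r * (r * (measure_const * (c1 + c2)))"
  have C0: "0 \<le> C" unfolding C_def using c r measure_const_nonneg by simp
  have ab: "r / p + r / q = 1"
  proof -
    have "r / p + r / q = r * (1 / p + 1 / q)" by (simp add: distrib_left)
    also have "\<dots> = r * (1 / r)" by (simp only: r(2))
    finally show ?thesis using r(1) by simp
  qed
  show thesis
  proof (rule that[OF C0])
    fix f g :: "'a \<Rightarrow> real" and L :: nat
    assume f: "bdd_supp f" and g: "bdd_supp g" and f0: "\<And>x. 0 \<le> f x" and g0: "\<And>x. 0 \<le> g x"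
      and fo: "\<And>c. open {x. c < f x}" and go: "\<And>c. open {x. c < g x}"
    note [measurable] = bdd_supp_measurable[OF f] bdd_supp_measurable[OF g]
    define F where "F = (\<lambda>x. ennreal (f x))"
    define G where "G = (\<lambda>x. ennreal (g x))"
    have FGm[measurable]: "F \<in> borel_measurable borel" "G \<in> borel_measurable borel" unfolding F_def G_def by measurable
    define h where "h x = ennreal (1 / level_const) * maximal L F G x" for x
    have mm[measurable]: "maximal L F G \<in> borel_measurable borel"
      unfolding maximal_def by (intro borel_measurable_SUP) auto
    have hm[measurable]: "h \<in> borel_measurable borel" unfolding h_def by measurable
    obtain B where B: "0 \<le> B" "\<And>x. \<bar>f x\<bar> \<le> B" using bdd_supp_bounded[OF f] by auto
    obtain B' where B': "0 \<le> B'" "\<And>x. \<bar>g x\<bar> \<le> B'" using bdd_supp_bounded[OF g] by auto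
    have "maximal L F G x \<le> ennreal (B * B' * measure M UNIV)" for x
      unfolding maximal_def F_def G_def
      using B B' by (intro SUP_least posavg_bounded ennreal_leI) (auto intro: order_trans[OF abs_ge_self])
    then have mfin: "maximal L F G x \<noteq> top" for x by (metis ennreal_neq_top top_unique)
    have hfin: "h x \<noteq> top" for x unfolding h_def using mfin by (simp add: ennreal_mult_eq_top_iff)
    let ?I = "\<integral>\<^sup>+x. epowr (F x) p \<partial>lborel" and ?J = "\<integral>\<^sup>+x. epowr (G x) q \<partial>lborel"
    let ?A = "\<lambda>l. \<integral>\<^sup>+x. epowr (hl F x) p1 * indicator {x. ennreal (l powr (r / p)) < hl F x} x \<partial>lborel"
    let ?B = "\<lambda>l. \<integral>\<^sup>+x. epowr (hl G x) q1 * indicator {x. ennreal (l powr (r / q)) < hl G x} x \<partial>lborel"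
    let ?a = "\<lambda>l. indicator {0<..} l * (ennreal (l powr (r - 1)) * (ennreal ((l powr (r / p)) powr (- p1)) * ?A l))"
    let ?b = "\<lambda>l. indicator {0<..} l * (ennreal (l powr (r - 1)) * (ennreal ((l powr (r / q)) powr (- q1)) * ?B l))"
    have lev: "(\<integral>\<^sup>+x. 1 * indicator {x. ennreal (l powr 1) < h x} x \<partial>lborel)
       \<le> ennreal measure_const * (ennreal ((l powr (r / p)) powr (- p1)) * ?A l + ennreal ((l powr (r / q)) powr (- q1)) * ?B l)" if l: "0 < l" for l
    proof -
      have e: "l powr (r / p) * l powr (r / q) = l" using l ab by (simp add: powr_add[symmetric])
      have "{x \<in> space lborel. ennreal l < h x} \<in> sets lborel" by measurable
      then have "(\<integral>\<^sup>+x. 1 * indicator {x. ennreal (l powr 1) < h x} x \<partial>lborel) = emeasure lborel {x. ennreal l < h x}"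
        using l by simp
      also have "\<dots> \<le> ennreal measure_const * (ennreal ((l powr (r / p)) powr (- p1)) * ?A l + ennreal ((l powr (r / q)) powr (- q1)) * ?B l)"
        using level_set_scaled[OF f g f0 g0 fo go, of "l powr (r / p)" "l powr (r / q)" L] l
        unfolding e h_def F_def G_def by simp
      finally show ?thesis .
    qed
    have "ennreal (1 / r) * (\<integral>\<^sup>+x. 1 * epowr (h x) (r / 1) \<partial>lborel)
       = (\<integral>\<^sup>+l. indicator {0<..} l * (ennreal (l powr (r - 1)) * (\<integral>\<^sup>+x. 1 * indicator {x. ennreal (l powr 1) < h x} x \<partial>lborel)) \<partial>lborel)"
      by (rule layer_cake[symmetric]) (use hfin r in auto)
    also have "\<dots> \<le> (\<integral>\<^sup>+l. ennreal measure_const * (?a l + ?b l) \<partial>lborel)"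
    proof (rule nn_integral_mono)
      fix l :: real
      show "indicator {0<..} l * (ennreal (l powr (r - 1)) * (\<integral>\<^sup>+x. 1 * indicator {x. ennreal (l powr 1) < h x} x \<partial>lborel)) \<le> ennreal measure_const * (?a l + ?b l)"
      proof (cases "0 < l")
        case True
        have "indicator {0<..} l * (ennreal (l powr (r - 1)) * (\<integral>\<^sup>+x. 1 * indicator {x. ennreal (l powr 1) < h x} x \<partial>lborel))
          \<le> indicator {0<..} l * (ennreal (l powr (r - 1)) * (ennreal measure_const * (ennreal ((l powr (r / p)) powr (- p1)) * ?A l + ennreal ((l powr (r / q)) powr (- q1)) * ?B l)))"
          by (intro mult_left_mono lev True) simp_all
        also have "\<dots> = ennreal measure_const * (?a l + ?b l)" by (simp only: distrib_left mult_ac)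
        finally show ?thesis .
      qed simp
    qed
    also have "\<dots> = ennreal measure_const * ((\<integral>\<^sup>+l. ?a l \<partial>lborel) + (\<integral>\<^sup>+l. ?b l \<partial>lborel))"
      by (subst nn_integral_cmult, measurable, subst nn_integral_add, measurable)
    also have "\<dots> \<le> ennreal measure_const * (ennreal c1 * ?I + ennreal c2 * ?J)"
    proof (intro mult_left_mono add_mono)
      show "(\<integral>\<^sup>+l. ?a l \<partial>lborel) \<le> ennreal c1 * ?I"
        unfolding c1_def F_def by (rule level_integral_hl) (use f f0 p r pos in auto)
      show "(\<integral>\<^sup>+l. ?b l \<partial>lborel) \<le> ennreal c2 * ?J"
        unfolding c2_def G_def by (rule level_integral_hl) (use g g0 q r pos in auto)
    qed simp
    also have "\<dots> \<le> ennreal measure_const * (ennreal (c1 + c2) * ?I + ennreal (c1 + c2) * ?J)"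
      using c by (intro mult_left_mono add_mono mult_right_mono ennreal_leI) auto
    also have "\<dots> = ennreal (measure_const * (c1 + c2)) * (?I + ?J)"
    proof -
      have "ennreal (measure_const * (c1 + c2)) = ennreal measure_const * ennreal (c1 + c2)"
        using c measure_const_nonneg by (intro ennreal_mult) auto
      then show ?thesis by (simp only: mult.assoc distrib_left)
    qed
    finally have "ennreal (1 / r) * (\<integral>\<^sup>+x. epowr (h x) r \<partial>lborel) \<le> ennreal (measure_const * (c1 + c2)) * (?I + ?J)" by simp
    then have "ennreal r * (ennreal (1 / r) * (\<integral>\<^sup>+x. epowr (h x) r \<partial>lborel)) \<le> ennreal r * (ennreal (measure_const * (c1 + c2)) * (?I + ?J))"
      by (rule mult_left_mono) simp
    moreover have "ennreal r * ennreal (1 / r) = 1" using r(1) by (subst ennreal_mult[symmetric]) auto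
    ultimately have hr: "(\<integral>\<^sup>+x. epowr (h x) r \<partial>lborel) \<le> ennreal r * (ennreal (measure_const * (c1 + c2)) * (?I + ?J))"
      by (simp only: mult.assoc[symmetric] mult_1_left)
    have "(\<integral>\<^sup>+x. epowr (maximal L F G x) r \<partial>lborel) = (\<integral>\<^sup>+x. ennreal (level_const powr r) * epowr (h x) r \<partial>lborel)"
    proof (rule nn_integral_cong)
      fix x
      have "maximal L F G x = ennreal level_const * h x"
        unfolding h_def using level_const_pos by (subst mult.assoc[symmetric], subst ennreal_mult[symmetric]) auto
      then show "epowr (maximal L F G x) r = ennreal (level_const powr r) * epowr (h x) r"
        using r level_const_pos by (simp add: epowr_mult epowr_ennreal)
    qed
    also have "\<dots> = ennreal (level_const powr r) * (\<integral>\<^sup>+x. epowr (h x) r \<partial>lborel)" by (rule nn_integral_cmult) measurable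
    also have "\<dots> \<le> ennreal (level_const powr r) * (ennreal r * (ennreal (measure_const * (c1 + c2)) * (?I + ?J)))"
      by (intro mult_left_mono hr) simp
    also have "\<dots> = ennreal C * (?I + ?J)"
      unfolding C_def using r c measure_const_nonneg
      by (subst ennreal_mult, simp, simp, subst ennreal_mult, simp, simp) (simp only: mult.assoc)
    finally show "(\<integral>\<^sup>+x. epowr (maximal L (\<lambda>x. ennreal (f x)) (\<lambda>x. ennreal (g x)) x) r \<partial>lborel)
       \<le> ennreal C * ((\<integral>\<^sup>+x. epowr (ennreal (f x)) p \<partial>lborel) + (\<integral>\<^sup>+x. epowr (ennreal (g x)) q \<partial>lborel))"
      unfolding F_def G_def .
  qed
qed

end

section \<open>From bounded lower semicontinuous functions to all Borel functions, and from finitely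
  many scales to all\<close>

lemma epowr_SUP_le:
  assumes "0 < s"
  shows "epowr (SUP i\<in>I. y i) s \<le> (SUP i\<in>I. epowr (y i) s)"
proof -
  have "y i \<le> epowr (SUP i\<in>I. epowr (y i) s) (1 / s)" if "i \<in> I" for i
  proof -
    have "epowr (y i) s \<le> (SUP i\<in>I. epowr (y i) s)" using that by (rule SUP_upper)
    then have "epowr (epowr (y i) s) (1 / s) \<le> epowr (SUP i\<in>I. epowr (y i) s) (1 / s)"
      using assms by (intro epowr_mono) auto
    then show ?thesis using assms by (simp add: epowr_epowr)
  qed
  then have "(SUP i\<in>I. y i) \<le> epowr (SUP i\<in>I. epowr (y i) s) (1 / s)" by (rule SUP_least)
  then have "epowr (SUP i\<in>I. y i) s \<le> epowr (epowr (SUP i\<in>I. epowr (y i) s) (1 / s)) s"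
    using assms by (intro epowr_mono) auto
  then show ?thesis using assms by (simp add: epowr_epowr)
qed

text \<open>Each dyadic level set of \<open>f\<close> is enclosed in an open set of almost the same
  measure, and \<open>H\<close> is the supremum of the upper dyadic values on these open sets.
  Rounding up costs at most a factor 2, hence \<open>2 powr p\<close>; the excess measures are
  chosen so that they contribute \<open>e / 2\<close>, \<open>e / 4\<close> and so on.\<close>

lemma lower_semicontinuous_majorant:
  fixes f :: "'a::euclidean_space \<Rightarrow> real"
  assumes [measurable]: "f \<in> borel_measurable borel" and f0: "\<And>x. 0 \<le> f x" and p: "0 < p" and e: "0 < e"
  obtains H :: "'a \<Rightarrow> ennreal" where "\<And>c. open {x. c < H x}" "\<And>x. ennreal (f x) \<le> H x"
    "(\<integral>\<^sup>+x. epowr (H x) p \<partial>lborel) \<le> ennreal (2 powr p) * (\<integral>\<^sup>+x. epowr (ennreal (f x)) p \<partial>lborel) + ennreal e"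
proof -
  \<comment> \<open>The dyadic exponents run over all integers; \<open>int_decode\<close> enumerates
    them by naturals so that countable sums apply.\<close>
  define a where "a i = 2 powr (real_of_int (int_decode i) + 1)" for i
  define S where "S i = {x. 2 powr (real_of_int (int_decode i)) < f x \<and> f x \<le> a i}" for i
  have ap: "0 < a i" for i by (simp add: a_def)
  have S_sets[measurable]: "S i \<in> sets borel" for i
  proof -
    have "{x \<in> space borel. 2 powr (real_of_int (int_decode i)) < f x \<and> f x \<le> a i} \<in> sets borel" by measurable
    then show ?thesis by (simp add: S_def)
  qed
  have disj: "disjoint_family S"
  proof -
    have "int_decode i \<le> int_decode j" if "x \<in> S i" "x \<in> S j" for i j x
    proof -
      have "2 powr (real_of_int (int_decode i)) < f x" "f x \<le> 2 powr (real_of_int (int_decode j) + 1)" using that by (auto simp: S_def a_def)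
      then have "2 powr (real_of_int (int_decode i)) < 2 powr (real_of_int (int_decode j) + 1)" by (rule less_le_trans)
      then show ?thesis by simp
    qed
    then have "i = j" if "x \<in> S i" "x \<in> S j" for i j x
      using that by (metis antisym int_decode_eq)
    then show ?thesis by (auto simp: disjoint_family_on_def)
  qed
  have cover: "\<exists>i. x \<in> S i" if "0 < f x" for x
  proof -
    define n where "n = \<lceil>log 2 (f x)\<rceil> - 1"
    have n: "real_of_int n < log 2 (f x)" "log 2 (f x) \<le> real_of_int n + 1" unfolding n_def by linarith+
    have "2 powr (real_of_int n) < 2 powr (log 2 (f x))" using n by (intro powr_less_mono) auto
    moreover have "2 powr (log 2 (f x)) \<le> 2 powr (real_of_int n + 1)" using n by (intro powr_mono) auto
    ultimately have "x \<in> S (int_encode n)" using that by (simp add: S_def a_def)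
    then show ?thesis by blast
  qed
  have "\<exists>U. open U \<and> S i \<subseteq> U \<and> emeasure lborel (U - S i) < ennreal (e * (1/2) ^ Suc i / a i powr p)" for i
    using outer_regular_lborel[of "S i" "e * (1/2) ^ Suc i / a i powr p"] e ap[of i] by (metis S_sets divide_pos_pos mult_pos_pos powr_gt_zero zero_less_divide_1_iff zero_less_numeral zero_less_power less_numeral_extra(3))
  then obtain U where U: "\<And>i. open (U i)" "\<And>i. S i \<subseteq> U i" "\<And>i. emeasure lborel (U i - S i) < ennreal (e * (1/2) ^ Suc i / a i powr p)"
    by metis
  have [measurable]: "U i \<in> sets borel" for i using U(1) by auto
  define H where "H x = (SUP i. ennreal (a i) * indicator (U i) x)" for x
  have 1: "open {x. c < H x}" for c
  proof -
    have "{x. c < H x} = (\<Union>i. {x. c < ennreal (a i) * indicator (U i) x})" by (auto simp: H_def less_SUP_iff)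
    moreover have "open {x. c < ennreal (a i) * indicator (U i) x}" for i
    proof -
      have "{x. c < ennreal (a i) * indicator (U i) x} = (if c < ennreal (a i) then U i else {})"
        by (auto simp: indicator_def)
      then show ?thesis using U(1) by simp
    qed
    ultimately show ?thesis by auto
  qed
  have 2: "ennreal (f x) \<le> H x" for x
  proof (cases "f x = 0")
    case False
    then obtain i where i: "x \<in> S i" using cover[of x] f0[of x] by auto
    then have "ennreal (f x) \<le> ennreal (a i) * indicator (U i) x" using U(2)[of i] by (auto simp: S_def intro!: ennreal_leI)
    also have "\<dots> \<le> H x" unfolding H_def by (rule SUP_upper) simp
    finally show ?thesis .
  qed simp
  have termU: "ennreal (a i powr p) * emeasure lborel (U i) \<le> ennreal (a i powr p) * emeasure lborel (S i) + ennreal (e * (1/2) ^ Suc i)" for i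
  proof -
    have "emeasure lborel (U i) = emeasure lborel (S i \<union> (U i - S i))" using U(2)[of i] by (simp add: Un_absorb1)
    also have "\<dots> \<le> emeasure lborel (S i) + emeasure lborel (U i - S i)" by (intro emeasure_subadditive) auto
    also have "\<dots> \<le> emeasure lborel (S i) + ennreal (e * (1/2) ^ Suc i / a i powr p)" using U(3)[of i] by (intro add_left_mono) simp
    finally have "ennreal (a i powr p) * emeasure lborel (U i) \<le> ennreal (a i powr p) * (emeasure lborel (S i) + ennreal (e * (1/2) ^ Suc i / a i powr p))"
      by (rule mult_left_mono) simp
    also have "\<dots> = ennreal (a i powr p) * emeasure lborel (S i) + ennreal (a i powr p * (e * (1/2) ^ Suc i / a i powr p))"
      using e by (simp only: distrib_left) (subst ennreal_mult[symmetric], auto)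
    also have "a i powr p * (e * (1/2) ^ Suc i / a i powr p) = e * (1/2) ^ Suc i" using ap[of i] by simp
    finally show ?thesis .
  qed
  have "(\<integral>\<^sup>+x. epowr (H x) p \<partial>lborel) \<le> (\<integral>\<^sup>+x. (\<Sum>i. ennreal (a i powr p) * indicator (U i) x) \<partial>lborel)"
  proof (rule nn_integral_mono)
    fix x
    have "epowr (H x) p \<le> (SUP i. epowr (ennreal (a i) * indicator (U i) x) p)" unfolding H_def by (rule epowr_SUP_le[OF p])
    also have "\<dots> \<le> (\<Sum>i. ennreal (a i powr p) * indicator (U i) x)"
    proof (rule SUP_least)
      fix i
      have "epowr (ennreal (a i) * indicator (U i) x) p = ennreal (a i powr p) * indicator (U i) x"
        using ap[of i] by (auto simp: indicator_def epowr_ennreal)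
      then show "epowr (ennreal (a i) * indicator (U i) x) p \<le> (\<Sum>i. ennreal (a i powr p) * indicator (U i) x)"
        using suminf_ge_term[of "\<lambda>i. ennreal (a i powr p) * indicator (U i) x" i] by simp
    qed
    finally show "epowr (H x) p \<le> (\<Sum>i. ennreal (a i powr p) * indicator (U i) x)" .
  qed
  also have "\<dots> = (\<Sum>i. ennreal (a i powr p) * emeasure lborel (U i))"
    by (subst nn_integral_suminf) (auto simp: nn_integral_cmult_indicator)
  also have "\<dots> \<le> (\<Sum>i. ennreal (a i powr p) * emeasure lborel (S i) + ennreal (e * (1/2) ^ Suc i))"
    by (intro suminf_le termU) auto
  also have "\<dots> = (\<Sum>i. ennreal (a i powr p) * emeasure lborel (S i)) + (\<Sum>i. ennreal (e * (1/2) ^ Suc i))"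
    by (rule suminf_add[symmetric]) auto
  also have "(\<Sum>i. ennreal (e * (1/2) ^ Suc i)) = ennreal e"
    by (rule suminf_ennreal_eq) (use e sums_mult[OF power_half_series, of e] in auto)
  also have "(\<Sum>i. ennreal (a i powr p) * emeasure lborel (S i)) = (\<integral>\<^sup>+x. (\<Sum>i. ennreal (a i powr p) * indicator (S i) x) \<partial>lborel)"
    by (subst nn_integral_suminf) (auto simp: nn_integral_cmult_indicator)
  also have "(\<integral>\<^sup>+x. (\<Sum>i. ennreal (a i powr p) * indicator (S i) x) \<partial>lborel) + ennreal e
      \<le> (\<integral>\<^sup>+x. ennreal (2 powr p) * epowr (ennreal (f x)) p \<partial>lborel) + ennreal e"
  proof (rule add_right_mono[OF nn_integral_mono])
    fix x
    have "(\<Sum>i. ennreal (a i powr p) * indicator (S i) x) \<le> (\<Sum>i. ennreal (2 powr p) * epowr (ennreal (f x)) p * indicator (S i) x)"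
    proof (intro suminf_le)
      fix i
      show "ennreal (a i powr p) * indicator (S i) x \<le> ennreal (2 powr p) * epowr (ennreal (f x)) p * indicator (S i) x"
      proof (cases "x \<in> S i")
        case True
        then have "a i \<le> 2 * f x" by (simp add: S_def a_def powr_add)
        then have "a i powr p \<le> (2 * f x) powr p" using ap[of i] p by (intro powr_mono2) auto
        also have "\<dots> = 2 powr p * f x powr p" using f0 by (simp add: powr_mult)
        finally have "ennreal (a i powr p) \<le> ennreal (2 powr p * f x powr p)" by (rule ennreal_leI)
        also have "\<dots> = ennreal (2 powr p) * epowr (ennreal (f x)) p" using f0 by (simp add: epowr_ennreal ennreal_mult)
        finally show ?thesis using True by simp
      qed simp
    qed auto
    also have "\<dots> = ennreal (2 powr p) * epowr (ennreal (f x)) p * indicator (\<Union>i. S i) x"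
      using disj by (simp add: suminf_indicator)
    also have "\<dots> \<le> ennreal (2 powr p) * epowr (ennreal (f x)) p * 1"
      by (intro mult_left_mono) (auto simp: indicator_def)
    finally show "(\<Sum>i. ennreal (a i powr p) * indicator (S i) x) \<le> ennreal (2 powr p) * epowr (ennreal (f x)) p" by simp
  qed
  also have "(\<integral>\<^sup>+x. ennreal (2 powr p) * epowr (ennreal (f x)) p \<partial>lborel) = ennreal (2 powr p) * (\<integral>\<^sup>+x. epowr (ennreal (f x)) p \<partial>lborel)"
    by (rule nn_integral_cmult) measurable
  finally show thesis using that[OF 1 2] by simp
qed

text \<open>The minimum with a constant and the restriction to an open ball both preserve open
  superlevel sets of a non-negative function, so the truncations stay lower semicontinuous.\<close>

definition truncate :: "nat \<Rightarrow> ('a::euclidean_space \<Rightarrow> ennreal) \<Rightarrow> 'a \<Rightarrow> real" where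
  "truncate k H x = enn2real (min (H x) (of_nat k)) * indicator (ball 0 (real k)) x"

lemma ennreal_truncate: "ennreal (truncate k H x) = min (H x) (of_nat k) * indicator (ball 0 (real k)) x"
proof -
  have "min (H x) (of_nat k) \<noteq> top" by (metis min.cobounded2 top_unique ennreal_of_nat_neq_top)
  then show ?thesis by (auto simp: truncate_def indicator_def less_top)
qed

lemma truncate_properties:
  fixes H :: "'a::euclidean_space \<Rightarrow> ennreal"
  assumes H: "\<And>c. open {x. c < H x}"
  shows "bdd_supp (truncate k H)" "0 \<le> truncate k H x" "open {x. c < truncate k H x}"
proof -
  have [measurable]: "H \<in> borel_measurable borel" by (rule borel_measurable_of_open_superlevel[OF H])
  have [measurable]: "ball (0::'a) (real k) \<in> sets borel" by simp
  have fin: "min (H x) (of_nat k) \<noteq> top" for x by (metis min.cobounded2 top_unique ennreal_of_nat_neq_top)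
  show "bdd_supp (truncate k H)"
  proof (rule bdd_suppI[where B="real k" and R="real k"])
    show "truncate k H \<in> borel_measurable borel" unfolding truncate_def by measurable
    have "enn2real (min (H x) (of_nat k)) \<le> real k" for x
      by (rule enn2real_leI) (simp_all add: ennreal_of_nat_eq_real_of_nat)
    then show "\<bar>truncate k H x\<bar> \<le> real k" for x by (simp add: truncate_def indicator_def)
  qed (simp add: truncate_def)
  show "0 \<le> truncate k H x" by (simp add: truncate_def)
  have "{x. c < truncate k H x} = (if c < 0 then UNIV else if c < real k then {x. ennreal c < H x} \<inter> ball 0 (real k) else {})"
  proof -
    have "c < truncate k H x \<longleftrightarrow> (c < real k \<and> ennreal c < H x \<and> x \<in> ball 0 (real k))" if "0 \<le> c" for x
    proof -
      have "c < truncate k H x \<longleftrightarrow> ennreal c < ennreal (truncate k H x)" using that by (simp add: ennreal_less_iff)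
      also have "\<dots> \<longleftrightarrow> (c < real k \<and> ennreal c < H x \<and> x \<in> ball 0 (real k))"
        unfolding ennreal_truncate using that by (auto simp: indicator_def ennreal_of_nat_eq_real_of_nat ennreal_less_iff)
      finally show ?thesis .
    qed
    moreover have "c < truncate k H x" if "c < 0" for x
    proof -
      have "0 \<le> truncate k H x" by (simp add: truncate_def)
      with that show ?thesis by linarith
    qed
    ultimately show ?thesis by auto
  qed
  then show "open {x. c < truncate k H x}" using H by auto
qed

lemma SUP_truncate: "(SUP k. ennreal (truncate k H x)) = H x"
proof (rule antisym)
  show "(SUP k. ennreal (truncate k H x)) \<le> H x" unfolding ennreal_truncate by (rule SUP_least) (simp add: indicator_def)
  show "H x \<le> (SUP k. ennreal (truncate k H x))"
  proof (rule dense_le)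
    fix c assume c: "c < H x"
    then have "c \<noteq> top" by auto
    then obtain n where n: "c \<le> of_nat n" using ennreal_Ex_less_of_nat[of c] by (auto simp: less_top intro: less_imp_le)
    obtain m where m: "norm x < real m" using reals_Archimedean2 by blast
    define k where "k = max n m"
    have mk: "norm x < real k" using m by (simp add: k_def)
    have "c \<le> of_nat k" using n by (rule order_trans) (simp add: k_def)
    then have "c \<le> ennreal (truncate k H x)" unfolding ennreal_truncate using c mk by (simp add: indicator_def)
    also have "\<dots> \<le> (SUP k. ennreal (truncate k H x))" by (rule SUP_upper) simp
    finally show "c \<le> (SUP k. ennreal (truncate k H x))" .
  qed
qed

lemma truncate_mono: "k \<le> k' \<Longrightarrow> ennreal (truncate k H x) \<le> ennreal (truncate k' H x)"
proof -
  assume k: "k \<le> k'"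
  then have "min (H x) (of_nat k) \<le> min (H x) (of_nat k')" by (intro min.mono) (auto simp: of_nat_mono)
  moreover have "indicator (ball 0 (real k)) x \<le> (indicator (ball 0 (real k')) x :: ennreal)" using k by (auto simp: indicator_def)
  ultimately show ?thesis unfolding ennreal_truncate by (intro mult_mono) auto
qed

context scale_average
begin

definition full_maximal :: "('a \<Rightarrow> ennreal) \<Rightarrow> ('a \<Rightarrow> ennreal) \<Rightarrow> 'a \<Rightarrow> ennreal" where
  "full_maximal F G x = (SUP l::int. posavg M (2 powr (- real_of_int l)) F G x)"

lemma borel_measurable_full_maximal [measurable]:
  assumes [measurable]: "F \<in> borel_measurable borel" "G \<in> borel_measurable borel"
  shows "full_maximal F G \<in> borel_measurable borel"
  unfolding full_maximal_def by (intro borel_measurable_SUP) auto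

lemma borel_measurable_maximal [measurable]:
  assumes [measurable]: "F \<in> borel_measurable borel" "G \<in> borel_measurable borel"
  shows "maximal L F G \<in> borel_measurable borel"
  unfolding maximal_def by (intro borel_measurable_SUP) auto

lemma full_maximal_mono: "(\<And>x. F x \<le> F' x) \<Longrightarrow> (\<And>x. G x \<le> G' x) \<Longrightarrow> full_maximal F G x \<le> full_maximal F' G' x"
  unfolding full_maximal_def by (intro SUP_mono' posavg_mono)

text \<open>One parameter \<open>k\<close> cuts off the values, the support and the range of scales.
  Everything increases in \<open>k\<close>, so monotone convergence recovers the average at each
  scale.\<close>

lemma full_maximal_truncate_le:
  assumes H: "\<And>c. open {x. c < H x}" and H': "\<And>c. open {x. c < H' x}"
  shows "full_maximal H H' x \<le> (SUP k. maximal k (\<lambda>x. ennreal (truncate k H x)) (\<lambda>x. ennreal (truncate k H' x)) x)"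
  unfolding full_maximal_def
proof (rule SUP_least)
  fix l :: int
  let ?t = "2 powr (- real_of_int l) :: real"
  let ?h = "\<lambda>k x. ennreal (truncate k H x)" and ?h' = "\<lambda>k x. ennreal (truncate k H' x)"
  have [measurable]: "?h k \<in> borel_measurable borel" "?h' k \<in> borel_measurable borel" for k
    using truncate_properties(1)[OF H] truncate_properties(1)[OF H'] by (auto dest!: bdd_supp_measurable)
  have inc: "incseq (\<lambda>k w. ?h k (x - ?t *\<^sub>R fst w) * ?h' k (x - ?t *\<^sub>R snd w))"
    unfolding incseq_def le_fun_def by (intro allI impI mult_mono truncate_mono) auto
  have "posavg M ?t H H' x = (\<integral>\<^sup>+w. (SUP k. ?h k (x - ?t *\<^sub>R fst w) * ?h' k (x - ?t *\<^sub>R snd w)) \<partial>M)"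
    unfolding posavg_def
  proof (rule nn_integral_cong)
    fix w
    have "(SUP k. ?h k (x - ?t *\<^sub>R fst w)) * (SUP k. ?h' k (x - ?t *\<^sub>R snd w)) = (SUP k. ?h k (x - ?t *\<^sub>R fst w) * ?h' k (x - ?t *\<^sub>R snd w))"
    proof (rule antisym)
      show "(SUP k. ?h k (x - ?t *\<^sub>R fst w)) * (SUP k. ?h' k (x - ?t *\<^sub>R snd w)) \<le> (SUP k. ?h k (x - ?t *\<^sub>R fst w) * ?h' k (x - ?t *\<^sub>R snd w))"
      proof -
        have "?h i (x - ?t *\<^sub>R fst w) * ?h' j (x - ?t *\<^sub>R snd w) \<le> (SUP k. ?h k (x - ?t *\<^sub>R fst w) * ?h' k (x - ?t *\<^sub>R snd w))" for i j
        proof -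
          have "?h i (x - ?t *\<^sub>R fst w) * ?h' j (x - ?t *\<^sub>R snd w) \<le> ?h (max i j) (x - ?t *\<^sub>R fst w) * ?h' (max i j) (x - ?t *\<^sub>R snd w)"
            by (intro mult_mono truncate_mono) auto
          also have "\<dots> \<le> (SUP k. ?h k (x - ?t *\<^sub>R fst w) * ?h' k (x - ?t *\<^sub>R snd w))" by (rule SUP_upper) simp
          finally show ?thesis .
        qed
        then show ?thesis
          by (simp add: SUP_mult_left_ennreal SUP_mult_right_ennreal SUP_least)
      qed
      show "(SUP k. ?h k (x - ?t *\<^sub>R fst w) * ?h' k (x - ?t *\<^sub>R snd w)) \<le> (SUP k. ?h k (x - ?t *\<^sub>R fst w)) * (SUP k. ?h' k (x - ?t *\<^sub>R snd w))"
        by (intro SUP_least mult_mono SUP_upper) auto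
    qed
    then show "H (x - ?t *\<^sub>R fst w) * H' (x - ?t *\<^sub>R snd w) = (SUP k. ?h k (x - ?t *\<^sub>R fst w) * ?h' k (x - ?t *\<^sub>R snd w))"
      by (simp only: SUP_truncate)
  qed
  also have "\<dots> = (SUP k. posavg M ?t (?h k) (?h' k) x)"
    unfolding posavg_def by (rule nn_integral_monotone_convergence_SUP[OF inc]) measurable
  also have "\<dots> \<le> (SUP k. maximal k (?h k) (?h' k) x)"
  proof (rule SUP_least)
    fix k
    define n where "n = max k (nat \<bar>l\<bar>)"
    have "posavg M ?t (?h k) (?h' k) x \<le> posavg M ?t (?h n) (?h' n) x"
      by (intro posavg_mono truncate_mono) (auto simp: n_def)
    also have "\<dots> \<le> maximal n (?h n) (?h' n) x"
      unfolding maximal_def by (rule SUP_upper) (auto simp: n_def)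
    also have "\<dots> \<le> (SUP k. maximal k (?h k) (?h' k) x)" by (rule SUP_upper) simp
    finally show "posavg M ?t (?h k) (?h' k) x \<le> (SUP k. maximal k (?h k) (?h' k) x)" .
  qed
  finally show "posavg M ?t H H' x \<le> (SUP k. maximal k (?h k) (?h' k) x)" .
qed

lemma maximal_mono:
  assumes "L \<le> L'" "\<And>x. F x \<le> F' x" "\<And>x. G x \<le> G' x"
  shows "maximal L F G x \<le> maximal L' F' G' x"
  unfolding maximal_def
proof (rule SUP_least)
  fix l assume "l \<in> {- int L..int L}"
  then have "l \<in> {- int L'..int L'}" using assms(1) by auto
  then have "posavg M (2 powr (- real_of_int l)) F' G' x \<le> (SUP l\<in>{- int L'..int L'}. posavg M (2 powr (- real_of_int l)) F' G' x)"
    by (rule SUP_upper)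
  then show "posavg M (2 powr (- real_of_int l)) F G x \<le> (SUP l\<in>{- int L'..int L'}. posavg M (2 powr (- real_of_int l)) F' G' x)"
    by (rule order_trans[OF posavg_mono[OF assms(2,3)]])
qed

text \<open>The functions are replaced by lower semicontinuous majorants and these by truncations.
  The constants \<open>2 powr p\<close> and \<open>2 powr q\<close> enter through the majorants,
  whose additive errors tend to 0 at the end.\<close>

lemma full_maximal_sum_bound:
  fixes p q r :: real
  assumes p: "1 < p" "p1 < p" and q: "1 < q" "q1 < q" and r: "0 < r" "1 / r = 1 / p + 1 / q"
  obtains C where "0 \<le> C" "\<And>f g. f \<in> borel_measurable borel \<Longrightarrow> g \<in> borel_measurable borel \<Longrightarrow> (\<And>x. 0 \<le> f x) \<Longrightarrow> (\<And>x. 0 \<le> g x) \<Longrightarrow>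
     (\<integral>\<^sup>+x. epowr (full_maximal (\<lambda>x. ennreal (f x)) (\<lambda>x. ennreal (g x)) x) r \<partial>lborel)
       \<le> ennreal C * ((\<integral>\<^sup>+x. epowr (ennreal (f x)) p \<partial>lborel) + (\<integral>\<^sup>+x. epowr (ennreal (g x)) q \<partial>lborel))"
proof -
  obtain C where C: "0 \<le> C" "\<And>f g L. bdd_supp f \<Longrightarrow> bdd_supp g \<Longrightarrow> (\<And>x. 0 \<le> f x) \<Longrightarrow> (\<And>x. 0 \<le> g x) \<Longrightarrow>
     (\<And>c. open {x. c < f x}) \<Longrightarrow> (\<And>c. open {x. c < g x}) \<Longrightarrow>
     (\<integral>\<^sup>+x. epowr (maximal L (\<lambda>x. ennreal (f x)) (\<lambda>x. ennreal (g x)) x) r \<partial>lborel)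
       \<le> ennreal C * ((\<integral>\<^sup>+x. epowr (ennreal (f x)) p \<partial>lborel) + (\<integral>\<^sup>+x. epowr (ennreal (g x)) q \<partial>lborel))"
    by (rule maximal_strong_type[OF p q r]) blast
  define c where "c = 2 powr p + 2 powr q"
  have c0: "0 \<le> c" "2 powr p \<le> c" "2 powr q \<le> c" by (auto simp: c_def)
  show thesis
  proof (rule that[of "C * c"])
    show "0 \<le> C * c" using C(1) c0 by simp
    fix f g :: "'a \<Rightarrow> real"
    assume [measurable]: "f \<in> borel_measurable borel" "g \<in> borel_measurable borel" and f0: "\<And>x. 0 \<le> f x" and g0: "\<And>x. 0 \<le> g x"
    let ?X = "\<integral>\<^sup>+x. epowr (ennreal (f x)) p \<partial>lborel" and ?Y = "\<integral>\<^sup>+x. epowr (ennreal (g x)) q \<partial>lborel"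
    let ?L = "\<integral>\<^sup>+x. epowr (full_maximal (\<lambda>x. ennreal (f x)) (\<lambda>x. ennreal (g x)) x) r \<partial>lborel"
    show "?L \<le> ennreal (C * c) * (?X + ?Y)"
    proof (rule ennreal_le_epsilon)
      fix e :: real assume e: "0 < e"
      \<comment> \<open>Each of the two majorants may exceed its share by
        \<open>d = e / (2 * (C + 1))\<close>, so that the total error \<open>2 * C * d\<close> is at
        most \<open>e\<close>; adding 1 avoids division by 0.\<close>
      define e' where "e' = e / (C + 1)"
      define d where "d = e' / 2"
      have d: "0 < d" unfolding d_def e'_def using e C(1) by simp
      have Cd: "C * d + C * d \<le> e"
      proof -
        have "2 * d = e / (C + 1)" unfolding e'_def[symmetric] by (simp add: d_def)
        moreover have "C * d + C * d = C * (2 * d)" by simp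
        ultimately have "C * d + C * d = e * (C / (C + 1))" by simp
        also have "\<dots> \<le> e * 1" using e C(1) by (intro mult_left_mono) auto
        finally show ?thesis by simp
      qed
      obtain H where H: "\<And>c. open {x. c < H x}" "\<And>x. ennreal (f x) \<le> H x" "(\<integral>\<^sup>+x. epowr (H x) p \<partial>lborel) \<le> ennreal (2 powr p) * ?X + ennreal d"
        using lower_semicontinuous_majorant[of f p d] f0 p d by auto
      obtain H' where H': "\<And>c. open {x. c < H' x}" "\<And>x. ennreal (g x) \<le> H' x" "(\<integral>\<^sup>+x. epowr (H' x) q \<partial>lborel) \<le> ennreal (2 powr q) * ?Y + ennreal d"
        using lower_semicontinuous_majorant[of g q d] g0 q d by auto
      let ?h = "\<lambda>k x. ennreal (truncate k H x)" and ?h' = "\<lambda>k x. ennreal (truncate k H' x)"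
      let ?m = "\<lambda>k. maximal k (?h k) (?h' k)"
      have [measurable]: "?h k \<in> borel_measurable borel" "?h' k \<in> borel_measurable borel" for k
        using truncate_properties(1)[OF H(1)] truncate_properties(1)[OF H'(1)] by (auto dest!: bdd_supp_measurable)
      have hH: "?h k x \<le> H x" "?h' k x \<le> H' x" for k x
        unfolding ennreal_truncate by (auto simp: indicator_def)
      have step: "(\<integral>\<^sup>+x. epowr (?m k x) r \<partial>lborel) \<le> ennreal C * ((\<integral>\<^sup>+x. epowr (H x) p \<partial>lborel) + (\<integral>\<^sup>+x. epowr (H' x) q \<partial>lborel))" for k
      proof -
        have "(\<integral>\<^sup>+x. epowr (?m k x) r \<partial>lborel) \<le> ennreal C * ((\<integral>\<^sup>+x. epowr (?h k x) p \<partial>lborel) + (\<integral>\<^sup>+x. epowr (?h' k x) q \<partial>lborel))"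
          by (intro C(2) truncate_properties H(1) H'(1))
        also have "\<dots> \<le> ennreal C * ((\<integral>\<^sup>+x. epowr (H x) p \<partial>lborel) + (\<integral>\<^sup>+x. epowr (H' x) q \<partial>lborel))"
          using p q by (intro mult_left_mono add_mono nn_integral_mono epowr_mono hH) auto
        finally show ?thesis .
      qed
      have "?L \<le> (\<integral>\<^sup>+x. (SUP k. epowr (?m k x) r) \<partial>lborel)"
      proof (rule nn_integral_mono)
        fix x
        have "full_maximal (\<lambda>x. ennreal (f x)) (\<lambda>x. ennreal (g x)) x \<le> full_maximal H H' x"
          by (rule full_maximal_mono[OF H(2) H'(2)])
        also have "\<dots> \<le> (SUP k. ?m k x)" by (rule full_maximal_truncate_le[OF H(1) H'(1)])
        finally have "epowr (full_maximal (\<lambda>x. ennreal (f x)) (\<lambda>x. ennreal (g x)) x) r \<le> epowr (SUP k. ?m k x) r"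
          using r by (intro epowr_mono) auto
        also have "\<dots> \<le> (SUP k. epowr (?m k x) r)" by (rule epowr_SUP_le[OF r(1)])
        finally show "epowr (full_maximal (\<lambda>x. ennreal (f x)) (\<lambda>x. ennreal (g x)) x) r \<le> (SUP k. epowr (?m k x) r)" .
      qed
      also have "\<dots> = (SUP k. \<integral>\<^sup>+x. epowr (?m k x) r \<partial>lborel)"
      proof (rule nn_integral_monotone_convergence_SUP)
        show "incseq (\<lambda>k x. epowr (?m k x) r)"
          unfolding incseq_def le_fun_def using r by (intro allI impI epowr_mono maximal_mono truncate_mono) auto
      qed measurable
      also have "\<dots> \<le> ennreal C * ((\<integral>\<^sup>+x. epowr (H x) p \<partial>lborel) + (\<integral>\<^sup>+x. epowr (H' x) q \<partial>lborel))"
        by (rule SUP_least) (rule step)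
      also have "\<dots> \<le> ennreal C * ((ennreal c * ?X + ennreal d) + (ennreal c * ?Y + ennreal d))"
        by (intro mult_left_mono add_mono order_trans[OF H(3)] order_trans[OF H'(3)] mult_right_mono ennreal_leI c0) auto
      also have "\<dots> = ennreal C * ennreal c * (?X + ?Y) + (ennreal C * ennreal d + ennreal C * ennreal d)"
        by (simp only: distrib_left ac_simps)
      also have "ennreal C * ennreal c = ennreal (C * c)" using C(1) c0 by (intro ennreal_mult[symmetric])
      also have "ennreal C * ennreal d + ennreal C * ennreal d = ennreal (C * d + C * d)"
        using C(1) d by (subst ennreal_plus) (simp_all only: ennreal_mult mult_nonneg_nonneg less_imp_le)
      finally show "?L \<le> ennreal (C * c) * (?X + ?Y) + ennreal e"
        using Cd by (rule order_trans[OF _ add_left_mono[OF ennreal_leI]])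
    qed
  qed
qed

end

section \<open>The surface measure\<close>

text \<open>The images of covering sets cover the image, and their diameters do not grow.\<close>

lemma hausdorff_outer_contraction:
  fixes \<Phi> :: "'a::metric_space \<Rightarrow> 'b::metric_space"
  assumes "\<And>x y. dist (\<Phi> x) (\<Phi> y) \<le> dist x y" "0 < s"
  shows "hausdorff_outer s (\<Phi> ` A) \<le> hausdorff_outer s A"
  unfolding hausdorff_outer_def
proof (rule SUP_mono')
  fix \<delta> :: real
  show "hausdorff_pre s \<delta> (\<Phi> ` A) \<le> hausdorff_pre s \<delta> A"
    unfolding hausdorff_pre_def[of s \<delta> A]
  proof (rule INF_greatest)
    fix U assume U: "U \<in> hausdorff_covers \<delta> A"
    then have bd: "bounded (U i)" and dm: "diameter (U i) \<le> \<delta>" for i by (auto simp: hausdorff_covers_def)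
    have D: "bounded (\<Phi> ` U i) \<and> diameter (\<Phi> ` U i) \<le> diameter (U i)" for i
    proof
      obtain x e where xe: "\<And>y. y \<in> U i \<Longrightarrow> dist x y \<le> e" using bd[of i] unfolding bounded_def by blast
      then have "\<forall>z\<in>\<Phi> ` U i. dist (\<Phi> x) z \<le> e" using assms(1) by (auto intro: order_trans)
      then show b: "bounded (\<Phi> ` U i)" unfolding bounded_def by blast
      show "diameter (\<Phi> ` U i) \<le> diameter (U i)"
      proof (cases "U i = {}")
        case False
        have "dist u v \<le> diameter (U i)" if uv: "u \<in> \<Phi> ` U i" "v \<in> \<Phi> ` U i" for u v
        proof -
          obtain x y where xy: "u = \<Phi> x" "v = \<Phi> y" "x \<in> U i" "y \<in> U i" using uv by blast
          have "dist x y \<le> diameter (U i)" using diameter_bounded_bound[OF bd xy(3,4)] .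
          then show ?thesis using assms(1)[of x y] xy by simp
        qed
        then show ?thesis using False by (auto simp: diameter_def intro!: cSUP_least)
      qed simp
    qed
    have "(\<lambda>i. \<Phi> ` U i) \<in> hausdorff_covers \<delta> (\<Phi> ` A)"
      unfolding hausdorff_covers_def
    proof (intro CollectI conjI allI)
      have "A \<subseteq> (\<Union>i. U i)" using U by (simp add: hausdorff_covers_def)
      then show "\<Phi> ` A \<subseteq> (\<Union>i. \<Phi> ` U i)" by blast
      show "bounded (\<Phi> ` U i)" for i using D by blast
      show "diameter (\<Phi> ` U i) \<le> \<delta>" for i using D[of i] dm[of i] by linarith
    qed
    then have "hausdorff_pre s \<delta> (\<Phi> ` A) \<le> (\<Sum>i. hausdorff_weight s (\<Phi> ` U i))"
      unfolding hausdorff_pre_def by (rule INF_lower)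
    also have "\<dots> \<le> (\<Sum>i. hausdorff_weight s (U i))"
    proof (intro suminf_le)
      fix i
      have "(diameter (\<Phi> ` U i) / 2) powr s \<le> (diameter (U i) / 2) powr s"
        using D[of i] assms(2) diameter_ge_0[of "\<Phi> ` U i"] by (intro powr_mono2) auto
      then show "hausdorff_weight s (\<Phi> ` U i) \<le> hausdorff_weight s (U i)"
        unfolding hausdorff_weight_def using assms(2) by (intro ennreal_leI mult_left_mono) auto
    qed auto
    finally show "hausdorff_pre s \<delta> (\<Phi> ` A) \<le> (\<Sum>i. hausdorff_weight s (U i))" .
  qed
qed

lemma hausdorff_outer_involution:
  fixes \<Phi> :: "'a::metric_space \<Rightarrow> 'a"
  assumes "\<And>x y. dist (\<Phi> x) (\<Phi> y) \<le> dist x y" "\<And>x. \<Phi> (\<Phi> x) = x" "0 < s"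
  shows "hausdorff_outer s (\<Phi> ` A) = hausdorff_outer s A"
proof (rule antisym)
  have "\<Phi> ` \<Phi> ` A = A" using assms(2) by (auto simp: image_iff)
  then show "hausdorff_outer s A \<le> hausdorff_outer s (\<Phi> ` A)"
    using hausdorff_outer_contraction[of \<Phi> s "\<Phi> ` A"] assms by simp
qed (rule hausdorff_outer_contraction[OF assms(1,3)])

text \<open>Pushing forward along the identity shrinks the Caratheodory sets on the surface to the
  Borel sets of the whole product space, where Fubini and measurability by composition are
  available.\<close>

definition surf_borel :: "real \<times> real \<Rightarrow> ((real^'d) \<times> (real^'d)) measure" where
  "surf_borel a = distr (surf_measure a) (borel \<Otimes>\<^sub>M borel) (\<lambda>w. w)"

lemma measurable_surf_measure:
  "N = borel \<Longrightarrow> (\<lambda>w. w) \<in> measurable (surf_measure a :: ((real^'d) \<times> (real^'d)) measure) N"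
proof -
  have "(\<lambda>w. w) \<in> measurable (hausdorff_measure (2 * real CARD('d) - 1) :: ((real^'d) \<times> (real^'d)) measure) borel"
    using sets_borel_subset_hausdorff_measure by (auto simp: measurable_def)
  then show "N = borel \<Longrightarrow> ?thesis" unfolding surf_measure_def by (auto intro: measurable_restrict_space1)
qed

lemma sets_surf_borel: "sets (surf_borel a) = sets (borel \<Otimes>\<^sub>M borel)"
  by (simp add: surf_borel_def)

lemma emeasure_surf_borel:
  assumes A: "A \<in> sets borel"
  shows "emeasure (surf_borel a :: ((real^'d) \<times> (real^'d)) measure) A = hausdorff_outer (2 * real CARD('d) - 1) (A \<inter> surf a)"
proof -
  let ?H = "hausdorff_measure (2 * real CARD('d) - 1) :: ((real^'d) \<times> (real^'d)) measure"
  have AH: "A \<in> sets ?H" using A sets_borel_subset_hausdorff_measure by blast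
  have SH: "surf a \<in> sets ?H" by (rule surf_in_sets_hausdorff_measure)
  have A': "A \<in> sets (borel \<Otimes>\<^sub>M borel)" unfolding borel_prod by (rule A)
  have "emeasure (surf_borel a) A = emeasure (surf_measure a) (A \<inter> surf a)"
    unfolding surf_borel_def using A' measurable_surf_measure[of "borel \<Otimes>\<^sub>M borel" a]
    by (subst emeasure_distr) (auto simp: surf_measure_def space_restrict_space borel_prod)
  also have "\<dots> = emeasure ?H (A \<inter> surf a)"
    unfolding surf_measure_def using SH by (intro emeasure_restrict_space) auto
  also have "\<dots> = hausdorff_outer (2 * real CARD('d) - 1) (A \<inter> surf a)"
    using AH SH by (intro emeasure_hausdorff_measure) auto
  finally show ?thesis .
qed

text \<open>The density bound is known over compact sets. Taken over the closed unit ball, above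
  which the whole surface lies, it shows that the measure is finite; inner regularity of the finite
  projected measure then extends the bound to Borel sets.\<close>

lemma emeasure_surf_borel_snd_le:
  assumes a: "1 \<le> fst a" "fst a \<le> real CARD('d)" "1 \<le> snd a" and d: "CARD('d::finite) \<ge> 2"
  shows "\<exists>K\<ge>0. \<forall>E\<in>sets borel. emeasure (surf_borel a :: ((real^'d) \<times> (real^'d)) measure) {w. snd w \<in> E} \<le> ennreal K * emeasure lborel E"
    and "emeasure (surf_borel a :: ((real^'d) \<times> (real^'d)) measure) UNIV < top"
proof -
  let ?M = "surf_borel a :: ((real^'d) \<times> (real^'d)) measure"
  define K where "K = unit_ball_vol (2 * real CARD('d) - 1) * 5 powr (2 * real CARD('d) - 1) / unit_ball_vol (2 * real CARD('d)) *
     (unit_ball_vol (real CARD('d)) * (real CARD('d) / fst a * 2 powr (real CARD('d) / fst a - 1) * 2) *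
      (fst a * 2 powr (fst a - 1) + snd a * 2 powr (snd a - 1)))"
  have preb: "{w :: (real^'d) \<times> (real^'d). snd w \<in> E} \<in> sets borel" if "E \<in> sets borel" for E
  proof -
    have "{w \<in> space (borel \<Otimes>\<^sub>M borel). snd (w :: (real^'d) \<times> (real^'d)) \<in> E} \<in> sets (borel \<Otimes>\<^sub>M borel)" using that by measurable
    then show ?thesis unfolding borel_prod by simp
  qed
  have cpt: "emeasure ?M {w. snd w \<in> C} \<le> ennreal K * emeasure lborel C" if C: "compact C" for C
  proof -
    have "emeasure ?M {w. snd w \<in> C} = hausdorff_outer (2 * real CARD('d) - 1) ({w. snd w \<in> C} \<inter> surf a)"
      by (intro emeasure_surf_borel preb) (use C in \<open>auto intro: borel_compact\<close>)
    also have "{w. snd w \<in> C} \<inter> surf a = {w \<in> surf a. snd w \<in> C}" by auto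
    also have "hausdorff_outer (2 * real CARD('d) - 1) {w \<in> surf a. snd w \<in> C} \<le> ennreal K * emeasure lborel C"
      unfolding K_def using hausdorff_outer_surf_snd_compact[OF a d C] by simp
    finally show ?thesis .
  qed
  have "{w. snd w \<in> cball 0 1} \<inter> surf a = UNIV \<inter> (surf a :: ((real^'d) \<times> (real^'d)) set)"
    using surf_norm_le(2)[of _ a] a by auto
  then have "emeasure ?M UNIV = emeasure ?M {w. snd w \<in> cball 0 1}"
    using emeasure_surf_borel[of UNIV a] emeasure_surf_borel[OF preb[of "cball 0 1"], of a] by simp
  also have "\<dots> \<le> ennreal K * emeasure lborel (cball (0::real^'d) 1)" by (rule cpt) simp
  also have "\<dots> < top"
    using emeasure_bounded_finite[of "cball (0::real^'d) 1"] by (simp add: ennreal_mult_less_top)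
  finally show fin: "emeasure ?M UNIV < top" .
  have K0: "0 \<le> K" unfolding K_def using a by (intro mult_nonneg_nonneg divide_nonneg_nonneg add_nonneg_nonneg) auto
  have sm: "snd \<in> measurable ?M borel"
    using measurable_cong_sets[OF sets_surf_borel refl, of a borel] by auto
  let ?N = "distr ?M borel snd"
  have sp: "space ?M = UNIV" using sets_eq_imp_space_eq[OF sets_surf_borel[of a]] by (simp add: space_pair_measure)
  have em: "emeasure ?N E = emeasure ?M {w. snd w \<in> E}" if "E \<in> sets borel" for E
    using sm that by (subst emeasure_distr) (auto simp: sp vimage_def)
  have "emeasure ?M {w. snd w \<in> E} \<le> ennreal K * emeasure lborel E" if E: "E \<in> sets borel" for E
  proof -
    have "emeasure ?N E = (SUP C\<in>{C. C \<subseteq> E \<and> compact C}. emeasure ?N C)"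
      by (rule inner_regular) (use E fin em[of UNIV] in auto)
    also have "\<dots> \<le> ennreal K * emeasure lborel E"
    proof (rule SUP_least)
      fix C assume C: "C \<in> {C. C \<subseteq> E \<and> compact C}"
      then have "emeasure ?N C = emeasure ?M {w. snd w \<in> C}" by (intro em borel_compact) auto
      also have "\<dots> \<le> ennreal K * emeasure lborel C" using C by (intro cpt) auto
      also have "\<dots> \<le> ennreal K * emeasure lborel E" using C E by (intro mult_left_mono emeasure_mono) auto
      finally show "emeasure ?N C \<le> ennreal K * emeasure lborel E" .
    qed
    finally show ?thesis using em[OF E] by simp
  qed
  with K0 show "\<exists>K\<ge>0. \<forall>E\<in>sets borel. emeasure ?M {w. snd w \<in> E} \<le> ennreal K * emeasure lborel E" by blast
qed

lemma dist_prod_le: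
  "dist (fst x) (fst y) = dist (fst x') (fst y') \<Longrightarrow> dist (snd x) (snd y) = dist (snd x') (snd y') \<Longrightarrow> dist x y \<le> dist x' y'"
  by (simp add: dist_prod_def)

text \<open>An involution that does not increase distances preserves the Hausdorff measure. Two
  pairs of exponents appear so that the exchange of the variables, which also exchanges the
  exponents, is covered along with the reflections.\<close>

lemma distr_surf_borel_involution:
  fixes \<Phi> :: "(real^'d) \<times> (real^'d) \<Rightarrow> (real^'d) \<times> (real^'d)"
  assumes d: "CARD('d::finite) \<ge> 2" and \<Phi>: "\<And>x y. dist (\<Phi> x) (\<Phi> y) \<le> dist x y" "\<And>x. \<Phi> (\<Phi> x) = x"
    and S: "\<And>w. \<Phi> w \<in> surf b \<longleftrightarrow> w \<in> surf a" and m: "\<Phi> \<in> measurable (borel \<Otimes>\<^sub>M borel) (borel \<Otimes>\<^sub>M borel)"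
  shows "distr (surf_borel a) (borel \<Otimes>\<^sub>M borel) \<Phi> = surf_borel b"
proof (rule measure_eqI)
  have m': "\<Phi> \<in> measurable (surf_borel a) (borel \<Otimes>\<^sub>M borel)"
    using m measurable_cong_sets[OF sets_surf_borel refl, of a "borel \<Otimes>\<^sub>M borel"] by auto
  have sp: "space (surf_borel a) = (UNIV :: ((real^'d) \<times> (real^'d)) set)" using sets_eq_imp_space_eq[OF sets_surf_borel[of a]] by (simp add: space_pair_measure)
  show "sets (distr (surf_borel a) (borel \<Otimes>\<^sub>M borel) \<Phi>) = sets (surf_borel b)" by (simp add: sets_surf_borel)
  fix A assume "A \<in> sets (distr (surf_borel a) (borel \<Otimes>\<^sub>M borel) \<Phi>)"
  then have A: "A \<in> sets (borel \<Otimes>\<^sub>M borel)" by simp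
  have pre: "\<Phi> -` A \<in> sets borel" using measurable_sets[OF m A] unfolding borel_prod by simp
  have "emeasure (distr (surf_borel a) (borel \<Otimes>\<^sub>M borel) \<Phi>) A = emeasure (surf_borel a) (\<Phi> -` A)"
    using m' A by (subst emeasure_distr) (auto simp: sp)
  also have "\<dots> = hausdorff_outer (2 * real CARD('d) - 1) (\<Phi> -` A \<inter> surf a)" by (rule emeasure_surf_borel[OF pre])
  also have "\<Phi> -` A \<inter> surf a = \<Phi> ` (A \<inter> surf b)"
  proof (intro equalityI subsetI)
    fix w assume "w \<in> \<Phi> -` A \<inter> surf a"
    then have "\<Phi> w \<in> A \<inter> surf b" using S by auto
    then show "w \<in> \<Phi> ` (A \<inter> surf b)" using \<Phi>(2)[of w] by (metis image_eqI)
  next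
    fix w assume "w \<in> \<Phi> ` (A \<inter> surf b)"
    then obtain z where "w = \<Phi> z" "z \<in> A" "z \<in> surf b" by auto
    then show "w \<in> \<Phi> -` A \<inter> surf a" using \<Phi>(2)[of z] S[of w] by auto
  qed
  also have "hausdorff_outer (2 * real CARD('d) - 1) (\<Phi> ` (A \<inter> surf b)) = hausdorff_outer (2 * real CARD('d) - 1) (A \<inter> surf b)"
    by (rule hausdorff_outer_involution[OF \<Phi>]) (use d in auto)
  also have "\<dots> = emeasure (surf_borel b) A" using A unfolding borel_prod by (rule emeasure_surf_borel[symmetric])
  finally show "emeasure (distr (surf_borel a) (borel \<Otimes>\<^sub>M borel) \<Phi>) A = emeasure (surf_borel b) A" .
qed

lemma dist_reflection: "norm v = 1 \<Longrightarrow> dist (reflection v x) (reflection v y) = dist x y"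
  by (simp add: dist_norm refl_diff[symmetric] norm_reflection)

text \<open>The first projection is handled by the bound for the second one on the surface with
  exchanged exponents. This is why both exponents have to be at most the dimension.\<close>

lemma averaging_measure_surf_borel:
  assumes a: "1 \<le> fst a" "fst a \<le> real CARD('d)" "1 \<le> snd a" "snd a \<le> real CARD('d)" and d: "CARD('d::finite) \<ge> 2"
  shows "\<exists>K. averaging_measure (surf_borel a :: ((real^'d) \<times> (real^'d)) measure) K"
proof -
  let ?M = "surf_borel a :: ((real^'d) \<times> (real^'d)) measure"
  have sp: "space ?M = UNIV" using sets_eq_imp_space_eq[OF sets_surf_borel[of a]] by (simp add: space_pair_measure)
  obtain K1 where K1: "0 \<le> K1" "\<And>E. E \<in> sets borel \<Longrightarrow> emeasure ?M {w. snd w \<in> E} \<le> ennreal K1 * emeasure lborel E"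
    using emeasure_surf_borel_snd_le(1)[OF a(1-3) d] by blast
  let ?b = "(snd a, fst a)"
  let ?M' = "surf_borel ?b :: ((real^'d) \<times> (real^'d)) measure"
  obtain K2 where K2: "0 \<le> K2" "\<And>E. E \<in> sets borel \<Longrightarrow> emeasure ?M' {w. snd w \<in> E} \<le> ennreal K2 * emeasure lborel E"
    using emeasure_surf_borel_snd_le(1)[of ?b] a d by auto
  let ?s = "\<lambda>w :: (real^'d) \<times> (real^'d). (snd w, fst w)"
  have sw: "distr ?M (borel \<Otimes>\<^sub>M borel) ?s = ?M'"
  proof (rule distr_surf_borel_involution[OF d])
    show "dist (?s x) (?s y) \<le> dist x y" for x y by (simp add: dist_prod_def add.commute)
    show "?s w \<in> surf ?b \<longleftrightarrow> w \<in> surf a" for w by (auto simp: surf_def add.commute split: prod.split)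
  qed (simp, measurable)
  have [measurable_cong]: "sets ?M = sets (borel \<Otimes>\<^sub>M borel)" by (rule sets_surf_borel)
  have sm: "?s \<in> measurable ?M (borel \<Otimes>\<^sub>M borel)" by measurable
  have fstb: "emeasure ?M {w. fst w \<in> E} \<le> ennreal K2 * emeasure lborel E" if E: "E \<in> sets borel" for E
  proof -
    have "{w \<in> space (borel \<Otimes>\<^sub>M borel). snd (w :: (real^'d) \<times> (real^'d)) \<in> E} \<in> sets (borel \<Otimes>\<^sub>M borel)" using E by measurable
    then have "emeasure ?M {w. fst w \<in> E} = emeasure ?M' {w. snd w \<in> E}"
      unfolding sw[symmetric] using sm by (subst emeasure_distr) (auto simp: space_pair_measure sp vimage_def)
    then show ?thesis using K2(2)[OF E] by simp
  qed
  show ?thesis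
  proof (intro exI averaging_measure.intro)
    show "finite_measure ?M" using emeasure_surf_borel_snd_le(2)[OF a(1-3) d] by (intro finite_measureI) (simp add: sp)
    show "sets ?M = sets (borel \<Otimes>\<^sub>M borel)" by (rule sets_surf_borel)
    show "2 \<le> DIM(real^'d)" using d by simp
    show "0 \<le> max K1 K2" using K1 by simp
    have mx: "ennreal K1 * z \<le> ennreal (max K1 K2) * z" "ennreal K2 * z \<le> ennreal (max K1 K2) * z" for z
      by (intro mult_right_mono ennreal_leI; simp)+
    show "emeasure ?M {w. fst w \<in> E} \<le> ennreal (max K1 K2) * emeasure lborel E" if "E \<in> sets borel" for E
      using fstb[OF that] mx(2) by (rule order_trans)
    show "emeasure ?M {w. snd w \<in> E} \<le> ennreal (max K1 K2) * emeasure lborel E" if "E \<in> sets borel" for E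
      using K1(2)[OF that] mx(1) by (rule order_trans)
    show "AE w in ?M. norm (fst w) \<le> 1 \<and> norm (snd w) \<le> 1"
    proof (rule AE_I')
      let ?Z = "{w \<in> space (borel \<Otimes>\<^sub>M borel). \<not> (norm (fst w) \<le> 1 \<and> norm (snd (w :: (real^'d) \<times> (real^'d))) \<le> 1)}"
      have Zs: "?Z \<in> sets (borel \<Otimes>\<^sub>M borel)" by measurable
      have "?Z \<inter> surf a = {}" using surf_norm_le[of _ a] a by auto
      then have "emeasure ?M ?Z = 0" using emeasure_surf_borel[of ?Z a] Zs unfolding borel_prod by simp
      then show "?Z \<in> null_sets ?M" using Zs by (simp add: null_sets_def sets_surf_borel)
      show "{w \<in> space ?M. \<not> (norm (fst w) \<le> 1 \<and> norm (snd w) \<le> 1)} \<subseteq> ?Z" by (auto simp: space_pair_measure)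
    qed
    fix v :: "real^'d" assume v: "norm v = 1"
    show "distr ?M (borel \<Otimes>\<^sub>M borel) (\<lambda>w. (reflection v (fst w), snd w)) = ?M"
    proof (rule distr_surf_borel_involution[OF d])
      show "dist (reflection v (fst x), snd x) (reflection v (fst y), snd y) \<le> dist x y" for x y
        by (rule dist_prod_le) (simp_all add: dist_reflection v)
      show "(reflection v (fst w), snd w) \<in> surf a \<longleftrightarrow> w \<in> surf a" for w
        by (cases w) (simp add: surf_def norm_reflection v)
    qed (simp add: reflection_reflection v, measurable)
    show "distr ?M (borel \<Otimes>\<^sub>M borel) (\<lambda>w. (fst w, reflection v (snd w))) = ?M"
    proof (rule distr_surf_borel_involution[OF d])
      show "dist (fst x, reflection v (snd x)) (fst y, reflection v (snd y)) \<le> dist x y" for x y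
        by (rule dist_prod_le) (simp_all add: dist_reflection v)
      show "(fst w, reflection v (snd w)) \<in> surf a \<longleftrightarrow> w \<in> surf a" for w
        by (cases w) (simp add: surf_def norm_reflection v)
    qed (simp add: reflection_reflection v, measurable)
  qed
qed

section \<open>The averages as integrals, and the weak bound from the single-scale
  hypothesis\<close>

lemma nn_integral_lebesgue_borel:
  "(\<integral>\<^sup>+x. h x \<partial>lebesgue) = (\<integral>\<^sup>+x. h x \<partial>(lborel :: 'a::euclidean_space measure))"
  by (rule nn_integral_completion)

lemma Lp_norm_ennreal:
  "0 < p \<Longrightarrow> Lp_norm (ennreal p) h = epowr (\<integral>\<^sup>+x. epowr (h x) p \<partial>lborel) (1 / p)"
  by (simp add: Lp_norm_def nn_integral_lebesgue_borel)

lemma avg_eq_integral_surf_borel: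
  fixes f g :: "real^'d \<Rightarrow> complex"
  assumes [measurable]: "f \<in> borel_measurable borel" "g \<in> borel_measurable borel"
  shows "avg a t f g x = (\<integral>w. f (x - t *\<^sub>R fst w) * g (x - t *\<^sub>R snd w) \<partial>surf_borel a)"
    and "integrable (surf_measure a) (avg_integrand t f g x) \<longleftrightarrow> integrable (surf_borel a) (\<lambda>w. f (x - t *\<^sub>R fst w) * g (x - t *\<^sub>R snd w))"
proof -
  have eq: "avg_integrand t f g x = (\<lambda>w. f (x - t *\<^sub>R fst w) * g (x - t *\<^sub>R snd w))"
    by (auto simp: avg_integrand_def fun_eq_iff)
  have m: "(\<lambda>w. w) \<in> measurable (surf_measure a) (borel \<Otimes>\<^sub>M borel)"
    by (rule measurable_surf_measure) (rule borel_prod)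
  have h: "(\<lambda>w. f (x - t *\<^sub>R fst w) * g (x - t *\<^sub>R snd w)) \<in> borel_measurable (borel \<Otimes>\<^sub>M borel)" by measurable
  show "avg a t f g x = (\<integral>w. f (x - t *\<^sub>R fst w) * g (x - t *\<^sub>R snd w) \<partial>surf_borel a)"
    unfolding avg_def eq surf_borel_def by (rule integral_distr[OF m h, symmetric])
  show "integrable (surf_measure a) (avg_integrand t f g x) \<longleftrightarrow> integrable (surf_borel a) (\<lambda>w. f (x - t *\<^sub>R fst w) * g (x - t *\<^sub>R snd w))"
    unfolding eq surf_borel_def by (rule integrable_distr_eq[OF m h, symmetric])
qed

lemma norm_avg_of_real:
  fixes f g :: "real^'d \<Rightarrow> real"
  assumes M: "averaging_measure (surf_borel a :: ((real^'d) \<times> (real^'d)) measure) K"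
    and f: "bdd_supp f" and g: "bdd_supp g" and f0: "\<And>x. 0 \<le> f x" and g0: "\<And>x. 0 \<le> g x"
  shows "ennreal (norm (avg a t (\<lambda>x. complex_of_real (f x)) (\<lambda>x. complex_of_real (g x)) x))
    = posavg (surf_borel a) t (\<lambda>x. ennreal (f x)) (\<lambda>x. ennreal (g x)) x"
proof -
  interpret averaging_measure "surf_borel a :: ((real^'d) \<times> (real^'d)) measure" K by (rule M)
  note [measurable] = bdd_supp_measurable[OF f] bdd_supp_measurable[OF g]
  obtain B where B: "0 \<le> B" "\<And>x. \<bar>g x\<bar> \<le> B" using bdd_supp_bounded[OF g] by auto
  have "avg a t (\<lambda>x. complex_of_real (f x)) (\<lambda>x. complex_of_real (g x)) x
      = (\<integral>w. complex_of_real (f (x - t *\<^sub>R fst w) * g (x - t *\<^sub>R snd w)) \<partial>surf_borel a)"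
    by (subst avg_eq_integral_surf_borel) simp_all
  also have "\<dots> = complex_of_real (\<integral>w. f (x - t *\<^sub>R fst w) * g (x - t *\<^sub>R snd w) \<partial>surf_borel a)"
    by (rule integral_complex_of_real)
  finally have "norm (avg a t (\<lambda>x. complex_of_real (f x)) (\<lambda>x. complex_of_real (g x)) x)
      = \<bar>\<integral>w. f (x - t *\<^sub>R fst w) * g (x - t *\<^sub>R snd w) \<partial>surf_borel a\<bar>" by simp
  also have "\<dots> = (\<integral>w. f (x - t *\<^sub>R fst w) * g (x - t *\<^sub>R snd w) \<partial>surf_borel a)"
    using f0 g0 by (intro abs_of_nonneg Bochner_Integration.integral_nonneg) simp
  finally have "ennreal (norm (avg a t (\<lambda>x. complex_of_real (f x)) (\<lambda>x. complex_of_real (g x)) x))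
      = (\<integral>\<^sup>+w. ennreal (f (x - t *\<^sub>R fst w) * g (x - t *\<^sub>R snd w)) \<partial>surf_borel a)"
    using f0 g0 by (subst nn_integral_eq_integral) (auto intro!: integrable_avg[OF f bdd_supp_measurable[OF g] B(2)])
  then show ?thesis unfolding posavg_def using f0 g0 by (simp add: ennreal_mult)
qed

text \<open>The weight on \<open>y\<close> is the one for which
  \<open>\<sigma> powr \<theta>\<close> times its power \<open>1 - \<theta>\<close> is 1, so both
  weights can be inserted into the product; then the usual Young inequality applies, with its
  coefficients bounded by 1.\<close>

lemma weighted_young:
  fixes x y \<theta> \<sigma> :: real
  assumes "0 \<le> x" "0 \<le> y" "0 < \<theta>" "\<theta> < 1" "0 < \<sigma>"
  shows "x powr \<theta> * y powr (1 - \<theta>) \<le> \<sigma> * x + \<sigma> powr (- (\<theta> / (1 - \<theta>))) * y"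
proof (cases "x = 0 \<or> y = 0")
  case True
  then show ?thesis using assms by auto
next
  case False
  then have xy: "0 < x" "0 < y" using assms by auto
  define s where "s = \<sigma> powr (- (\<theta> / (1 - \<theta>)))"
  have s: "0 < s" using assms by (simp add: s_def)
  have ss: "\<sigma> powr \<theta> * s powr (1 - \<theta>) = 1"
  proof -
    have "s powr (1 - \<theta>) = \<sigma> powr (- \<theta>)" unfolding s_def powr_powr using assms by simp
    then show ?thesis using assms by (simp add: powr_add[symmetric])
  qed
  have "x powr \<theta> * y powr (1 - \<theta>) = (\<sigma> powr \<theta> * s powr (1 - \<theta>)) * (x powr \<theta> * y powr (1 - \<theta>))"
    unfolding ss by simp
  also have "\<dots> = (\<sigma> * x) powr \<theta> * (s * y) powr (1 - \<theta>)"
    using assms s by (simp add: powr_mult)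
  also have "\<dots> \<le> \<theta> * (\<sigma> * x) + (1 - \<theta>) * (s * y)"
    using assms s xy by (intro Youngs_inequality_0) auto
  also have "\<dots> \<le> 1 * (\<sigma> * x) + 1 * (s * y)"
    using assms s by (intro add_mono mult_right_mono) auto
  finally show ?thesis unfolding s_def by simp
qed

lemma (in averaging_measure) posavg_scale:
  assumes t: "0 < t"
  shows "posavg M t f g x = posavg M 1 (\<lambda>y. f (t *\<^sub>R y)) (\<lambda>y. g (t *\<^sub>R y)) (x /\<^sub>R t)"
proof -
  have "t *\<^sub>R (x /\<^sub>R t - 1 *\<^sub>R y) = x - t *\<^sub>R y" for y using t by (simp add: scaleR_diff_right)
  then show ?thesis unfolding posavg_def by simp
qed

text \<open>Chebyshev turns the norm bound at scale 1 into a bound by a product of powers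
  \<open>\<theta> = r0 / p0\<close> and \<open>1 - \<theta> = r0 / q0\<close> of the two integrals,
  and Young's inequality makes it additive; \<open>\<theta> / (1 - \<theta>) = q0 / p0\<close> is
  the exponent of the weight.\<close>

lemma weak_of_avg_bounded:
  fixes a :: "real \<times> real" and p0 q0 r0 :: real
  assumes M: "averaging_measure (surf_borel a :: ((real^'d::finite) \<times> (real^'d)) measure) K"
    and bd: "avg_bounded TYPE('d) a (ennreal p0) (ennreal q0) (ennreal r0)"
    and pq: "1 \<le> p0" "1 \<le> q0" "0 < r0" "1 / r0 = 1 / p0 + 1 / q0"
  obtains B where "0 \<le> B" "\<And>t c \<sigma> f g. 0 < t \<Longrightarrow> 0 < c \<Longrightarrow> 0 < \<sigma> \<Longrightarrow> bdd_supp f \<Longrightarrow> bdd_supp g \<Longrightarrow>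
      (\<And>x. 0 \<le> f x) \<Longrightarrow> (\<And>x. 0 \<le> g x) \<Longrightarrow>
      emeasure lborel {x. ennreal c < posavg (surf_borel a :: ((real^'d) \<times> (real^'d)) measure) t (\<lambda>x. ennreal (f x)) (\<lambda>x. ennreal (g x)) x}
        \<le> ennreal (B * c powr (- r0)) * (ennreal \<sigma> * (\<integral>\<^sup>+x. ennreal (f x powr p0) \<partial>lborel)
            + ennreal (\<sigma> powr (- (q0 / p0))) * (\<integral>\<^sup>+x. ennreal (g x powr q0) \<partial>lborel))"
proof -
  interpret averaging_measure "surf_borel a :: ((real^'d) \<times> (real^'d)) measure" K by (rule M)
  let ?M = "surf_borel a :: ((real^'d) \<times> (real^'d)) measure"
  define \<theta> where "\<theta> = r0 / p0"
  have sum1: "r0 / p0 + r0 / q0 = 1"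
  proof -
    have "r0 / p0 + r0 / q0 = r0 * (1 / p0 + 1 / q0)" by (simp add: distrib_left)
    also have "\<dots> = r0 * (1 / r0)" by (simp only: pq(4))
    finally show ?thesis using pq(3) by simp
  qed
  have th: "1 - \<theta> = r0 / q0" unfolding \<theta>_def using sum1 by simp
  have \<theta>: "0 < \<theta>" "\<theta> < 1"
  proof -
    show "0 < \<theta>" unfolding \<theta>_def using pq by simp
    have "0 < r0 / q0" using pq by simp
    then show "\<theta> < 1" using th by linarith
  qed
  have thr: "\<theta> / (1 - \<theta>) = q0 / p0" unfolding th unfolding \<theta>_def using pq by simp
  from bd obtain C0 where C0: "\<And>f g :: real^'d \<Rightarrow> complex. f \<in> Lp_space (ennreal p0) \<Longrightarrow> g \<in> Lp_space (ennreal q0) \<Longrightarrow>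
       Lp_norm_fun (ennreal r0) (avg a 1 f g) \<le> ennreal C0 * Lp_norm_fun (ennreal p0) f * Lp_norm_fun (ennreal q0) g"
    unfolding avg_bounded_def by blast
  \<comment> \<open>The constant of the hypothesis may be a negative real, which
    \<open>ennreal\<close> sends to 0; its non-negative part can be raised to powers.\<close>
  define C where "C = max 0 C0"
  have C: "0 \<le> C" "ennreal C0 \<le> ennreal C" unfolding C_def by (auto intro: ennreal_leI)
  define B where "B = C powr r0"
  have unit: "emeasure lborel {x. ennreal c < posavg ?M 1 (\<lambda>x. ennreal (f x)) (\<lambda>x. ennreal (g x)) x}
        \<le> ennreal (B * c powr (- r0)) * (ennreal \<sigma> * (\<integral>\<^sup>+x. ennreal (f x powr p0) \<partial>lborel)
            + ennreal (\<sigma> powr (- (q0 / p0))) * (\<integral>\<^sup>+x. ennreal (g x powr q0) \<partial>lborel))"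
    if c: "0 < c" and \<sigma>: "0 < \<sigma>" and f: "bdd_supp f" and g: "bdd_supp g" and f0: "\<And>x. 0 \<le> f x" and g0: "\<And>x. 0 \<le> g x"
    for c \<sigma> and f g :: "real^'d \<Rightarrow> real"
  proof -
    note [measurable] = bdd_supp_measurable[OF f] bdd_supp_measurable[OF g]
    let ?P = "posavg ?M 1 (\<lambda>x. ennreal (f x)) (\<lambda>x. ennreal (g x))"
    let ?f = "\<lambda>x. complex_of_real (f x)" and ?g = "\<lambda>x. complex_of_real (g x)"
    have fin: "\<exists>y\<ge>0. (\<integral>\<^sup>+x. epowr (ennreal (h x)) s \<partial>lborel) = ennreal y"
      if h: "bdd_supp h" "\<And>x. 0 \<le> h x" "1 \<le> s" for h :: "real^'d \<Rightarrow> real" and s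
    proof -
      obtain B R where B: "0 \<le> B" "\<And>x. \<bar>h x\<bar> \<le> B" "\<And>x. R < norm x \<Longrightarrow> h x = 0" using bdd_suppE[OF h(1)] by blast
      note [measurable] = bdd_supp_measurable[OF h(1)]
      have "bdd_supp (\<lambda>x. h x powr s)"
      proof (rule bdd_suppI[where B="B powr s" and R=R])
        show "\<bar>h x powr s\<bar> \<le> B powr s" for x using B(2)[of x] h by (auto intro: powr_mono2)
      qed (use B in auto)
      then have "integrable lborel (\<lambda>x. h x powr s)" by (rule bdd_supp_integrable)
      then have "(\<integral>\<^sup>+x. ennreal (h x powr s) \<partial>lborel) = ennreal (\<integral>x. h x powr s \<partial>lborel)"
        by (intro nn_integral_eq_integral) auto
      then show ?thesis using h(2) by (simp add: epowr_ennreal) (metis Bochner_Integration.integral_nonneg powr_ge_zero)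
    qed
    obtain x where x: "0 \<le> x" "(\<integral>\<^sup>+x. epowr (ennreal (f x)) p0 \<partial>lborel) = ennreal x" using fin[OF f f0 pq(1)] by blast
    obtain y where y: "0 \<le> y" "(\<integral>\<^sup>+x. epowr (ennreal (g x)) q0 \<partial>lborel) = ennreal y" using fin[OF g g0 pq(2)] by blast
    have nf: "Lp_norm_fun (ennreal p0) ?f = ennreal (x powr (1 / p0))"
      using pq f0 x by (simp add: Lp_norm_ennreal epowr_ennreal)
    have ng: "Lp_norm_fun (ennreal q0) ?g = ennreal (y powr (1 / q0))"
      using pq g0 y by (simp add: Lp_norm_ennreal epowr_ennreal)
    have "?f \<in> Lp_space (ennreal p0)" "?g \<in> Lp_space (ennreal q0)"
      unfolding Lp_space_def using nf ng by (auto simp: measurable_completion)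
    from C0[OF this] have "Lp_norm_fun (ennreal r0) (avg a 1 ?f ?g) \<le> ennreal C0 * ennreal (x powr (1 / p0)) * ennreal (y powr (1 / q0))"
      unfolding nf ng .
    also have "\<dots> \<le> ennreal C * ennreal (x powr (1 / p0)) * ennreal (y powr (1 / q0))"
      by (intro mult_right_mono C) auto
    also have "\<dots> = ennreal (C * x powr (1 / p0) * y powr (1 / q0))" using C by (simp add: ennreal_mult)
    finally have "epowr (Lp_norm_fun (ennreal r0) (avg a 1 ?f ?g)) r0 \<le> epowr (ennreal (C * x powr (1 / p0) * y powr (1 / q0))) r0"
      using pq by (intro epowr_mono) auto
    also have "\<dots> = ennreal (B * (x powr \<theta> * y powr (1 - \<theta>)))"
      using C x y pq unfolding B_def th unfolding \<theta>_def by (simp add: epowr_ennreal powr_mult powr_powr)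
    also have "epowr (Lp_norm_fun (ennreal r0) (avg a 1 ?f ?g)) r0 = (\<integral>\<^sup>+x. epowr (?P x) r0 \<partial>lborel)"
      using pq(3) by (simp add: Lp_norm_ennreal epowr_epowr norm_avg_of_real[OF M f g f0 g0])
    finally have I: "(\<integral>\<^sup>+x. epowr (?P x) r0 \<partial>lborel) \<le> ennreal (B * (x powr \<theta> * y powr (1 - \<theta>)))" .
    have B0: "0 \<le> B" by (simp add: B_def)
    have "emeasure lborel {x. ennreal c < ?P x} \<le> emeasure lborel {x \<in> UNIV. 1 \<le> ennreal (c powr (- r0)) * epowr (?P x) r0}"
    proof (rule emeasure_mono)
      show "{x. ennreal c < ?P x} \<subseteq> {x \<in> UNIV. 1 \<le> ennreal (c powr (- r0)) * epowr (?P x) r0}"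
      proof (intro subsetI CollectI conjI UNIV_I)
        fix x assume "x \<in> {x. ennreal c < ?P x}"
        then have "epowr (ennreal c) r0 \<le> epowr (?P x) r0" using pq by (intro epowr_mono) auto
        then have "ennreal (c powr (- r0)) * epowr (ennreal c) r0 \<le> ennreal (c powr (- r0)) * epowr (?P x) r0" by (rule mult_left_mono) simp
        moreover have "ennreal (c powr (- r0)) * epowr (ennreal c) r0 = 1"
          using c by (simp add: epowr_ennreal ennreal_mult[symmetric] powr_add[symmetric])
        ultimately show "1 \<le> ennreal (c powr (- r0)) * epowr (?P x) r0" by simp
      qed
      have "{x \<in> space lborel. 1 \<le> ennreal (c powr (- r0)) * epowr (?P x) r0} \<in> sets lborel" by measurable
      then show "{x \<in> UNIV. 1 \<le> ennreal (c powr (- r0)) * epowr (?P x) r0} \<in> sets lborel" by simp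
    qed
    also have "\<dots> \<le> ennreal (c powr (- r0)) * (\<integral>\<^sup>+x. epowr (?P x) r0 * indicator UNIV x \<partial>lborel)"
      by (rule nn_integral_Markov_inequality) auto
    also have "\<dots> \<le> ennreal (c powr (- r0)) * ennreal (B * (x powr \<theta> * y powr (1 - \<theta>)))"
      using I by (intro mult_left_mono) auto
    also have "\<dots> \<le> ennreal (c powr (- r0)) * ennreal (B * (\<sigma> * x + \<sigma> powr (- (q0 / p0)) * y))"
      using weighted_young[OF x(1) y(1) \<theta> \<sigma>] B0 unfolding thr by (intro mult_left_mono ennreal_leI) auto
    also have "\<dots> = ennreal (B * c powr (- r0)) * (ennreal \<sigma> * ennreal x + ennreal (\<sigma> powr (- (q0 / p0))) * ennreal y)"
    proof -
      have "ennreal \<sigma> * ennreal x + ennreal (\<sigma> powr (- (q0 / p0))) * ennreal y = ennreal (\<sigma> * x + \<sigma> powr (- (q0 / p0)) * y)"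
        using \<sigma> x y by (simp add: ennreal_mult)
      then show ?thesis using B0 \<sigma> x y by (simp only: ennreal_mult[symmetric] mult_nonneg_nonneg add_nonneg_nonneg powr_ge_zero less_imp_le) (simp only: mult_ac)
    qed
    also have "ennreal x = (\<integral>\<^sup>+x. ennreal (f x powr p0) \<partial>lborel)" using x f0 by (simp add: epowr_ennreal)
    also have "ennreal y = (\<integral>\<^sup>+x. ennreal (g x powr q0) \<partial>lborel)" using y g0 by (simp add: epowr_ennreal)
    finally show ?thesis .
  qed
  \<comment> \<open>A dilation by \<open>t\<close> multiplies the measure of the level set and both
    integrals by the same factor \<open>t ^ d\<close>, so the additive bound has the same constant
    at every scale.\<close>
  show thesis
  proof (rule that[of B])
    show "0 \<le> B" by (simp add: B_def)
    fix t c \<sigma> :: real and f g :: "real^'d \<Rightarrow> real"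
    assume t: "0 < t" and c: "0 < c" and \<sigma>: "0 < \<sigma>" and f: "bdd_supp f" and g: "bdd_supp g" and f0: "\<And>x. 0 \<le> f x" and g0: "\<And>x. 0 \<le> g x"
    note [measurable] = bdd_supp_measurable[OF f] bdd_supp_measurable[OF g]
    let ?n = "DIM(real^'d)"
    have dil: "bdd_supp (\<lambda>y. h (t *\<^sub>R y))" if h: "bdd_supp h" for h :: "real^'d \<Rightarrow> real"
    proof -
      obtain B R where B: "0 \<le> B" "\<And>x. \<bar>h x\<bar> \<le> B" "\<And>x. R < norm x \<Longrightarrow> h x = 0" using bdd_suppE[OF h] by blast
      note [measurable] = bdd_supp_measurable[OF h]
      show ?thesis
      proof (rule bdd_suppI[where B=B and R="R / t"])
        fix y :: "real^'d" assume "R / t < norm y"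
        then have "R < norm (t *\<^sub>R y)" using t by (simp add: field_simps)
        then show "h (t *\<^sub>R y) = 0" by (rule B)
      qed (use B in auto)
    qed
    have sc: "ennreal (t ^ ?n) * (\<integral>\<^sup>+x. ennreal (h (t *\<^sub>R x) powr s) \<partial>lborel) = (\<integral>\<^sup>+x. ennreal (h x powr s) \<partial>lborel)"
      if [measurable]: "h \<in> borel_measurable borel" for h :: "real^'d \<Rightarrow> real" and s
      using nn_integral_lborel_affine[of "\<lambda>x. ennreal (h x powr s)" t 0] t by simp
    let ?P = "posavg ?M 1 (\<lambda>x. ennreal (f (t *\<^sub>R x))) (\<lambda>x. ennreal (g (t *\<^sub>R x)))"
    have Ps: "posavg ?M t (\<lambda>x. ennreal (f x)) (\<lambda>x. ennreal (g x)) x = ?P (x /\<^sub>R t)" for x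
      by (rule posavg_scale[OF t])
    have [measurable]: "?P \<in> borel_measurable borel" by measurable
    have "emeasure lborel {x. ennreal c < posavg ?M t (\<lambda>x. ennreal (f x)) (\<lambda>x. ennreal (g x)) x}
        = (\<integral>\<^sup>+x. indicator {x. ennreal c < ?P x} (x /\<^sub>R t) \<partial>lborel)"
    proof -
      have "{x \<in> space lborel. ennreal c < ?P (x /\<^sub>R t)} \<in> sets lborel" by measurable
      then have "emeasure lborel {x. ennreal c < ?P (x /\<^sub>R t)} = (\<integral>\<^sup>+x. indicator {x. ennreal c < ?P (x /\<^sub>R t)} x \<partial>lborel)" by simp
      then show ?thesis unfolding Ps by (simp add: indicator_def)
    qed
    also have "\<dots> = ennreal (t ^ ?n) * (\<integral>\<^sup>+x. indicator {x. ennreal c < ?P x} x \<partial>lborel)"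
    proof -
      have P': "{x. ennreal c < ?P x} \<in> sets borel"
      proof -
        have "{x \<in> space borel. ennreal c < ?P x} \<in> sets borel" by measurable
        then show ?thesis by simp
      qed
      have "(\<lambda>x. indicator {x. ennreal c < ?P x} (x /\<^sub>R t) :: ennreal) \<in> borel_measurable borel"
        using P' by measurable
      from nn_integral_lborel_affine[OF this, of t 0] show ?thesis using t by simp
    qed
    also have "(\<integral>\<^sup>+x. indicator {x. ennreal c < ?P x} x \<partial>lborel) = emeasure lborel {x. ennreal c < ?P x}"
    proof -
      have "{x \<in> space lborel. ennreal c < ?P x} \<in> sets lborel" by measurable
      then show ?thesis by simp
    qed
    also have "ennreal (t ^ ?n) * emeasure lborel {x. ennreal c < ?P x}
      \<le> ennreal (t ^ ?n) * (ennreal (B * c powr (- r0)) * (ennreal \<sigma> * (\<integral>\<^sup>+x. ennreal (f (t *\<^sub>R x) powr p0) \<partial>lborel)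
            + ennreal (\<sigma> powr (- (q0 / p0))) * (\<integral>\<^sup>+x. ennreal (g (t *\<^sub>R x) powr q0) \<partial>lborel)))"
      by (intro mult_left_mono unit c \<sigma> dil f g f0 g0) simp
    also have "\<dots> = ennreal (B * c powr (- r0)) * (ennreal \<sigma> * (ennreal (t ^ ?n) * (\<integral>\<^sup>+x. ennreal (f (t *\<^sub>R x) powr p0) \<partial>lborel))
            + ennreal (\<sigma> powr (- (q0 / p0))) * (ennreal (t ^ ?n) * (\<integral>\<^sup>+x. ennreal (g (t *\<^sub>R x) powr q0) \<partial>lborel)))"
      by (simp only: distrib_left mult_ac)
    also have "\<dots> = ennreal (B * c powr (- r0)) * (ennreal \<sigma> * (\<integral>\<^sup>+x. ennreal (f x powr p0) \<partial>lborel)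
            + ennreal (\<sigma> powr (- (q0 / p0))) * (\<integral>\<^sup>+x. ennreal (g x powr q0) \<partial>lborel))"
      by (subst (1 2) sc) auto
    finally show "emeasure lborel {x. ennreal c < posavg ?M t (\<lambda>x. ennreal (f x)) (\<lambda>x. ennreal (g x)) x}
      \<le> ennreal (B * c powr (- r0)) * (ennreal \<sigma> * (\<integral>\<^sup>+x. ennreal (f x powr p0) \<partial>lborel)
            + ennreal (\<sigma> powr (- (q0 / p0))) * (\<integral>\<^sup>+x. ennreal (g x powr q0) \<partial>lborel))" .
  qed
qed

section \<open>From the sum of two integrals to the product of norms\<close>

context scale_average
begin

lemma full_maximal_rescale:
  assumes [measurable]: "f \<in> borel_measurable borel" "g \<in> borel_measurable borel"
    and f0: "\<And>x. 0 \<le> f x" and g0: "\<And>x. 0 \<le> g x" and s: "0 < s"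
  shows "full_maximal (\<lambda>x. ennreal (s * f x)) (\<lambda>x. ennreal (1 / s * g x)) x
    = full_maximal (\<lambda>x. ennreal (f x)) (\<lambda>x. ennreal (g x)) x"
proof -
  let ?F = "\<lambda>x. ennreal (f x)" and ?G = "\<lambda>x. ennreal (g x)"
  have eq: "(\<lambda>x. ennreal (s * f x)) = (\<lambda>x. ennreal s * ?F x)" "(\<lambda>x. ennreal (1 / s * g x)) = (\<lambda>x. ennreal (1 / s) * ?G x)"
    using s f0 g0 by (auto simp: fun_eq_iff ennreal_mult[symmetric])
  have "posavg M t (\<lambda>x. ennreal s * ?F x) (\<lambda>x. ennreal (1 / s) * ?G x) x = posavg M t ?F ?G x" for t
  proof -
    have "posavg M t (\<lambda>x. ennreal s * ?F x) (\<lambda>x. ennreal (1 / s) * ?G x) x = ennreal s * posavg M t ?F (\<lambda>x. ennreal (1 / s) * ?G x) x"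
      by (rule posavg_cmult_left) measurable
    also have "posavg M t ?F (\<lambda>x. ennreal (1 / s) * ?G x) x = ennreal (1 / s) * posavg M t ?F ?G x"
      by (rule posavg_cmult_right) measurable
    also have "ennreal s * (ennreal (1 / s) * posavg M t ?F ?G x) = ennreal (s * (1 / s)) * posavg M t ?F ?G x"
      using s by (subst ennreal_mult) (auto simp: mult.assoc)
    finally show ?thesis using s by simp
  qed
  then show ?thesis unfolding full_maximal_def eq by simp
qed

text \<open>The left side does not change when \<open>f\<close> is replaced by \<open>s * f\<close>
  and \<open>g\<close> by \<open>g / s\<close>, whereas the right side becomes
  \<open>s powr p * X + s powr (- q) * Y\<close>. The choice of \<open>s\<close> that makes both
  terms equal turns the sum into twice a product.\<close>

lemma full_maximal_product_bound:
  fixes p q r :: real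
  assumes p: "1 < p" "p1 < p" and q: "1 < q" "q1 < q" and r: "0 < r" "1 / r = 1 / p + 1 / q"
  obtains C where "0 \<le> C" "\<And>f g X Y. f \<in> borel_measurable borel \<Longrightarrow> g \<in> borel_measurable borel \<Longrightarrow> (\<And>x. 0 \<le> f x) \<Longrightarrow> (\<And>x. 0 \<le> g x) \<Longrightarrow>
     (\<integral>\<^sup>+x. epowr (ennreal (f x)) p \<partial>lborel) = ennreal X \<Longrightarrow> (\<integral>\<^sup>+x. epowr (ennreal (g x)) q \<partial>lborel) = ennreal Y \<Longrightarrow> 0 \<le> X \<Longrightarrow> 0 \<le> Y \<Longrightarrow>
     (\<integral>\<^sup>+x. epowr (full_maximal (\<lambda>x. ennreal (f x)) (\<lambda>x. ennreal (g x)) x) r \<partial>lborel) \<le> ennreal (C * (X powr (r / p) * Y powr (r / q)))"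
proof -
  obtain C where C: "0 \<le> C" "\<And>f g. f \<in> borel_measurable borel \<Longrightarrow> g \<in> borel_measurable borel \<Longrightarrow> (\<And>x. 0 \<le> f x) \<Longrightarrow> (\<And>x. 0 \<le> g x) \<Longrightarrow>
     (\<integral>\<^sup>+x. epowr (full_maximal (\<lambda>x. ennreal (f x)) (\<lambda>x. ennreal (g x)) x) r \<partial>lborel)
       \<le> ennreal C * ((\<integral>\<^sup>+x. epowr (ennreal (f x)) p \<partial>lborel) + (\<integral>\<^sup>+x. epowr (ennreal (g x)) q \<partial>lborel))"
    by (rule full_maximal_sum_bound[OF p q r]) blast
  have rpq: "r / p = q / (p + q)" "r / q = p / (p + q)"
  proof -
    have "1 / r = (p + q) / (p * q)" unfolding r(2) using p q by (simp add: field_simps)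
    then have "r = p * q / (p + q)" using r(1) p q by (simp add: field_simps)
    then show "r / p = q / (p + q)" "r / q = p / (p + q)" using p q by auto
  qed
  show thesis
  proof (rule that[of "2 * C"])
    show "0 \<le> 2 * C" using C by simp
    fix f g :: "'a \<Rightarrow> real" and X Y :: real
    assume fm[measurable]: "f \<in> borel_measurable borel" and gm[measurable]: "g \<in> borel_measurable borel" and f0: "\<And>x. 0 \<le> f x" and g0: "\<And>x. 0 \<le> g x"
      and X: "(\<integral>\<^sup>+x. epowr (ennreal (f x)) p \<partial>lborel) = ennreal X" and Y: "(\<integral>\<^sup>+x. epowr (ennreal (g x)) q \<partial>lborel) = ennreal Y"
      and X0: "0 \<le> X" and Y0: "0 \<le> Y"
    let ?I = "\<integral>\<^sup>+x. epowr (full_maximal (\<lambda>x. ennreal (f x)) (\<lambda>x. ennreal (g x)) x) r \<partial>lborel"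
    have bd: "?I \<le> ennreal (C * (s powr p * X + s powr (- q) * Y))" if s: "0 < s" for s
    proof -
      have e1: "(\<integral>\<^sup>+x. epowr (ennreal (s * f x)) p \<partial>lborel) = ennreal (s powr p * X)"
      proof -
        have "(\<integral>\<^sup>+x. epowr (ennreal (s * f x)) p \<partial>lborel) = (\<integral>\<^sup>+x. ennreal (s powr p) * epowr (ennreal (f x)) p \<partial>lborel)"
        proof (rule nn_integral_cong)
          fix x
          have "epowr (ennreal (s * f x)) p = ennreal ((s * f x) powr p)" using s f0[of x] by (intro epowr_ennreal) simp
          also have "(s * f x) powr p = s powr p * f x powr p" by (rule powr_mult)
          finally show "epowr (ennreal (s * f x)) p = ennreal (s powr p) * epowr (ennreal (f x)) p"
            using f0[of x] by (simp add: epowr_ennreal ennreal_mult)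
        qed
        also have "\<dots> = ennreal (s powr p) * ennreal X" unfolding X[symmetric] by (rule nn_integral_cmult) measurable
        finally show ?thesis using X0 by (simp add: ennreal_mult)
      qed
      have e2: "(\<integral>\<^sup>+x. epowr (ennreal (1 / s * g x)) q \<partial>lborel) = ennreal (s powr (- q) * Y)"
      proof -
        have "(1 / s) powr q = s powr (- q)" using s by (simp add: powr_divide powr_minus inverse_eq_divide)
        then have pw: "(1 / s * g x) powr q = s powr (- q) * g x powr q" for x
          using s g0[of x] powr_mult[of "1 / s" "g x" q] by simp
        have "(\<integral>\<^sup>+x. epowr (ennreal (1 / s * g x)) q \<partial>lborel) = (\<integral>\<^sup>+x. ennreal (s powr (- q)) * epowr (ennreal (g x)) q \<partial>lborel)"
        proof (rule nn_integral_cong)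
          fix x
          have "epowr (ennreal (1 / s * g x)) q = ennreal ((1 / s * g x) powr q)" using s g0[of x] by (intro epowr_ennreal) simp
          then show "epowr (ennreal (1 / s * g x)) q = ennreal (s powr (- q)) * epowr (ennreal (g x)) q"
            unfolding pw using g0[of x] by (simp add: epowr_ennreal ennreal_mult)
        qed
        also have "\<dots> = ennreal (s powr (- q)) * ennreal Y" unfolding Y[symmetric] by (rule nn_integral_cmult) measurable
        finally show ?thesis using Y0 by (simp add: ennreal_mult)
      qed
      have "?I = (\<integral>\<^sup>+x. epowr (full_maximal (\<lambda>x. ennreal (s * f x)) (\<lambda>x. ennreal (1 / s * g x)) x) r \<partial>lborel)"
        using full_maximal_rescale[OF fm gm f0 g0 s] by simp
      also have "\<dots> \<le> ennreal C * (ennreal (s powr p * X) + ennreal (s powr (- q) * Y))"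
        unfolding e1[symmetric] e2[symmetric] by (rule C(2)) (use s f0 g0 in \<open>auto simp del: times_divide_eq_left\<close>)
      also have "\<dots> = ennreal (C * (s powr p * X + s powr (- q) * Y))"
        using C(1) X0 Y0 by (subst ennreal_mult) (auto simp: ennreal_plus)
      finally show ?thesis .
    qed
    \<comment> \<open>The optimal \<open>s\<close> exists only for positive integrals; both are
      raised by \<open>d\<close>, which then tends to 0.\<close>
    have bd2: "?I \<le> ennreal (2 * C * ((X + d) powr (r / p) * (Y + d) powr (r / q)))" if d: "0 < d" for d
    proof -
      define X' where "X' = X + d"
      define Y' where "Y' = Y + d"
      have XY: "0 < X'" "0 < Y'" "X \<le> X'" "Y \<le> Y'" using X0 Y0 d by (auto simp: X'_def Y'_def)
      \<comment> \<open>Solves \<open>s powr p * X' = s powr (- q) * Y'\<close>.\<close>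
      define s where "s = (Y' / X') powr (1 / (p + q))"
      have s: "0 < s" using XY by (simp add: s_def)
      have pq: "p + q \<noteq> 0" using p q by simp
      have qe: "1 - p / (p + q) = q / (p + q)" "1 - q / (p + q) = p / (p + q)" using p q by (simp_all add: field_simps)
      have e1: "s powr p * X' = X' powr (r / p) * Y' powr (r / q)"
      proof -
        have "s powr p = Y' powr (p / (p + q)) / X' powr (p / (p + q))"
          using XY by (simp add: s_def powr_powr powr_divide)
        then have "s powr p * X' = Y' powr (p / (p + q)) * (X' powr 1 / X' powr (p / (p + q)))" using XY by simp
        also have "X' powr 1 / X' powr (p / (p + q)) = X' powr (1 - p / (p + q))" by (rule powr_diff[symmetric])
        finally show ?thesis unfolding rpq qe by (simp add: mult.commute)
      qed
      have e2: "s powr (- q) * Y' = X' powr (r / p) * Y' powr (r / q)"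
      proof -
        have "s powr q = Y' powr (q / (p + q)) / X' powr (q / (p + q))"
          using XY by (simp add: s_def powr_powr powr_divide)
        then have "s powr (- q) = X' powr (q / (p + q)) / Y' powr (q / (p + q))" by (simp add: powr_minus)
        then have "s powr (- q) * Y' = X' powr (q / (p + q)) * (Y' powr 1 / Y' powr (q / (p + q)))" using XY by simp
        also have "Y' powr 1 / Y' powr (q / (p + q)) = Y' powr (1 - q / (p + q))" by (rule powr_diff[symmetric])
        finally show ?thesis unfolding rpq qe by simp
      qed
      have "?I \<le> ennreal (C * (s powr p * X + s powr (- q) * Y))" by (rule bd[OF s])
      also have "\<dots> \<le> ennreal (C * (s powr p * X' + s powr (- q) * Y'))"
        using C(1) XY by (intro ennreal_leI mult_left_mono add_mono) auto
      also have "C * (s powr p * X' + s powr (- q) * Y') = 2 * C * (X' powr (r / p) * Y' powr (r / q))"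
        unfolding e1 e2 by simp
      finally show ?thesis unfolding X'_def Y'_def .
    qed
    have lim: "((\<lambda>d. ennreal (2 * C * ((X + d) powr (r / p) * (Y + d) powr (r / q)))) \<longlongrightarrow> ennreal (2 * C * ((X + 0) powr (r / p) * (Y + 0) powr (r / q)))) (at_right 0)"
    proof (intro tendsto_ennrealI tendsto_intros tendsto_powr')
      have pos: "\<forall>\<^sub>F d::real in at_right 0. 0 < d" by (rule eventually_at_right_less)
      have rp: "0 < r / p" "0 < r / q" using r p q by auto
      show "X + 0 \<noteq> 0 \<or> (0 < r / p \<and> (\<forall>\<^sub>F d in at_right 0. 0 \<le> X + d))"
        using rp X0 pos by (auto elim: eventually_mono)
      show "Y + 0 \<noteq> 0 \<or> (0 < r / q \<and> (\<forall>\<^sub>F d in at_right 0. 0 \<le> Y + d))"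
        using rp Y0 pos by (auto elim: eventually_mono)
    qed
    have ev: "\<forall>\<^sub>F d in at_right 0. ?I \<le> ennreal (2 * C * ((X + d) powr (r / p) * (Y + d) powr (r / q)))"
      using eventually_at_right_less[of "0::real"] by eventually_elim (rule bd2)
    from tendsto_lowerbound[OF lim ev] show "?I \<le> ennreal (2 * C * (X powr (r / p) * Y powr (r / q)))"
      by simp
  qed
qed

end

section \<open>Lebesgue measurable functions\<close>

text \<open>Subsets of a null set have outer measure 0 and so satisfy the Caratheodory condition.
  This completeness makes the integrand measurable for functions \<open>f\<close> and
  \<open>g\<close> that are only Lebesgue measurable.\<close>

lemma null_surf_measure_subset:
  assumes Z: "Z \<in> null_sets (surf_measure a :: ((real^'d) \<times> (real^'d)) measure)" and A: "A \<subseteq> Z"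
  shows "A \<in> sets (surf_measure a)"
proof -
  let ?s = "2 * real CARD('d) - 1"
  let ?H = "hausdorff_measure ?s :: ((real^'d) \<times> (real^'d)) measure"
  have SH: "surf a \<in> sets ?H" by (rule surf_in_sets_hausdorff_measure)
  have ZH: "Z \<in> null_sets ?H" and "Z \<subseteq> surf a"
    using Z SH unfolding surf_measure_def by (auto simp: null_sets_restrict_space)
  have "hausdorff_outer ?s Z = 0"
    using null_setsD1[OF ZH] unfolding emeasure_hausdorff_measure[OF null_setsD2[OF ZH]] .
  then have z: "hausdorff_outer ?s B = 0" if "B \<subseteq> A" for B
    using hausdorff_outer_mono[of B Z ?s] that A by auto
  have "hausdorff_outer ?s (A \<inter> X) + hausdorff_outer ?s ((UNIV - A) \<inter> X) = hausdorff_outer ?s X" for X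
  proof (rule antisym)
    show "hausdorff_outer ?s (A \<inter> X) + hausdorff_outer ?s ((UNIV - A) \<inter> X) \<le> hausdorff_outer ?s X"
      using z[of "A \<inter> X"] by (simp add: hausdorff_outer_mono)
    have "hausdorff_outer ?s ((A \<inter> X) \<union> ((UNIV - A) \<inter> X)) \<le> hausdorff_outer ?s (A \<inter> X) + hausdorff_outer ?s ((UNIV - A) \<inter> X)"
      by (rule hausdorff_outer_Un)
    moreover have "(A \<inter> X) \<union> ((UNIV - A) \<inter> X) = X" by auto
    ultimately show "hausdorff_outer ?s X \<le> hausdorff_outer ?s (A \<inter> X) + hausdorff_outer ?s ((UNIV - A) \<inter> X)" by simp
  qed
  then have "A \<in> sets ?H" by (simp add: sets_hausdorff_measure lambda_system_def)
  then show ?thesis unfolding surf_measure_def using \<open>Z \<subseteq> surf a\<close> A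
    by (auto simp: sets_restrict_space intro!: image_eqI[of _ _ A])
qed

lemma borel_representative:
  fixes f :: "'a::euclidean_space \<Rightarrow> complex"
  assumes f: "f \<in> borel_measurable lebesgue"
  obtains f' N where "f' \<in> borel_measurable borel" "N \<in> null_sets lborel" "\<And>x. x \<notin> N \<Longrightarrow> f x = f' x"
proof -
  have "(\<lambda>x. Re (f x)) \<in> borel_measurable lebesgue" "(\<lambda>x. Im (f x)) \<in> borel_measurable lebesgue" using f by measurable
  from this[THEN completion_ex_borel_measurable_real] obtain u v where uv: "u \<in> borel_measurable lborel" "AE x in lborel. Re (f x) = u x" "v \<in> borel_measurable lborel" "AE x in lborel. Im (f x) = v x"
    by blast
  define f' where "f' x = complex_of_real (u x) + \<i> * complex_of_real (v x)" for x
  have "AE x in lborel. f x = f' x" using uv(2,4) by eventually_elim (simp add: f'_def complex_eq_iff)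
  then obtain N where N: "N \<in> null_sets lborel" "{x \<in> space lborel. f x \<noteq> f' x} \<subseteq> N"
    by (rule AE_E) (auto simp: null_sets_def)
  have "f' \<in> borel_measurable borel" unfolding f'_def using uv(1,3) by measurable
  with N that show thesis by auto
qed

text \<open>Both projections of the surface measure have densities, so for every \<open>x\<close>,
  not just almost every one, the points of the surface that are sent into a null set of exceptional
  arguments form a null set.\<close>

lemma avg_cong_null:
  fixes f g f' g' :: "real^'d::finite \<Rightarrow> complex"
  assumes M: "averaging_measure (surf_borel a :: ((real^'d) \<times> (real^'d)) measure) K" and t: "0 < t"
    and N: "N \<in> null_sets lborel" "\<And>x. x \<notin> N \<Longrightarrow> f x = f' x" and N': "N' \<in> null_sets lborel" "\<And>x. x \<notin> N' \<Longrightarrow> g x = g' x"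
    and [measurable]: "f' \<in> borel_measurable borel" "g' \<in> borel_measurable borel"
  shows "avg a t f g x = avg a t f' g' x"
    and "integrable (surf_measure a) (avg_integrand t f g x) \<longleftrightarrow> integrable (surf_measure a) (avg_integrand t f' g' x)"
proof -
  interpret averaging_measure "surf_borel a :: ((real^'d) \<times> (real^'d)) measure" K by (rule M)
  let ?S = "surf_measure a :: ((real^'d) \<times> (real^'d)) measure"
  have m: "(\<lambda>w. w) \<in> measurable ?S (borel \<Otimes>\<^sub>M borel)"
    by (rule measurable_surf_measure) (rule borel_prod)
  have null: "{y. x - t *\<^sub>R y \<in> L} \<in> null_sets lborel" if L: "L \<in> null_sets lborel" for L :: "(real^'d) set"
  proof -
    have [measurable]: "L \<in> sets borel" using L by auto
    have "{y \<in> space borel. x - t *\<^sub>R y \<in> L} \<in> sets borel" by measurable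
    then have s: "{y. x - t *\<^sub>R y \<in> L} \<in> sets borel" by simp
    have "0 = (\<integral>\<^sup>+z. indicator L z \<partial>lborel)" using L by auto
    also have "\<dots> = ennreal (\<bar>- t\<bar> ^ DIM(real^'d)) * (\<integral>\<^sup>+y. indicator L (x + (- t) *\<^sub>R y) \<partial>lborel)"
      by (rule nn_integral_lborel_affine) (use t in auto)
    also have "(\<integral>\<^sup>+y. indicator L (x + (- t) *\<^sub>R y) \<partial>lborel) = (\<integral>\<^sup>+y. indicator {y. x - t *\<^sub>R y \<in> L} y \<partial>lborel)"
      by (intro nn_integral_cong) (auto simp: indicator_def)
    also have "\<dots> = emeasure lborel {y. x - t *\<^sub>R y \<in> L}" using s by simp
    finally have "emeasure lborel {y. x - t *\<^sub>R y \<in> L} = 0" using t by auto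
    then show ?thesis using s by auto
  qed
  define Z where "Z = {w \<in> space ?S. x - t *\<^sub>R fst w \<in> N \<or> x - t *\<^sub>R snd w \<in> N'}"
  have Z: "Z \<in> null_sets ?S"
  proof -
    let ?A = "{w :: (real^'d) \<times> (real^'d). fst w \<in> {y. x - t *\<^sub>R y \<in> N}}" and ?B = "{w :: (real^'d) \<times> (real^'d). snd w \<in> {y. x - t *\<^sub>R y \<in> N'}}"
    have sN: "{y. x - t *\<^sub>R y \<in> N} \<in> sets borel" "{y. x - t *\<^sub>R y \<in> N'} \<in> sets borel" using null[OF N(1)] null[OF N'(1)] by auto
    have "{w \<in> space (borel \<Otimes>\<^sub>M borel). fst (w :: (real^'d) \<times> (real^'d)) \<in> {y. x - t *\<^sub>R y \<in> N}} \<in> sets (borel \<Otimes>\<^sub>M borel)"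
      "{w \<in> space (borel \<Otimes>\<^sub>M borel). snd (w :: (real^'d) \<times> (real^'d)) \<in> {y. x - t *\<^sub>R y \<in> N'}} \<in> sets (borel \<Otimes>\<^sub>M borel)"
      using sN by measurable
    then have AB: "?A \<in> sets (borel \<Otimes>\<^sub>M borel)" "?B \<in> sets (borel \<Otimes>\<^sub>M borel)" by (simp_all add: space_pair_measure)
    have "emeasure (surf_borel a) ?A = 0" using fst_le[OF sN(1)] null[OF N(1)] by (simp add: null_sets_def)
    moreover have "emeasure (surf_borel a) ?B = 0" using snd_le[OF sN(2)] null[OF N'(1)] by (simp add: null_sets_def)
    ultimately have "?A \<inter> space ?S \<in> null_sets ?S" "?B \<inter> space ?S \<in> null_sets ?S"
      using AB measurable_sets[OF m AB(1)] measurable_sets[OF m AB(2)]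
      unfolding surf_borel_def by (auto simp: emeasure_distr[OF m] null_sets_def vimage_def)
    then have "(?A \<inter> space ?S) \<union> (?B \<inter> space ?S) \<in> null_sets ?S" by (rule null_sets.Un)
    moreover have "(?A \<inter> space ?S) \<union> (?B \<inter> space ?S) = Z" unfolding Z_def by auto
    ultimately show ?thesis by simp
  qed
  let ?h = "avg_integrand t f g x" and ?h' = "avg_integrand t f' g' x"
  have eq: "?h w = ?h' w" if "w \<in> space ?S" "w \<notin> Z" for w
    using that N(2)[of "x - t *\<^sub>R fst w"] N'(2)[of "x - t *\<^sub>R snd w"] by (auto simp: Z_def avg_integrand_def split: prod.split)
  have h'm: "?h' \<in> borel_measurable ?S"
  proof -
    have "(\<lambda>w. f' (x - t *\<^sub>R fst w) * g' (x - t *\<^sub>R snd w)) \<in> borel_measurable (borel \<Otimes>\<^sub>M borel)" by measurable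
    from measurable_compose[OF m this] show ?thesis by (simp add: avg_integrand_def case_prod_beta)
  qed
  have hm: "?h \<in> borel_measurable ?S"
  proof (rule measurableI)
    fix A :: "complex set" assume A: "A \<in> sets borel"
    \<comment> \<open>Off \<open>Z\<close> the two integrands agree; within \<open>Z\<close> every
      set is measurable by completeness.\<close>
    have e: "?h -` A \<inter> space ?S = (?h' -` A \<inter> space ?S - Z) \<union> (?h -` A \<inter> space ?S \<inter> Z)" using eq by auto
    have "?h' -` A \<inter> space ?S - Z \<in> sets ?S" using measurable_sets[OF h'm A] Z by auto
    moreover have "?h -` A \<inter> space ?S \<inter> Z \<in> sets ?S" by (rule null_surf_measure_subset[OF Z]) auto
    ultimately show "?h -` A \<inter> space ?S \<in> sets ?S" by (subst e) (rule sets.Un)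
  qed simp
  have ae: "AE w in ?S. ?h w = ?h' w" using eq by (intro AE_I'[OF Z]) auto
  show "avg a t f g x = avg a t f' g' x" unfolding avg_def by (rule integral_cong_AE[OF hm h'm ae])
  show "integrable ?S ?h \<longleftrightarrow> integrable ?S ?h'" by (rule integrable_cong_AE[OF hm h'm ae])
qed

lemma one_divide_ennreal: "0 < x \<Longrightarrow> 1 / ennreal x = ennreal (1 / x)"
  using divide_ennreal[of 1 x] by simp

lemma ennreal_of_pos_reciprocal:
  assumes "1 \<le> p" "0 < enn2real (1 / p)"
  obtains P where "p = ennreal P" "1 \<le> P" "enn2real (1 / p) = 1 / P"
proof (cases p)
  case (real P)
  then have "1 \<le> P" using assms(1) by (simp add: ennreal_ge_1)
  then show thesis using that[of P] real by (simp add: one_divide_ennreal)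
qed (use assms in simp)

lemma Lp_space_representative:
  fixes f :: "'a::euclidean_space \<Rightarrow> complex"
  assumes f: "f \<in> Lp_space (ennreal p)" and p: "0 < p"
  obtains f' N X where "f' \<in> borel_measurable borel" "N \<in> null_sets lborel" "\<And>x. x \<notin> N \<Longrightarrow> f x = f' x"
    "0 \<le> X" "(\<integral>\<^sup>+x. epowr (ennreal (norm (f' x))) p \<partial>lborel) = ennreal X" "Lp_norm_fun (ennreal p) f = ennreal (X powr (1 / p))"
proof -
  have "f \<in> borel_measurable lebesgue" using f by (simp add: Lp_space_def)
  from borel_representative[OF this] obtain f' N where f': "f' \<in> borel_measurable borel" "N \<in> null_sets lborel" "\<And>x. x \<notin> N \<Longrightarrow> f x = f' x"
    by blast
  let ?I = "\<integral>\<^sup>+x. epowr (ennreal (norm (f' x))) p \<partial>lborel"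
  have "(\<integral>\<^sup>+x. epowr (ennreal (norm (f x))) p \<partial>lborel) = ?I"
    by (intro nn_integral_cong_AE AE_I'[OF f'(2)]) (use f'(3) in force)
  then have L: "Lp_norm_fun (ennreal p) f = epowr ?I (1 / p)" using p by (simp add: Lp_norm_ennreal)
  moreover have "Lp_norm_fun (ennreal p) f < \<infinity>" using f by (simp add: Lp_space_def)
  ultimately have "?I \<noteq> top" by auto
  then obtain X where X: "0 \<le> X" "?I = ennreal X" by (cases ?I) auto
  show thesis using that[OF f' X] L X by (simp add: epowr_ennreal)
qed

text \<open>Borel representatives and absolute values reduce everything to the positive average. Its
  supremum over the scales has finite \<open>r\<close>-integral, so it is finite almost everywhere,
  and this is absolute convergence of the averages at every dyadic scale.\<close>

lemma lacunary_maximal_bound: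
  fixes a :: "real \<times> real" and p q r C :: real and f g :: "real^'d::finite \<Rightarrow> complex"
  assumes M: "averaging_measure (surf_borel a :: ((real^'d) \<times> (real^'d)) measure) K"
    and pqr: "0 < p" "0 < q" "0 < r" and C: "0 \<le> C"
    and bd: "\<And>(f :: real^'d \<Rightarrow> real) g X Y. f \<in> borel_measurable borel \<Longrightarrow> g \<in> borel_measurable borel \<Longrightarrow> (\<And>x. 0 \<le> f x) \<Longrightarrow> (\<And>x. 0 \<le> g x) \<Longrightarrow>
     (\<integral>\<^sup>+x. epowr (ennreal (f x)) p \<partial>lborel) = ennreal X \<Longrightarrow> (\<integral>\<^sup>+x. epowr (ennreal (g x)) q \<partial>lborel) = ennreal Y \<Longrightarrow> 0 \<le> X \<Longrightarrow> 0 \<le> Y \<Longrightarrow>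
     (\<integral>\<^sup>+x. epowr (SUP l::int. posavg (surf_borel a) (2 powr (- real_of_int l)) (\<lambda>x. ennreal (f x)) (\<lambda>x. ennreal (g x)) x) r \<partial>lborel)
       \<le> ennreal (C * (X powr (r / p) * Y powr (r / q)))"
    and f: "f \<in> Lp_space (ennreal p)" and g: "g \<in> Lp_space (ennreal q)"
  shows "avg_converges a (2 powi (- l)) f g"
    and "(\<lambda>x. SUP l::int. ennreal (norm (avg a (2 powi (- l)) f g x))) \<in> borel_measurable lebesgue"
    and "Lp_norm (ennreal r) (\<lambda>x. SUP l::int. ennreal (norm (avg a (2 powi (- l)) f g x)))
      \<le> ennreal (C powr (1 / r)) * Lp_norm_fun (ennreal p) f * Lp_norm_fun (ennreal q) g"
proof -
  interpret averaging_measure "surf_borel a :: ((real^'d) \<times> (real^'d)) measure" K by (rule M)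
  let ?M = "surf_borel a :: ((real^'d) \<times> (real^'d)) measure"
  obtain f' N X where f'[measurable]: "f' \<in> borel_measurable borel" and N: "N \<in> null_sets lborel" "\<And>x. x \<notin> N \<Longrightarrow> f x = f' x"
    and X: "0 \<le> X" "(\<integral>\<^sup>+x. epowr (ennreal (norm (f' x))) p \<partial>lborel) = ennreal X" "Lp_norm_fun (ennreal p) f = ennreal (X powr (1 / p))"
    using Lp_space_representative[OF f pqr(1)] by blast
  obtain g' N' Y where g'[measurable]: "g' \<in> borel_measurable borel" and N': "N' \<in> null_sets lborel" "\<And>x. x \<notin> N' \<Longrightarrow> g x = g' x"
    and Y: "0 \<le> Y" "(\<integral>\<^sup>+x. epowr (ennreal (norm (g' x))) q \<partial>lborel) = ennreal Y" "Lp_norm_fun (ennreal q) g = ennreal (Y powr (1 / q))"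
    using Lp_space_representative[OF g pqr(2)] by blast
  let ?F = "\<lambda>x. ennreal (norm (f' x))" and ?G = "\<lambda>x. ennreal (norm (g' x))"
  define h where "h t x w = f' (x - t *\<^sub>R fst w) * g' (x - t *\<^sub>R snd w)" for t x and w :: "(real^'d) \<times> (real^'d)"
  have [measurable]: "h t x \<in> borel_measurable ?M" for t x unfolding h_def by measurable
  have t0: "0 < (2::real) powi (- l)" for l :: int by simp
  have tl: "(2::real) powi (- l) = 2 powr (- real_of_int l)" for l :: int
    using powr_real_of_int'[of "2::real" "- l"] by simp
  have av: "avg a t f g x = (\<integral>w. h t x w \<partial>?M)"
    and ig: "integrable (surf_measure a) (avg_integrand t f g x) \<longleftrightarrow> integrable ?M (h t x)" if "0 < t" for t x
  proof -
    have "avg a t f g x = avg a t f' g' x"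
      by (rule avg_cong_null(1)[OF M that N(1) _ N'(1) _ f' g']) (fact N(2) N'(2))+
    then show "avg a t f g x = (\<integral>w. h t x w \<partial>?M)" unfolding h_def by (simp only: avg_eq_integral_surf_borel(1)[OF f' g'])
    have "integrable (surf_measure a) (avg_integrand t f g x) \<longleftrightarrow> integrable (surf_measure a) (avg_integrand t f' g' x)"
      by (rule avg_cong_null(2)[OF M that N(1) _ N'(1) _ f' g']) (fact N(2) N'(2))+
    then show "integrable (surf_measure a) (avg_integrand t f g x) \<longleftrightarrow> integrable ?M (h t x)"
      unfolding h_def by (simp only: avg_eq_integral_surf_borel(2)[OF f' g'])
  qed
  have nh: "(\<integral>\<^sup>+w. ennreal (norm (h t x w)) \<partial>?M) = posavg ?M t ?F ?G x" for t x
    unfolding posavg_def h_def by (intro nn_integral_cong) (simp add: norm_mult ennreal_mult)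
  let ?S = "\<lambda>x. SUP l::int. posavg ?M (2 powr (- real_of_int l)) ?F ?G x"
  let ?A = "\<lambda>x. SUP l::int. ennreal (norm (avg a (2 powi (- l)) f g x))"
  have [measurable]: "?S \<in> borel_measurable borel" by (intro borel_measurable_SUP) auto
  have I: "(\<integral>\<^sup>+x. epowr (?S x) r \<partial>lborel) \<le> ennreal (C * (X powr (r / p) * Y powr (r / q)))"
    by (rule bd[OF _ _ _ _ X(2) Y(2) X(1) Y(1)]) auto
  have le: "?A x \<le> ?S x" for x
  proof (intro SUP_mono' )
    fix l :: int
    let ?t = "2 powi (- l) :: real"
    have "ennreal (norm (avg a ?t f g x)) \<le> (\<integral>\<^sup>+w. ennreal (norm (h ?t x w)) \<partial>?M)"
    \<comment> \<open>Where the integrand fails to be integrable the Bochner integral is 0 and the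
      inequality is trivial.\<close>
    proof (cases "integrable ?M (h ?t x)")
      case True
      then show ?thesis unfolding av[OF t0] by (rule integral_norm_bound_ennreal)
    next
      case False
      then show ?thesis unfolding av[OF t0] by (simp add: not_integrable_integral_eq)
    qed
    then show "ennreal (norm (avg a ?t f g x)) \<le> posavg ?M (2 powr (- real_of_int l)) ?F ?G x"
      unfolding nh tl .
  qed
  have "AE x in lborel. epowr (?S x) r \<noteq> \<infinity>"
    by (rule nn_integral_PInf_AE) (use I in \<open>auto simp: top_unique\<close>)
  then have fin: "AE x in lebesgue. ?S x \<noteq> top"
    by (intro AE_completion) (auto elim: eventually_mono)
  show "avg_converges a (2 powi (- l)) f g"
    unfolding avg_converges_def ig[OF t0] using fin
  proof eventually_elim
    case (elim x)
    have "posavg ?M (2 powr (- real_of_int l)) ?F ?G x \<le> ?S x" by (rule SUP_upper) simp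
    moreover have "?S x < top" using elim unfolding less_top .
    ultimately have "posavg ?M (2 powr (- real_of_int l)) ?F ?G x < top" by (rule le_less_trans)
    then show ?case unfolding integrable_iff_bounded nh tl by simp
  qed
  have "(\<lambda>x. \<integral>w. h t x w \<partial>?M) \<in> borel_measurable borel" for t unfolding h_def by measurable
  then have "?A \<in> borel_measurable borel" unfolding av[OF t0] by (intro borel_measurable_SUP) auto
  then show "?A \<in> borel_measurable lebesgue" by (intro measurable_completion) simp
  have "Lp_norm (ennreal r) ?A = epowr (\<integral>\<^sup>+x. epowr (?A x) r \<partial>lborel) (1 / r)"
    using pqr by (rule_tac Lp_norm_ennreal) simp
  also have "\<dots> \<le> epowr (ennreal (C * (X powr (r / p) * Y powr (r / q)))) (1 / r)"
  proof (rule epowr_mono)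
    have "(\<integral>\<^sup>+x. epowr (?A x) r \<partial>lborel) \<le> (\<integral>\<^sup>+x. epowr (?S x) r \<partial>lborel)"
      using pqr by (intro nn_integral_mono epowr_mono le) simp
    also note I
    finally show "(\<integral>\<^sup>+x. epowr (?A x) r \<partial>lborel) \<le> ennreal (C * (X powr (r / p) * Y powr (r / q)))" .
  qed (use pqr in simp)
  also have "\<dots> = ennreal (C powr (1 / r) * X powr (1 / p) * Y powr (1 / q))"
    using C X(1) Y(1) pqr by (simp add: epowr_ennreal powr_mult powr_powr mult.assoc)
  also have "\<dots> = ennreal (C powr (1 / r)) * Lp_norm_fun (ennreal p) f * Lp_norm_fun (ennreal q) g"
    unfolding X(3) Y(3) by (simp add: ennreal_mult)
  finally show "Lp_norm (ennreal r) ?A \<le> ennreal (C powr (1 / r)) * Lp_norm_fun (ennreal p) f * Lp_norm_fun (ennreal q) g" .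
qed

text \<open>A nearby point of the region has both exponents strictly smaller, which is where the decay in
  the truncation parameters comes from.\<close>

lemma interior_holder_region:
  assumes int: "(enn2real (1 / p), enn2real (1 / q)) \<in> interior (holder_region TYPE('d::finite) a)"
    and p: "1 \<le> p" and q: "1 \<le> q"
  obtains P Q P0 Q0 R0 where "p = ennreal P" "q = ennreal Q" "1 \<le> P0" "P0 < P" "1 \<le> Q0" "Q0 < Q" "0 < R0"
    "1 / R0 = 1 / P0 + 1 / Q0" "avg_bounded TYPE('d) a (ennreal P0) (ennreal Q0) (ennreal R0)"
proof -
  let ?H = "holder_region TYPE('d) a"
  define x where "x = enn2real (1 / p)"
  define y where "y = enn2real (1 / q)"
  have nn: "0 \<le> fst z" "0 \<le> snd z" if "z \<in> ?H" for z using that by (auto simp: holder_region_def)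
  obtain e where e: "0 < e" "ball (x, y) e \<subseteq> ?H" using int unfolding x_def y_def mem_interior by blast
  have near: "(x + s, y + t) \<in> ?H" if "\<bar>s\<bar> + \<bar>t\<bar> < e" for s t
  proof -
    have "dist (x, y) (x + s, y + t) = norm (s, t)" by (simp add: dist_norm norm_minus_commute norm_Pair)
    also have "\<dots> \<le> \<bar>s\<bar> + \<bar>t\<bar>" using norm_Pair_le[of s t] by simp
    finally show ?thesis using that e by (auto simp: mem_ball)
  qed
  \<comment> \<open>The region lies in the closed first quadrant, so an interior point has positive
    coordinates; in particular neither exponent is infinite.\<close>
  have xy: "0 < x" "0 < y" using nn[OF near[of "- (e / 2)" 0]] nn[OF near[of 0 "- (e / 2)"]] e by auto
  obtain P where P: "p = ennreal P" "1 \<le> P" "x = 1 / P"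
    using ennreal_of_pos_reciprocal[OF p] xy(1) unfolding x_def by metis
  obtain Q where Q: "q = ennreal Q" "1 \<le> Q" "y = 1 / Q"
    using ennreal_of_pos_reciprocal[OF q] xy(2) unfolding y_def by metis
  \<comment> \<open>Increasing both reciprocals lowers both exponents; the shift has total size
    \<open>2 * e / 3\<close>, within the ball.\<close>
  have "(x + e / 3, y + e / 3) \<in> ?H" using e by (intro near) simp
  then obtain p0 q0 r0 where h: "x + e / 3 = enn2real (1 / p0)" "y + e / 3 = enn2real (1 / q0)" "1 \<le> p0" "1 \<le> q0"
     "0 < r0" "1 / r0 = 1 / p0 + 1 / q0" "avg_bounded TYPE('d) a p0 q0 r0"
    unfolding holder_region_def by blast
  have "0 < enn2real (1 / p0)" "0 < enn2real (1 / q0)" using h(1,2) xy e by linarith+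
  then obtain P0 Q0 where P0: "p0 = ennreal P0" "1 \<le> P0" "enn2real (1 / p0) = 1 / P0"
    and Q0: "q0 = ennreal Q0" "1 \<le> Q0" "enn2real (1 / q0) = 1 / Q0"
    using ennreal_of_pos_reciprocal[OF h(3)] ennreal_of_pos_reciprocal[OF h(4)] by metis
  have "1 / P < 1 / P0" "1 / Q < 1 / Q0" using h(1,2) P0 Q0 P(3) Q(3) e by linarith+
  then have lt: "P0 < P" "Q0 < Q" using P P0 Q Q0 by (auto simp: field_simps)
  have s: "1 / r0 = ennreal (1 / P0 + 1 / Q0)"
    unfolding h(6) P0(1) Q0(1) using P0(2) Q0(2) by (simp add: one_divide_ennreal)
  have sp: "0 < 1 / P0 + 1 / Q0" using P0(2) Q0(2) by (intro add_pos_pos) auto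
  have "r0 \<noteq> top" using s sp by auto
  then obtain R0 where R0: "r0 = ennreal R0" "0 < R0" using h(5) by (cases r0) auto
  have "1 / R0 = 1 / P0 + 1 / Q0"
    using s sp R0 by (simp add: one_divide_ennreal del: ennreal_plus)
  then show thesis using that[OF P(1) Q(1) P0(2) lt(1) Q0(2) lt(2) R0(2)] h(7) unfolding P0 Q0 R0 by blast
qed

theorem theorem4:
  fixes a :: "real \<times> real" and p q r :: ennreal
  assumes "CARD('d::finite) \<ge> 2"
    and "1 \<le> fst a" "fst a \<le> real CARD('d)" "1 \<le> snd a" "snd a \<le> real CARD('d)"
    and "1 \<le> p" "1 \<le> q"
    and "(enn2real (1 / p), enn2real (1 / q)) \<in> interior (holder_region TYPE('d) a)"
    and "0 < r" "r < \<infinity>" "1 / r = 1 / p + 1 / q"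
  shows "\<exists>C::real. \<forall>f g :: real^'d \<Rightarrow> complex. f \<in> Lp_space p \<longrightarrow> g \<in> Lp_space q \<longrightarrow>
    (\<forall>l::int. avg_converges a (2 powi (- l)) f g) \<and>
    (\<lambda>x. SUP l::int. ennreal (norm (avg a (2 powi (- l)) f g x))) \<in> borel_measurable lebesgue \<and>
    Lp_norm r (\<lambda>x. SUP l::int. ennreal (norm (avg a (2 powi (- l)) f g x)))
      \<le> ennreal C * Lp_norm_fun p f * Lp_norm_fun q g"
proof -
  let ?M = "surf_borel a :: ((real^'d) \<times> (real^'d)) measure"
  from interior_holder_region[OF assms(8,6,7)] obtain P Q P0 Q0 R0 where
    pq: "p = ennreal P" "q = ennreal Q" and P0: "1 \<le> P0" "P0 < P" and Q0: "1 \<le> Q0" "Q0 < Q"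
    and R0: "0 < R0" "1 / R0 = 1 / P0 + 1 / Q0"
    and ab: "avg_bounded TYPE('d) a (ennreal P0) (ennreal Q0) (ennreal R0)"
    by blast
  obtain R where R: "r = ennreal R" "0 < R" using assms(9,10) by (cases r) auto
  have RPQ: "1 / R = 1 / P + 1 / Q"
  proof -
    have "ennreal (1 / R) = ennreal (1 / P + 1 / Q)"
      using assms(11) R P0 Q0 unfolding pq by (simp add: one_divide_ennreal)
    then show ?thesis using R P0 Q0 by (subst (asm) ennreal_inj) auto
  qed
  obtain K where M: "averaging_measure ?M K"
    using averaging_measure_surf_borel[OF assms(2-5,1)] by blast
  obtain B where B: "0 \<le> B" "\<And>t c \<sigma> f g. 0 < t \<Longrightarrow> 0 < c \<Longrightarrow> 0 < \<sigma> \<Longrightarrow> bdd_supp f \<Longrightarrow> bdd_supp g \<Longrightarrow>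
      (\<And>x. 0 \<le> f x) \<Longrightarrow> (\<And>x. 0 \<le> g x) \<Longrightarrow>
      emeasure lborel {x. ennreal c < posavg ?M t (\<lambda>x. ennreal (f x)) (\<lambda>x. ennreal (g x)) x}
        \<le> ennreal (B * c powr (- R0)) * (ennreal \<sigma> * (\<integral>\<^sup>+x. ennreal (f x powr P0) \<partial>lborel)
            + ennreal (\<sigma> powr (- (Q0 / P0))) * (\<integral>\<^sup>+x. ennreal (g x powr Q0) \<partial>lborel))"
    using weak_of_avg_bounded[OF M ab P0(1) Q0(1) R0] by blast
  \<comment> \<open>The midpoints leave a gap on either side: below for the decay in the layer
    indices, above for the integration over heights.\<close>
  define P1 where "P1 = (P0 + P) / 2"
  define Q1 where "Q1 = (Q0 + Q) / 2"
  define \<gamma> where "\<gamma> = Q0 / P0"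
  \<comment> \<open>The smallest of the four gains that bound \<open>\<kappa> * (r0 + 2)\<close> in
    the locale; dividing it by \<open>R0 + 2\<close> yields an admissible rate.\<close>
  define m where "m = min (min ((P1 - P0) / 64) (\<gamma> * (P1 - P0) / 64)) (min ((Q1 - Q0) / (64 * \<gamma>)) ((Q1 - Q0) / 64))"
  define \<kappa> where "\<kappa> = min (1 / 32) (m / (R0 + 2))"
  have lt: "P0 < P1" "P1 < P" "Q0 < Q1" "Q1 < Q" using P0 Q0 by (auto simp: P1_def Q1_def)
  have \<gamma>: "0 < \<gamma>" using P0 Q0 by (simp add: \<gamma>_def)
  have m: "0 < m" using lt \<gamma> by (simp add: m_def)
  have \<kappa>: "0 < \<kappa>" "\<kappa> \<le> 1 / 32" using m R0(1) by (simp add: \<kappa>_def) (simp only: \<kappa>_def min.cobounded1)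
  have "\<kappa> * (R0 + 2) \<le> m / (R0 + 2) * (R0 + 2)" using R0 by (intro mult_right_mono) (auto simp: \<kappa>_def)
  then have "\<kappa> * (R0 + 2) \<le> m" using R0 by simp
  then have \<kappa>m: "\<kappa> * (R0 + 2) \<le> (P1 - P0) / 64" "\<kappa> * (R0 + 2) \<le> \<gamma> * (P1 - P0) / 64"
      "\<kappa> * (R0 + 2) \<le> (Q1 - Q0) / (64 * \<gamma>)" "\<kappa> * (R0 + 2) \<le> (Q1 - Q0) / 64"
    by (simp_all only: m_def min.bounded_iff)
  interpret scale_average ?M K B P0 Q0 R0 \<gamma> P1 Q1 \<kappa>
  proof (rule scale_average.intro[OF M scale_average_axioms.intro])
    show "0 < P0" "0 < Q0" using P0 Q0 by auto
  qed (fact B(1) lt(1) lt(3) R0(1) \<gamma> \<kappa> \<kappa>m B(2)[folded \<gamma>_def])+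
  have PQ: "1 < P" "1 < Q" using P0 Q0 by auto
  from full_maximal_product_bound[OF PQ(1) lt(2) PQ(2) lt(4) R(2) RPQ]
  obtain C where C: "0 \<le> C" "\<And>f g X Y. f \<in> borel_measurable borel \<Longrightarrow> g \<in> borel_measurable borel \<Longrightarrow> (\<And>x. 0 \<le> f x) \<Longrightarrow> (\<And>x. 0 \<le> g x) \<Longrightarrow>
     (\<integral>\<^sup>+x. epowr (ennreal (f x)) P \<partial>lborel) = ennreal X \<Longrightarrow> (\<integral>\<^sup>+x. epowr (ennreal (g x)) Q \<partial>lborel) = ennreal Y \<Longrightarrow> 0 \<le> X \<Longrightarrow> 0 \<le> Y \<Longrightarrow>
     (\<integral>\<^sup>+x. epowr (full_maximal (\<lambda>x. ennreal (f x)) (\<lambda>x. ennreal (g x)) x) R \<partial>lborel) \<le> ennreal (C * (X powr (R / P) * Y powr (R / Q)))"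
    by blast
  have "0 < P" "0 < Q" using PQ by auto
  note * = lacunary_maximal_bound[OF M this R(2) C(1) C(2)[unfolded full_maximal_def]]
  show ?thesis unfolding pq R(1) by (intro exI[of _ "C powr (1 / R)"] allI impI conjI *)
qed

end
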